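(* Let $T$ be a complete theory with $NIP$ (we assume $T = T^{eq}$), let $\bar M$ be a saturated (monster) model of $T$, and let $G$ be a group definable over $\emptyset$ in $\bar M$. Then there is a type-definable subgroup of $G$, denoted $G^{st}$, with the following properties: (1) $G^{st}$ is type-definable over $\emptyset$; (2) the hyperdefinable set $G/G^{st}$ is stable; (3) $G^{st}$ is the smallest type-definable (with parameters) subgroup $H$ of $G$ such that $G/H$ is stable, i.e. $G^{st}\subseteq H$ for every subgroup $H$ of $G$ type-definable over a small set of parameters with $G/H$ stable. Moreover $G^{st}$ is a normal subgroup of $G$.
   Context: "Small" means of cardinality less than the degree of saturation of $\bar M$; type-definable means definable by a partial type over a small set of parameters. A hyperdefinable set is a quotient $X/E$ where $X$ is type-definable and $E$ is a type-definable equivalence relation on $X$; it is defined over $A$ if $X$ and $E$ are type-defined over $A$. For $H$ a type-definable subgroup of $G$, $G/H$ is the hyperdefinable set of left cosets (the quotient of $G$ by the type-definable equivalence relation $x^{-1}y\in H$). Stability of a hyperdefinable set: if $X/E$ is defined over $A$, then $X/E$ is stable if for every sequence $(a_i,b_i)_{i<\omega}$ which is indiscernible over $A$ and with $a_i\in X/E$ for all $i$, we have $tp(a_i,b_j/A)=tp(a_j,b_i/A)$ whenever $i\neq j$ (here $b_i$ are arbitrary tuples, possibly hyperimaginaries). *)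

theory Defs
  imports "HOL-Algebra.Coset" "HOL-Library.Equipollence"
begin

section \<open>Many-sorted first-order logic\<close>

text \<open>
  Every element of the type \<open>'s\<close> is a sort.  Arities are partial maps; a symbol belongs to the
  language iff it has an arity.
\<close>

record ('f, 'r, 's) lang =
  fun_ar :: "'f \<Rightarrow> ('s list \<times> 's) option"
  rel_ar :: "'r \<Rightarrow> 's list option"

text \<open>
  Bound variables are de Bruijn indices; free variables (and parameters) are named by
  elements of \<open>'v\<close>.
\<close>

datatype ('f, 'v) trm =
    Bnd nat
  | Fre 'v
  | Fn 'f "('f, 'v) trm list"

datatype ('f, 'r, 's, 'v) fm =
    Eq "('f, 'v) trm" "('f, 'v) trm"
  | Rel 'r "('f, 'v) trm list"
  | Neg "('f, 'r, 's, 'v) fm"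
  | Con "('f, 'r, 's, 'v) fm" "('f, 'r, 's, 'v) fm"
  | Exi 's "('f, 'r, 's, 'v) fm"

text \<open>
  A context \<open>\<Gamma> :: 'v \<rightharpoonup> 's\<close> gives the admissible free variables together with their sorts, and
  \<open>bs\<close> lists the sorts of the bound variables.
\<close>

primrec trm_sort ::
  "('f, 'r, 's) lang \<Rightarrow> ('v \<Rightarrow> 's option) \<Rightarrow> 's list \<Rightarrow> ('f, 'v) trm \<Rightarrow> 's option" where
  "trm_sort L \<Gamma> bs (Bnd n) = (if n < length bs then Some (bs ! n) else None)"
| "trm_sort L \<Gamma> bs (Fre v) = \<Gamma> v"
| "trm_sort L \<Gamma> bs (Fn f ts) =
     (case fun_ar L f of
        None \<Rightarrow> None
      | Some (ss, s) \<Rightarrow> if map (trm_sort L \<Gamma> bs) ts = map Some ss then Some s else None)"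

primrec wf_fm ::
  "('f, 'r, 's) lang \<Rightarrow> ('v \<Rightarrow> 's option) \<Rightarrow> 's list \<Rightarrow> ('f, 'r, 's, 'v) fm \<Rightarrow> bool" where
  "wf_fm L \<Gamma> bs (Eq t u) \<longleftrightarrow> (\<exists>s. trm_sort L \<Gamma> bs t = Some s \<and> trm_sort L \<Gamma> bs u = Some s)"
| "wf_fm L \<Gamma> bs (Rel r ts) \<longleftrightarrow>
     (\<exists>ss. rel_ar L r = Some ss \<and> map (trm_sort L \<Gamma> bs) ts = map Some ss)"
| "wf_fm L \<Gamma> bs (Neg \<phi>) \<longleftrightarrow> wf_fm L \<Gamma> bs \<phi>"
| "wf_fm L \<Gamma> bs (Con \<phi> \<psi>) \<longleftrightarrow> wf_fm L \<Gamma> bs \<phi> \<and> wf_fm L \<Gamma> bs \<psi>"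
| "wf_fm L \<Gamma> bs (Exi s \<phi>) \<longleftrightarrow> wf_fm L \<Gamma> (s # bs) \<phi>"

abbreviation sentence :: "('f, 'r, 's) lang \<Rightarrow> ('f, 'r, 's, 'v) fm \<Rightarrow> bool" where
  "sentence L \<phi> \<equiv> wf_fm L Map.empty [] \<phi>"

text \<open>
  The domain of sort \<open>s\<close> is \<open>{a. srt M a = Some s}\<close>, so distinct sorts have disjoint domains, and
  \<open>dom (srt M)\<close> is the set of all elements of the structure.
\<close>

record ('f, 'r, 's, 'a) fo_struct =
  srt :: "'a \<Rightarrow> 's option"
  fn :: "'f \<Rightarrow> 'a list \<Rightarrow> 'a"
  rl :: "'r \<Rightarrow> 'a list \<Rightarrow> bool"

definition is_struct :: "('f, 'r, 's) lang \<Rightarrow> ('f, 'r, 's, 'a) fo_struct \<Rightarrow> bool" where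
  "is_struct L M \<longleftrightarrow>
     (\<forall>s. \<exists>a. srt M a = Some s) \<and>
     (\<forall>f ss s as. fun_ar L f = Some (ss, s) \<and> map (srt M) as = map Some ss \<longrightarrow>
        srt M (fn M f as) = Some s)"

primrec val :: "('f, 'r, 's, 'a) fo_struct \<Rightarrow> ('v \<Rightarrow> 'a) \<Rightarrow> 'a list \<Rightarrow> ('f, 'v) trm \<Rightarrow> 'a" where
  "val M \<rho> bs (Bnd n) = bs ! n"
| "val M \<rho> bs (Fre v) = \<rho> v"
| "val M \<rho> bs (Fn f ts) = fn M f (map (val M \<rho> bs) ts)"

primrec sat ::
  "('f, 'r, 's, 'a) fo_struct \<Rightarrow> ('v \<Rightarrow> 'a) \<Rightarrow> 'a list \<Rightarrow> ('f, 'r, 's, 'v) fm \<Rightarrow> bool" where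
  "sat M \<rho> bs (Eq t u) \<longleftrightarrow> val M \<rho> bs t = val M \<rho> bs u"
| "sat M \<rho> bs (Rel r ts) \<longleftrightarrow> rl M r (map (val M \<rho> bs) ts)"
| "sat M \<rho> bs (Neg \<phi>) \<longleftrightarrow> \<not> sat M \<rho> bs \<phi>"
| "sat M \<rho> bs (Con \<phi> \<psi>) \<longleftrightarrow> sat M \<rho> bs \<phi> \<and> sat M \<rho> bs \<psi>"
| "sat M \<rho> bs (Exi s \<phi>) \<longleftrightarrow> (\<exists>a. srt M a = Some s \<and> sat M \<rho> (a # bs) \<phi>)"

definition models :: "('f, 'r, 's, 'a) fo_struct \<Rightarrow> ('f, 'r, 's, 'v) fm set \<Rightarrow> bool" where
  "models M T \<longleftrightarrow> (\<forall>\<phi>\<in>T. \<forall>\<rho>. sat M \<rho> [] \<phi>)"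

text \<open>
  Consistency is not part of this definition; it follows as soon as \<open>T\<close> has a model \<open>M\<close>, and
  then \<open>T\<close> is the full (deductively closed) theory of \<open>M\<close>.
\<close>

definition complete_theory :: "('f, 'r, 's) lang \<Rightarrow> ('f, 'r, 's, 'v) fm set \<Rightarrow> bool" where
  "complete_theory L T \<longleftrightarrow>
     (\<forall>\<phi>\<in>T. sentence L \<phi>) \<and> (\<forall>\<phi>. sentence L \<phi> \<longrightarrow> \<phi> \<in> T \<or> Neg \<phi> \<in> T)"

section \<open>Definable and type-definable sets\<close>

text \<open>
  A tuple is a function on an index set \<open>dom \<Gamma>\<close> (\<open>undefined\<close> elsewhere), where \<open>\<Gamma>\<close> prescribes the
  sorts of the coordinates.  The concatenation of \<open>x\<close> and \<open>y\<close> is \<open>case_sum x y\<close>, a tuple in the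
  context \<open>case_sum \<Gamma> \<Delta>\<close>.
\<close>

definition tuples :: "('f, 'r, 's, 'a) fo_struct \<Rightarrow> ('i \<Rightarrow> 's option) \<Rightarrow> ('i \<Rightarrow> 'a) set" where
  "tuples M \<Gamma> = {x \<in> extensional (dom \<Gamma>). \<forall>i\<in>dom \<Gamma>. srt M (x i) = \<Gamma> i}"

text \<open>
  Formulas over \<open>A\<close> in the variables \<open>\<Gamma>\<close>: the free variable \<open>Inl i\<close> is the \<open>i\<close>-th variable, and
  \<open>Inr a\<close> is the parameter \<open>a \<in> A\<close>.
\<close>

definition fm_over ::
  "('f, 'r, 's) lang \<Rightarrow> ('f, 'r, 's, 'a) fo_struct \<Rightarrow> 'a set \<Rightarrow> ('i \<Rightarrow> 's option) \<Rightarrow>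
   ('f, 'r, 's, 'i + 'a) fm set" where
  "fm_over L M A \<Gamma> = {\<phi>. wf_fm L (case_sum \<Gamma> (srt M |` A)) [] \<phi>}"

definition holds ::
  "('f, 'r, 's, 'a) fo_struct \<Rightarrow> ('f, 'r, 's, 'i + 'a) fm \<Rightarrow> ('i \<Rightarrow> 'a) \<Rightarrow> bool" where
  "holds M \<phi> x \<longleftrightarrow> sat M (case_sum x (\<lambda>a. a)) [] \<phi>"

definition definable ::
  "('f, 'r, 's) lang \<Rightarrow> ('f, 'r, 's, 'a) fo_struct \<Rightarrow> 'a set \<Rightarrow> ('i \<Rightarrow> 's option) \<Rightarrow>
   ('i \<Rightarrow> 'a) set \<Rightarrow> bool" where
  "definable L M A \<Gamma> D \<longleftrightarrow>
     finite (dom \<Gamma>) \<and> (\<exists>\<phi>\<in>fm_over L M A \<Gamma>. D = {x \<in> tuples M \<Gamma>. holds M \<phi> x})"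

definition type_definable ::
  "('f, 'r, 's) lang \<Rightarrow> ('f, 'r, 's, 'a) fo_struct \<Rightarrow> 'a set \<Rightarrow> ('i \<Rightarrow> 's option) \<Rightarrow>
   ('i \<Rightarrow> 'a) set \<Rightarrow> bool" where
  "type_definable L M A \<Gamma> D \<longleftrightarrow>
     (\<exists>\<Sigma>\<subseteq>fm_over L M A \<Gamma>. D = {x \<in> tuples M \<Gamma>. \<forall>\<phi>\<in>\<Sigma>. holds M \<phi> x})"

section \<open>The ambient theory and its monster model\<close>

definition small :: "('f, 'r, 's, 'a) fo_struct \<Rightarrow> 'b set \<Rightarrow> bool" where
  "small M A \<longleftrightarrow> A \<prec> dom (srt M)"

definition saturated :: "('f, 'r, 's) lang \<Rightarrow> ('f, 'r, 's, 'a) fo_struct \<Rightarrow> bool" where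
  "saturated L M \<longleftrightarrow>
     (\<forall>A s. \<forall>\<Sigma>\<subseteq>fm_over L M A (\<lambda>_::unit. Some s).
        A \<subseteq> dom (srt M) \<and> small M A \<and>
        (\<forall>\<Sigma>\<^sub>0\<subseteq>\<Sigma>. finite \<Sigma>\<^sub>0 \<longrightarrow>
           (\<exists>x\<in>tuples M (\<lambda>_::unit. Some s). \<forall>\<phi>\<in>\<Sigma>\<^sub>0. holds M \<phi> x)) \<longrightarrow>
        (\<exists>x\<in>tuples M (\<lambda>_::unit. Some s). \<forall>\<phi>\<in>\<Sigma>. holds M \<phi> x))"

text \<open>
  For a complete theory \<open>T\<close> the set \<open>T\<close> is equinumerous with the set of all formulas, so
  \<open>T \<prec> dom (srt M)\<close> says that the cardinality (= degree of saturation) of \<open>M\<close> exceeds \<open>|T|\<close>.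
\<close>

definition monster_model ::
  "('f, 'r, 's) lang \<Rightarrow> ('f, 'r, 's, 'v) fm set \<Rightarrow> ('f, 'r, 's, 'a) fo_struct \<Rightarrow> bool" where
  "monster_model L T M \<longleftrightarrow>
     is_struct L M \<and> models M T \<and> saturated L M \<and> T \<prec> dom (srt M)"

text \<open>
  No partitioned formula \<open>\<phi>(x; y)\<close> without parameters shatters an infinite set of tuples of the
  monster model.
\<close>

definition nip :: "('f, 'r, 's) lang \<Rightarrow> ('f, 'r, 's, 'a) fo_struct \<Rightarrow> bool" where
  "nip L M \<longleftrightarrow>
     (\<forall>(\<Gamma> :: nat \<Rightarrow> 's option) (\<Delta> :: nat \<Rightarrow> 's option).
        finite (dom \<Gamma>) \<and> finite (dom \<Delta>) \<longrightarrow>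
        (\<forall>\<phi>\<in>fm_over L M {} (case_sum \<Gamma> \<Delta>).
           \<not> (\<exists>S\<subseteq>tuples M \<Gamma>. infinite S \<and>
                (\<forall>S'\<subseteq>S. \<exists>y\<in>tuples M \<Delta>. \<forall>x\<in>S. holds M \<phi> (case_sum x y) \<longleftrightarrow> x \<in> S'))))"

text \<open>
  \<open>T = T\<^sup>e\<^sup>q\<close>: for every \<open>\<emptyset>\<close>-definable equivalence relation \<open>E\<close> on a finite product of sorts there is
  a sort consisting of the \<open>E\<close>-classes, via a \<open>\<emptyset>\<close>-definable quotient map \<open>f\<close>.
\<close>

definition eq_closed :: "('f, 'r, 's) lang \<Rightarrow> ('f, 'r, 's, 'a) fo_struct \<Rightarrow> bool" where
  "eq_closed L M \<longleftrightarrow>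
     (\<forall>(\<Gamma> :: nat \<Rightarrow> 's option) E.
        finite (dom \<Gamma>) \<and> equiv (tuples M \<Gamma>) E \<and>
        definable L M {} (case_sum \<Gamma> \<Gamma>) {case_sum x y |x y. (x, y) \<in> E} \<longrightarrow>
        (\<exists>s f. f ` tuples M \<Gamma> = {a. srt M a = Some s} \<and>
           (\<forall>x\<in>tuples M \<Gamma>. \<forall>y\<in>tuples M \<Gamma>. f x = f y \<longleftrightarrow> (x, y) \<in> E) \<and>
           definable L M {} (case_sum \<Gamma> (\<lambda>_::unit. Some s))
             {case_sum x (\<lambda>_. f x) |x. x \<in> tuples M \<Gamma>}))"

definition definable_group ::
  "('f, 'r, 's) lang \<Rightarrow> ('f, 'r, 's, 'a) fo_struct \<Rightarrow> 'a set \<Rightarrow> ('i \<Rightarrow> 's option) \<Rightarrow>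
   ('i \<Rightarrow> 'a) monoid \<Rightarrow> bool" where
  "definable_group L M A \<Gamma> G \<longleftrightarrow>
     group G \<and>
     definable L M A \<Gamma> (carrier G) \<and>
     definable L M A (case_sum \<Gamma> (case_sum \<Gamma> \<Gamma>))
       {case_sum x (case_sum y (x \<otimes>\<^bsub>G\<^esub> y)) |x y. x \<in> carrier G \<and> y \<in> carrier G}"

section \<open>Hyperimaginaries and stability\<close>

definition hyperdefinable ::
  "('f, 'r, 's) lang \<Rightarrow> ('f, 'r, 's, 'a) fo_struct \<Rightarrow> 'a set \<Rightarrow> ('i \<Rightarrow> 's option) \<Rightarrow>
   ('i \<Rightarrow> 'a) set \<Rightarrow> (('i \<Rightarrow> 'a) \<times> ('i \<Rightarrow> 'a)) set \<Rightarrow> bool" where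
  "hyperdefinable L M A \<Gamma> X E \<longleftrightarrow>
     type_definable L M A \<Gamma> X \<and> equiv X E \<and>
     type_definable L M A (case_sum \<Gamma> \<Gamma>) {case_sum x y |x y. (x, y) \<in> E}"

definition same_type ::
  "('f, 'r, 's) lang \<Rightarrow> ('f, 'r, 's, 'a) fo_struct \<Rightarrow> 'a set \<Rightarrow> ('i \<Rightarrow> 's option) \<Rightarrow>
   ('i \<Rightarrow> 'a) \<Rightarrow> ('i \<Rightarrow> 'a) \<Rightarrow> bool" where
  "same_type L M A \<Gamma> x y \<longleftrightarrow> (\<forall>\<phi>\<in>fm_over L M A \<Gamma>. holds M \<phi> x \<longleftrightarrow> holds M \<phi> y)"

text \<open>
  A hyperimaginary is given by its set of representatives, an equivalence class.  The type of the
  class of \<open>x\<close> under \<open>E\<close> over \<open>A\<close> is the partial type \<open>\<exists>z. E(v, z) \<and> z \<Turnstile> tp(x / A)\<close>.  Hence, in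
  a saturated model, two classes have the same type iff they have representatives of the
  same type; for classes that are singletons this is equality of types of real tuples.
\<close>

definition same_htype ::
  "('f, 'r, 's) lang \<Rightarrow> ('f, 'r, 's, 'a) fo_struct \<Rightarrow> 'a set \<Rightarrow> ('i \<Rightarrow> 's option) \<Rightarrow>
   ('i \<Rightarrow> 'a) set \<Rightarrow> ('i \<Rightarrow> 'a) set \<Rightarrow> bool" where
  "same_htype L M A \<Gamma> c d \<longleftrightarrow> (\<exists>x\<in>c. \<exists>y\<in>d. same_type L M A \<Gamma> x y)"

text \<open>
  Pairs and finite sequences of hyperimaginaries are the classes of the product equivalence
  relation: a representative is a concatenation of representatives.
\<close>

definition hpair :: "('i \<Rightarrow> 'a) set \<Rightarrow> ('j \<Rightarrow> 'a) set \<Rightarrow> ('i + 'j \<Rightarrow> 'a) set" where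
  "hpair c d = {case_sum x y |x y. x \<in> c \<and> y \<in> d}"

definition hseq :: "nat \<Rightarrow> (nat \<Rightarrow> ('i \<Rightarrow> 'a) set) \<Rightarrow> (nat \<times> 'i \<Rightarrow> 'a) set" where
  "hseq n c = {\<lambda>(k, i). if k < n then x k i else undefined |x. \<forall>k<n. x k \<in> c k}"

definition seq_ctxt :: "nat \<Rightarrow> ('i \<Rightarrow> 's option) \<Rightarrow> (nat \<times> 'i \<Rightarrow> 's option)" where
  "seq_ctxt n \<Gamma> = (\<lambda>(k, i). if k < n then \<Gamma> i else None)"

definition indiscernible ::
  "('f, 'r, 's) lang \<Rightarrow> ('f, 'r, 's, 'a) fo_struct \<Rightarrow> 'a set \<Rightarrow> ('i \<Rightarrow> 's option) \<Rightarrow>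
   (nat \<Rightarrow> ('i \<Rightarrow> 'a) set) \<Rightarrow> bool" where
  "indiscernible L M A \<Gamma> c \<longleftrightarrow>
     (\<forall>n f g. strict_mono_on {..<n} f \<and> strict_mono_on {..<n} g \<longrightarrow>
        same_htype L M A (seq_ctxt n \<Gamma>) (hseq n (\<lambda>k. c (f k))) (hseq n (\<lambda>k. c (g k))))"

text \<open>
  Stability of \<open>X/E\<close>, which is defined over \<open>A\<close>.  The \<open>b\<^sub>i\<close> range over hyperimaginaries, i.e.
  elements of some \<open>Y/F\<close> defined over \<open>A\<close> (real tuples being the case of equality), where \<open>Y\<close>
  consists of tuples of small length.  A small index set injects into \<open>dom (srt M)\<close>, so it
  is no restriction to index these tuples by a subset of \<open>'a\<close>.
\<close>

definition stable_quotient ::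
  "('f, 'r, 's) lang \<Rightarrow> ('f, 'r, 's, 'a) fo_struct \<Rightarrow> 'a set \<Rightarrow> ('i \<Rightarrow> 's option) \<Rightarrow>
   ('i \<Rightarrow> 'a) set \<Rightarrow> (('i \<Rightarrow> 'a) \<times> ('i \<Rightarrow> 'a)) set \<Rightarrow> bool" where
  "stable_quotient L M A \<Gamma> X E \<longleftrightarrow>
     hyperdefinable L M A \<Gamma> X E \<and>
     (\<forall>(\<Delta> :: 'a \<Rightarrow> 's option) Y F a b.
        small M (dom \<Delta>) \<and> hyperdefinable L M A \<Delta> Y F \<and>
        (\<forall>i. a i \<in> X // E) \<and> (\<forall>i. b i \<in> Y // F) \<and>
        indiscernible L M A (case_sum \<Gamma> \<Delta>) (\<lambda>i. hpair (a i) (b i)) \<longrightarrow>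
        (\<forall>i j. i \<noteq> j \<longrightarrow>
           same_htype L M A (case_sum \<Gamma> \<Delta>) (hpair (a i) (b j)) (hpair (a j) (b i))))"

end

theory Submission
  imports Defs "HOL-Library.Ramsey" Complex_Main
begin

text \<open>
  Call a type-definable subgroup \<open>H\<close> unstable if there are a \<open>\<emptyset>\<close>-definable family \<open>S(b, x)\<close>, a definable
  \<open>\<theta> \<supseteq> H\<close> and sequences with \<open>c\<^sub>i \<in> S(b\<^sub>j)\<close> for \<open>i < j\<close> and \<open>c\<^sub>i \<notin> S(b\<^sub>j) \<theta>\<close> for \<open>j < i\<close>; by compactness this
  is the failure of stability of \<open>G/H\<close>.  If \<open>H\<close> is not unstable, then along an indiscernible sequence every
  right \<open>H\<close>-invariant type-definable condition whose parameters avoid \<open>l < u\<close> passes from \<open>c\<^sub>u\<close> down to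
  \<open>c\<^sub>l\<close>.  This shows that finite intersections, hence by compactness all small intersections, of
  subgroups with stable quotient again have stable quotient.

  Let \<open>G/H\<close> be stable and suppose that some formula implied by \<open>H\<close> is not implied, uniformly in the
  conjugates, by finitely many conjugates of \<open>H\<close> under automorphisms.  A greedy choice and
  Ramsey's theorem yield an indiscernible sequence of conjugates \<open>H\<^sub>q\<close> and elements \<open>c\<^sub>q \<notin> H\<^sub>q\<close> that lie in \<open>H\<^sub>r\<close> for
  all \<open>r < q\<close>.  By NIP \<open>H\<^sub>0\<close> contains the intersection of the \<open>H\<^sub>q\<close> with \<open>q \<noteq> 0\<close>, since otherwise products of
  elements outside exactly one \<open>H\<^sub>q\<close> would shatter the sequence; moving \<open>c\<^sub>1\<close> to \<open>c\<^sub>0\<close> modulo the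
  intersection of the \<open>H\<^sub>q\<close>, \<open>q \<notin> [0, 1]\<close>, contradicts this.  Hence the intersection of all
  conjugates of \<open>H\<close> is type-definable over \<open>\<emptyset>\<close> with stable quotient, and the least such
  subgroup is the one sought; it is normal because its conjugates in \<open>G\<close> have stable quotients too.
\<close>

section \<open>Substitution in formulas\<close>

text \<open>Automorphisms of the monster are never constructed: a conjugate of H is the same family
  of formulas read at a parameter tuple with the same type over the empty set, and every property of
  H that has to be carried over is shown to be a type-definable condition on that tuple. Stability
  is traded for \<open>unst\<close> because a failure then carries one definable
  \<open>\<theta>\<close> around H, and compactness can replace H by a finitely cut out
  approximation inside \<open>\<theta>\<close>; the definition by indiscernible sequences of
  hyperimaginaries offers no such handle. The price is that closure under intersection stops being
  formal: a half-graph that survives thickening by an intersection of two neighbourhoods need not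
  survive thickening by either one. Sequences are indexed by the rationals so that there is room
  below, above and strictly between any two positions. NIP yields a parameter-free subgroup inside
  each H; from then on no cardinality has to be counted, because an intersection of arbitrarily many
  sets type-defined over the empty set is again one.\<close>

abbreviation ren_trm :: "('v \<Rightarrow> 'w) \<Rightarrow> ('f, 'v) trm \<Rightarrow> ('f, 'w) trm" where
  "ren_trm \<equiv> map_trm (\<lambda>x. x)"

abbreviation ren :: "('v \<Rightarrow> 'w) \<Rightarrow> ('f, 'r, 's, 'v) fm \<Rightarrow> ('f, 'r, 's, 'w) fm" where
  "ren \<equiv> map_fm (\<lambda>x. x) (\<lambda>x. x) (\<lambda>x. x)"

abbreviation fv :: "('f, 'r, 's, 'v) fm \<Rightarrow> 'v set" where
  "fv \<equiv> set4_fm"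

lemma map_eq_map_Some: "map f ts = map Some ss \<Longrightarrow> \<forall>t\<in>set ts. \<exists>s. f t = Some s"
  by (metis (no_types, lifting) imageE image_eqI list.set_map)

lemma trm_sort_ren: "trm_sort L \<Gamma> bs (ren_trm h t) = trm_sort L (\<lambda>v. \<Gamma> (h v)) bs t"
proof (induction t)
  case (Fn f ts)
  then have "map (trm_sort L \<Gamma> bs \<circ> ren_trm h) ts = map (trm_sort L (\<lambda>v. \<Gamma> (h v)) bs) ts"
    by simp
  then show ?case by (simp split: option.split del: map_eq_conv)
qed auto

lemma wf_fm_ren: "wf_fm L \<Gamma> bs (ren h \<phi>) \<longleftrightarrow> wf_fm L (\<lambda>v. \<Gamma> (h v)) bs \<phi>"
proof (induction \<phi> arbitrary: bs)
  case (Rel r ts)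
  have "trm_sort L \<Gamma> bs \<circ> ren_trm h = trm_sort L (\<lambda>v. \<Gamma> (h v)) bs"
    by (auto simp: trm_sort_ren)
  then show ?case by (simp del: map_eq_conv)
qed (auto simp: trm_sort_ren)

lemma val_ren: "val M \<rho> bs (ren_trm h t) = val M (\<lambda>v. \<rho> (h v)) bs t"
proof (induction t)
  case (Fn f ts)
  then have "map (val M \<rho> bs \<circ> ren_trm h) ts = map (val M (\<lambda>v. \<rho> (h v)) bs) ts"
    by simp
  then show ?case by (simp del: map_eq_conv)
qed auto

lemma sat_ren: "sat M \<rho> bs (ren h \<phi>) \<longleftrightarrow> sat M (\<lambda>v. \<rho> (h v)) bs \<phi>"
proof (induction \<phi> arbitrary: bs)
  case (Rel r ts)
  have "val M \<rho> bs \<circ> ren_trm h = val M (\<lambda>v. \<rho> (h v)) bs"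
    by (auto simp: val_ren)
  then show ?case by (simp del: map_eq_conv)
qed (auto simp: val_ren)

lemma val_cong: "(\<And>v. v \<in> set2_trm t \<Longrightarrow> \<rho> v = \<rho>' v) \<Longrightarrow> val M \<rho> bs t = val M \<rho>' bs t"
proof (induction t)
  case (Fn f ts)
  then have "map (val M \<rho> bs) ts = map (val M \<rho>' bs) ts" by auto
  then show ?case by (simp del: map_eq_conv)
qed auto

lemma sat_cong: "(\<And>v. v \<in> fv \<phi> \<Longrightarrow> \<rho> v = \<rho>' v) \<Longrightarrow> sat M \<rho> bs \<phi> \<longleftrightarrow> sat M \<rho>' bs \<phi>"
proof (induction \<phi> arbitrary: bs)
  case (Rel r ts)
  then have "map (val M \<rho> bs) ts = map (val M \<rho>' bs) ts"
    by (auto intro!: val_cong)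
  then show ?case by (simp del: map_eq_conv)
next
  case (Eq t u)
  then show ?case using val_cong[of t \<rho> \<rho>' M bs] val_cong[of u \<rho> \<rho>' M bs] by auto
next
  case (Con \<phi>1 \<phi>2)
  then show ?case by auto
next
  case (Exi s \<phi>)
  then show ?case by auto
next
  case (Neg \<phi>)
  then show ?case by auto
qed

lemma trm_sort_cong:
  "(\<And>v. v \<in> set2_trm t \<Longrightarrow> \<Gamma> v = \<Gamma>' v) \<Longrightarrow> trm_sort L \<Gamma> bs t = trm_sort L \<Gamma>' bs t"
proof (induction t)
  case (Fn f ts)
  then have "map (trm_sort L \<Gamma> bs) ts = map (trm_sort L \<Gamma>' bs) ts" by auto
  then show ?case by (simp split: option.split del: map_eq_conv)
qed auto

lemma wf_fm_cong:
  "(\<And>v. v \<in> fv \<phi> \<Longrightarrow> \<Gamma> v = \<Gamma>' v) \<Longrightarrow> wf_fm L \<Gamma> bs \<phi> \<longleftrightarrow> wf_fm L \<Gamma>' bs \<phi>"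
proof (induction \<phi> arbitrary: bs)
  case (Rel r ts)
  then have "map (trm_sort L \<Gamma> bs) ts = map (trm_sort L \<Gamma>' bs) ts"
    by (auto intro!: trm_sort_cong)
  then show ?case by (simp del: map_eq_conv)
next
  case (Eq t u)
  then show ?case using trm_sort_cong[of t \<Gamma> \<Gamma>' L bs] trm_sort_cong[of u \<Gamma> \<Gamma>' L bs] by auto
next
  case (Con \<phi>1 \<phi>2)
  then show ?case by auto
next
  case (Exi s \<phi>)
  then show ?case by auto
next
  case (Neg \<phi>)
  then show ?case by auto
qed

lemma trm_sort_fv: "trm_sort L \<Gamma> bs t = Some s \<Longrightarrow> set2_trm t \<subseteq> dom \<Gamma>"
proof (induction t arbitrary: s)
  case (Fn f ts)
  obtain ss where "map (trm_sort L \<Gamma> bs) ts = map Some ss"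
    using Fn.prems by (auto split: option.splits prod.splits if_splits)
  then have "\<forall>t\<in>set ts. \<exists>s. trm_sort L \<Gamma> bs t = Some s"
    by (rule map_eq_map_Some)
  then show ?case using Fn.IH by (auto simp: subset_iff) blast
qed (auto split: if_splits)

lemma wf_fm_fv: "wf_fm L \<Gamma> bs \<phi> \<Longrightarrow> fv \<phi> \<subseteq> dom \<Gamma>"
proof (induction \<phi> arbitrary: bs)
  case (Rel r ts)
  then obtain ss where "map (trm_sort L \<Gamma> bs) ts = map Some ss" by auto
  then have "\<forall>t\<in>set ts. \<exists>s. trm_sort L \<Gamma> bs t = Some s"
    by (rule map_eq_map_Some)
  then have "\<forall>t\<in>set ts. set2_trm t \<subseteq> dom \<Gamma>"
    by (meson trm_sort_fv)
  then show ?case by auto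
next
  case (Eq t u)
  then obtain s where "trm_sort L \<Gamma> bs t = Some s" "trm_sort L \<Gamma> bs u = Some s" by auto
  then show ?case using trm_sort_fv[of L \<Gamma> bs] by simp
next
  case (Con \<phi>1 \<phi>2)
  then show ?case using Con.IH[of bs] by simp
next
  case (Exi s \<phi>)
  then show ?case by auto
next
  case (Neg \<phi>)
  then show ?case by auto
qed

lemma finite_fv_trm: "finite (set2_trm t)"
  by (induction t) auto

lemma finite_fv: "finite (fv \<phi>)"
  by (induction \<phi>) (auto simp: finite_fv_trm)

text \<open>Binding a free variable: it becomes the outermost de Bruijn index.\<close>

primrec bind_trm :: "'v \<Rightarrow> nat \<Rightarrow> ('f, 'v) trm \<Rightarrow> ('f, 'v) trm" where
  "bind_trm v n (Bnd k) = Bnd k"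
| "bind_trm v n (Fre w) = (if w = v then Bnd n else Fre w)"
| "bind_trm v n (Fn f ts) = Fn f (map (bind_trm v n) ts)"

primrec bind :: "'v \<Rightarrow> nat \<Rightarrow> ('f, 'r, 's, 'v) fm \<Rightarrow> ('f, 'r, 's, 'v) fm" where
  "bind v n (Eq t u) = Eq (bind_trm v n t) (bind_trm v n u)"
| "bind v n (Rel r ts) = Rel r (map (bind_trm v n) ts)"
| "bind v n (Neg \<phi>) = Neg (bind v n \<phi>)"
| "bind v n (Con \<phi> \<psi>) = Con (bind v n \<phi>) (bind v n \<psi>)"
| "bind v n (Exi s \<phi>) = Exi s (bind v (Suc n) \<phi>)"

text \<open>The new sort goes to the far end of \<open>bs\<close>, where the index
  \<open>length bs\<close> points, so indices already present keep their meaning and no lifting of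
  indices occurs.\<close>

lemma trm_sort_bind:
  assumes upd: "\<Gamma>' = \<Gamma>(v := None)" "\<Gamma> v = Some s" and "trm_sort L \<Gamma> bs t = Some s'"
  shows "trm_sort L \<Gamma>' (bs @ [s]) (bind_trm v (length bs) t) = Some s'"
  using assms(3)
proof (induction t arbitrary: s')
  case (Fn f ts)
  obtain ss where ss: "fun_ar L f = Some (ss, s')" "map (trm_sort L \<Gamma> bs) ts = map Some ss"
    using Fn.prems by (auto split: option.splits prod.splits if_splits)
  have "map (trm_sort L \<Gamma>' (bs @ [s]) \<circ> bind_trm v (length bs)) ts = map Some ss"
  proof (rule nth_equalityI)
    show "length (map (trm_sort L \<Gamma>' (bs @ [s]) \<circ> bind_trm v (length bs)) ts) =
        length (map Some ss)"
      using arg_cong[OF ss(2), of length] by simp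
  next
    fix i assume "i < length (map (trm_sort L \<Gamma>' (bs @ [s]) \<circ> bind_trm v (length bs)) ts)"
    then have i: "i < length ts" by simp
    then have "trm_sort L \<Gamma> bs (ts ! i) = Some (ss ! i)" and "i < length ss"
      using ss(2) by (metis length_map nth_map)+
    then show "map (trm_sort L \<Gamma>' (bs @ [s]) \<circ> bind_trm v (length bs)) ts ! i =
        map Some ss ! i"
      using Fn.IH i by simp
  qed
  then show ?case using ss by simp
qed (auto simp: nth_append upd split: if_splits)

lemma wf_fm_bind:
  assumes upd: "\<Gamma>' = \<Gamma>(v := None)" "\<Gamma> v = Some s" and "wf_fm L \<Gamma> bs \<phi>"
  shows "wf_fm L \<Gamma>' (bs @ [s]) (bind v (length bs) \<phi>)"
  using assms(3)
proof (induction \<phi> arbitrary: bs)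
  case (Rel r ts)
  then obtain ss where ss: "rel_ar L r = Some ss" "map (trm_sort L \<Gamma> bs) ts = map Some ss"
    by auto
  have "map (trm_sort L \<Gamma>' (bs @ [s]) \<circ> bind_trm v (length bs)) ts = map Some ss"
  proof (rule nth_equalityI)
    show "length (map (trm_sort L \<Gamma>' (bs @ [s]) \<circ> bind_trm v (length bs)) ts) =
        length (map Some ss)"
      using arg_cong[OF ss(2), of length] by simp
  next
    fix i assume "i < length (map (trm_sort L \<Gamma>' (bs @ [s]) \<circ> bind_trm v (length bs)) ts)"
    then have i: "i < length ts" by simp
    then have "trm_sort L \<Gamma> bs (ts ! i) = Some (ss ! i)" and "i < length ss"
      using ss(2) by (metis length_map nth_map)+
    then show "map (trm_sort L \<Gamma>' (bs @ [s]) \<circ> bind_trm v (length bs)) ts ! i =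
        map Some ss ! i"
      using trm_sort_bind[OF upd(1,2)] i by simp
  qed
  then show ?case using ss by simp
next
  case (Eq t u)
  then show ?case using trm_sort_bind[OF upd(1,2)] by fastforce
next
  case (Exi s' \<phi>)
  then show ?case using Exi.IH[of "s' # bs"] by simp
qed auto

text \<open>Well-sortedness matters here: a dangling index would read the appended value
  \<open>a\<close> on the left but not on the right.\<close>

lemma val_bind:
  assumes upd: "\<rho>' = \<rho>(v := a)" and "trm_sort L \<Gamma> sb t = Some s" "length sb = length bs"
  shows "val M \<rho> (bs @ [a]) (bind_trm v (length bs) t) = val M \<rho>' bs t"
  using assms(2,3)
proof (induction t arbitrary: s)
  case (Fn f ts)
  obtain ss where "map (trm_sort L \<Gamma> sb) ts = map Some ss"
    using Fn.prems by (auto split: option.splits prod.splits if_splits)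
  then have "\<forall>t\<in>set ts. \<exists>s. trm_sort L \<Gamma> sb t = Some s"
    by (rule map_eq_map_Some)
  then have "map (val M \<rho> (bs @ [a]) \<circ> bind_trm v (length bs)) ts = map (val M \<rho>' bs) ts"
    using Fn.IH Fn.prems by auto
  then show ?case by (simp del: map_eq_conv)
qed (auto simp: nth_append upd split: if_splits)

lemma sat_bind:
  assumes upd: "\<rho>' = \<rho>(v := a)" and "wf_fm L \<Gamma> sb \<phi>" "length sb = length bs"
  shows "sat M \<rho> (bs @ [a]) (bind v (length bs) \<phi>) \<longleftrightarrow> sat M \<rho>' bs \<phi>"
  using assms(2,3)
proof (induction \<phi> arbitrary: bs sb)
  case (Rel r ts)
  obtain ss where "map (trm_sort L \<Gamma> sb) ts = map Some ss" using Rel.prems by auto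
  then have "\<forall>t\<in>set ts. \<exists>s. trm_sort L \<Gamma> sb t = Some s"
    by (rule map_eq_map_Some)
  then have "map (val M \<rho> (bs @ [a]) \<circ> bind_trm v (length bs)) ts = map (val M \<rho>' bs) ts"
    using val_bind[OF upd _ Rel.prems(2), of L \<Gamma> _ _ M] by fastforce
  then show ?case by (simp del: map_eq_conv)
next
  case (Exi s \<phi>)
  have "sat M \<rho> ((b # bs) @ [a]) (bind v (length (b # bs)) \<phi>) \<longleftrightarrow> sat M \<rho>' (b # bs) \<phi>"
    for b
    using Exi.prems by (intro Exi.IH[of "s # sb" "b # bs"]) auto
  then show ?case by (simp del: map_eq_conv)
next
  case (Eq t u)
  then obtain s where s: "trm_sort L \<Gamma> sb t = Some s" "trm_sort L \<Gamma> sb u = Some s" by auto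
  show ?case
    using val_bind[OF upd s(1) Eq.prems(2), of M] val_bind[OF upd s(2) Eq.prems(2), of M] by simp
next
  case (Con \<phi>1 \<phi>2)
  then show ?case by auto
next
  case (Neg \<phi>)
  then show ?case by auto
qed

section \<open>Definable predicates on environments\<close>

text \<open>
  Definability without variable names: a predicate on an environment \<open>X :: 'z set\<close> is definable
  when a formula expresses it whose free variables are coordinate functions \<open>u :: 'z \<Rightarrow> 'a\<close> from \<open>\<U>\<close>,
  evaluated at \<open>u z\<close>.  Constant functions play the role of parameters.
\<close>

definition cx :: "('f, 'r, 's, 'a) fo_struct \<Rightarrow> 'z set \<Rightarrow> ('z \<Rightarrow> 'a) set \<Rightarrow> ('z \<Rightarrow> 'a) \<Rightarrow> 's option" where
  "cx M X \<U> u =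
     (if u \<in> \<U> \<and> X \<noteq> {} \<and> (\<exists>s. \<forall>z\<in>X. srt M (u z) = Some s) then srt M (u (SOME z. z \<in> X)) else None)"

definition dfn :: "('f, 'r, 's) lang \<Rightarrow> ('f, 'r, 's, 'a) fo_struct \<Rightarrow> 'z set \<Rightarrow> ('z \<Rightarrow> 'a) set \<Rightarrow>
    ('z \<Rightarrow> bool) \<Rightarrow> bool" where
  "dfn L M X \<U> P \<longleftrightarrow> (\<exists>\<phi>. wf_fm L (cx M X \<U>) [] \<phi> \<and> (\<forall>z\<in>X. P z \<longleftrightarrow> sat M (\<lambda>u. u z) [] \<phi>))"

text \<open>The family may have any size. Smallness, where compactness needs it, is a condition on
  the coordinates and not on the number of formulas.\<close>

definition tdf :: "('f, 'r, 's) lang \<Rightarrow> ('f, 'r, 's, 'a) fo_struct \<Rightarrow> 'z set \<Rightarrow> ('z \<Rightarrow> 'a) set \<Rightarrow>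
    ('z \<Rightarrow> bool) \<Rightarrow> bool" where
  "tdf L M X \<U> P \<longleftrightarrow> (\<exists>\<P>. (\<forall>Q\<in>\<P>. dfn L M X \<U> Q) \<and> (\<forall>z\<in>X. P z \<longleftrightarrow> (\<forall>Q\<in>\<P>. Q z)))"

text \<open>With \<open>co \<Delta> A\<close> as coordinates, \<open>dfn\<close> on
  \<open>tuples M \<Delta>\<close> is definability over \<open>A\<close> in the sense of
  \<open>fm_over\<close>; the two directions are \<open>dfn_of_fm_over\<close> and
  \<open>fm_over_of_dfn\<close>.\<close>

definition co :: "('w \<Rightarrow> 's option) \<Rightarrow> 'a set \<Rightarrow> (('w \<Rightarrow> 'a) \<Rightarrow> 'a) set" where
  "co \<Delta> A = (\<lambda>i x. x i) ` dom \<Delta> \<union> (\<lambda>a x. a) ` A"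

definition prodc :: "('y \<Rightarrow> 'a) set \<Rightarrow> ('z \<Rightarrow> 'a) set \<Rightarrow> ('y \<times> 'z \<Rightarrow> 'a) set" where
  "prodc \<U> \<V> = (\<lambda>u p. u (fst p)) ` \<U> \<union> (\<lambda>v p. v (snd p)) ` \<V>"

lemma cx_eq:
  assumes "z \<in> X"
  shows "cx M X \<U> u =
    (if u \<in> \<U> \<and> (\<exists>s. \<forall>z\<in>X. srt M (u z) = Some s) then srt M (u z) else None)"
proof -
  have "(SOME z. z \<in> X) \<in> X" using assms by (rule someI)
  then have "srt M (u (SOME z. z \<in> X)) = srt M (u z)" if "\<exists>s. \<forall>z\<in>X. srt M (u z) = Some s"
    using that assms by metis
  then show ?thesis using assms unfolding cx_def by auto
qed

lemma cx_SomeD: "cx M X \<U> u = Some s \<Longrightarrow> u \<in> \<U> \<and> (\<forall>z\<in>X. srt M (u z) = Some s)"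
  by (cases "X = {}") (auto simp: cx_def[of _ "{}"] cx_eq split: if_splits)

lemma cx_SomeI: "z \<in> X \<Longrightarrow> u \<in> \<U> \<Longrightarrow> (\<And>z. z \<in> X \<Longrightarrow> srt M (u z) = Some s) \<Longrightarrow> cx M X \<U> u = Some s"
  by (simp add: cx_eq)

lemma ex_wf_sentence: "\<exists>\<phi>. wf_fm L \<Gamma> [] \<phi>"
  by (rule exI[of _ "Exi undefined (Eq (Bnd 0) (Bnd 0))"]) simp

text \<open>Variable names are arbitrary here: \<open>\<alpha>\<close> interprets each as a
  coordinate function, and renaming along \<open>\<alpha>\<close> produces a formula whose variables
  are the functions themselves.\<close>

lemma dfnI:
  assumes "wf_fm L \<Gamma> [] \<phi>"
    and "\<And>v. v \<in> dom \<Gamma> \<Longrightarrow> v \<in> fv \<phi> \<Longrightarrow> \<alpha> v \<in> \<U>"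
    and "\<And>v z. v \<in> dom \<Gamma> \<Longrightarrow> v \<in> fv \<phi> \<Longrightarrow> z \<in> X \<Longrightarrow> srt M (\<alpha> v z) = \<Gamma> v"
    and "\<And>z. z \<in> X \<Longrightarrow> P z \<longleftrightarrow> sat M (\<lambda>v. \<alpha> v z) [] \<phi>"
  shows "dfn L M X \<U> P"
\<comment> \<open>On an empty environment \<open>cx\<close> assigns no sort at all, so the given
  formula cannot be reused; any sentence will do.\<close>
proof (cases "X = {}")
  case True
  then show ?thesis using ex_wf_sentence by (auto simp: dfn_def)
next
  case False
  then obtain z0 where z0: "z0 \<in> X" by auto
  have "wf_fm L (\<lambda>v. cx M X \<U> (\<alpha> v)) [] \<phi>"
  proof (rule wf_fm_cong[THEN iffD1, OF _ assms(1)])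
    fix v assume v: "v \<in> fv \<phi>"
    then have "v \<in> dom \<Gamma>" using wf_fm_fv[OF assms(1)] by auto
    then obtain s where s: "\<Gamma> v = Some s" by auto
    show "\<Gamma> v = cx M X \<U> (\<alpha> v)"
      using cx_SomeI[OF z0 assms(2)[OF \<open>v \<in> dom \<Gamma>\<close> v], of M s]
        assms(3)[OF \<open>v \<in> dom \<Gamma>\<close> v] s by simp
  qed
  then show ?thesis
    unfolding dfn_def using assms(4) by (intro exI[of _ "ren \<alpha> \<phi>"]) (simp add: wf_fm_ren sat_ren)
qed

lemma dfnE:
  assumes "dfn L M X \<U> P"
  shows "\<exists>\<phi>. wf_fm L (cx M X \<U>) [] \<phi> \<and> (\<forall>z\<in>X. P z \<longleftrightarrow> sat M (\<lambda>u. u z) [] \<phi>) \<and>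
    (\<forall>u\<in>fv \<phi>. u \<in> \<U>) \<and> (\<forall>u\<in>fv \<phi>. \<forall>z\<in>X. srt M (u z) = cx M X \<U> u)"
proof -
  obtain \<phi> where \<phi>: "wf_fm L (cx M X \<U>) [] \<phi>" "\<forall>z\<in>X. P z \<longleftrightarrow> sat M (\<lambda>u. u z) [] \<phi>"
    using assms unfolding dfn_def by blast
  have "\<exists>s. cx M X \<U> u = Some s" if "u \<in> fv \<phi>" for u
    using wf_fm_fv[OF \<phi>(1)] that by auto
  then have "u \<in> \<U> \<and> (\<forall>z\<in>X. srt M (u z) = cx M X \<U> u)" if "u \<in> fv \<phi>" for u
    using cx_SomeD[of M X \<U> u] that by fastforce
  with \<phi> show ?thesis by blast
qed

lemma dfn_cong: "(\<And>z. z \<in> X \<Longrightarrow> P z = Q z) \<Longrightarrow> dfn L M X \<U> P \<longleftrightarrow> dfn L M X \<U> Q"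
  unfolding dfn_def by auto

lemma dfn_not:
  assumes "dfn L M X \<U> P"
  shows "dfn L M X \<U> (\<lambda>z. \<not> P z)"
proof -
  obtain \<phi> where "wf_fm L (cx M X \<U>) [] \<phi>" "\<forall>z\<in>X. P z \<longleftrightarrow> sat M (\<lambda>u. u z) [] \<phi>"
    using assms unfolding dfn_def by blast
  then show ?thesis unfolding dfn_def by (intro exI[of _ "Neg \<phi>"]) simp
qed

lemma dfn_conj:
  assumes "dfn L M X \<U> P" "dfn L M X \<U> Q"
  shows "dfn L M X \<U> (\<lambda>z. P z \<and> Q z)"
proof -
  obtain \<phi> \<psi> where "wf_fm L (cx M X \<U>) [] \<phi>" "\<forall>z\<in>X. P z \<longleftrightarrow> sat M (\<lambda>u. u z) [] \<phi>"
    "wf_fm L (cx M X \<U>) [] \<psi>" "\<forall>z\<in>X. Q z \<longleftrightarrow> sat M (\<lambda>u. u z) [] \<psi>"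
    using assms unfolding dfn_def by blast
  then show ?thesis unfolding dfn_def by (intro exI[of _ "Con \<phi> \<psi>"]) simp
qed

lemma dfn_disj:
  assumes "dfn L M X \<U> P" "dfn L M X \<U> Q"
  shows "dfn L M X \<U> (\<lambda>z. P z \<or> Q z)"
proof -
  have "dfn L M X \<U> (\<lambda>z. \<not> (\<not> P z \<and> \<not> Q z))" by (intro dfn_not dfn_conj assms)
  then show ?thesis by (rule dfn_cong[THEN iffD1, rotated]) blast
qed

lemma dfn_imp:
  assumes "dfn L M X \<U> P" "dfn L M X \<U> Q"
  shows "dfn L M X \<U> (\<lambda>z. P z \<longrightarrow> Q z)"
proof -
  have "dfn L M X \<U> (\<lambda>z. \<not> P z \<or> Q z)" by (intro dfn_not dfn_disj assms)
  then show ?thesis by (rule dfn_cong[THEN iffD1, rotated]) blast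
qed

lemma dfn_iff:
  assumes "dfn L M X \<U> P" "dfn L M X \<U> Q"
  shows "dfn L M X \<U> (\<lambda>z. P z \<longleftrightarrow> Q z)"
proof -
  have "dfn L M X \<U> (\<lambda>z. (P z \<longrightarrow> Q z) \<and> (Q z \<longrightarrow> P z))" by (intro dfn_imp dfn_conj assms)
  then show ?thesis by (rule dfn_cong[THEN iffD1, rotated]) blast
qed

text \<open>Substitution is a renaming of variables, from \<open>v\<close> to \<open>v\<close>
  composed with \<open>t\<close>; hence the demand that these composites are coordinates
  again.\<close>

lemma dfn_comp:
  assumes "dfn L M Y \<V> P" "\<And>z. z \<in> X \<Longrightarrow> t z \<in> Y" "\<And>v. v \<in> \<V> \<Longrightarrow> (\<lambda>z. v (t z)) \<in> \<U>"
  shows "dfn L M X \<U> (\<lambda>z. P (t z))"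
proof -
  obtain \<phi> where "wf_fm L (cx M Y \<V>) [] \<phi>" "\<forall>z\<in>Y. P z \<longleftrightarrow> sat M (\<lambda>u. u z) [] \<phi>"
    "\<forall>u\<in>fv \<phi>. u \<in> \<V>" "\<forall>u\<in>fv \<phi>. \<forall>z\<in>Y. srt M (u z) = cx M Y \<V> u"
    by (rule exE[OF dfnE[OF assms(1)]], elim conjE, rule that)
  note \<phi> = this[rule_format]
  show ?thesis
    by (rule dfnI[OF \<phi>(1), of "\<lambda>v z. v (t z)"]) (use \<phi> assms(2,3) in auto)
qed

lemma dfn_mono: "dfn L M Y \<V> P \<Longrightarrow> X \<subseteq> Y \<Longrightarrow> \<V> \<subseteq> \<U> \<Longrightarrow> dfn L M X \<U> P"
  using dfn_comp[of L M Y \<V> P X "\<lambda>z. z" \<U>] by auto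

lemma dfn_dep:
  assumes "dfn L M X \<U> P" "z \<in> X" "z' \<in> X" "\<And>u. u \<in> \<U> \<Longrightarrow> u z = u z'"
  shows "P z \<longleftrightarrow> P z'"
proof -
  obtain \<phi> where "wf_fm L (cx M X \<U>) [] \<phi>" "\<forall>z\<in>X. P z \<longleftrightarrow> sat M (\<lambda>u. u z) [] \<phi>"
    "\<forall>u\<in>fv \<phi>. u \<in> \<U>" "\<forall>u\<in>fv \<phi>. \<forall>z\<in>X. srt M (u z) = cx M X \<U> u"
    by (rule exE[OF dfnE[OF assms(1)]], elim conjE, rule that)
  note \<phi> = this[rule_format]
  show ?thesis
    using \<phi>(2)[OF assms(2)] \<phi>(2)[OF assms(3)] sat_cong[of \<phi> "\<lambda>u. u z" "\<lambda>u. u z'"] \<phi>(3) assms(4)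
    by metis
qed

text \<open>A formula has finitely many free variables. This is what later reduces infinite tuples
  and infinite sets of positions to finite ones.\<close>

lemma dfn_finite:
  assumes "dfn L M X \<U> P"
  obtains \<U>' where "finite \<U>'" "\<U>' \<subseteq> \<U>" "dfn L M X \<U>' P"
    "\<And>u. u \<in> \<U>' \<Longrightarrow> \<exists>s. \<forall>z\<in>X. srt M (u z) = Some s"
proof -
  obtain \<phi> where "wf_fm L (cx M X \<U>) [] \<phi>" "\<forall>z\<in>X. P z \<longleftrightarrow> sat M (\<lambda>u. u z) [] \<phi>"
    "\<forall>u\<in>fv \<phi>. u \<in> \<U>" "\<forall>u\<in>fv \<phi>. \<forall>z\<in>X. srt M (u z) = cx M X \<U> u"
    by (rule exE[OF dfnE[OF assms(1)]], elim conjE, rule that)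
  note \<phi> = this[rule_format]
  have "dfn L M X (fv \<phi>) P"
    by (rule dfnI[OF \<phi>(1), of "\<lambda>v. v"]) (use \<phi> in auto)
  moreover have "\<exists>s. \<forall>z\<in>X. srt M (u z) = Some s" if u: "u \<in> fv \<phi>" for u
    using wf_fm_fv[OF \<phi>(1)] u \<phi>(4)[OF u] by auto
  ultimately show thesis
    using that[of "fv \<phi>"] finite_fv \<phi>(3) by blast
qed

lemma dfn_True: "dfn L M X \<U> (\<lambda>z. True)"
proof -
  obtain \<phi> where "wf_fm L (cx M X \<U>) [] (\<phi> :: ('a, 'b, 'c, 'e \<Rightarrow> 'd) fm)" using ex_wf_sentence by blast
  then have "dfn L M X \<U> (\<lambda>z. sat M (\<lambda>u. u z) [] \<phi>)" by (auto simp: dfn_def)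
  from dfn_disj[OF this dfn_not[OF this]] show ?thesis
    by (rule dfn_cong[THEN iffD1, rotated]) blast
qed

lemma dfn_const: "dfn L M X \<U> (\<lambda>z. c)"
  using dfn_True dfn_not[OF dfn_True] by (cases c) auto

lemma dfn_eq:
  assumes "u \<in> \<U>" "v \<in> \<U>" "\<And>z. z \<in> X \<Longrightarrow> srt M (u z) = Some s" "\<And>z. z \<in> X \<Longrightarrow> srt M (v z) = Some s"
  shows "dfn L M X \<U> (\<lambda>z. u z = v z)"
proof (rule dfnI[of L "\<lambda>_. Some s" "Eq (Fre True) (Fre False)" "\<lambda>b. if b then u else v"])
qed (use assms in \<open>auto split: if_splits\<close>)

lemma dfn_ball_finite: "finite F \<Longrightarrow> (\<And>i. i \<in> F \<Longrightarrow> dfn L M X \<U> (P i)) \<Longrightarrow> dfn L M X \<U> (\<lambda>z. \<forall>i\<in>F. P i z)"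
proof (induction rule: finite_induct)
  case empty
  then show ?case by (simp add: dfn_True)
next
  case (insert x F)
  have "dfn L M X \<U> (\<lambda>z. P x z \<and> (\<forall>i\<in>F. P i z))"
    by (rule dfn_conj) (use insert in blast)+
  then show ?case by (rule dfn_cong[THEN iffD1, rotated]) blast
qed

lemma bind_out:
  assumes "finite W" "W \<subseteq> dom \<Gamma>" "wf_fm L \<Gamma> [] \<phi>"
  shows "\<exists>\<phi>'. wf_fm L (\<Gamma> |` (- W)) [] \<phi>' \<and> (\<forall>\<rho>. sat M \<rho> [] \<phi>' \<longleftrightarrow>
    (\<exists>y. (\<forall>v\<in>W. srt M (y v) = \<Gamma> v) \<and> sat M (override_on \<rho> y W) [] \<phi>))"
  using assms(1,2)
proof (induction rule: finite_induct)
  case empty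
  then show ?case using assms(3) by (intro exI[of _ \<phi>]) (simp add: restrict_map_def)
next
  case (insert w W)
  then obtain \<phi>' where \<phi>': "wf_fm L (\<Gamma> |` (- W)) [] \<phi>'"
    "\<And>\<rho>. sat M \<rho> [] \<phi>' \<longleftrightarrow> (\<exists>y. (\<forall>v\<in>W. srt M (y v) = \<Gamma> v) \<and> sat M (override_on \<rho> y W) [] \<phi>)"
    by auto
  obtain s where s: "\<Gamma> w = Some s" using insert.prems by auto
  then have s': "(\<Gamma> |` (- W)) w = Some s" using insert.hyps by (simp add: restrict_map_def)
  have "\<Gamma> |` (- insert w W) = (\<Gamma> |` (- W))(w := None)"
    by (auto simp: restrict_map_def)
  then have "wf_fm L (\<Gamma> |` (- insert w W)) [] (Exi s (bind w 0 \<phi>'))"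
    using wf_fm_bind[OF refl s' \<phi>'(1)] by simp
  moreover have "sat M \<rho> [] (Exi s (bind w 0 \<phi>')) \<longleftrightarrow>
      (\<exists>y. (\<forall>v\<in>insert w W. srt M (y v) = \<Gamma> v) \<and> sat M (override_on \<rho> y (insert w W)) [] \<phi>)" for \<rho>
  proof -
    have "sat M \<rho> [] (Exi s (bind w 0 \<phi>')) \<longleftrightarrow> (\<exists>a. srt M a = Some s \<and> sat M (\<rho>(w := a)) [] \<phi>')"
      using sat_bind[OF refl \<phi>'(1), where bs = "[]" and v = w and M = M] by simp
    also have "\<dots> \<longleftrightarrow> (\<exists>a y. srt M a = Some s \<and> (\<forall>v\<in>W. srt M (y v) = \<Gamma> v) \<and>
        sat M (override_on (\<rho>(w := a)) y W) [] \<phi>)"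
      using \<phi>'(2) by blast
    also have "\<dots> \<longleftrightarrow> (\<exists>y. (\<forall>v\<in>insert w W. srt M (y v) = \<Gamma> v) \<and>
        sat M (override_on \<rho> y (insert w W)) [] \<phi>)" (is "?l \<longleftrightarrow> ?r")
    proof
      assume ?l
      then obtain a y where *: "srt M a = Some s" "\<forall>v\<in>W. srt M (y v) = \<Gamma> v"
        "sat M (override_on (\<rho>(w := a)) y W) [] \<phi>" by blast
      have "override_on \<rho> (y(w := a)) (insert w W) = override_on (\<rho>(w := a)) y W"
        using insert.hyps by (auto simp: override_on_def)
      then show ?r using * s insert.hyps by (intro exI[of _ "y(w := a)"]) auto
    next
      assume ?r
      then obtain y where *: "\<forall>v\<in>insert w W. srt M (y v) = \<Gamma> v"
        "sat M (override_on \<rho> y (insert w W)) [] \<phi>" by blast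
      have "override_on \<rho> y (insert w W) = override_on (\<rho>(w := y w)) y W"
        by (auto simp: override_on_def)
      then show ?l using * s by (intro exI[of _ "y w"] exI[of _ y]) auto
    qed
    finally show ?thesis .
  qed
  ultimately show ?case by blast
qed

lemma tuples_sort: "x \<in> tuples M \<Delta> \<Longrightarrow> i \<in> dom \<Delta> \<Longrightarrow> srt M (x i) = \<Delta> i"
  by (simp add: tuples_def)

lemma tuples_eqI: "x \<in> tuples M \<Delta> \<Longrightarrow> y \<in> tuples M \<Delta> \<Longrightarrow> (\<And>i. i \<in> dom \<Delta> \<Longrightarrow> x i = y i) \<Longrightarrow> x = y"
  unfolding tuples_def by (auto intro: extensionalityI)

lemma restrict_tuples: "(\<And>i. i \<in> dom \<Delta> \<Longrightarrow> srt M (x i) = \<Delta> i) \<Longrightarrow> restrict x (dom \<Delta>) \<in> tuples M \<Delta>"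
  by (auto simp: tuples_def)

lemma tuples_nonempty: "is_struct L M \<Longrightarrow> \<exists>x. x \<in> tuples M \<Delta>"
proof -
  assume "is_struct L M"
  then have "\<forall>i. \<exists>a. i \<in> dom \<Delta> \<longrightarrow> srt M a = \<Delta> i"
    unfolding is_struct_def by (metis domD)
  then obtain f where "\<forall>i. i \<in> dom \<Delta> \<longrightarrow> srt M (f i) = \<Delta> i" by metis
  then show ?thesis using restrict_tuples by blast
qed

text \<open>\<open>\<Delta>\<close> may have infinitely many entries although a formula has finitely
  many quantifiers: only the entries that the formula reads are quantified, and the remaining ones
  are filled from a fixed tuple \<open>y0\<close>.\<close>

lemma dfn_ex:
  fixes X :: "'z set" and M :: "('f, 'r, 's, 'a) fo_struct" and \<Delta> :: "'w \<Rightarrow> 's option"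
  assumes str: "is_struct L M"
    and "dfn L M (X \<times> tuples M \<Delta>) (prodc \<U> (co \<Delta> {})) (\<lambda>p. P (fst p) (snd p))"
  shows "dfn L M X \<U> (\<lambda>z. \<exists>y\<in>tuples M \<Delta>. P z y)"
proof (cases "X = {}")
  case True
  then show ?thesis using dfn_cong[of X "\<lambda>z. True" "\<lambda>z. \<exists>y\<in>tuples M \<Delta>. P z y"] dfn_True by force
next
  case False
  obtain y0 where y0: "y0 \<in> tuples M \<Delta>" using tuples_nonempty[OF str] by blast
  let ?X = "X \<times> tuples M \<Delta>" and ?U = "prodc \<U> (co \<Delta> {})"
  obtain \<phi> where "wf_fm L (cx M ?X ?U) [] \<phi>" "\<forall>z\<in>?X. P (fst z) (snd z) \<longleftrightarrow> sat M (\<lambda>u. u z) [] \<phi>"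
    "\<forall>u\<in>fv \<phi>. u \<in> ?U" "\<forall>u\<in>fv \<phi>. \<forall>z\<in>?X. srt M (u z) = cx M ?X ?U u"
    by (rule exE[OF dfnE[OF assms(2)]], elim conjE, rule that)
  note \<phi> = this[rule_format]
  let ?G = "cx M ?X ?U |` fv \<phi>"
  have wf: "wf_fm L ?G [] \<phi>"
    by (rule wf_fm_cong[THEN iffD1, OF _ \<phi>(1)]) simp
  \<comment> \<open>\<open>W\<close> collects the variables that read the quantified tuple; the
    others factor through the first component and stay free.\<close>
  define W where "W = fv \<phi> - (\<lambda>u p. u (fst p)) ` \<U>"
  have finW: "finite W" unfolding W_def using finite_fv by blast
  have Wdom: "W \<subseteq> dom ?G" using wf_fm_fv[OF wf] W_def by auto
  have "\<forall>w\<in>W. \<exists>i\<in>dom \<Delta>. w = (\<lambda>p. snd p i)"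
    using \<phi>(3) unfolding W_def prodc_def co_def by blast
  then obtain ix where ix: "\<And>w. w \<in> W \<Longrightarrow> ix w \<in> dom \<Delta> \<and> w = (\<lambda>p. snd p (ix w))" by metis
  obtain \<phi>' where \<phi>': "wf_fm L (?G |` (- W)) [] \<phi>'"
    "\<And>\<rho>. sat M \<rho> [] \<phi>' \<longleftrightarrow>
      (\<exists>y. (\<forall>v\<in>W. srt M (y v) = ?G v) \<and> sat M (override_on \<rho> y W) [] \<phi>)"
    using bind_out[OF finW Wdom wf, of M] by blast
  \<comment> \<open>Variables that stay free do not look at the second component, so
    \<open>y0\<close> serves as a dummy.\<close>
  define \<alpha> where "\<alpha> v z = v (z, y0)" for v :: "'z \<times> ('w \<Rightarrow> 'a) \<Rightarrow> 'a" and z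
  have dom: "v \<in> fv \<phi> - W" if "v \<in> dom (?G |` (- W))" for v
    using that by (auto simp: restrict_map_def split: if_splits)
  show ?thesis
  proof (rule dfnI[OF \<phi>'(1), of \<alpha>])
    show "\<alpha> v \<in> \<U>" if "v \<in> dom (?G |` (- W))" for v
    proof -
      have "v \<in> fv \<phi> - W" by (rule dom[OF that])
      then obtain u where "u \<in> \<U>" "v = (\<lambda>p. u (fst p))" unfolding W_def by blast
      then show ?thesis by (simp add: \<alpha>_def[abs_def])
    qed
    show "srt M (\<alpha> v z) = (?G |` (- W)) v" if "v \<in> dom (?G |` (- W))" "z \<in> X" for v z
      using \<phi>(4)[of v "(z, y0)"] dom[OF that(1)] that(2) y0 unfolding \<alpha>_def by simp
  next
    fix z assume z: "z \<in> X"
    have srtW: "?G v = \<Delta> (ix v)" if "v \<in> W" for v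
    proof -
      have "?G v = srt M (v (z, y0))" using \<phi>(4)[of v "(z, y0)"] that z y0 unfolding W_def by simp
      also have "v (z, y0) = y0 (ix v)" using ix[OF that] by (metis snd_conv)
      finally show ?thesis using tuples_sort[OF y0] ix[OF that] by simp
    qed
    have out: "v (z, y) = \<alpha> v z" if "v \<in> fv \<phi>" "v \<notin> W" for v y
      using that unfolding W_def \<alpha>_def by auto
    have snd_ix: "v (z, y) = y (ix v)" if "v \<in> W" for v y
      using ix[OF that] by (metis snd_conv)
    show "(\<exists>y\<in>tuples M \<Delta>. P z y) \<longleftrightarrow> sat M (\<lambda>v. \<alpha> v z) [] \<phi>'"
    proof
      assume "\<exists>y\<in>tuples M \<Delta>. P z y"
      then obtain y where y: "y \<in> tuples M \<Delta>" "P z y" by blast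
      have "sat M (\<lambda>u. u (z, y)) [] \<phi>" using \<phi>(2)[of "(z, y)"] y z by simp
      moreover have "override_on (\<lambda>v. \<alpha> v z) (\<lambda>u. u (z, y)) W v = v (z, y)" if "v \<in> fv \<phi>" for v
        using out[OF that] by (simp add: override_on_def)
      ultimately have "sat M (override_on (\<lambda>v. \<alpha> v z) (\<lambda>u. u (z, y)) W) [] \<phi>"
        by (subst sat_cong[where \<rho>' = "\<lambda>u. u (z, y)"]) auto
      moreover have "\<forall>v\<in>W. srt M (v (z, y)) = ?G v"
        using srtW snd_ix ix tuples_sort[OF y(1)] by metis
      ultimately show "sat M (\<lambda>v. \<alpha> v z) [] \<phi>'"
        unfolding \<phi>'(2) by (intro exI[of _ "\<lambda>u. u (z, y)"] conjI)
    next
      assume "sat M (\<lambda>v. \<alpha> v z) [] \<phi>'"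
      then obtain y where y: "\<And>v. v \<in> W \<Longrightarrow> srt M (y v) = ?G v"
        "sat M (override_on (\<lambda>v. \<alpha> v z) y W) [] \<phi>"
        unfolding \<phi>'(2) by blast
      \<comment> \<open>An assignment to the variables in \<open>W\<close> is read back as a tuple:
        entry \<open>i\<close> is the value of the variable \<open>\<lambda>p. snd p i\<close>, or
        the entry of \<open>y0\<close> if that variable is not in \<open>W\<close>.\<close>
      define y' where "y' i = (if \<exists>v\<in>W. v = (\<lambda>p. snd p i) then y (\<lambda>p. snd p i) else y0 i)" for i
      have y'W: "y' (ix v) = y v" if "v \<in> W" for v
      proof -
        have "v = (\<lambda>p. snd p (ix v))" using ix[OF that] by blast
        then show ?thesis unfolding y'_def using that by metis
      qed
      have "srt M (y' i) = \<Delta> i" if i: "i \<in> dom \<Delta>" for i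
      proof (cases "\<exists>v\<in>W. v = (\<lambda>p. snd p i)")
        case True
        then obtain v where v: "v \<in> W" "v = (\<lambda>p. snd p i)" by blast
        have "srt M (y' i) = ?G v" using y(1)[OF v(1)] v True by (auto simp: y'_def)
        also have "\<dots> = srt M (v (z, y0))" using srtW[OF v(1)] snd_ix[OF v(1)] ix[OF v(1)]
            tuples_sort[OF y0] by metis
        also have "\<dots> = \<Delta> i" using v(2) tuples_sort[OF y0 i] by simp
        finally show ?thesis .
      next
        case False
        then show ?thesis using tuples_sort[OF y0 i] by (simp add: y'_def)
      qed
      then have mem: "restrict y' (dom \<Delta>) \<in> tuples M \<Delta>" by (rule restrict_tuples)
      have "override_on (\<lambda>v. \<alpha> v z) y W v = v (z, restrict y' (dom \<Delta>))" if v: "v \<in> fv \<phi>" for v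
      proof (cases "v \<in> W")
        case True
        have "v (z, restrict y' (dom \<Delta>)) = restrict y' (dom \<Delta>) (ix v)" by (rule snd_ix[OF True])
        then show ?thesis using y'W[OF True] ix[OF True] True by (simp add: override_on_def)
      next
        case False
        then show ?thesis using out[OF v False] by (simp add: override_on_def)
      qed
      then have "sat M (\<lambda>u. u (z, restrict y' (dom \<Delta>))) [] \<phi>"
        using y(2) by (subst (asm) sat_cong[where \<rho>' = "\<lambda>u. u (z, restrict y' (dom \<Delta>))"]) auto
      then show "\<exists>y\<in>tuples M \<Delta>. P z y" using \<phi>(2)[of "(z, restrict y' (dom \<Delta>))"] mem z by auto
    qed
  qed
qed

section \<open>Saturation and compactness\<close>

lemma tuples_iff: "x \<in> tuples M \<Delta> \<longleftrightarrow> x \<in> extensional (dom \<Delta>) \<and> (\<forall>i\<in>dom \<Delta>. srt M (x i) = \<Delta> i)"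
  by (auto simp: tuples_def)

lemma dfn_of_fm_over:
  fixes M :: "('f, 'r, 's, 'a) fo_struct" and \<Delta> :: "'w \<Rightarrow> 's option"
  assumes "\<phi> \<in> fm_over L M A \<Delta>"
  shows "dfn L M (tuples M \<Delta>) (co \<Delta> A) (holds M \<phi>)"
proof (rule dfnI[of L "case_sum \<Delta> (srt M |` A)" \<phi> "case_sum (\<lambda>i x. x i) (\<lambda>a x. a)"])
  show "wf_fm L (case_sum \<Delta> (srt M |` A)) [] \<phi>" using assms by (simp add: fm_over_def)
  fix v assume v: "v \<in> dom (case_sum \<Delta> (srt M |` A))"
  then show "case_sum (\<lambda>i x. x i) (\<lambda>a x. a) v \<in> co \<Delta> A"
    by (cases v) (auto simp: co_def restrict_map_def split: if_splits)
  fix z assume "z \<in> tuples M \<Delta>"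
  then show "srt M (case_sum (\<lambda>i x. x i) (\<lambda>a x. a) v z) = case_sum \<Delta> (srt M |` A) v"
    using v by (cases v) (auto simp: restrict_map_def tuples_iff split: if_splits)
next
  fix z :: "'w \<Rightarrow> 'a"
  have "(\<lambda>v. case_sum (\<lambda>i x. x i) (\<lambda>a x. a) v z) = case_sum z (\<lambda>a. a)"
    by (auto split: sum.split)
  then show "holds M \<phi> z \<longleftrightarrow> sat M (\<lambda>v. case_sum (\<lambda>i x. x i) (\<lambda>a x. a) v z) [] \<phi>"
    by (simp add: holds_def)
qed

text \<open>A coordinate function is turned back into a variable name by choosing an index or a
  parameter that produces it.\<close>

lemma fm_over_of_dfn:
  fixes M :: "('f, 'r, 's, 'a) fo_struct" and \<Delta> :: "'w \<Rightarrow> 's option"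
  assumes str: "is_struct L M" and P: "dfn L M (tuples M \<Delta>) (co \<Delta> A) P"
  shows "\<exists>\<phi>\<in>fm_over L M A \<Delta>. \<forall>x\<in>tuples M \<Delta>. P x \<longleftrightarrow> holds M \<phi> x"
proof -
  obtain x0 where x0: "x0 \<in> tuples M \<Delta>" using tuples_nonempty[OF str] by blast
  obtain \<phi> where "wf_fm L (cx M (tuples M \<Delta>) (co \<Delta> A)) [] \<phi>" "\<forall>z\<in>tuples M \<Delta>. P z \<longleftrightarrow> sat M (\<lambda>u. u z) [] \<phi>"
    "\<forall>u\<in>fv \<phi>. u \<in> co \<Delta> A" "\<forall>u\<in>fv \<phi>. \<forall>z\<in>tuples M \<Delta>. srt M (u z) = cx M (tuples M \<Delta>) (co \<Delta> A) u"
    by (rule exE[OF dfnE[OF P]], elim conjE, rule that)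
  note \<phi> = this[rule_format]
  have "\<forall>u\<in>co \<Delta> A. \<exists>v. (\<exists>i\<in>dom \<Delta>. v = Inl i \<and> u = (\<lambda>x. x i)) \<or> (\<exists>a\<in>A. v = Inr a \<and> u = (\<lambda>x. a))"
    unfolding co_def by blast
  then obtain h :: "(('w \<Rightarrow> 'a) \<Rightarrow> 'a) \<Rightarrow> 'w + 'a" where
    h: "\<And>u. u \<in> co \<Delta> A \<Longrightarrow> (\<exists>i\<in>dom \<Delta>. h u = Inl i \<and> u = (\<lambda>x. x i)) \<or> (\<exists>a\<in>A. h u = Inr a \<and> u = (\<lambda>x. a))"
    by metis
  have "wf_fm L (\<lambda>u. case_sum \<Delta> (srt M |` A) (h u)) [] \<phi>"
  proof (rule wf_fm_cong[THEN iffD1, OF _ \<phi>(1)])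
    fix u assume u: "u \<in> fv \<phi>"
    have "cx M (tuples M \<Delta>) (co \<Delta> A) u = srt M (u x0)" using \<phi>(4)[OF u x0] by simp
    then show "cx M (tuples M \<Delta>) (co \<Delta> A) u = case_sum \<Delta> (srt M |` A) (h u)"
      using h[OF \<phi>(3)[OF u]] tuples_sort[OF x0] by auto (metis domI)
  qed
  then have "ren h \<phi> \<in> fm_over L M A \<Delta>"
    by (simp add: fm_over_def wf_fm_ren)
  moreover have "P x \<longleftrightarrow> holds M (ren h \<phi>) x" if x: "x \<in> tuples M \<Delta>" for x
  proof -
    have "u x = case_sum x (\<lambda>a. a) (h u)" if "u \<in> fv \<phi>" for u
      using h[OF \<phi>(3)[OF that]] by auto
    then have "sat M (\<lambda>u. u x) [] \<phi> \<longleftrightarrow> sat M (\<lambda>u. case_sum x (\<lambda>a. a) (h u)) [] \<phi>"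
      by (intro sat_cong) auto
    then show ?thesis using \<phi>(2)[OF x] by (simp add: holds_def sat_ren)
  qed
  ultimately show ?thesis by blast
qed

lemma tdf_of_dfn: "dfn L M X \<U> P \<Longrightarrow> tdf L M X \<U> P"
  unfolding tdf_def by (intro exI[of _ "{P}"]) auto

lemma tdf_cong: "(\<And>z. z \<in> X \<Longrightarrow> P z = Q z) \<Longrightarrow> tdf L M X \<U> P \<longleftrightarrow> tdf L M X \<U> Q"
  unfolding tdf_def by auto

lemma tdf_all:
  assumes "\<And>i. i \<in> I \<Longrightarrow> tdf L M X \<U> (P i)"
  shows "tdf L M X \<U> (\<lambda>z. \<forall>i\<in>I. P i z)"
proof -
  obtain \<P> where \<P>: "\<And>i. i \<in> I \<Longrightarrow> (\<forall>Q\<in>\<P> i. dfn L M X \<U> Q) \<and> (\<forall>z\<in>X. P i z \<longleftrightarrow> (\<forall>Q\<in>\<P> i. Q z))"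
  proof -
    have "\<forall>i\<in>I. \<exists>\<P>. (\<forall>Q\<in>\<P>. dfn L M X \<U> Q) \<and> (\<forall>z\<in>X. P i z \<longleftrightarrow> (\<forall>Q\<in>\<P>. Q z))"
      using assms unfolding tdf_def by simp
    from bchoice[OF this] show thesis by (elim exE) (rule that, erule bspec)
  qed
  show ?thesis unfolding tdf_def
  proof (intro exI[of _ "\<Union>i\<in>I. \<P> i"] conjI ballI)
    show "dfn L M X \<U> Q" if "Q \<in> (\<Union>i\<in>I. \<P> i)" for Q using \<P> that by auto
    show "(\<forall>i\<in>I. P i z) \<longleftrightarrow> (\<forall>Q\<in>\<Union>i\<in>I. \<P> i. Q z)" if "z \<in> X" for z using \<P> that by auto
  qed
qed

lemma tdf_conj:
  assumes "tdf L M X \<U> P" "tdf L M X \<U> Q"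
  shows "tdf L M X \<U> (\<lambda>z. P z \<and> Q z)"
proof -
  have "tdf L M X \<U> (\<lambda>z. \<forall>b\<in>UNIV. if b then P z else Q z)"
  proof (rule tdf_all)
    show "tdf L M X \<U> (\<lambda>z. if b then P z else Q z)" for b
      using assms by (cases b) simp_all
  qed
  then show ?thesis by (rule tdf_cong[THEN iffD1, rotated]) (auto split: if_splits)
qed

lemma tdf_comp:
  assumes "tdf L M Y \<V> P" "\<And>z. z \<in> X \<Longrightarrow> t z \<in> Y" "\<And>v. v \<in> \<V> \<Longrightarrow> (\<lambda>z. v (t z)) \<in> \<U>"
  shows "tdf L M X \<U> (\<lambda>z. P (t z))"
proof -
  obtain \<P> where \<P>: "\<forall>Q\<in>\<P>. dfn L M Y \<V> Q" "\<forall>z\<in>Y. P z \<longleftrightarrow> (\<forall>Q\<in>\<P>. Q z)"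
    using assms(1) unfolding tdf_def by blast
  have "dfn L M X \<U> (\<lambda>z. Q (t z))" if "Q \<in> \<P>" for Q
    by (rule dfn_comp[where t = t, OF \<P>(1)[rule_format, OF that] assms(2,3)])
  then show ?thesis unfolding tdf_def
    by (intro exI[of _ "(\<lambda>Q z. Q (t z)) ` \<P>"]) (use \<P>(2) assms(2) in auto)
qed

lemma tdf_mono: "tdf L M Y \<V> P \<Longrightarrow> X \<subseteq> Y \<Longrightarrow> \<V> \<subseteq> \<U> \<Longrightarrow> tdf L M X \<U> P"
  using tdf_comp[of L M Y \<V> P X "\<lambda>z. z" \<U>] by auto

text \<open>The bridge by which hypotheses and conclusions stated with \<open>type_definable\<close>
  enter and leave the calculus of \<open>tdf\<close>.\<close>

lemma tdf_type_definable:
  fixes M :: "('f, 'r, 's, 'a) fo_struct" and \<Delta> :: "'w \<Rightarrow> 's option"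
  assumes str: "is_struct L M"
  shows "type_definable L M A \<Delta> D \<longleftrightarrow> D \<subseteq> tuples M \<Delta> \<and> tdf L M (tuples M \<Delta>) (co \<Delta> A) (\<lambda>x. x \<in> D)"
proof
  assume "type_definable L M A \<Delta> D"
  then obtain \<Sigma> where S: "\<Sigma> \<subseteq> fm_over L M A \<Delta>" "D = {x \<in> tuples M \<Delta>. \<forall>\<phi>\<in>\<Sigma>. holds M \<phi> x}"
    unfolding type_definable_def by blast
  have "tdf L M (tuples M \<Delta>) (co \<Delta> A) (\<lambda>x. x \<in> D)"
    unfolding tdf_def
    by (rule exI[of _ "holds M ` \<Sigma>"]) (use S dfn_of_fm_over in blast)
  then show "D \<subseteq> tuples M \<Delta> \<and> tdf L M (tuples M \<Delta>) (co \<Delta> A) (\<lambda>x. x \<in> D)" using S(2) by blast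
next
  assume *: "D \<subseteq> tuples M \<Delta> \<and> tdf L M (tuples M \<Delta>) (co \<Delta> A) (\<lambda>x. x \<in> D)"
  then obtain \<P> where P: "\<forall>Q\<in>\<P>. dfn L M (tuples M \<Delta>) (co \<Delta> A) Q"
    "\<forall>x\<in>tuples M \<Delta>. x \<in> D \<longleftrightarrow> (\<forall>Q\<in>\<P>. Q x)"
    unfolding tdf_def by blast
  have "\<forall>Q\<in>\<P>. \<exists>\<phi>\<in>fm_over L M A \<Delta>. \<forall>x\<in>tuples M \<Delta>. Q x \<longleftrightarrow> holds M \<phi> x"
    using fm_over_of_dfn[OF str] P(1) by blast
  then obtain F where F: "\<And>Q. Q \<in> \<P> \<Longrightarrow> F Q \<in> fm_over L M A \<Delta> \<and> (\<forall>x\<in>tuples M \<Delta>. Q x \<longleftrightarrow> holds M (F Q) x)"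
    by metis
  have "D = {x \<in> tuples M \<Delta>. \<forall>\<phi>\<in>F ` \<P>. holds M \<phi> x}"
  proof
    show "D \<subseteq> {x \<in> tuples M \<Delta>. \<forall>\<phi>\<in>F ` \<P>. holds M \<phi> x}"
    proof
      fix x assume x: "x \<in> D"
      then have "x \<in> tuples M \<Delta>" using * by blast
      then show "x \<in> {x \<in> tuples M \<Delta>. \<forall>\<phi>\<in>F ` \<P>. holds M \<phi> x}" using x P(2) F by auto
    qed
    show "{x \<in> tuples M \<Delta>. \<forall>\<phi>\<in>F ` \<P>. holds M \<phi> x} \<subseteq> D"
      using P(2) F by auto
  qed
  then show "type_definable L M A \<Delta> D"
    unfolding type_definable_def using F by blast
qed

lemma lesspoll_iff_ordLess: "A \<prec> B \<longleftrightarrow> (card_of A, card_of B) \<in> ordLess"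
proof -
  have "B \<lesssim> A \<longleftrightarrow> (card_of B, card_of A) \<in> ordLeq"
    unfolding lepoll_def using card_of_ordLeq[of B A] by auto
  moreover have "A \<prec> B \<longleftrightarrow> \<not> B \<lesssim> A"
    using lepoll_antisym lesspoll_def lesspoll_trans1[of B A B] lesspoll_not_refl
      lesspoll_imp_lepoll eqpoll_imp_lepoll eqpoll_sym
    by (metis card_of_ordLeq lepoll_def ordLeq_total card_of_Well_order)
  ultimately have "A \<prec> B \<longleftrightarrow> (card_of B, card_of A) \<notin> ordLeq" by blast
  then show ?thesis by (metis card_of_Well_order not_ordLess_iff_ordLeq)
qed

locale monster =
  fixes L :: "('f, 'r, 's) lang" and M :: "('f, 'r, 's, 'a) fo_struct"
  assumes str: "is_struct L M"
    and saturated: "saturated L M"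
    and uncountable: "(UNIV :: nat set) \<prec> dom (srt M)"
begin

abbreviation U :: "'a set" where "U \<equiv> dom (srt M)"

lemma infinite_U: "infinite U"
  using uncountable lepoll_trans[of "UNIV :: nat set" U] infinite_le_lepoll
    lesspoll_imp_lepoll by blast

lemma small_subset: "small M B \<Longrightarrow> A \<subseteq> B \<Longrightarrow> small M A"
  unfolding small_def using subset_imp_lepoll lesspoll_trans1 by blast

lemma small_image: "small M B \<Longrightarrow> small M (f ` B)"
  unfolding small_def using image_lepoll lesspoll_trans1 by blast

lemma small_Un: "small M A \<Longrightarrow> small M B \<Longrightarrow> small M (A \<union> B)"
  unfolding small_def lesspoll_iff_ordLess using card_of_Un_ordLess_infinite[OF infinite_U] by blast

lemma small_countable: "countable A \<Longrightarrow> small M A"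
  unfolding small_def using uncountable lesspoll_trans1[of A "UNIV :: nat set"]
  by (auto simp: countable_def lepoll_def)

lemma small_finite: "finite A \<Longrightarrow> small M A"
  by (simp add: small_countable countable_finite)

lemma small_times:
  assumes "countable A" "small M B"
  shows "small M (A \<times> B)"
proof (cases "finite B")
  case True
  then show ?thesis using assms(1) by (intro small_countable countable_SIGMA) (auto intro: countable_finite)
next
  case False
  then have "(UNIV :: nat set) \<lesssim> B" using infinite_le_lepoll by blast
  moreover have "A \<lesssim> (UNIV :: nat set)" using assms(1) by (auto simp: countable_def lepoll_def)
  ultimately have "A \<lesssim> B" using lepoll_trans by blast
  then have "A \<times> B \<lesssim> B \<times> B" by (simp add: times_lepoll_mono)
  also have "B \<times> B \<approx> B"
    using card_of_Times_same_infinite[OF False] by (simp add: eqpoll_iff_card_of_ordIso)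
  finally show ?thesis using assms(2) unfolding small_def using lesspoll_trans1 by blast
qed

text \<open>A parameter outside the structure has no sort, so no well-formed formula mentions it.
  Saturation is stated for parameters inside the structure, and this restores that
  condition.\<close>

lemma co_Int: "dfn L M (tuples M \<Delta>) (co \<Delta> A) P \<Longrightarrow> dfn L M (tuples M \<Delta>) (co \<Delta> (A \<inter> U)) P"
proof -
  assume "dfn L M (tuples M \<Delta>) (co \<Delta> A) P"
  then obtain \<phi> where \<phi>: "\<phi> \<in> fm_over L M A \<Delta>" "\<forall>x\<in>tuples M \<Delta>. P x \<longleftrightarrow> holds M \<phi> x"
    using fm_over_of_dfn[OF str] by blast
  have "srt M |` A = srt M |` (A \<inter> U)" by (auto simp: restrict_map_def fun_eq_iff)
  then have "\<phi> \<in> fm_over L M (A \<inter> U) \<Delta>" using \<phi>(1) by (simp add: fm_over_def)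
  from dfn_of_fm_over[OF this] show ?thesis
    by (rule dfn_cong[THEN iffD1, rotated]) (use \<phi>(2) in simp)
qed

lemma saturated1:
  fixes s :: 's
  defines "\<Delta> \<equiv> \<lambda>_::unit. Some s"
  assumes "small M A" and "\<And>Q. Q \<in> \<Q> \<Longrightarrow> dfn L M (tuples M \<Delta>) (co \<Delta> A) Q"
    and "\<And>\<Q>'. \<Q>' \<subseteq> \<Q> \<Longrightarrow> finite \<Q>' \<Longrightarrow> \<exists>x\<in>tuples M \<Delta>. \<forall>Q\<in>\<Q>'. Q x"
  shows "\<exists>x\<in>tuples M \<Delta>. \<forall>Q\<in>\<Q>. Q x"
proof -
  have "\<forall>Q\<in>\<Q>. \<exists>\<phi>\<in>fm_over L M (A \<inter> U) \<Delta>. \<forall>x\<in>tuples M \<Delta>. Q x \<longleftrightarrow> holds M \<phi> x"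
    using fm_over_of_dfn[OF str co_Int] assms(3) by blast
  then obtain F where F: "\<And>Q. Q \<in> \<Q> \<Longrightarrow>
      F Q \<in> fm_over L M (A \<inter> U) \<Delta> \<and> (\<forall>x\<in>tuples M \<Delta>. Q x \<longleftrightarrow> holds M (F Q) x)"
    by metis
  have "\<exists>x\<in>tuples M \<Delta>. \<forall>\<phi>\<in>F ` \<Q>. holds M \<phi> x"
  proof (rule saturated[unfolded saturated_def, rule_format, of "F ` \<Q>" "A \<inter> U" s, folded \<Delta>_def])
    show "F ` \<Q> \<subseteq> fm_over L M (A \<inter> U) \<Delta>" using F by blast
    have "\<exists>x\<in>tuples M \<Delta>. \<forall>\<phi>\<in>\<Sigma>. holds M \<phi> x" if S: "\<Sigma> \<subseteq> F ` \<Q>" "finite \<Sigma>" for \<Sigma>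
    proof -
      obtain \<Q>' where "\<Q>' \<subseteq> \<Q>" "finite \<Q>'" "\<Sigma> = F ` \<Q>'"
        using finite_subset_image[OF S(2,1)] by blast
      moreover obtain x where "x \<in> tuples M \<Delta>" "\<forall>Q\<in>\<Q>'. Q x"
        using assms(4)[of \<Q>'] calculation by blast
      ultimately show ?thesis using F by (intro bexI[of _ x]) auto
    qed
    moreover have "small M (A \<inter> U)" using assms(2) small_subset by blast
    ultimately show "A \<inter> U \<subseteq> U \<and> small M (A \<inter> U) \<and>
      (\<forall>\<Sigma>\<^sub>0\<subseteq>F ` \<Q>. finite \<Sigma>\<^sub>0 \<longrightarrow> (\<exists>x\<in>tuples M \<Delta>. \<forall>\<phi>\<in>\<Sigma>\<^sub>0. holds M \<phi> x))" by blast
  qed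
  then show ?thesis using F by auto
qed

text \<open>A maximal finitely consistent partial assignment is total, by saturation in one variable.\<close>

lemma compactness:
  fixes \<Delta> :: "'w \<Rightarrow> 's option"
  assumes "small M (dom \<Delta>)" "small M A"
    and Q: "\<And>Q. Q \<in> \<Q> \<Longrightarrow> dfn L M (tuples M \<Delta>) (co \<Delta> A) Q"
    and fin: "\<And>\<Q>'. \<Q>' \<subseteq> \<Q> \<Longrightarrow> finite \<Q>' \<Longrightarrow> \<exists>x\<in>tuples M \<Delta>. \<forall>Q\<in>\<Q>'. Q x"
  shows "\<exists>x\<in>tuples M \<Delta>. \<forall>Q\<in>\<Q>. Q x"
proof -
  define con where "con R \<Q>' x \<longleftrightarrow> x \<in> tuples M \<Delta> \<and> (\<forall>w\<in>R. x (fst w) = snd w) \<and> (\<forall>Q\<in>\<Q>'. Q x)"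
    for R :: "('w \<times> 'a) set" and \<Q>' and x
  \<comment> \<open>Consistency is demanded only of finite pieces of the assignment together with
    finitely many conditions; that is what lets it survive unions of chains.\<close>
  define C where "C = {R. R \<subseteq> dom \<Delta> \<times> UNIV \<and>
    (\<forall>R' \<Q>'. finite R' \<and> R' \<subseteq> R \<and> finite \<Q>' \<and> \<Q>' \<subseteq> \<Q> \<longrightarrow> (\<exists>x. con R' \<Q>' x))}"
  have "\<exists>R\<in>C. \<forall>R'\<in>C. R \<subseteq> R' \<longrightarrow> R' = R"
  proof (rule subset_Zorn')
    fix c assume c: "subset.chain C c"
    then have chain: "\<And>R. R \<in> c \<Longrightarrow> R \<in> C" "\<And>R R'. R \<in> c \<Longrightarrow> R' \<in> c \<Longrightarrow> R \<subseteq> R' \<or> R' \<subseteq> R"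
      by (auto simp: subset_chain_def)
    have "\<exists>x. con R' \<Q>' x" if R': "finite R'" "R' \<subseteq> \<Union>c" "finite \<Q>'" "\<Q>' \<subseteq> \<Q>" for R' \<Q>'
    proof (cases "R' = {}")
      case True
      then show ?thesis using fin[OF R'(4,3)] by (auto simp: con_def)
    next
      case False
      then have "c \<noteq> {}" using R'(2) by auto
      then obtain R where "R \<in> c" "R' \<subseteq> R"
        using finite_subset_Union_chain[OF R'(1,2) _ c] by blast
      then show ?thesis using chain(1) R' unfolding C_def by blast
    qed
    then show "\<Union>c \<in> C" using chain(1) unfolding C_def by blast
  qed
  then obtain R where R: "R \<in> C" and max: "\<And>R'. R' \<in> C \<Longrightarrow> R \<subseteq> R' \<Longrightarrow> R' = R" by blast
  have Rdom: "R \<subseteq> dom \<Delta> \<times> UNIV"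
    and Rcon: "\<And>R' \<Q>'. finite R' \<Longrightarrow> R' \<subseteq> R \<Longrightarrow> finite \<Q>' \<Longrightarrow> \<Q>' \<subseteq> \<Q> \<Longrightarrow> \<exists>x. con R' \<Q>' x"
    using R unfolding C_def by blast+
  have single: "a = b" if "(v, a) \<in> R" "(v, b) \<in> R" for v a b
    using Rcon[of "{(v, a), (v, b)}" "{}"] that by (auto simp: con_def)
  define A' where "A' = A \<union> snd ` R"
  \<comment> \<open>The values assigned so far become parameters. There are at most as many of them
    as indices, so saturation still applies.\<close>
  have "inj_on fst R" using single by (force simp: inj_on_def)
  then have "R \<lesssim> dom \<Delta>" unfolding lepoll_def using Rdom by force
  then have "small M R" using assms(1) lesspoll_trans1 unfolding small_def by blast
  then have smallA': "small M A'" unfolding A'_def using assms(2) small_Un small_image by blast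
  have total: "\<exists>a. (v, a) \<in> R" if v: "v \<in> dom \<Delta>" for v
  proof -
    obtain s where s: "\<Delta> v = Some s" using v by auto
    let ?D = "\<lambda>_::unit. Some s"
    \<comment> \<open>The one-variable type of an admissible value at \<open>v\<close>: the rest of
      the tuple is quantified away, which \<open>dfn_ex\<close> allows even for infinite
      \<open>\<Delta>\<close>.\<close>
    define \<psi> where "\<psi> R' \<Q>' z \<longleftrightarrow> (\<exists>x\<in>tuples M \<Delta>. ((\<forall>w\<in>R'. x (fst w) = snd w) \<and> (\<forall>Q\<in>\<Q>'. Q x)) \<and> x v = z ())"
      for R' \<Q>' and z :: "unit \<Rightarrow> 'a"
    have \<psi>_con: "\<psi> R' \<Q>' z \<longleftrightarrow> (\<exists>x. con R' \<Q>' x \<and> x v = z ())" for R' \<Q>' z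
      unfolding \<psi>_def con_def by blast
    let ?T = "{\<psi> R' \<Q>' | R' \<Q>'. finite R' \<and> R' \<subseteq> R \<and> finite \<Q>' \<and> \<Q>' \<subseteq> \<Q>}"
    have "\<exists>z\<in>tuples M ?D. \<forall>Q\<in>?T. Q z"
    proof (rule saturated1[OF smallA'])
      fix P assume "P \<in> ?T"
      then obtain R' \<Q>' where P: "P = \<psi> R' \<Q>'" "finite R'" "R' \<subseteq> R" "finite \<Q>'" "\<Q>' \<subseteq> \<Q>" by blast
      let ?X = "tuples M ?D \<times> tuples M \<Delta>" and ?U = "prodc (co ?D A') (co \<Delta> {})"
      have "dfn L M ?X ?U (\<lambda>p. snd p (fst w) = snd w)" if w: "w \<in> R'" for w
      proof -
        have d: "fst w \<in> dom \<Delta>" using w P(3) Rdom by auto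
        obtain x where x: "con {w} {} x" using Rcon[of "{w}" "{}"] w P(3) by auto
        have "srt M (snd w) = \<Delta> (fst w)"
          using x d tuples_sort[of x M \<Delta> "fst w"] unfolding con_def by (cases w) auto
        moreover have "(\<lambda>p. snd w) \<in> ?U"
        proof -
          have "(\<lambda>x. snd w) \<in> co ?D A'" using w P(3) by (auto simp: co_def A'_def)
          then show ?thesis unfolding prodc_def by (auto simp: image_iff)
        qed
        moreover have "(\<lambda>p. snd p (fst w)) \<in> ?U" using d by (auto simp: prodc_def co_def)
        moreover obtain s' where "\<Delta> (fst w) = Some s'" using d by auto
        ultimately show ?thesis
          using d tuples_sort by (intro dfn_eq[where s = s']) (auto simp: mem_Times_iff tuples_iff)
      qed
      moreover have "dfn L M ?X ?U (\<lambda>p. Q (snd p))" if "Q \<in> \<Q>'" for Q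
      proof (rule dfn_comp[where t = snd])
        show "dfn L M (tuples M \<Delta>) (co \<Delta> A) Q" using Q that P(5) by blast
        fix u assume "u \<in> co \<Delta> A"
        then consider i where "i \<in> dom \<Delta>" "u = (\<lambda>x. x i)" | a where "a \<in> A" "u = (\<lambda>x. a)"
          unfolding co_def by blast
        then show "(\<lambda>z. u (snd z)) \<in> ?U"
        proof cases
          case 1
          then show ?thesis by (auto simp: prodc_def co_def)
        next
          case 2
          then have "(\<lambda>x. a) \<in> co ?D A'" by (auto simp: co_def A'_def)
          then show ?thesis using 2 unfolding prodc_def by (auto simp: image_iff)
        qed
      qed auto
      moreover have "dfn L M ?X ?U (\<lambda>p. snd p v = fst p ())"
      proof (rule dfn_eq[where s = s])
        show "(\<lambda>p. snd p v) \<in> ?U" using v by (auto simp: prodc_def co_def)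
        show "(\<lambda>p. fst p ()) \<in> ?U" unfolding prodc_def co_def by (rule UnI1) auto
        show "srt M (snd p v) = Some s" if "p \<in> ?X" for p
          using that tuples_sort[of "snd p" M \<Delta> v] s v by auto
        show "srt M (fst p ()) = Some s" if "p \<in> ?X" for p
          using that by (auto simp: tuples_iff)
      qed
      ultimately have "dfn L M ?X ?U (\<lambda>p. ((\<forall>w\<in>R'. snd p (fst w) = snd w) \<and> (\<forall>Q\<in>\<Q>'. Q (snd p))) \<and>
          snd p v = fst p ())"
        using P by (intro dfn_conj dfn_ball_finite) auto
      from dfn_ex[OF str this] show "dfn L M (tuples M ?D) (co ?D A') P"
        unfolding P(1) \<psi>_def[abs_def] by simp
    next
      fix T assume T: "T \<subseteq> ?T" "finite T"
      have "\<forall>P\<in>T. \<exists>R' \<Q>'. P = \<psi> R' \<Q>' \<and> finite R' \<and> R' \<subseteq> R \<and> finite \<Q>' \<and> \<Q>' \<subseteq> \<Q>"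
        using T(1) by blast
      then obtain r q where rq: "\<And>P. P \<in> T \<Longrightarrow>
          P = \<psi> (r P) (q P) \<and> finite (r P) \<and> r P \<subseteq> R \<and> finite (q P) \<and> q P \<subseteq> \<Q>"
        by metis
      obtain x where x: "con (\<Union>(r ` T)) (\<Union>(q ` T)) x"
        using Rcon[of "\<Union>(r ` T)" "\<Union>(q ` T)"] T(2) rq by blast
      have "\<forall>P\<in>T. P (\<lambda>_. x v)"
      proof
        fix P assume P: "P \<in> T"
        have "con (r P) (q P) x" using x P unfolding con_def by auto
        then have "\<psi> (r P) (q P) (\<lambda>_. x v)" unfolding \<psi>_con by (intro exI[of _ x]) simp
        then show "P (\<lambda>_. x v)" using rq[OF P] by simp
      qed
      moreover have "(\<lambda>_::unit. x v) \<in> tuples M ?D"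
      proof -
        have "x \<in> tuples M \<Delta>" using x by (simp add: con_def)
        then have "srt M (x v) = Some s" using s tuples_sort[of x M \<Delta> v] v by simp
        then show ?thesis by (simp add: tuples_iff dom_def)
      qed
      ultimately show "\<exists>z\<in>tuples M ?D. \<forall>Q\<in>T. Q z" by blast
    qed
    then obtain z where z1: "z \<in> tuples M ?D" "\<forall>Q\<in>?T. Q z" by (elim bexE)
    have z: "\<psi> R' \<Q>' z" if "finite R'" "R' \<subseteq> R" "finite \<Q>'" "\<Q>' \<subseteq> \<Q>" for R' \<Q>'
      by (rule z1(2)[rule_format]) (use that in blast)
    have "insert (v, z ()) R \<in> C"
    proof -
      have "\<exists>x. con R' \<Q>' x" if R': "finite R'" "R' \<subseteq> insert (v, z ()) R" "finite \<Q>'" "\<Q>' \<subseteq> \<Q>" for R' \<Q>'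
      proof -
        have "\<psi> (R' - {(v, z ())}) \<Q>' z" by (rule z) (use R' in auto)
        then obtain x where x: "con (R' - {(v, z ())}) \<Q>' x" "x v = z ()" unfolding \<psi>_con by (elim exE conjE)
        have "x w = a" if wa: "(w, a) \<in> R'" for w a
        proof (cases "(w, a) = (v, z ())")
          case True
          then show ?thesis using x(2) by simp
        next
          case False
          then have "(w, a) \<in> R' - {(v, z ())}" using wa by simp
          then have "x (fst (w, a)) = snd (w, a)" using x(1) unfolding con_def by blast
          then show ?thesis by simp
        qed
        then have "\<forall>w\<in>R'. x (fst w) = snd w" by simp
        then have "con R' \<Q>' x" using x(1) unfolding con_def by (elim conjE) (intro conjI)
        then show ?thesis by blast
      qed
      then show ?thesis using v Rdom unfolding C_def by auto
    qed
    then have "insert (v, z ()) R = R" by (rule max) auto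
    then show ?thesis by blast
  qed
  then obtain f where f: "\<And>v. v \<in> dom \<Delta> \<Longrightarrow> (v, f v) \<in> R" by metis
  define x where "x = restrict f (dom \<Delta>)"
  have "srt M (f v) = \<Delta> v" if v: "v \<in> dom \<Delta>" for v
  proof -
    obtain y where "con {(v, f v)} {} y" using Rcon[of "{(v, f v)}" "{}"] f[OF v] by auto
    then show ?thesis using v tuples_sort by (fastforce simp: con_def)
  qed
  then have x: "x \<in> tuples M \<Delta>" unfolding x_def by (rule restrict_tuples)
  moreover have "Q x" if QQ: "Q \<in> \<Q>" for Q
  proof -
    obtain \<U>' where U': "finite \<U>'" "\<U>' \<subseteq> co \<Delta> A" "dfn L M (tuples M \<Delta>) \<U>' Q"
      using dfn_finite[OF Q[OF QQ]] by metis
    \<comment> \<open>\<open>Q\<close> reads only the finitely many entries in \<open>V\<close>.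
      Finite consistency gives a tuple that agrees with \<open>x\<close> there and satisfies
      \<open>Q\<close>, and \<open>dfn_dep\<close> transfers \<open>Q\<close> to
      \<open>x\<close>.\<close>
    define V where "V = {i \<in> dom \<Delta>. (\<lambda>x::'w \<Rightarrow> 'a. x i) \<in> \<U>'}"
    have inj: "inj (\<lambda>i (x::'w \<Rightarrow> 'a). x i)"
    proof (rule injI)
      fix i j assume *: "(\<lambda>x::'w \<Rightarrow> 'a. x i) = (\<lambda>x. x j)"
      obtain a b :: 'a where "a \<noteq> b" using infinite_U
        by (metis finite.emptyI finite_insert finite_subset insertI1 insert_absorb subsetI)
      then show "i = j" using fun_cong[OF *, of "\<lambda>k. if k = i then a else b"] by (auto split: if_splits)
    qed
    have "finite ((\<lambda>i (x::'w \<Rightarrow> 'a). x i) ` V)" using U'(1) by (rule rev_finite_subset) (auto simp: V_def)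
    then have "finite V" using finite_imageD inj inj_on_subset by blast
    then obtain y where y: "con ((\<lambda>v. (v, f v)) ` V) {Q} y"
      using Rcon[of "(\<lambda>v. (v, f v)) ` V" "{Q}"] QQ f unfolding V_def by auto
    have "u x = u y" if u: "u \<in> \<U>'" for u
    proof -
      consider i where "i \<in> dom \<Delta>" "u = (\<lambda>x. x i)" | a where "u = (\<lambda>x. a)"
        using U'(2) u unfolding co_def by blast
      then show ?thesis
      proof cases
        case 1
        then have "i \<in> V" using u by (simp add: V_def)
        then have "y i = f i" using y by (simp add: con_def)
        then show ?thesis using 1 by (simp add: x_def)
      qed simp
    qed
    then show ?thesis
      using dfn_dep[OF U'(3) x, of y] y unfolding con_def by auto
  qed
  ultimately show ?thesis by blast
qed

end

text \<open>Coordinate maps: substitution along such a map preserves definability.\<close>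

definition cm :: "'z set \<Rightarrow> ('z \<Rightarrow> 'a) set \<Rightarrow> 'y set \<Rightarrow> ('y \<Rightarrow> 'a) set \<Rightarrow> ('z \<Rightarrow> 'y) \<Rightarrow> bool" where
  "cm X \<U> Y \<V> t \<longleftrightarrow> (\<forall>z\<in>X. t z \<in> Y) \<and> (\<forall>v\<in>\<V>. (\<lambda>z. v (t z)) \<in> \<U>)"

lemma cmI: "(\<And>z. z \<in> X \<Longrightarrow> t z \<in> Y) \<Longrightarrow> (\<And>v. v \<in> \<V> \<Longrightarrow> (\<lambda>z. v (t z)) \<in> \<U>) \<Longrightarrow> cm X \<U> Y \<V> t"
  by (simp add: cm_def)

lemma cmD: "cm X \<U> Y \<V> t \<Longrightarrow> z \<in> X \<Longrightarrow> t z \<in> Y"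
  by (simp add: cm_def)

lemma dfn_cm: "dfn L M Y \<V> P \<Longrightarrow> cm X \<U> Y \<V> t \<Longrightarrow> dfn L M X \<U> (\<lambda>z. P (t z))"
  by (rule dfn_comp[where t = t]) (auto simp: cm_def)

lemma tdf_cm: "tdf L M Y \<V> P \<Longrightarrow> cm X \<U> Y \<V> t \<Longrightarrow> tdf L M X \<U> (\<lambda>z. P (t z))"
  by (rule tdf_comp[where t = t]) (auto simp: cm_def)

lemma cm_id: "cm X \<U> X \<U> (\<lambda>z. z)"
  by (simp add: cm_def)

lemma cm_mono: "\<V> \<subseteq> \<U> \<Longrightarrow> X \<subseteq> Y \<Longrightarrow> cm X \<U> Y \<V> (\<lambda>z. z)"
  by (auto simp: cm_def)

lemma cm_comp: "cm X \<U> Y \<V> t \<Longrightarrow> cm Y \<V> Z \<W> s \<Longrightarrow> cm X \<U> Z \<W> (\<lambda>z. s (t z))"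
proof (rule cmI)
  assume *: "cm X \<U> Y \<V> t" "cm Y \<V> Z \<W> s"
  show "s (t z) \<in> Z" if "z \<in> X" for z using * that by (auto simp: cm_def)
  show "(\<lambda>z. v (s (t z))) \<in> \<U>" if "v \<in> \<W>" for v
  proof -
    have "(\<lambda>z. v (s z)) \<in> \<V>" using *(2) that by (simp add: cm_def)
    moreover have "\<forall>v\<in>\<V>. (\<lambda>z. v (t z)) \<in> \<U>" using *(1) by (simp add: cm_def)
    ultimately show ?thesis by (rule bspec[rotated])
  qed
qed

lemma cm_fst: "cm (X \<times> Y) (prodc \<U> \<V>) X \<U> fst"
  by (auto simp: cm_def prodc_def)

lemma cm_snd: "cm (X \<times> Y) (prodc \<U> \<V>) Y \<V> snd"
  by (auto simp: cm_def prodc_def)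

lemma cm_pair: "cm X \<U> Y \<V> s \<Longrightarrow> cm X \<U> Z \<W> t \<Longrightarrow> cm X \<U> (Y \<times> Z) (prodc \<V> \<W>) (\<lambda>z. (s z, t z))"
  by (auto simp: cm_def prodc_def)

lemma cm_const: "c \<in> D \<Longrightarrow> (\<And>i. i \<in> dom \<Delta> \<Longrightarrow> (\<lambda>z. c i) \<in> \<U>) \<Longrightarrow> cm X \<U> D (co \<Delta> {}) (\<lambda>z. c)"
  by (auto simp: cm_def co_def)

lemma cm_co: "cm X \<U> D (co \<Delta> {}) s \<Longrightarrow> (\<And>a. a \<in> A \<Longrightarrow> (\<lambda>z. a) \<in> \<U>) \<Longrightarrow> cm X \<U> D (co \<Delta> A) s"
  by (auto simp: cm_def co_def)

text \<open>The same formula is read on the larger environment. Well-formedness depends on the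
  sorts, so a coordinate of constant sort on \<open>X'\<close> has to keep that sort on
  \<open>X\<close>.\<close>

lemma dfn_extend:
  assumes "X' \<subseteq> X" "X' \<noteq> {}"
    and sorted: "\<And>u s. u \<in> \<U> \<Longrightarrow> (\<And>z. z \<in> X' \<Longrightarrow> srt M (u z) = Some s) \<Longrightarrow> \<forall>z\<in>X. srt M (u z) = Some s"
    and "dfn L M X' \<U> Q"
  shows "\<exists>Q'. dfn L M X \<U> Q' \<and> (\<forall>z\<in>X'. Q z \<longleftrightarrow> Q' z)"
proof -
  obtain \<phi> where "wf_fm L (cx M X' \<U>) [] \<phi>" "\<forall>z\<in>X'. Q z \<longleftrightarrow> sat M (\<lambda>u. u z) [] \<phi>"
    "\<forall>u\<in>fv \<phi>. u \<in> \<U>" "\<forall>u\<in>fv \<phi>. \<forall>z\<in>X'. srt M (u z) = cx M X' \<U> u"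
    by (rule exE[OF dfnE[OF assms(4)]], elim conjE, rule that)
  note \<phi> = this[rule_format]
  have "dfn L M X \<U> (\<lambda>z. sat M (\<lambda>u. u z) [] \<phi>)"
  proof (rule dfnI[OF \<phi>(1), where \<alpha> = "\<lambda>u. u"])
    fix v z assume v: "v \<in> dom (cx M X' \<U>)" "v \<in> fv \<phi>" "z \<in> X"
    obtain s where s: "cx M X' \<U> v = Some s" using v(1) by auto
    then have "srt M (v z) = Some s" if "z \<in> X'" for z using \<phi>(4)[OF v(2) that] by simp
    then show "srt M (v z) = cx M X' \<U> v" using sorted[OF \<phi>(3)[OF v(2)]] v(3) s by metis
  qed (use \<phi>(3) in auto)
  then show ?thesis using \<phi>(2) by blast
qed

section \<open>Environments with the compactness property\<close>

definition cpt :: "('f, 'r, 's) lang \<Rightarrow> ('f, 'r, 's, 'a) fo_struct \<Rightarrow> 'z set \<Rightarrow> ('z \<Rightarrow> 'a) set \<Rightarrow> bool" where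
  "cpt L M X \<U> \<longleftrightarrow> (\<forall>\<Q>. (\<forall>Q\<in>\<Q>. dfn L M X \<U> Q) \<longrightarrow>
     (\<forall>\<Q>'. \<Q>' \<subseteq> \<Q> \<longrightarrow> finite \<Q>' \<longrightarrow> (\<exists>z\<in>X. \<forall>Q\<in>\<Q>'. Q z)) \<longrightarrow> (\<exists>z\<in>X. \<forall>Q\<in>\<Q>. Q z))"

lemma cptD:
  assumes "cpt L M X \<U>" "\<And>Q. Q \<in> \<Q> \<Longrightarrow> dfn L M X \<U> Q"
    "\<And>\<Q>'. \<Q>' \<subseteq> \<Q> \<Longrightarrow> finite \<Q>' \<Longrightarrow> \<exists>z\<in>X. \<forall>Q\<in>\<Q>'. Q z"
  shows "\<exists>z\<in>X. \<forall>Q\<in>\<Q>. Q z"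
  using assms(1)[unfolded cpt_def, rule_format, of \<Q>] assms(2,3) by simp

text \<open>The form in which compactness is mostly used: \<open>\<Q>\<close> together with the
  negation of \<open>R\<close> is inconsistent, hence finitely inconsistent.\<close>

lemma cpt_imp:
  assumes cpt: "cpt L M X \<U>" and Q: "\<And>Q. Q \<in> \<Q> \<Longrightarrow> dfn L M X \<U> Q" and R: "dfn L M X \<U> R"
    and imp: "\<And>z. z \<in> X \<Longrightarrow> (\<And>Q. Q \<in> \<Q> \<Longrightarrow> Q z) \<Longrightarrow> R z"
  shows "\<exists>F. F \<subseteq> \<Q> \<and> finite F \<and> (\<forall>z\<in>X. (\<forall>Q\<in>F. Q z) \<longrightarrow> R z)"
proof (rule ccontr)
  assume no: "\<nexists>F. F \<subseteq> \<Q> \<and> finite F \<and> (\<forall>z\<in>X. (\<forall>Q\<in>F. Q z) \<longrightarrow> R z)"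
  let ?N = "\<lambda>z. \<not> R z"
  have "\<exists>z\<in>X. \<forall>Q\<in>insert ?N \<Q>. Q z"
  proof (rule cptD[OF cpt])
    fix Q assume "Q \<in> insert ?N \<Q>"
    then consider "Q = ?N" | "Q \<in> \<Q>" by blast
    then show "dfn L M X \<U> Q"
    proof cases
      case 1
      then show ?thesis using dfn_not[OF R] by simp
    qed (rule Q)
  next
    fix \<Q>' assume F: "\<Q>' \<subseteq> insert ?N \<Q>" "finite \<Q>'"
    have "\<exists>z\<in>X. (\<forall>Q\<in>\<Q>' - {?N}. Q z) \<and> \<not> R z"
      using no[simplified, rule_format, of "\<Q>' - {?N}"] F by blast
    then obtain z where z: "z \<in> X" "\<forall>Q\<in>\<Q>' - {?N}. Q z" "\<not> R z" by (elim bexE conjE)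
    have "Q z" if "Q \<in> \<Q>'" for Q
      by (cases "Q = ?N") (use z that in auto)
    then show "\<exists>z\<in>X. \<forall>Q\<in>\<Q>'. Q z" using z(1) by (intro bexI[of _ z] ballI)
  qed
  then obtain z where "z \<in> X" "\<forall>Q\<in>insert ?N \<Q>. Q z" by (elim bexE)
  note z = this
  have "?N z" by (rule bspec[OF z(2) insertI1])
  moreover have "R z" by (rule imp[OF z(1)]) (rule bspec[OF z(2) insertI2])
  ultimately show False by simp
qed

lemma cpt_image:
  assumes "cpt L M Y \<V>" "cm Y \<V> X \<U> s" "\<And>x. x \<in> X \<Longrightarrow> \<exists>y\<in>Y. x = s y"
  shows "cpt L M X \<U>"
  unfolding cpt_def
proof (intro allI impI)
  fix \<Q> assume Q: "\<forall>Q\<in>\<Q>. dfn L M X \<U> Q" "\<forall>\<Q>'\<subseteq>\<Q>. finite \<Q>' \<longrightarrow> (\<exists>z\<in>X. \<forall>Q\<in>\<Q>'. Q z)"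
  let ?Q = "(\<lambda>Q y. Q (s y)) ` \<Q>"
  have "\<exists>y\<in>Y. \<forall>Q\<in>?Q. Q y"
  proof (rule cptD[OF assms(1)])
    fix R assume "R \<in> ?Q"
    then show "dfn L M Y \<V> R" 
      by (elim imageE) (simp add: dfn_cm[OF Q(1)[rule_format] assms(2)])
  next
    fix \<Q>' assume fin_img: "\<Q>' \<subseteq> ?Q" "finite \<Q>'"
    obtain F where F: "F \<subseteq> \<Q>" "finite F" "\<Q>' = (\<lambda>Q y. Q (s y)) ` F"
      using finite_subset_image[OF fin_img(2,1)] by (elim exE conjE) (rule that)
    obtain z where "z \<in> X" "\<forall>Q\<in>F. Q z" using Q(2)[rule_format, OF F(1,2)] by (elim bexE)
    moreover obtain y where "y \<in> Y" "z = s y" using assms(3)[OF calculation(1)] by (elim bexE)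
    ultimately show "\<exists>y\<in>Y. \<forall>Q\<in>\<Q>'. Q y" unfolding F(3) by (intro bexI[of _ y]) simp_all
  qed
  then obtain y where "y \<in> Y" "\<forall>Q\<in>?Q. Q y" by (elim bexE)
  then show "\<exists>z\<in>X. \<forall>Q\<in>\<Q>. Q z" using cmD[OF assms(2)] by (intro bexI[of _ "s y"]) simp_all
qed

text \<open>The conditions that cut out \<open>X'\<close> are added to the given ones, so
  \<open>X'\<close> may be merely type-definable.\<close>

lemma cpt_restrict:
  assumes cpt: "cpt L M X \<U>" and sub: "X' \<subseteq> X"
    and sorted: "\<And>u s. u \<in> \<U> \<Longrightarrow> (\<And>z. z \<in> X' \<Longrightarrow> srt M (u z) = Some s) \<Longrightarrow> \<forall>z\<in>X. srt M (u z) = Some s"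
    and X': "tdf L M X \<U> (\<lambda>z. z \<in> X')"
  shows "cpt L M X' \<U>"
  unfolding cpt_def
proof (intro allI impI)
  fix \<Q> assume Q: "\<forall>Q\<in>\<Q>. dfn L M X' \<U> Q" "\<forall>\<Q>'\<subseteq>\<Q>. finite \<Q>' \<longrightarrow> (\<exists>z\<in>X'. \<forall>Q\<in>\<Q>'. Q z)"
  have ne: "X' \<noteq> {}" using Q(2)[rule_format, of "{}"] by auto
  obtain \<P> where \<P>: "\<forall>P\<in>\<P>. dfn L M X \<U> P" "\<forall>z\<in>X. z \<in> X' \<longleftrightarrow> (\<forall>P\<in>\<P>. P z)"
    using X' unfolding tdf_def by (elim exE conjE)
  have "\<forall>Q\<in>\<Q>. \<exists>Q'. dfn L M X \<U> Q' \<and> (\<forall>z\<in>X'. Q z \<longleftrightarrow> Q' z)"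
  proof
    fix Q assume "Q \<in> \<Q>"
    then have "dfn L M X' \<U> Q" using Q(1) by simp
    then show "\<exists>Q'. dfn L M X \<U> Q' \<and> (\<forall>z\<in>X'. Q z \<longleftrightarrow> Q' z)"
      by (rule dfn_extend[OF sub ne, rotated]) (rule sorted)
  qed
  then obtain e where e: "\<forall>Q\<in>\<Q>. dfn L M X \<U> (e Q) \<and> (\<forall>z\<in>X'. Q z \<longleftrightarrow> e Q z)"
    using that by (elim bchoice[THEN exE])
  have "\<exists>z\<in>X. \<forall>Q\<in>\<P> \<union> e ` \<Q>. Q z"
  proof (rule cptD[OF cpt])
    show "dfn L M X \<U> Q" if "Q \<in> \<P> \<union> e ` \<Q>" for Q using that \<P>(1) e by auto
  next
    fix \<Q>' assume *: "\<Q>' \<subseteq> \<P> \<union> e ` \<Q>" "finite \<Q>'"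
    then have fin_img: "\<Q>' - \<P> \<subseteq> e ` \<Q>" "finite (\<Q>' - \<P>)" by auto
    obtain F where F: "F \<subseteq> \<Q>" "finite F" "\<Q>' - \<P> = e ` F"
      using finite_subset_image[OF fin_img(2,1)] by (elim exE conjE) (rule that)
    obtain z where z: "z \<in> X'" "\<forall>Q\<in>F. Q z" using Q(2)[rule_format, OF F(1,2)] by (elim bexE)
    have "R z" if R: "R \<in> \<Q>'" for R
    proof (cases "R \<in> \<P>")
      case True
      then show ?thesis using \<P>(2) z(1) sub by auto
    next
      case False
      then obtain Q where "Q \<in> F" "R = e Q" using R F(3) by auto
      then show ?thesis using e z F(1) by auto
    qed
    then show "\<exists>z\<in>X. \<forall>Q\<in>\<Q>'. Q z" using z(1) sub by (intro bexI[of _ z] ballI) auto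
  qed
  then obtain z where z: "z \<in> X" "\<forall>Q\<in>\<P> \<union> e ` \<Q>. Q z" by (elim bexE)
  have "\<forall>P\<in>\<P>. P z" by (rule ballI, rule bspec[OF z(2)]) simp
  then have "z \<in> X'" using \<P>(2) z(1) by blast
  moreover have "Q z" if "Q \<in> \<Q>" for Q
  proof -
    have "e Q z" using bspec[OF z(2), of "e Q"] that by simp
    then show ?thesis using e that \<open>z \<in> X'\<close> by simp
  qed
  ultimately show "\<exists>z\<in>X'. \<forall>Q\<in>\<Q>. Q z" by (intro bexI[of _ z] ballI)
qed

lemma prod_sorted:
  assumes D: "D \<subseteq> tuples M \<Delta>" "D \<noteq> {}"
    and u: "u \<in> prodc \<U> (co \<Delta> {})" "\<And>z. z \<in> X \<times> D \<Longrightarrow> srt M (u z) = Some s"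
  shows "\<forall>z\<in>X \<times> tuples M \<Delta>. srt M (u z) = Some s"
proof
  fix z assume z: "z \<in> X \<times> tuples M \<Delta>"
  obtain d where d: "d \<in> D" using D(2) by auto
  then have "(fst z, d) \<in> X \<times> D" using z by auto
  then have *: "srt M (u (fst z, d)) = Some s" by (rule u(2))
  consider v where "u = (\<lambda>p. v (fst p))" | i where "i \<in> dom \<Delta>" "u = (\<lambda>p. snd p i)"
    using u(1) unfolding prodc_def co_def by blast
  then show "srt M (u z) = Some s"
  proof cases
    case 1
    then show ?thesis using * by simp
  next
    case 2
    have "srt M (snd z i) = \<Delta> i" using z tuples_sort[OF _ 2(1), of "snd z" M] by auto
    moreover have "srt M (d i) = \<Delta> i" using d D(1) tuples_sort[OF _ 2(1), of d M] by auto
    ultimately have "srt M (snd z i) = \<Delta> i" "srt M (d i) = \<Delta> i" .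
    then show ?thesis using 2 * by simp
  qed
qed

text \<open>Quantification over a definable \<open>D\<close> is quantification over tuples with the
  conjunct \<open>y \<in> D\<close>; the predicate, given only over \<open>D\<close>, is first
  extended to all tuples.\<close>

lemma dfn_exD:
  assumes str: "is_struct L M" and D: "D \<subseteq> tuples M \<Delta>" "dfn L M (tuples M \<Delta>) (co \<Delta> {}) (\<lambda>y. y \<in> D)"
    and P: "dfn L M (X \<times> D) (prodc \<U> (co \<Delta> {})) (\<lambda>p. P (fst p) (snd p))"
  shows "dfn L M X \<U> (\<lambda>z. \<exists>y\<in>D. P z y)"
proof (cases "X \<times> D = {}")
  case True
  then have "(\<exists>y\<in>D. P z y) \<longleftrightarrow> False" if "z \<in> X" for z using that by auto
  then show ?thesis by (rule dfn_cong[THEN iffD2]) (simp_all add: dfn_const)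
next
  case False
  then have "D \<noteq> {}" by auto
  then obtain P' where P': "dfn L M (X \<times> tuples M \<Delta>) (prodc \<U> (co \<Delta> {})) P'"
    "\<forall>p\<in>X \<times> D. P (fst p) (snd p) \<longleftrightarrow> P' p"
  proof -
    have "X \<times> D \<subseteq> X \<times> tuples M \<Delta>" using D(1) by auto
    then have "\<exists>P'. dfn L M (X \<times> tuples M \<Delta>) (prodc \<U> (co \<Delta> {})) P' \<and>
      (\<forall>p\<in>X \<times> D. P (fst p) (snd p) \<longleftrightarrow> P' p)"
    proof (rule dfn_extend[OF _ False _ P])
      fix u s assume "u \<in> prodc \<U> (co \<Delta> {})" "\<And>z. z \<in> X \<times> D \<Longrightarrow> srt M (u z) = Some s"
      then show "\<forall>z\<in>X \<times> tuples M \<Delta>. srt M (u z) = Some s"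
        by (rule prod_sorted[OF D(1) \<open>D \<noteq> {}\<close>])
    qed
    then obtain P' where "dfn L M (X \<times> tuples M \<Delta>) (prodc \<U> (co \<Delta> {})) P' \<and>
      (\<forall>p\<in>X \<times> D. P (fst p) (snd p) \<longleftrightarrow> P' p)" by (elim exE)
    then show thesis by (elim conjE) (rule that)
  qed
  have "dfn L M X \<U> (\<lambda>z. \<exists>y\<in>tuples M \<Delta>. y \<in> D \<and> P' (z, y))"
    by (intro dfn_ex[OF str] dfn_conj dfn_cm[OF D(2) cm_snd])
      (rule dfn_cong[THEN iffD1, OF _ P'(1)], simp)
  then show ?thesis
  proof (rule dfn_cong[THEN iffD1, rotated])
    fix z assume "z \<in> X"
    then show "(\<exists>y\<in>tuples M \<Delta>. y \<in> D \<and> P' (z, y)) \<longleftrightarrow> (\<exists>y\<in>D. P z y)"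
      using P'(2) D(1) by fastforce
  qed
qed

lemma dfn_allD:
  assumes "is_struct L M" "D \<subseteq> tuples M \<Delta>" "dfn L M (tuples M \<Delta>) (co \<Delta> {}) (\<lambda>y. y \<in> D)"
    and "dfn L M (X \<times> D) (prodc \<U> (co \<Delta> {})) (\<lambda>p. P (fst p) (snd p))"
  shows "dfn L M X \<U> (\<lambda>z. \<forall>y\<in>D. P z y)"
proof -
  have "dfn L M X \<U> (\<lambda>z. \<not> (\<exists>y\<in>D. \<not> P z y))"
    by (intro dfn_not dfn_exD[OF assms(1-3)] assms(4))
  then show ?thesis by (rule dfn_cong[THEN iffD1, rotated]) blast
qed

context monster
begin

lemma cpt_tuples: "small M (dom \<Delta>) \<Longrightarrow> small M A \<Longrightarrow> cpt L M (tuples M \<Delta>) (co \<Delta> A)"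
  unfolding cpt_def
proof (intro allI impI)
  fix \<Q> assume *: "small M (dom \<Delta>)" "small M A" "\<forall>Q\<in>\<Q>. dfn L M (tuples M \<Delta>) (co \<Delta> A) Q"
    "\<forall>\<Q>'\<subseteq>\<Q>. finite \<Q>' \<longrightarrow> (\<exists>z\<in>tuples M \<Delta>. \<forall>Q\<in>\<Q>'. Q z)"
  show "\<exists>z\<in>tuples M \<Delta>. \<forall>Q\<in>\<Q>. Q z"
    by (rule compactness[OF *(1,2)]) (rule *(3,4)[rule_format], assumption+)+
qed

lemma cpt_D:
  assumes "small M (dom \<Delta>)" "small M A" and D: "D \<subseteq> tuples M \<Delta>" "tdf L M (tuples M \<Delta>) (co \<Delta> A) (\<lambda>y. y \<in> D)"
    "D \<noteq> {}"
  shows "cpt L M D (co \<Delta> A)"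
proof (rule cpt_restrict[OF cpt_tuples[OF assms(1,2)] D(1) _ D(2)])
  fix u s assume u: "u \<in> co \<Delta> A" "\<And>z. z \<in> D \<Longrightarrow> srt M (u z) = Some s"
  obtain d where d: "d \<in> D" using D(3) by auto
  consider a where "u = (\<lambda>x. a)" | i where "i \<in> dom \<Delta>" "u = (\<lambda>x. x i)"
    using u(1) unfolding co_def by blast
  then show "\<forall>z\<in>tuples M \<Delta>. srt M (u z) = Some s"
  proof cases
    case 1
    then show ?thesis using u(2)[OF d] by simp
  next
    case 2
    have "srt M (d i) = \<Delta> i" using D(1) d tuples_sort[OF _ 2(1), of d M] by auto
    then show ?thesis using u(2)[OF d] 2 tuples_sort[OF _ 2(1), of _ M] by simp
  qed
qed

text \<open>Fixing \<open>z\<close> turns each coordinate \<open>u\<close> in \<open>\<U>\<close>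
  into the parameter \<open>u z\<close>, which is why \<open>\<U>\<close> has to be small.\<close>

lemma cpt_fibre:
  assumes z: "z \<in> X" and small: "small M \<U>" "small M (dom \<Delta>)"
    and D: "D \<subseteq> tuples M \<Delta>" "tdf L M (tuples M \<Delta>) (co \<Delta> {}) (\<lambda>y. y \<in> D)"
    and Q: "\<And>Q. Q \<in> \<Q> \<Longrightarrow> dfn L M (X \<times> D) (prodc \<U> (co \<Delta> {})) Q"
    and fin: "\<And>\<Q>'. \<Q>' \<subseteq> \<Q> \<Longrightarrow> finite \<Q>' \<Longrightarrow> \<exists>y\<in>D. \<forall>Q\<in>\<Q>'. Q (z, y)"
  shows "\<exists>y\<in>D. \<forall>Q\<in>\<Q>. Q (z, y)"
proof -
  define A where "A = (\<lambda>u. u z) ` \<U>"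
  have A: "small M A" unfolding A_def by (rule small_image[OF small(1)])
  have "D \<noteq> {}" using fin[of "{}"] by auto
  then have cpt: "cpt L M D (co \<Delta> A)"
    by (rule cpt_D[OF small(2) A D(1) tdf_mono[OF D(2)], rotated 2]) (auto simp: co_def)
  have "\<exists>y\<in>D. \<forall>R\<in>(\<lambda>Q y. Q (z, y)) ` \<Q>. R y"
  proof (rule cptD[OF cpt])
    fix R assume "R \<in> (\<lambda>Q y. Q (z, y)) ` \<Q>"
    then obtain Q' where Q': "Q' \<in> \<Q>" "R = (\<lambda>y. Q' (z, y))" by (elim imageE)
    have "cm D (co \<Delta> A) (X \<times> D) (prodc \<U> (co \<Delta> {})) (Pair z)"
      using z by (auto simp: cm_def prodc_def co_def A_def)
    from dfn_cm[OF Q[OF Q'(1)] this] show "dfn L M D (co \<Delta> A) R" unfolding Q'(2) .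
  next
    fix \<Q>' assume fin_img: "\<Q>' \<subseteq> (\<lambda>Q y. Q (z, y)) ` \<Q>" "finite \<Q>'"
    obtain F where F: "F \<subseteq> \<Q>" "finite F" "\<Q>' = (\<lambda>Q y. Q (z, y)) ` F"
      using finite_subset_image[OF fin_img(2,1)] by (elim exE conjE) (rule that)
    show "\<exists>y\<in>D. \<forall>R\<in>\<Q>'. R y" using fin[OF F(1,2)] unfolding F(3) by simp
  qed
  then show ?thesis by simp
qed

lemma finite_dfn_ex:
  assumes D: "D \<subseteq> tuples M \<Delta>" "dfn L M (tuples M \<Delta>) (co \<Delta> {}) (\<lambda>y. y \<in> D)"
    and F: "finite F" "\<And>Q. Q \<in> F \<Longrightarrow> dfn L M (X \<times> D) (prodc \<U> (co \<Delta> {})) Q"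
  shows "dfn L M X \<U> (\<lambda>z. \<exists>y\<in>D. \<forall>Q\<in>F. Q (z, y))"
proof (rule dfn_exD[OF str D])
  show "dfn L M (X \<times> D) (prodc \<U> (co \<Delta> {})) (\<lambda>p. \<forall>Q\<in>F. Q (fst p, snd p))"
    using F by (intro dfn_ball_finite) simp_all
qed

text \<open>A quantifier does not commute with an infinite conjunction in general. By compactness in
  the fibre over \<open>z\<close> it suffices to quantify each finite subconjunction separately, and
  these are definable.\<close>

lemma tdf_exD:
  assumes D: "D \<subseteq> tuples M \<Delta>" "dfn L M (tuples M \<Delta>) (co \<Delta> {}) (\<lambda>y. y \<in> D)"
    and small: "small M \<U>" "small M (dom \<Delta>)"
    and P: "tdf L M (X \<times> D) (prodc \<U> (co \<Delta> {})) (\<lambda>p. P (fst p) (snd p))"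
  shows "tdf L M X \<U> (\<lambda>z. \<exists>y\<in>D. P z y)"
proof -
  obtain \<P> where \<P>: "\<forall>Q\<in>\<P>. dfn L M (X \<times> D) (prodc \<U> (co \<Delta> {})) Q"
    "\<forall>p\<in>X \<times> D. P (fst p) (snd p) \<longleftrightarrow> (\<forall>Q\<in>\<P>. Q p)"
    using P unfolding tdf_def by (elim exE conjE)
  let ?T = "(\<lambda>F z. \<exists>y\<in>D. \<forall>Q\<in>F. Q (z, y)) ` {F. F \<subseteq> \<P> \<and> finite F}"
  have "dfn L M X \<U> R" if "R \<in> ?T" for R
    using that finite_dfn_ex[OF D, of _ X \<U>] \<P>(1) by (elim imageE) auto
  moreover have "(\<exists>y\<in>D. P z y) \<longleftrightarrow> (\<forall>R\<in>?T. R z)" if z: "z \<in> X" for z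
  proof
    assume "\<exists>y\<in>D. P z y"
    then obtain y where y: "y \<in> D" "P z y" by (elim bexE)
    then have "\<forall>Q\<in>\<P>. Q (z, y)" using \<P>(2) z by fastforce
    then show "\<forall>R\<in>?T. R z" using y(1) by auto
  next
    assume *: "\<forall>R\<in>?T. R z"
    have "\<exists>y\<in>D. \<forall>Q\<in>\<P>. Q (z, y)"
    proof (rule cpt_fibre[OF z small D(1) tdf_of_dfn[OF D(2)]])
      fix F assume "F \<subseteq> \<P>" "finite F"
      then show "\<exists>y\<in>D. \<forall>Q\<in>F. Q (z, y)" using * by simp
    qed (use \<P>(1) in simp)
    then obtain y where "y \<in> D" "\<forall>Q\<in>\<P>. Q (z, y)" by (elim bexE)
    then show "\<exists>y\<in>D. P z y" using \<P>(2) z by (intro bexI[of _ y]) auto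
  qed
  ultimately show ?thesis unfolding tdf_def by (intro exI[of _ ?T] conjI ballI)
qed

text \<open>The first component is found from the quantified finite subconjunctions, the second by
  compactness in its fibre.\<close>

lemma cpt_prod:
  assumes cpt: "cpt L M X \<U>" and small: "small M \<U>" "small M (dom \<Delta>)"
    and D: "D \<subseteq> tuples M \<Delta>" "dfn L M (tuples M \<Delta>) (co \<Delta> {}) (\<lambda>y. y \<in> D)"
  shows "cpt L M (X \<times> D) (prodc \<U> (co \<Delta> {}))"
  unfolding cpt_def
proof (intro allI impI)
  fix \<Q> assume Q: "\<forall>Q\<in>\<Q>. dfn L M (X \<times> D) (prodc \<U> (co \<Delta> {})) Q"
    "\<forall>\<Q>'\<subseteq>\<Q>. finite \<Q>' \<longrightarrow> (\<exists>p\<in>X \<times> D. \<forall>Q\<in>\<Q>'. Q p)"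
  let ?T = "(\<lambda>F z. \<exists>y\<in>D. \<forall>Q\<in>F. Q (z, y)) ` {F. F \<subseteq> \<Q> \<and> finite F}"
  have "\<exists>z\<in>X. \<forall>R\<in>?T. R z"
  proof (rule cptD[OF cpt])
    show "dfn L M X \<U> R" if "R \<in> ?T" for R
      using that finite_dfn_ex[OF D, of _ X \<U>] Q(1) by (elim imageE) auto
  next
    fix \<T> assume fin_img: "\<T> \<subseteq> ?T" "finite \<T>"
    obtain K where K: "K \<subseteq> {F. F \<subseteq> \<Q> \<and> finite F}" "finite K"
      "\<T> = (\<lambda>F z. \<exists>y\<in>D. \<forall>Q\<in>F. Q (z, y)) ` K"
      using finite_subset_image[OF fin_img(2,1)] by (elim exE conjE) (rule that)
    have "\<Union>K \<subseteq> \<Q>" "finite (\<Union>K)" using K by auto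
    then obtain p where p: "p \<in> X \<times> D" "\<forall>Q\<in>\<Union>K. Q p" using Q(2) by (elim allE impE bexE)
    have "R (fst p)" if R: "R \<in> \<T>" for R
    proof -
      obtain F where F: "F \<in> K" "R = (\<lambda>z. \<exists>y\<in>D. \<forall>Q\<in>F. Q (z, y))"
        using R unfolding K(3) by (elim imageE)
      have "Q (fst p, snd p)" if "Q \<in> F" for Q
        using bspec[OF p(2), of Q] that F(1) by auto
      then show ?thesis using p(1) unfolding F(2) by (intro bexI[of _ "snd p"] ballI) auto
    qed
    then show "\<exists>z\<in>X. \<forall>R\<in>\<T>. R z" using p(1) by (intro bexI[of _ "fst p"] ballI) auto
  qed
  then obtain z where z: "z \<in> X" "\<forall>R\<in>?T. R z" by (elim bexE)
  have "\<exists>y\<in>D. \<forall>Q\<in>\<Q>. Q (z, y)"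
  proof (rule cpt_fibre[OF z(1) small D(1) tdf_of_dfn[OF D(2)]])
    fix F assume "F \<subseteq> \<Q>" "finite F"
    then show "\<exists>y\<in>D. \<forall>Q\<in>F. Q (z, y)" using z(2) by simp
  qed (use Q(1) in simp)
  then obtain y where "y \<in> D" "\<forall>Q\<in>\<Q>. Q (z, y)" by (elim bexE)
  then show "\<exists>p\<in>X \<times> D. \<forall>Q\<in>\<Q>. Q p" using z(1) by (intro bexI[of _ "(z, y)"]) auto
qed

lemma dfn_tuples_UNIV: "dfn L M (tuples M \<Delta>) (co \<Delta> {}) (\<lambda>y. y \<in> tuples M \<Delta>)"
  by (rule dfn_cong[THEN iffD2, OF _ dfn_True]) simp

lemma small_co: "small M (dom \<Delta>) \<Longrightarrow> small M A \<Longrightarrow> small M (co \<Delta> A)"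
  unfolding co_def by (intro small_Un small_image)

lemma small_prodc: "small M \<U> \<Longrightarrow> small M \<V> \<Longrightarrow> small M (prodc \<U> \<V>)"
  unfolding prodc_def by (intro small_Un small_image)

end

section \<open>Ramsey's theorem and indiscernible sequences\<close>

lemma strict_mono_on_subset: "strict_mono_on I f \<Longrightarrow> J \<subseteq> I \<Longrightarrow> strict_mono_on J f"
  by (auto intro!: strict_mono_onI dest: strict_mono_onD)

lemma strict_mono_on_image_unique:
  fixes h h' :: "'o::linorder \<Rightarrow> nat"
  assumes I: "finite I" and h: "strict_mono_on I h" "strict_mono_on I h'" "h ` I = h' ` I" and q: "q \<in> I"
  shows "h q = h' q"
proof -
  let ?l = "sorted_list_of_set I"
  have "map k ?l = sorted_list_of_set (k ` I)" if k: "strict_mono_on I k" for k :: "'o \<Rightarrow> nat"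
  proof (rule sorted_distinct_set_unique)
    show "sorted (map k ?l)"
      unfolding sorted_map
    proof (rule sorted_wrt_mono_rel[of _ "(\<le>)"])
      show "k x \<le> k y" if "x \<in> set ?l" "y \<in> set ?l" "x \<le> y" for x y
        using that I k by (metis order.order_iff_strict set_sorted_list_of_set strict_mono_onD)
    qed simp
    show "distinct (map k ?l)" using I strict_mono_on_imp_inj_on[OF k] by (simp add: distinct_map)
    show "set (map k ?l) = set (sorted_list_of_set (k ` I))" using I by simp
  qed (use I in simp_all)
  then have "map h ?l = map h' ?l" using h by simp
  then show ?thesis using q I by simp
qed

text \<open>Increasing maps from the finite set \<open>I\<close> correspond to sets of
  \<open>card I\<close> numbers, so a property of such maps is a colouring of these sets.\<close>

lemma ramsey_strict_mono:
  fixes P :: "('o::linorder \<Rightarrow> nat) \<Rightarrow> bool"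
  assumes Z: "infinite Z" and I: "finite I"
    and dep: "\<And>h h'. (\<And>q. q \<in> I \<Longrightarrow> h q = h' q) \<Longrightarrow> P h = P h'"
  shows "\<exists>Y\<subseteq>Z. infinite Y \<and> (\<forall>h h'. strict_mono_on I h \<and> strict_mono_on I h' \<and> h ` I \<subseteq> Y \<and> h' ` I \<subseteq> Y \<longrightarrow> P h = P h')"
proof -
  define c where "c X = (if \<exists>h. strict_mono_on I h \<and> h ` I = X \<and> P h then 1 else 0 :: nat)" for X
  have "\<forall>X. X \<subseteq> Z \<and> finite X \<and> card X = card I \<longrightarrow> c X < 2" by (simp add: c_def)
  from Ramsey[OF Z this] obtain Y t where Y: "Y \<subseteq> Z" "infinite Y"
    "\<And>X. X \<subseteq> Y \<Longrightarrow> finite X \<Longrightarrow> card X = card I \<Longrightarrow> c X = t"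
    by (elim exE conjE) (rule that, auto)
  have "P h \<longleftrightarrow> t = 1" if h: "strict_mono_on I h" "h ` I \<subseteq> Y" for h
  proof -
    have "c (h ` I) = t" using Y(3)[OF h(2)] I card_image[OF strict_mono_on_imp_inj_on[OF h(1)]] by simp
    moreover have "P h' = P h" if "strict_mono_on I h'" "h' ` I = h ` I" for h'
      by (rule dep, rule strict_mono_on_image_unique[OF I that(1) h(1) that(2)])
    ultimately show ?thesis using h(1) unfolding c_def by (metis zero_neq_one)
  qed
  then show ?thesis using Y(1,2) by (intro exI[of _ Y]) simp
qed

text \<open>Properties of different arities are handled one after the other, each inside the
  homogeneous set found for the previous ones.\<close>

lemma ramsey_family:
  fixes P :: "'j \<Rightarrow> ('o::linorder \<Rightarrow> nat) \<Rightarrow> bool"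
  assumes "finite J" and "\<And>j. j \<in> J \<Longrightarrow> finite (I j)"
    and "\<And>j h h'. j \<in> J \<Longrightarrow> (\<And>q. q \<in> I j \<Longrightarrow> h q = h' q) \<Longrightarrow> P j h = P j h'"
  shows "\<exists>Z. infinite Z \<and> (\<forall>j\<in>J. \<forall>h h'. strict_mono_on (I j) h \<and> strict_mono_on (I j) h' \<and>
    h ` I j \<subseteq> Z \<and> h' ` I j \<subseteq> Z \<longrightarrow> P j h = P j h')"
  using assms
proof (induction rule: finite_induct)
  case empty
  show ?case by (rule exI[of _ UNIV]) simp
next
  case (insert j J)
  have "\<exists>Z. infinite Z \<and> (\<forall>j\<in>J. \<forall>h h'. strict_mono_on (I j) h \<and> strict_mono_on (I j) h' \<and>
    h ` I j \<subseteq> Z \<and> h' ` I j \<subseteq> Z \<longrightarrow> P j h = P j h')"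
    by (rule insert.IH; rule insert.prems) simp_all
  then obtain Z where Z: "infinite Z" "\<forall>j\<in>J. \<forall>h h'. strict_mono_on (I j) h \<and> strict_mono_on (I j) h' \<and>
    h ` I j \<subseteq> Z \<and> h' ` I j \<subseteq> Z \<longrightarrow> P j h = P j h'"
    by (elim exE conjE)
  have "\<exists>Y\<subseteq>Z. infinite Y \<and> (\<forall>h h'. strict_mono_on (I j) h \<and> strict_mono_on (I j) h' \<and>
      h ` I j \<subseteq> Y \<and> h' ` I j \<subseteq> Y \<longrightarrow> P j h = P j h')"
    by (rule ramsey_strict_mono[OF Z(1)]; rule insert.prems) simp_all
  then obtain Y where Y: "Y \<subseteq> Z" "infinite Y" "\<forall>h h'. strict_mono_on (I j) h \<and> strict_mono_on (I j) h' \<and>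
      h ` I j \<subseteq> Y \<and> h' ` I j \<subseteq> Y \<longrightarrow> P j h = P j h'" by (elim exE conjE)
  show ?case
  proof (intro exI[of _ Y] conjI ballI allI impI)
    fix i h h' assume i: "i \<in> insert j J" and h: "strict_mono_on (I i) h \<and> strict_mono_on (I i) h' \<and>
      h ` I i \<subseteq> Y \<and> h' ` I i \<subseteq> Y"
    show "P i h = P i h'"
    proof (cases "i = j")
      case True
      then show ?thesis using Y(3) h by simp
    next
      case False
      then have "i \<in> J" using i by simp
      moreover have "h ` I i \<subseteq> Z" "h' ` I i \<subseteq> Z" using h Y(1) by auto
      ultimately show ?thesis using Z(2) h by simp
    qed
  qed (rule Y(2))
qed

lemma strict_mono_on_into:
  assumes "finite (K :: 'o::linorder set)" "infinite (Z :: nat set)"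
  shows "\<exists>k. strict_mono_on K k \<and> (\<forall>q. k q \<in> Z)"
proof (intro exI conjI allI)
  let ?k = "\<lambda>q. enumerate Z (card {x \<in> K. x < q})"
  show "?k q \<in> Z" for q using enumerate_in_set[OF assms(2)] by simp
  show "strict_mono_on K ?k"
  proof (rule strict_mono_onI)
    fix q r assume "q \<in> K" "r \<in> K" "q < r"
    then have "{x \<in> K. x < q} \<subset> {x \<in> K. x < r}" by auto
    then have "card {x \<in> K. x < q} < card {x \<in> K. x < r}" using assms(1) by (intro psubset_card_mono) auto
    then show "?k q < ?k r" using enumerate_mono[OF _ assms(2)] by simp
  qed
qed

definition seqs :: "'z set \<Rightarrow> ('o \<Rightarrow> 'z) set" where
  "seqs X = {\<rho>. \<forall>q. \<rho> q \<in> X}"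

text \<open>The set \<open>I\<close> records which positions of the sequence a condition may read.
  This is how it is later expressed that the parameters of a condition avoid given
  positions.\<close>

definition sco :: "('z \<Rightarrow> 'a) set \<Rightarrow> 'o set \<Rightarrow> 'a set \<Rightarrow> (('o \<Rightarrow> 'z) \<Rightarrow> 'a) set" where
  "sco \<U> I B = (\<lambda>(u, q) \<rho>. u (\<rho> q)) ` (\<U> \<times> I) \<union> (\<lambda>b \<rho>. b) ` B"

lemma seqsD: "\<rho> \<in> seqs X \<Longrightarrow> \<rho> q \<in> X"
  by (simp add: seqs_def)

lemma seqs_comp: "\<rho> \<in> seqs X \<Longrightarrow> \<rho> \<circ> f \<in> seqs X"
  by (simp add: seqs_def)

lemma sco_mono: "I \<subseteq> J \<Longrightarrow> A \<subseteq> B \<Longrightarrow> sco \<U> I A \<subseteq> sco \<U> J B"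
  unfolding sco_def by (intro Un_mono image_mono Sigma_mono) auto

lemma sco_const: "b \<in> B \<Longrightarrow> (\<lambda>\<rho>. b) \<in> sco \<U> I B"
  unfolding sco_def by blast

lemma cm_at: "q \<in> I \<Longrightarrow> cm (seqs X) (sco \<U> I B) X \<U> (\<lambda>\<rho>. \<rho> q)"
  unfolding cm_def sco_def by (auto simp: seqsD image_iff)

lemma cm_reindex: "f ` I \<subseteq> J \<Longrightarrow> cm (seqs X) (sco \<U> J B) (seqs X) (sco \<U> I B) (\<lambda>\<rho>. \<rho> \<circ> f)"
proof (rule cmI)
  fix v assume f: "f ` I \<subseteq> J" and "v \<in> sco \<U> I B"
  then consider u q where "u \<in> \<U>" "q \<in> I" "v = (\<lambda>\<rho>. u (\<rho> q))" | b where "b \<in> B" "v = (\<lambda>\<rho>. b)"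
    unfolding sco_def by auto
  then show "(\<lambda>\<rho>. v (\<rho> \<circ> f)) \<in> sco \<U> J B"
  proof cases
    case 1
    then have "(u, f q) \<in> \<U> \<times> J" using f by auto
    then have "(\<lambda>(u, q) \<rho>. u (\<rho> q)) (u, f q) \<in> sco \<U> J B" unfolding sco_def by (rule UnI1[OF imageI])
    then show ?thesis using 1(3) by simp
  next
    case 2
    then show ?thesis by (simp add: sco_const)
  qed
qed (rule seqs_comp)

lemma dfn_sco_finite:
  assumes "dfn L M (seqs X) (sco \<U> I B) P"
  shows "\<exists>I'. finite I' \<and> I' \<subseteq> I \<and> dfn L M (seqs X) (sco \<U> I' B) P"
proof -
  obtain \<V> where V: "finite \<V>" "\<V> \<subseteq> sco \<U> I B" "dfn L M (seqs X) \<V> P"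
    using dfn_finite[OF assms] by metis
  have "\<exists>I'. finite I' \<and> I' \<subseteq> I \<and> v \<in> sco \<U> I' B" if "v \<in> \<V>" for v
  proof -
    have "v \<in> sco \<U> I B" using V(2) that by auto
    then consider u q where "u \<in> \<U>" "q \<in> I" "v = (\<lambda>\<rho>. u (\<rho> q))" | b where "b \<in> B" "v = (\<lambda>\<rho>. b)"
      unfolding sco_def by auto
    then show ?thesis
    proof cases
      case 1
      then show ?thesis by (intro exI[of _ "{q}"]) (auto simp: sco_def)
    next
      case 2
      then show ?thesis by (intro exI[of _ "{}"]) (simp add: sco_const)
    qed
  qed
  then obtain k where k: "\<forall>v\<in>\<V>. finite (k v) \<and> k v \<subseteq> I \<and> v \<in> sco \<U> (k v) B" by metis
  let ?I = "\<Union>(k ` \<V>)"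
  have "\<V> \<subseteq> sco \<U> ?I B"
  proof
    fix v assume v: "v \<in> \<V>"
    then have "sco \<U> (k v) B \<subseteq> sco \<U> ?I B" by (intro sco_mono) auto
    then show "v \<in> sco \<U> ?I B" using k v by auto
  qed
  then have "dfn L M (seqs X) (sco \<U> ?I B) P" by (rule dfn_mono[OF V(3) order_refl])
  then show ?thesis using k V(1) by (intro exI[of _ ?I]) auto
qed

text \<open>The maps need only increase on \<open>I\<close>, the positions that \<open>P\<close> may
  read. Other positions can be sent anywhere, which is used when a single position is
  redirected.\<close>

definition indisc :: "('f, 'r, 's) lang \<Rightarrow> ('f, 'r, 's, 'a) fo_struct \<Rightarrow> 'z set \<Rightarrow> ('z \<Rightarrow> 'a) set \<Rightarrow> 'a set \<Rightarrow>
    (rat \<Rightarrow> 'z) \<Rightarrow> bool" where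
  "indisc L M X \<U> B \<rho> \<longleftrightarrow> \<rho> \<in> seqs X \<and>
     (\<forall>(I :: rat set) P f g. dfn L M (seqs X) (sco \<U> I B) P \<longrightarrow> strict_mono_on I f \<longrightarrow> strict_mono_on I g \<longrightarrow>
        P (\<rho> \<circ> f) = P (\<rho> \<circ> g))"

text \<open>This is the Ehrenfeucht-Mostowski type of \<open>e\<close> over \<open>B\<close>.
  \<open>I\<close> is finite because an infinite set of rationals need not embed increasingly into
  the naturals, and then the condition on \<open>e\<close> would be vacuous.\<close>

definition em_of :: "('f, 'r, 's) lang \<Rightarrow> ('f, 'r, 's, 'a) fo_struct \<Rightarrow> 'z set \<Rightarrow> ('z \<Rightarrow> 'a) set \<Rightarrow> 'a set \<Rightarrow>
    (nat \<Rightarrow> 'z) \<Rightarrow> (rat \<Rightarrow> 'z) \<Rightarrow> bool" where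
  "em_of L M X \<U> B e \<rho> \<longleftrightarrow>
     (\<forall>I P. finite I \<longrightarrow> dfn L M (seqs X) (sco \<U> I B) P \<longrightarrow>
        (\<forall>f. strict_mono_on I f \<longrightarrow> P (e \<circ> f)) \<longrightarrow> P \<rho>)"

lemma indisc_tdf:
  fixes I :: "rat set" and f g :: "rat \<Rightarrow> rat"
  assumes "indisc L M X \<U> B \<rho>" "tdf L M (seqs X) (sco \<U> I B) P" "strict_mono_on I f" "strict_mono_on I g"
  shows "P (\<rho> \<circ> f) = P (\<rho> \<circ> g)"
proof -
  obtain \<P> where \<P>: "\<forall>Q\<in>\<P>. dfn L M (seqs X) (sco \<U> I B) Q" "\<forall>z\<in>seqs X. P z \<longleftrightarrow> (\<forall>Q\<in>\<P>. Q z)"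
    using assms(2) unfolding tdf_def by (elim exE conjE)
  have "Q (\<rho> \<circ> f) = Q (\<rho> \<circ> g)" if "Q \<in> \<P>" for Q
    using assms(1)[unfolded indisc_def, THEN conjunct2, rule_format, of I Q f g] assms(3,4) \<P>(1) that
    by simp
  moreover have "\<rho> \<circ> f \<in> seqs X" "\<rho> \<circ> g \<in> seqs X"
    using assms(1) seqs_comp unfolding indisc_def by auto
  ultimately show ?thesis using \<P>(2) ball_cong[OF refl, of \<P> "\<lambda>Q. Q (\<rho> \<circ> f)" "\<lambda>Q. Q (\<rho> \<circ> g)"]
    by simp
qed

lemma em_of_tdf:
  assumes "em_of L M X \<U> B e \<rho>" "\<rho> \<in> seqs X" "e \<in> seqs X" "finite I" "tdf L M (seqs X) (sco \<U> I B) P"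
    "\<And>f. strict_mono_on I f \<Longrightarrow> P (e \<circ> f)"
  shows "P \<rho>"
proof -
  obtain \<P> where \<P>: "\<forall>Q\<in>\<P>. dfn L M (seqs X) (sco \<U> I B) Q" "\<forall>z\<in>seqs X. P z \<longleftrightarrow> (\<forall>Q\<in>\<P>. Q z)"
    using assms(5) unfolding tdf_def by (elim exE conjE)
  have "Q \<rho>" if Q: "Q \<in> \<P>" for Q
  proof -
    have "Q (e \<circ> f)" if "strict_mono_on I f" for f
    proof -
      have "e \<circ> f \<in> seqs X" using assms(3) by (simp add: seqs_def)
      then have "\<forall>Q\<in>\<P>. Q (e \<circ> f)" using \<P>(2) assms(6)[OF that] by simp
      then show ?thesis using Q by (rule bspec)
    qed
    then show ?thesis
      using assms(1)[unfolded em_of_def, rule_format, of I Q] assms(4) \<P>(1) Q by simp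
  qed
  then have "\<forall>Q\<in>\<P>. Q \<rho>" by (rule ballI)
  then show ?thesis using \<P>(2) assms(2) by simp
qed

text \<open>Finitely many instances of the two demands, indiscernibility and the type of
  \<open>e\<close>, are met by a subsequence of \<open>e\<close> itself: Ramsey's theorem makes the
  formulas involved constant on increasing tuples from a set \<open>Z\<close>, and the rationals
  involved are mapped increasingly into \<open>Z\<close>. Compactness does the rest.\<close>

lemma em_exists:
  fixes X :: "'z set" and e :: "nat \<Rightarrow> 'z"
  assumes cpt: "cpt L M (seqs X :: (rat \<Rightarrow> 'z) set) (sco \<U> UNIV B)" and e: "e \<in> seqs X"
  shows "\<exists>\<rho>. indisc L M X \<U> B \<rho> \<and> em_of L M X \<U> B e \<rho>"
proof -
  define ok where "ok I P f g \<longleftrightarrow> finite I \<and> dfn L M (seqs X) (sco \<U> I B) P \<and> strict_mono_on I f \<and>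
    strict_mono_on I g" for I :: "rat set" and P :: "(rat \<Rightarrow> 'z) \<Rightarrow> bool" and f g :: "rat \<Rightarrow> rat"
  define T1 where "T1 = {(\<lambda>\<rho>. P (\<rho> \<circ> f) \<longleftrightarrow> P (\<rho> \<circ> g)) | I P f g. ok I P f g}"
  define T2 where "T2 = {P. \<exists>I. ok I P id id \<and> (\<forall>f. strict_mono_on I f \<longrightarrow> P (e \<circ> f))}"
  have "\<exists>\<rho>\<in>seqs X. \<forall>Q\<in>T1 \<union> T2. Q \<rho>"
  proof (rule cptD[OF cpt])
    fix Q assume "Q \<in> T1 \<union> T2"
    then consider I P f g where "ok I P f g" "Q = (\<lambda>\<rho>. P (\<rho> \<circ> f) \<longleftrightarrow> P (\<rho> \<circ> g))" | I where "ok I Q id id"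
      unfolding T1_def T2_def by blast
    then show "dfn L M (seqs X) (sco \<U> UNIV B) Q"
    proof cases
      case 1
      have "dfn L M (seqs X) (sco \<U> I B) P" using 1(1) by (simp add: ok_def)
      then show ?thesis unfolding 1(2)
        by (intro dfn_iff dfn_cm[of L M "seqs X" "sco \<U> I B" P _ _ "\<lambda>\<rho>. \<rho> \<circ> _"] cm_reindex) auto
    next
      case 2
      then show ?thesis unfolding ok_def
        by (elim conjE) (rule dfn_mono, assumption, rule order_refl, rule sco_mono, auto)
    qed
  next
    fix \<Q>' assume Q': "\<Q>' \<subseteq> T1 \<union> T2" "finite \<Q>'"
    have "\<exists>I P f g. ok I P f g \<and> (Q = (\<lambda>\<rho>. P (\<rho> \<circ> f) \<longleftrightarrow> P (\<rho> \<circ> g)) \<or>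
        Q = P \<and> (\<forall>f. strict_mono_on I f \<longrightarrow> P (e \<circ> f)))" if "Q \<in> \<Q>'" for Q
    proof -
      have "Q \<in> T1 \<or> Q \<in> T2" using Q'(1) that by auto
      then show ?thesis
      proof
        assume "Q \<in> T1"
        then obtain I P f g where "Q = (\<lambda>\<rho>. P (\<rho> \<circ> f) \<longleftrightarrow> P (\<rho> \<circ> g)) \<and> ok I P f g"
          unfolding T1_def mem_Collect_eq by (elim exE)
        then show ?thesis by (intro exI[of _ I] exI[of _ P] exI[of _ f] exI[of _ g]) simp
      next
        assume "Q \<in> T2"
        then obtain I where "ok I Q id id \<and> (\<forall>f. strict_mono_on I f \<longrightarrow> Q (e \<circ> f))"
          unfolding T2_def mem_Collect_eq by (elim exE)
        then show ?thesis by (intro exI[of _ I] exI[of _ Q] exI[of _ id]) simp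
      qed
    qed
    then have "\<forall>Q\<in>\<Q>'. \<exists>w. case w of (I, P, f, g) \<Rightarrow> ok I P f g \<and> (Q = (\<lambda>\<rho>. P (\<rho> \<circ> f) \<longleftrightarrow> P (\<rho> \<circ> g)) \<or>
        Q = P \<and> (\<forall>f. strict_mono_on I f \<longrightarrow> P (e \<circ> f)))"
      by (simp add: split_paired_Ex)
    from bchoice[OF this] obtain w where w: "\<forall>Q\<in>\<Q>'. case w Q of (I, P, f, g) \<Rightarrow> ok I P f g \<and>
        (Q = (\<lambda>\<rho>. P (\<rho> \<circ> f) \<longleftrightarrow> P (\<rho> \<circ> g)) \<or> Q = P \<and> (\<forall>f. strict_mono_on I f \<longrightarrow> P (e \<circ> f)))"
      by (elim exE)
    define I where "I Q = fst (w Q)" for Q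
    define P where "P Q = fst (snd (w Q))" for Q
    define f where "f Q = fst (snd (snd (w Q)))" for Q
    define g where "g Q = snd (snd (snd (w Q)))" for Q
    have ok: "ok (I Q) (P Q) (f Q) (g Q)"
      and Qeq: "Q = (\<lambda>\<rho>. P Q (\<rho> \<circ> f Q) \<longleftrightarrow> P Q (\<rho> \<circ> g Q)) \<or> Q = P Q \<and> (\<forall>f. strict_mono_on (I Q) f \<longrightarrow> P Q (e \<circ> f))"
      if "Q \<in> \<Q>'" for Q
      using bspec[OF w that] unfolding I_def P_def f_def g_def by (simp_all add: case_prod_beta)
    have "\<exists>Z. infinite Z \<and> (\<forall>Q\<in>\<Q>'. \<forall>h h'. strict_mono_on (I Q) h \<and> strict_mono_on (I Q) h' \<and>
      h ` I Q \<subseteq> Z \<and> h' ` I Q \<subseteq> Z \<longrightarrow> P Q (e \<circ> h) = P Q (e \<circ> h'))"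
    proof (rule ramsey_family[OF Q'(2)])
      show "finite (I Q)" if "Q \<in> \<Q>'" for Q using ok[OF that] by (simp add: ok_def)
      fix Q and h h' :: "rat \<Rightarrow> nat" assume Q: "Q \<in> \<Q>'" and h: "\<And>q. q \<in> I Q \<Longrightarrow> h q = h' q"
      have "dfn L M (seqs X) (sco \<U> (I Q) B) (P Q)" using ok[OF Q] by (simp add: ok_def)
      then show "P Q (e \<circ> h) = P Q (e \<circ> h')"
        by (rule dfn_dep) (use e h in \<open>auto simp: seqs_def sco_def\<close>)
    qed
    then obtain Z where Z: "infinite Z" "\<forall>Q\<in>\<Q>'. \<forall>h h'. strict_mono_on (I Q) h \<and> strict_mono_on (I Q) h' \<and>
      h ` I Q \<subseteq> Z \<and> h' ` I Q \<subseteq> Z \<longrightarrow> P Q (e \<circ> h) = P Q (e \<circ> h')"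
      by (elim exE conjE)
    \<comment> \<open>All positions at which the finitely many conditions look: the index sets
      themselves and their images under the two maps.\<close>
    define K where "K = (\<Union>Q\<in>\<Q>'. I Q \<union> f Q ` I Q \<union> g Q ` I Q)"
    have "finite K" unfolding K_def using Q'(2) ok by (auto simp: ok_def)
    then obtain k where k: "strict_mono_on K k" "\<forall>q. k q \<in> Z" using strict_mono_on_into[OF _ Z(1)] by blast
    have smc: "strict_mono_on (I Q) (k \<circ> j)" if "strict_mono_on (I Q) j" "j ` I Q \<subseteq> K" for j Q
    proof (rule strict_mono_onI)
      fix q r assume qr: "q \<in> I Q" "r \<in> I Q" "q < r"
      then have "j q < j r" using that(1) by (simp add: strict_mono_onD)
      moreover have "j q \<in> K" "j r \<in> K" using that(2) qr by auto
      ultimately show "(k \<circ> j) q < (k \<circ> j) r" using k(1) by (simp add: strict_mono_onD)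
    qed
    have "Q (e \<circ> k)" if Q: "Q \<in> \<Q>'" for Q
    proof (cases "Q = (\<lambda>\<rho>. P Q (\<rho> \<circ> f Q) \<longleftrightarrow> P Q (\<rho> \<circ> g Q))")
      case True
      have "f Q ` I Q \<subseteq> K" "g Q ` I Q \<subseteq> K" unfolding K_def using Q by auto
      then have "strict_mono_on (I Q) (k \<circ> f Q)" "strict_mono_on (I Q) (k \<circ> g Q)"
        using smc ok[OF Q] by (auto simp: ok_def)
      moreover have "(k \<circ> f Q) ` I Q \<subseteq> Z" "(k \<circ> g Q) ` I Q \<subseteq> Z" using k(2) by auto
      ultimately have "P Q (e \<circ> (k \<circ> f Q)) = P Q (e \<circ> (k \<circ> g Q))" using Z(2) Q by blast
      then show ?thesis by (subst True) (simp add: comp_assoc)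
    next
      case False
      then have Q2: "Q = P Q" "\<forall>f. strict_mono_on (I Q) f \<longrightarrow> P Q (e \<circ> f)" using Qeq[OF Q] by auto
      have "strict_mono_on (I Q) k" using k(1) by (rule strict_mono_on_subset) (use Q in \<open>auto simp: K_def\<close>)
      then show ?thesis using Q2 by metis
    qed
    moreover have "e \<circ> k \<in> seqs X" using e by (simp add: seqs_def)
    ultimately show "\<exists>\<rho>\<in>seqs X. \<forall>Q\<in>\<Q>'. Q \<rho>" by (intro bexI[of _ "e \<circ> k"] ballI)
  qed
  then obtain \<rho> where \<rho>: "\<rho> \<in> seqs X" "\<forall>Q\<in>T1 \<union> T2. Q \<rho>" by (elim bexE)
  have "indisc L M X \<U> B \<rho>"
    unfolding indisc_def
  proof (intro conjI allI impI)
    fix I :: "rat set" and P and f g :: "rat \<Rightarrow> rat"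
    assume P: "dfn L M (seqs X) (sco \<U> I B) P" and fg: "strict_mono_on I f" "strict_mono_on I g"
    obtain I' where I': "finite I'" "I' \<subseteq> I" "dfn L M (seqs X) (sco \<U> I' B) P"
      using dfn_sco_finite[OF P] by (elim exE conjE)
    then have "ok I' P f g" using strict_mono_on_subset[OF fg(1) I'(2)] strict_mono_on_subset[OF fg(2) I'(2)] by (simp add: ok_def)
    then have "(\<lambda>\<rho>. P (\<rho> \<circ> f) \<longleftrightarrow> P (\<rho> \<circ> g)) \<in> T1"
      unfolding T1_def mem_Collect_eq by (intro exI[of _ I'] exI[of _ P] exI[of _ f] exI[of _ g]) simp
    from bspec[OF \<rho>(2) UnI1[OF this]] show "P (\<rho> \<circ> f) = P (\<rho> \<circ> g)" .
  qed (rule \<rho>(1))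
  moreover have "em_of L M X \<U> B e \<rho>"
    unfolding em_of_def
  proof (intro allI impI)
    fix I :: "rat set" and P
    assume "finite I" "dfn L M (seqs X) (sco \<U> I B) P" "\<forall>f. strict_mono_on I f \<longrightarrow> P (e \<circ> f)"
    then have "P \<in> T2" unfolding T2_def mem_Collect_eq
      by (intro exI[of _ I]) (simp add: ok_def strict_mono_on_def)
    from bspec[OF \<rho>(2) UnI2[OF this]] show "P \<rho>" .
  qed
  ultimately show ?thesis by (intro exI[of _ \<rho>] conjI)
qed

section \<open>Definable groups\<close>

locale defgrp = monster L M for L :: "('f, 'r, 's) lang" and M :: "('f, 'r, 's, 'a) fo_struct" +
  fixes \<Gamma> :: "'i \<Rightarrow> 's option" and G :: "('i \<Rightarrow> 'a) monoid" (structure)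
  assumes dg: "definable_group L M {} \<Gamma> G"
begin

sublocale group G
  using dg by (simp add: definable_group_def)

abbreviation gco :: "(('i \<Rightarrow> 'a) \<Rightarrow> 'a) set" where "gco \<equiv> co \<Gamma> {}"

lemma dfn_of_definable:
  fixes \<Delta> :: "'w \<Rightarrow> 's option"
  assumes "definable L M A \<Delta> D"
  shows "dfn L M (tuples M \<Delta>) (co \<Delta> A) (\<lambda>x. x \<in> D)"
proof -
  obtain \<phi> where \<phi>: "\<phi> \<in> fm_over L M A \<Delta>" "D = {x \<in> tuples M \<Delta>. holds M \<phi> x}"
    using assms unfolding definable_def by blast
  show ?thesis by (rule dfn_cong[THEN iffD1, OF _ dfn_of_fm_over[OF \<phi>(1)]]) (simp add: \<phi>(2))
qed

lemma finite_dom: "finite (dom \<Gamma>)"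
  using dg by (simp add: definable_group_def definable_def)

lemma small_dom: "small M (dom \<Gamma>)"
  by (rule small_finite[OF finite_dom])

lemma carrier_tuples: "carrier G \<subseteq> tuples M \<Gamma>"
  using dg unfolding definable_group_def definable_def by blast

lemma dfn_carrier: "dfn L M (tuples M \<Gamma>) gco (\<lambda>x. x \<in> carrier G)"
  using dg by (intro dfn_of_definable) (simp add: definable_group_def)

lemma carrier_ne: "carrier G \<noteq> {}"
  using one_closed by auto

lemmas dfn_exG = dfn_exD[OF str carrier_tuples dfn_carrier]
lemmas dfn_allG = dfn_allD[OF str carrier_tuples dfn_carrier]

lemma small_gco: "small M gco"
  by (simp add: small_co small_dom small_finite)

lemma tdf_exG:
  assumes "small M \<U>" "tdf L M (X \<times> carrier G) (prodc \<U> gco) (\<lambda>p. P (fst p) (snd p))"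
  shows "tdf L M X \<U> (\<lambda>z. \<exists>y\<in>carrier G. P z y)"
  by (rule tdf_exD[OF carrier_tuples dfn_carrier assms(1) small_dom assms(2)])

lemma cpt_prodG: "cpt L M X \<U> \<Longrightarrow> small M \<U> \<Longrightarrow> cpt L M (X \<times> carrier G) (prodc \<U> gco)"
  by (rule cpt_prod[OF _ _ small_dom carrier_tuples dfn_carrier])

lemma cm_coord: "cm X \<U> D (co \<Delta> A) a \<Longrightarrow> i \<in> dom \<Delta> \<Longrightarrow> (\<lambda>z. a z i) \<in> \<U>"
  unfolding cm_def co_def by fast

lemma dfn_gvar_eq:
  assumes "cm X \<U> (carrier G) gco a" "cm X \<U> (carrier G) gco b"
  shows "dfn L M X \<U> (\<lambda>z. a z = b z)"
proof -
  have "dfn L M X \<U> (\<lambda>z. \<forall>i\<in>dom \<Gamma>. a z i = b z i)"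
  proof (rule dfn_ball_finite[OF finite_dom])
    fix i assume i: "i \<in> dom \<Gamma>"
    then obtain s where s: "\<Gamma> i = Some s" by auto
    show "dfn L M X \<U> (\<lambda>z. a z i = b z i)"
    proof (rule dfn_eq[where s = s])
      show "(\<lambda>z. a z i) \<in> \<U>" "(\<lambda>z. b z i) \<in> \<U>"
        by (rule cm_coord[OF assms(1) i], rule cm_coord[OF assms(2) i])
      show "srt M (a z i) = Some s" if "z \<in> X" for z
        using tuples_sort[OF subsetD[OF carrier_tuples cmD[OF assms(1) that]] i] s by simp
      show "srt M (b z i) = Some s" if "z \<in> X" for z
        using tuples_sort[OF subsetD[OF carrier_tuples cmD[OF assms(2) that]] i] s by simp
    qed
  qed
  then show ?thesis
  proof (rule dfn_cong[THEN iffD1, rotated])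
    fix z assume "z \<in> X"
    then have "a z \<in> tuples M \<Gamma>" "b z \<in> tuples M \<Gamma>" using assms cmD carrier_tuples by (metis subsetD)+
    then show "(\<forall>i\<in>dom \<Gamma>. a z i = b z i) \<longleftrightarrow> a z = b z" using tuples_eqI by metis
  qed
qed

lemma case_sum_eq: "case_sum f g = case_sum f' g' \<longleftrightarrow> f = f' \<and> g = g'"
  by (metis case_sum_o_inj)

lemma cm_case_sum:
  fixes \<Delta> :: "'u \<Rightarrow> 's option" and \<Delta>' :: "'v \<Rightarrow> 's option"
  assumes "cm X \<U> (tuples M \<Delta>) (co \<Delta> {}) a" "cm X \<U> (tuples M \<Delta>') (co \<Delta>' {}) b"
  shows "cm X \<U> (tuples M (case_sum \<Delta> \<Delta>')) (co (case_sum \<Delta> \<Delta>') {}) (\<lambda>z. case_sum (a z) (b z))"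
proof (rule cmI)
  fix z assume "z \<in> X"
  then have "a z \<in> tuples M \<Delta>" "b z \<in> tuples M \<Delta>'" using assms cmD by metis+
  then show "case_sum (a z) (b z) \<in> tuples M (case_sum \<Delta> \<Delta>')"
    by (auto simp: tuples_iff extensional_def dom_def split: sum.splits)
next
  fix v :: "('u + 'v \<Rightarrow> 'a) \<Rightarrow> 'a" assume "v \<in> co (case_sum \<Delta> \<Delta>') {}"
  then obtain j where j: "j \<in> dom (case_sum \<Delta> \<Delta>')" "v = (\<lambda>x. x j)" unfolding co_def by auto
  show "(\<lambda>z. v (case_sum (a z) (b z))) \<in> \<U>"
  proof (cases j)
    case (Inl i)
    then have "i \<in> dom \<Delta>" using j(1) by auto
    from cm_coord[OF assms(1) this] show ?thesis using Inl j(2) by simp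
  next
    case (Inr i)
    then have "i \<in> dom \<Delta>'" using j(1) by auto
    from cm_coord[OF assms(2) this] show ?thesis using Inr j(2) by simp
  qed
qed

lemma cm_carrier_tuples: "cm X \<U> (carrier G) gco a \<Longrightarrow> cm X \<U> (tuples M \<Gamma>) gco a"
  using carrier_tuples by (auto simp: cm_def)

lemma dfn_gvar_mult:
  assumes a: "cm X \<U> (carrier G) gco a" and b: "cm X \<U> (carrier G) gco b" and c: "cm X \<U> (carrier G) gco c"
  shows "dfn L M X \<U> (\<lambda>z. a z \<otimes> b z = c z)"
proof -
  let ?m = "{case_sum x (case_sum y (x \<otimes> y)) |x y. x \<in> carrier G \<and> y \<in> carrier G}"
  have "dfn L M (tuples M (case_sum \<Gamma> (case_sum \<Gamma> \<Gamma>))) (co (case_sum \<Gamma> (case_sum \<Gamma> \<Gamma>)) {}) (\<lambda>x. x \<in> ?m)"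
    using dg by (intro dfn_of_definable) (simp add: definable_group_def)
  from dfn_cm[OF this cm_case_sum[OF cm_carrier_tuples[OF a]
      cm_case_sum[OF cm_carrier_tuples[OF b] cm_carrier_tuples[OF c]]]]
  show ?thesis
  proof (rule dfn_cong[THEN iffD1, rotated])
    fix z assume "z \<in> X"
    then have "a z \<in> carrier G" "b z \<in> carrier G" using a b cmD by metis+
    then show "case_sum (a z) (case_sum (b z) (c z)) \<in> ?m \<longleftrightarrow> a z \<otimes> b z = c z"
      by (auto simp: case_sum_eq)
  qed
qed

text \<open>A definable map into the group, given by its graph. The group operation is a definable
  relation and not a function symbol, so composite group terms can enter formulas only through this
  notion and \<open>dfn_subst\<close>.\<close>

definition dtm :: "'z set \<Rightarrow> ('z \<Rightarrow> 'a) set \<Rightarrow> ('z \<Rightarrow> 'i \<Rightarrow> 'a) \<Rightarrow> bool" where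
  "dtm X \<U> t \<longleftrightarrow> (\<forall>z\<in>X. t z \<in> carrier G) \<and>
     dfn L M (X \<times> carrier G) (prodc \<U> gco) (\<lambda>p. snd p = t (fst p))"

lemma dtm_closed: "dtm X \<U> t \<Longrightarrow> z \<in> X \<Longrightarrow> t z \<in> carrier G"
  by (simp add: dtm_def)

lemma dtm_var:
  assumes "cm X \<U> (carrier G) gco a"
  shows "dtm X \<U> a"
  unfolding dtm_def
  using cmD[OF assms] dfn_gvar_eq[OF cm_snd cm_comp[OF cm_fst assms]] by blast

lemma cm_lift: "cm X \<U> Y \<V> s \<Longrightarrow> cm (X \<times> Z) (prodc \<U> \<W>) (Y \<times> Z) (prodc \<V> \<W>) (\<lambda>p. (s (fst p), snd p))"
  by (rule cm_pair[OF cm_comp[OF cm_fst] cm_snd])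

lemma dtm_cm:
  assumes "dtm Y \<V> t" "cm X \<U> Y \<V> s"
  shows "dtm X \<U> (\<lambda>z. t (s z))"
proof -
  have "dfn L M (X \<times> carrier G) (prodc \<U> gco) (\<lambda>p. snd (s (fst p), snd p) = t (fst (s (fst p), snd p)))"
    by (rule dfn_cm[OF _ cm_lift[OF assms(2)]]) (use assms(1) in \<open>simp add: dtm_def\<close>)
  then show ?thesis using assms(1) cmD[OF assms(2)] by (simp add: dtm_def)
qed

lemma dfn_subst:
  assumes "dfn L M (X \<times> carrier G) (prodc \<U> gco) (\<lambda>p. P (fst p) (snd p))" "dtm X \<U> t"
  shows "dfn L M X \<U> (\<lambda>z. P z (t z))"
proof -
  have "dfn L M X \<U> (\<lambda>z. \<exists>y\<in>carrier G. y = t z \<and> P z y)"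
    by (intro dfn_exG dfn_conj assms(1)) (use assms(2) in \<open>simp add: dtm_def\<close>)
  then show ?thesis
    by (rule dfn_cong[THEN iffD1, rotated]) (use dtm_closed[OF assms(2)] in auto)
qed

lemma dfn_rel:
  assumes "dfn L M (Y \<times> carrier G) (prodc \<V> gco) (\<lambda>p. R (fst p) (snd p))" "cm X \<U> Y \<V> s" "dtm X \<U> t"
  shows "dfn L M X \<U> (\<lambda>z. R (s z) (t z))"
proof (rule dfn_subst[OF _ assms(3)])
  show "dfn L M (X \<times> carrier G) (prodc \<U> gco) (\<lambda>p. R (s (fst p)) (snd p))"
    using dfn_cm[OF assms(1) cm_lift[OF assms(2)]] by simp
qed

lemma tdf_rel:
  assumes "tdf L M (Y \<times> carrier G) (prodc \<V> gco) (\<lambda>p. R (fst p) (snd p))" "cm X \<U> Y \<V> s" "dtm X \<U> t"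
  shows "tdf L M X \<U> (\<lambda>z. R (s z) (t z))"
proof -
  obtain \<P> where \<P>: "\<forall>Q\<in>\<P>. dfn L M (Y \<times> carrier G) (prodc \<V> gco) Q"
    "\<forall>p\<in>Y \<times> carrier G. R (fst p) (snd p) \<longleftrightarrow> (\<forall>Q\<in>\<P>. Q p)"
    using assms(1) unfolding tdf_def by (elim exE conjE)
  have "dfn L M X \<U> (\<lambda>z. Q (s z, t z))" if "Q \<in> \<P>" for Q
    by (rule dfn_rel[OF _ assms(2,3), where R = "\<lambda>x y. Q (x, y)"]) (use \<P>(1) that in simp)
  moreover have "R (s z) (t z) \<longleftrightarrow> (\<forall>Q'\<in>(\<lambda>Q z. Q (s z, t z)) ` \<P>. Q' z)" if "z \<in> X" for z
    using \<P>(2)[rule_format, of "(s z, t z)"] cmD[OF assms(2) that] dtm_closed[OF assms(3) that] by auto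
  ultimately show ?thesis
    unfolding tdf_def by (intro exI[of _ "(\<lambda>Q z. Q (s z, t z)) ` \<P>"]) auto
qed

lemma dfn_eqG: "dtm X \<U> t \<Longrightarrow> dtm X \<U> t' \<Longrightarrow> dfn L M X \<U> (\<lambda>z. t' z = t z)"
  using dfn_subst[where P = "\<lambda>z y. y = t z"] by (simp add: dtm_def)

lemma dtm_graph:
  assumes "\<And>z. z \<in> X \<Longrightarrow> t z \<in> carrier G"
    "dfn L M (X \<times> carrier G) (prodc \<U> gco) R"
    "\<And>z w. z \<in> X \<Longrightarrow> w \<in> carrier G \<Longrightarrow> R (z, w) \<longleftrightarrow> w = t z"
  shows "dtm X \<U> t"
  unfolding dtm_def
proof (intro conjI ballI)
  show "dfn L M (X \<times> carrier G) (prodc \<U> gco) (\<lambda>p. snd p = t (fst p))"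
    by (rule dfn_cong[THEN iffD1, OF _ assms(2)]) (use assms(3) in auto)
qed (rule assms(1))

text \<open>The identity is the only idempotent of a group, which defines it without parameters from
  the multiplication.\<close>

lemma dtm_one: "dtm X \<U> (\<lambda>z. \<one>)"
proof (rule dtm_graph[where R = "\<lambda>p. snd p \<otimes> snd p = snd p"])
  show "dfn L M (X \<times> carrier G) (prodc \<U> gco) (\<lambda>p. snd p \<otimes> snd p = snd p)"
    by (intro dfn_gvar_mult cm_snd)
  show "snd (z, w) \<otimes> snd (z, w) = snd (z, w) \<longleftrightarrow> w = \<one>" if "w \<in> carrier G" for z w
    using that by (simp add: l_cancel_one)
qed simp

lemma dtm_mult:
  assumes "dtm X \<U> t" "dtm X \<U> t'"
  shows "dtm X \<U> (\<lambda>z. t z \<otimes> t' z)"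
proof (rule dtm_graph[where R = "\<lambda>p. \<exists>x\<in>carrier G. \<exists>y\<in>carrier G. (x = t (fst p) \<and> y = t' (fst p)) \<and> x \<otimes> y = snd p"])
  let ?X1 = "(X \<times> carrier G) \<times> carrier G" and ?U1 = "prodc (prodc \<U> gco) gco"
  let ?X2 = "?X1 \<times> carrier G" and ?U2 = "prodc ?U1 gco"
  have c0: "cm ?X1 ?U1 X \<U> (\<lambda>p. fst (fst p))" by (rule cm_comp[OF cm_fst cm_fst])
  have t: "dfn L M ?X2 ?U2 (\<lambda>p. snd (fst p) = t (fst (fst (fst p))))"
    by (intro dfn_eqG dtm_cm[OF assms(1) cm_comp[OF cm_fst c0]] dtm_var cm_comp[OF cm_fst cm_snd])
  have t': "dfn L M ?X2 ?U2 (\<lambda>p. snd p = t' (fst (fst (fst p))))"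
    by (intro dfn_eqG dtm_cm[OF assms(2) cm_comp[OF cm_fst c0]] dtm_var cm_snd)
  have m: "dfn L M ?X2 ?U2 (\<lambda>p. snd (fst p) \<otimes> snd p = snd (fst (fst p)))"
    by (intro dfn_gvar_mult cm_snd cm_comp[OF cm_fst cm_snd] cm_comp[OF cm_fst cm_comp[OF cm_fst cm_snd]])
  show "dfn L M (X \<times> carrier G) (prodc \<U> gco)
      (\<lambda>p. \<exists>x\<in>carrier G. \<exists>y\<in>carrier G. (x = t (fst p) \<and> y = t' (fst p)) \<and> x \<otimes> y = snd p)"
    by (intro dfn_exG dfn_conj t t' m)
qed (use dtm_closed[OF assms(1)] dtm_closed[OF assms(2)] in auto)

lemma dtm_inv:
  assumes "dtm X \<U> t"
  shows "dtm X \<U> (\<lambda>z. inv (t z))"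
proof (rule dtm_graph[where R = "\<lambda>p. t (fst p) \<otimes> snd p = \<one>"])
  show "dfn L M (X \<times> carrier G) (prodc \<U> gco) (\<lambda>p. t (fst p) \<otimes> snd p = \<one>)"
    by (intro dfn_eqG dtm_one dtm_mult dtm_cm[OF assms cm_fst] dtm_var cm_snd)
  show "t (fst (z, w)) \<otimes> snd (z, w) = \<one> \<longleftrightarrow> w = inv (t z)" if "z \<in> X" "w \<in> carrier G" for z w
    using that dtm_closed[OF assms that(1)] by (metis fst_conv snd_conv inv_equality inv_inv r_inv)
qed (use dtm_closed[OF assms] in auto)

lemma dtm_const: "c \<in> carrier G \<Longrightarrow> (\<And>i. i \<in> dom \<Gamma> \<Longrightarrow> (\<lambda>z. c i) \<in> \<U>) \<Longrightarrow> dtm X \<U> (\<lambda>z. c)"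
  by (rule dtm_var[OF cm_const])

end

section \<open>Unstable subgroups\<close>

lemma prodcI1: "u \<in> \<U> \<Longrightarrow> (\<lambda>p. u (fst p)) \<in> prodc \<U> \<V>"
  unfolding prodc_def by blast

lemma prodcI2: "v \<in> \<V> \<Longrightarrow> (\<lambda>p. v (snd p)) \<in> prodc \<U> \<V>"
  unfolding prodc_def by blast

lemma coI: "i \<in> dom \<Delta> \<Longrightarrow> (\<lambda>x. x i) \<in> co \<Delta> A"
  unfolding co_def by blast

lemma coI2: "a \<in> A \<Longrightarrow> (\<lambda>x. a) \<in> co \<Delta> A"
  unfolding co_def by blast

abbreviation params :: "'a set \<Rightarrow> ('z \<Rightarrow> 'a) set" where "params A \<equiv> (\<lambda>a z. a) ` A"

lemma params_prodc:
  fixes \<U> :: "('y \<Rightarrow> 'a) set" and \<V> :: "('z \<Rightarrow> 'a) set"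
  assumes "params A \<subseteq> \<U>"
  shows "params A \<subseteq> prodc \<U> \<V>"
proof
  fix v :: "'y \<times> 'z \<Rightarrow> 'a" assume "v \<in> params A"
  then obtain a where a: "a \<in> A" "v = (\<lambda>z. a)" by blast
  then have "(\<lambda>z. a) \<in> \<U>" using assms by blast
  from prodcI1[OF this] show "v \<in> prodc \<U> \<V>" using a(2) by simp
qed

text \<open>On a single point finite satisfiability is satisfiability, whatever the coordinates.
  This serves to freeze a whole sequence while group elements are added as further
  components.\<close>

lemma cpt_singleton: "cpt L M {z0} \<U>"
  unfolding cpt_def
proof (intro allI impI)
  fix \<Q>
  assume *: "\<forall>\<Q>'\<subseteq>\<Q>. finite \<Q>' \<longrightarrow> (\<exists>z\<in>{z0}. \<forall>Q\<in>\<Q>'. Q z)"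
  have "Q z0" if "Q \<in> \<Q>" for Q using *[rule_format, of "{Q}"] that by simp
  then show "\<exists>z\<in>{z0}. \<forall>Q\<in>\<Q>. Q z" by (intro bexI[of _ z0] ballI) simp_all
qed

text \<open>The affine map of \<open>[l, u]\<close> onto \<open>[a, b]\<close>, continued by the
  identity; order is preserved because \<open>[a, b]\<close> lies inside
  \<open>[l, u]\<close>.\<close>

lemma squeeze:
  fixes l u a b :: rat
  assumes "l < u" "l \<le> a" "a < b" "b \<le> u"
  shows "\<exists>f. strict_mono f \<and> (\<forall>q. q < l \<or> u < q \<longrightarrow> f q = q) \<and> (\<forall>q. l < q \<and> q < u \<longrightarrow> a < f q \<and> f q < b)"
proof -
  define g where "g q = a + (b - a) * ((q - l) / (u - l))" for q
  have pos: "0 < b - a" "0 < u - l" using assms by auto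
  have mono: "g q < g r" if "q < r" for q r
    using that pos unfolding g_def by (simp add: divide_strict_right_mono)
  have gl: "g l = a" by (simp add: g_def)
  have gu: "g u = b" using pos by (simp add: g_def)
  have in_ab: "a \<le> g q \<and> g q \<le> b" if "l \<le> q" "q \<le> u" for q
    using mono[of l q] mono[of q u] gl gu that by (metis order.order_iff_strict)
  define f where "f q = (if l \<le> q \<and> q \<le> u then g q else q)" for q
  have "strict_mono f"
  proof (rule strict_monoI)
    fix q r :: rat assume qr: "q < r"
    show "f q < f r"
      using mono[OF qr] in_ab[of q] in_ab[of r] qr assms unfolding f_def by (auto split: if_splits)
  qed
  moreover have "\<forall>q. q < l \<or> u < q \<longrightarrow> f q = q" by (auto simp: f_def)
  moreover have "\<forall>q. l < q \<and> q < u \<longrightarrow> a < f q \<and> f q < b"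
    using mono gl gu by (auto simp: f_def)
  ultimately show ?thesis by blast
qed

context defgrp
begin

text \<open>
  The half-graph of \<open>S\<close> survives thickening its fibres by \<open>\<theta>\<close>, so it separates cosets of every subgroup of \<open>\<theta>\<close>.
\<close>

definition unst :: "('i \<Rightarrow> 'a) set \<Rightarrow> bool" where
  "unst H \<longleftrightarrow> (\<exists>(\<Delta> :: nat \<Rightarrow> 's option) S \<theta> c b.
     dfn L M (tuples M \<Delta> \<times> carrier G) (prodc (co \<Delta> {}) gco) (\<lambda>p. S (fst p) (snd p)) \<and>
     dfn L M (carrier G) (co \<Gamma> U) (\<lambda>x. x \<in> \<theta>) \<and> H \<subseteq> \<theta> \<and>
     (\<forall>i :: nat. c i \<in> carrier G) \<and> (\<forall>j. b j \<in> tuples M \<Delta>) \<and>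
     (\<forall>i j. i < j \<longrightarrow> S (b j) (c i)) \<and>
     (\<forall>i j. j < i \<longrightarrow> \<not> (\<exists>x\<in>carrier G. S (b j) x \<and> inv x \<otimes> c i \<in> \<theta>)))"

text \<open>\<open>unst\<close> asks for a parameter-free \<open>S\<close> and a context indexed by
  numbers. A formula reads finitely many coordinates of the \<open>Y\<close> component, and
  constants among them count as coordinates, so the parameters of \<open>S\<close> move into the
  tuples \<open>b j\<close>.\<close>

lemma unstI:
  fixes Y :: "'y set" and b :: "nat \<Rightarrow> 'y"
  assumes S: "dfn L M (Y \<times> carrier G) (prodc \<V> gco) (\<lambda>p. S (fst p) (snd p))"
    and \<theta>: "dfn L M (carrier G) (co \<Gamma> U) (\<lambda>x. x \<in> \<theta>)" "H \<subseteq> \<theta>"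
    and c: "\<And>i. c i \<in> carrier G" and b: "\<And>j. b j \<in> Y"
    and lt: "\<And>i j. i < j \<Longrightarrow> S (b j) (c i)"
    and gt: "\<And>i j x. j < i \<Longrightarrow> x \<in> carrier G \<Longrightarrow> S (b j) x \<Longrightarrow> inv x \<otimes> c i \<notin> \<theta>"
  shows "unst H"
proof -
  let ?X = "Y \<times> carrier G" and ?U = "prodc \<V> gco"
  obtain \<phi> where "wf_fm L (cx M ?X ?U) [] \<phi>" "\<forall>z\<in>?X. S (fst z) (snd z) \<longleftrightarrow> sat M (\<lambda>u. u z) [] \<phi>"
    "\<forall>u\<in>fv \<phi>. u \<in> ?U" "\<forall>u\<in>fv \<phi>. \<forall>z\<in>?X. srt M (u z) = cx M ?X ?U u"
    by (rule exE[OF dfnE[OF S]], elim conjE, rule that)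
  note \<phi> = this[rule_format]
  define W where "W = fv \<phi> \<inter> (\<lambda>v p. v (fst p)) ` \<V>"
  have finW: "finite W" unfolding W_def using finite_fv by blast
  obtain h :: "('y \<times> ('i \<Rightarrow> 'a) \<Rightarrow> 'a) \<Rightarrow> nat" where h: "inj_on h W"
    using finite_imp_inj_to_nat_seg[OF finW] by (elim exE conjE)
  have "\<forall>u\<in>fv \<phi> - W. \<exists>i. i \<in> dom \<Gamma> \<and> u = (\<lambda>p. snd p i)"
  proof
    fix u assume u: "u \<in> fv \<phi> - W"
    then have "u \<in> ?U" using \<phi>(3) by blast
    then show "\<exists>i. i \<in> dom \<Gamma> \<and> u = (\<lambda>p. snd p i)"
      using u unfolding W_def prodc_def co_def by auto
  qed
  from bchoice[OF this] obtain ix where ix: "\<forall>u\<in>fv \<phi> - W. ix u \<in> dom \<Gamma> \<and> u = (\<lambda>p. snd p (ix u))"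
    by (elim exE)
  define \<Delta> where "\<Delta> n = (if n \<in> h ` W then cx M ?X ?U (the_inv_into W h n) else None)" for n
  have \<Delta>h: "\<Delta> (h u) = cx M ?X ?U u" if "u \<in> W" for u
    using that the_inv_into_f_f[OF h that] by (simp add: \<Delta>_def)
  \<comment> \<open>The coordinates in \<open>W\<close> look only at the \<open>Y\<close> component;
    \<open>\<one>\<close> merely fills the other place.\<close>
  define b' where "b' j n = (if n \<in> dom \<Delta> then the_inv_into W h n (b j, \<one>) else undefined)" for j n
  define \<alpha> where "\<alpha> u p = (if u \<in> W then fst p (h u) else snd p (ix u))"
    for u and p :: "(nat \<Rightarrow> 'a) \<times> ('i \<Rightarrow> 'a)"
  define S' where "S' y x \<longleftrightarrow> sat M (\<lambda>u. \<alpha> u (y, x)) [] \<phi>" for y x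
  have sortW: "\<exists>s. cx M ?X ?U u = Some s" if "u \<in> fv \<phi>" for u
    using wf_fm_fv[OF \<phi>(1)] that by auto
  have hdom: "h u \<in> dom \<Delta>" if "u \<in> W" for u
    using \<Delta>h[OF that] sortW[of u] that by (auto simp: W_def)
  have b': "b' j \<in> tuples M \<Delta>" for j
  proof -
    have "srt M (b' j n) = \<Delta> n" if n: "n \<in> dom \<Delta>" for n
    proof -
      obtain u where u: "u \<in> W" "n = h u" using n by (auto simp: \<Delta>_def split: if_splits)
      then have "b' j n = u (b j, \<one>)" using n the_inv_into_f_f[OF h u(1)] by (simp add: b'_def)
      then show ?thesis using \<phi>(4)[of u "(b j, \<one>)"] u b \<Delta>h by (auto simp: W_def)
    qed
    then show ?thesis by (auto simp: tuples_iff extensional_def b'_def)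
  qed
  have S'b: "S' (b' j) x \<longleftrightarrow> S (b j) x" if x: "x \<in> carrier G" for j x
  proof -
    have "\<alpha> u (b' j, x) = u (b j, x)" if u: "u \<in> fv \<phi>" for u
    proof (cases "u \<in> W")
      case True
      then have "\<alpha> u (b' j, x) = u (b j, \<one>)"
        using hdom[OF True] the_inv_into_f_f[OF h True] by (simp add: \<alpha>_def b'_def)
      also have "\<dots> = u (b j, x)" using True by (auto simp: W_def)
      finally show ?thesis .
    next
      case False
      have "u (b j, x) = x (ix u)" using ix u False by (metis DiffI snd_conv)
      then show ?thesis using False by (simp add: \<alpha>_def)
    qed
    then have "S' (b' j) x \<longleftrightarrow> sat M (\<lambda>u. u (b j, x)) [] \<phi>" unfolding S'_def by (rule sat_cong)
    then show ?thesis using \<phi>(2)[of "(b j, x)"] b x by simp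
  qed
  have "dfn L M (tuples M \<Delta> \<times> carrier G) (prodc (co \<Delta> {}) gco) (\<lambda>p. S' (fst p) (snd p))"
  proof (rule dfnI[OF \<phi>(1), where \<alpha> = \<alpha>])
    fix u assume u: "u \<in> fv \<phi>"
    show "\<alpha> u \<in> prodc (co \<Delta> {}) gco"
    proof (cases "u \<in> W")
      case True
      then have "\<alpha> u = (\<lambda>p. (\<lambda>x. x (h u)) (fst p))" by (simp add: \<alpha>_def[abs_def])
      then show ?thesis using prodcI1[OF coI[OF hdom[OF True]]] by simp
    next
      case False
      then have "\<alpha> u = (\<lambda>p. (\<lambda>x. x (ix u)) (snd p))" "ix u \<in> dom \<Gamma>"
        using ix u by (simp_all add: \<alpha>_def[abs_def])
      then show ?thesis using prodcI2[OF coI] by metis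
    qed
    fix z assume z: "z \<in> tuples M \<Delta> \<times> carrier G"
    show "srt M (\<alpha> u z) = cx M ?X ?U u"
    proof (cases "u \<in> W")
      case True
      then show ?thesis using tuples_sort[of "fst z" M \<Delta> "h u"] z hdom[OF True] \<Delta>h[OF True]
        by (auto simp: \<alpha>_def)
    next
      case False
      then have i: "ix u \<in> dom \<Gamma>" "u = (\<lambda>p. snd p (ix u))" using ix u by auto
      have "cx M ?X ?U u = srt M (u (b 0, \<one>))" using \<phi>(4)[OF u, of "(b 0, \<one>)"] b by simp
      also have "u (b 0, \<one>) = \<one> (ix u)" using i(2) by (metis snd_conv)
      also have "srt M (\<one> (ix u)) = \<Gamma> (ix u)" using tuples_sort[OF subsetD[OF carrier_tuples one_closed] i(1)] .
      also have "\<dots> = srt M (snd z (ix u))"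
        using tuples_sort[of "snd z", OF subsetD[OF carrier_tuples] i(1)] z by auto
      finally show ?thesis using False by (simp add: \<alpha>_def)
    qed
  next
    fix z assume "z \<in> tuples M \<Delta> \<times> carrier G"
    show "S' (fst z) (snd z) \<longleftrightarrow> sat M (\<lambda>v. \<alpha> v z) [] \<phi>" by (simp add: S'_def)
  qed
  moreover have "\<forall>i j. i < j \<longrightarrow> S' (b' j) (c i)" using lt S'b c by simp
  moreover have "\<forall>i j. j < i \<longrightarrow> \<not> (\<exists>x\<in>carrier G. S' (b' j) x \<and> inv x \<otimes> c i \<in> \<theta>)"
    using gt S'b by simp
  ultimately show ?thesis
    unfolding unst_def using \<theta> c b'
    by (intro exI[of _ \<Delta>] exI[of _ S'] exI[of _ \<theta>] exI[of _ c] exI[of _ b']) simp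
qed

lemma dfn_in_definable:
  assumes "dfn L M (carrier G) (co \<Gamma> A) (\<lambda>x. x \<in> \<theta>)" "dtm X \<U> t" "params A \<subseteq> \<U>"
  shows "dfn L M X \<U> (\<lambda>z. t z \<in> \<theta>)"
proof (rule dfn_subst[OF _ assms(2)])
  show "dfn L M (X \<times> carrier G) (prodc \<U> gco) (\<lambda>p. snd p \<in> \<theta>)"
  proof (rule dfn_cm[OF assms(1)], rule cm_co[OF cm_snd])
    fix a assume "a \<in> A"
    then have "(\<lambda>z. a) \<in> \<U>" using assms(3) by auto
    from prodcI1[OF this] show "(\<lambda>z. a) \<in> prodc \<U> gco" .
  qed
qed

text \<open>The order is turned around by passing to the complement of the fibre of \<open>S\<close>
  thickened by \<open>\<theta>\<close>. For the separation to come out on the other side the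
  neighbourhood must be symmetric, hence \<open>{x \<in> \<theta>. inv x \<in> \<theta>}\<close>; it
  still contains \<open>H\<close> because \<open>H\<close> is closed under inverses.\<close>

lemma unst_revI:
  fixes Y :: "'y set" and b :: "nat \<Rightarrow> 'y"
  assumes S: "dfn L M (Y \<times> carrier G) (prodc \<V> gco) (\<lambda>p. S (fst p) (snd p))"
    and \<theta>: "dfn L M (carrier G) (co \<Gamma> U) (\<lambda>x. x \<in> \<theta>)" "H \<subseteq> \<theta>" and H: "subgroup H G"
    and c: "\<And>i. c i \<in> carrier G" and b: "\<And>j. b j \<in> Y"
    and gt: "\<And>i j. j < i \<Longrightarrow> S (b j) (c i)"
    and lt: "\<And>i j x. i < j \<Longrightarrow> x \<in> carrier G \<Longrightarrow> S (b j) x \<Longrightarrow> inv x \<otimes> c i \<notin> \<theta>"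
  shows "unst H"
proof -
  define \<V>' where "\<V>' = \<V> \<union> params U"
  define S' where "S' y x \<longleftrightarrow> \<not> (\<exists>z\<in>carrier G. S y z \<and> inv z \<otimes> x \<in> \<theta>)" for y x
  let ?X2 = "(Y \<times> carrier G) \<times> carrier G" and ?U2 = "prodc (prodc \<V>' gco) gco"
  have cY: "cm ?X2 ?U2 Y \<V> (\<lambda>p. fst (fst p))"
    by (rule cm_comp[OF cm_comp[OF cm_fst cm_fst] cm_mono[OF _ order_refl]]) (simp add: \<V>'_def)
  have "dfn L M ?X2 ?U2 (\<lambda>p. S (fst (fst p)) (snd p))"
    by (rule dfn_rel[OF S cY dtm_var[OF cm_snd]])
  moreover have "dfn L M ?X2 ?U2 (\<lambda>p. inv (snd p) \<otimes> snd (fst p) \<in> \<theta>)"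
  proof (rule dfn_in_definable[OF \<theta>(1)])
    show "dtm ?X2 ?U2 (\<lambda>p. inv (snd p) \<otimes> snd (fst p))"
      by (intro dtm_mult dtm_inv dtm_var[OF cm_snd] dtm_var[OF cm_comp[OF cm_fst cm_snd]])
    show "params U \<subseteq> ?U2" by (intro params_prodc) (simp add: \<V>'_def)
  qed
  ultimately have "dfn L M (Y \<times> carrier G) (prodc \<V>' gco) (\<lambda>p. S' (fst p) (snd p))"
    unfolding S'_def by (intro dfn_not dfn_exG dfn_conj)
  moreover have "dfn L M (carrier G) (co \<Gamma> U) (\<lambda>x. x \<in> {x \<in> \<theta>. inv x \<in> \<theta>})"
  proof -
    have "dfn L M (carrier G) (co \<Gamma> U) (\<lambda>x. inv x \<in> \<theta>)"
      by (rule dfn_in_definable[OF \<theta>(1) dtm_inv[OF dtm_var]])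
        (auto simp: co_def cm_def)
    then show ?thesis using dfn_conj[OF \<theta>(1)] by simp
  qed
  moreover have "H \<subseteq> {x \<in> \<theta>. inv x \<in> \<theta>}" using \<theta>(2) subgroup.m_inv_closed[OF H] by auto
  ultimately show ?thesis
  proof (rule unstI[OF _ _ _ c b])
    show "S' (b j) (c i)" if "i < j" for i j using lt[OF that] by (auto simp: S'_def)
    fix i j x assume *: "j < i" "x \<in> carrier G" "S' (b j) x"
    show "inv x \<otimes> c i \<notin> {x \<in> \<theta>. inv x \<in> \<theta>}"
    proof
      assume "inv x \<otimes> c i \<in> {x \<in> \<theta>. inv x \<in> \<theta>}"
      then have "inv (inv x \<otimes> c i) \<in> \<theta>" by simp
      then have "inv (c i) \<otimes> x \<in> \<theta>" using *(2) c by (simp add: inv_mult_group)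
      then show False using *(3) gt[OF *(1)] c unfolding S'_def by blast
    qed
  qed
qed

section \<open>Sequences of pairs of a group element and a tuple\<close>

abbreviation Xb :: "('w \<Rightarrow> 's option) \<Rightarrow> (('i \<Rightarrow> 'a) \<times> ('w \<Rightarrow> 'a)) set" where
  "Xb \<Delta> \<equiv> carrier G \<times> tuples M \<Delta>"

abbreviation Ub :: "('w \<Rightarrow> 's option) \<Rightarrow> (('i \<Rightarrow> 'a) \<times> ('w \<Rightarrow> 'a) \<Rightarrow> 'a) set" where
  "Ub \<Delta> \<equiv> prodc gco (co \<Delta> {})"

lemma small_sco: "countable I \<Longrightarrow> small M (dom \<Delta>) \<Longrightarrow> small M B \<Longrightarrow> small M (sco (Ub \<Delta>) I B)"
proof -
  assume *: "countable I" "small M (dom \<Delta>)" "small M B"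
  have "small M (I \<times> Ub \<Delta>)"
    using * by (intro small_times small_prodc small_gco small_co) (simp_all add: small_finite)
  then have "small M (prod.swap ` (I \<times> Ub \<Delta>))" by (rule small_image)
  then have "small M (Ub \<Delta> \<times> I)" by (simp add: product_swap)
  then show ?thesis unfolding sco_def by (intro small_Un small_image) (use * in simp_all)
qed

text \<open>A sequence of pairs is flattened into one tuple indexed by position and entry, so that
  compactness for tuples applies. That every position carries a group element is possibly infinitely
  many conditions, so \<open>D\<close> is presented as type-definable only.\<close>

lemma seqs_cover:
  fixes \<Delta> :: "'w \<Rightarrow> 's option"
  assumes small: "small M (dom \<Delta>)"
  shows "\<exists>(\<Psi> :: 'o::countable \<times> ('i + 'w) \<Rightarrow> 's option) D s. small M (dom \<Psi>) \<and> D \<subseteq> tuples M \<Psi> \<and> D \<noteq> {} \<and>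
    (\<forall>B. tdf L M (tuples M \<Psi>) (co \<Psi> B) (\<lambda>x. x \<in> D)) \<and>
    (\<forall>B. cm D (co \<Psi> B) (seqs (Xb \<Delta>) :: ('o \<Rightarrow> _) set) (sco (Ub \<Delta>) UNIV B) s) \<and> (\<forall>\<rho>\<in>seqs (Xb \<Delta>). \<exists>y\<in>D. \<rho> = s y)"
proof -
  define \<Psi> :: "'o \<times> ('i + 'w) \<Rightarrow> 's option" where "\<Psi> = (\<lambda>(q, v). case_sum \<Gamma> \<Delta> v)"
  define s :: "('o \<times> ('i + 'w) \<Rightarrow> 'a) \<Rightarrow> 'o \<Rightarrow> ('i \<Rightarrow> 'a) \<times> ('w \<Rightarrow> 'a)"
    where "s x q = (\<lambda>i. x (q, Inl i), \<lambda>w. x (q, Inr w))" for x q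
  define Y where "Y = {x \<in> tuples M \<Psi>. \<forall>q\<in>UNIV. fst (s x q) \<in> carrier G}"
  have "dom \<Psi> \<subseteq> UNIV \<times> (Inl ` dom \<Gamma> \<union> Inr ` dom \<Delta>)"
    by (fastforce simp: \<Psi>_def split: sum.splits)
  moreover have "small M ((UNIV :: 'o set) \<times> (Inl ` dom \<Gamma> \<union> Inr ` dom \<Delta>))"
    by (intro small_times small_Un small_image small_dom small) simp
  ultimately have sPsi: "small M (dom \<Psi>)" by (rule small_subset[rotated])
  have ext: "x (q, v) = undefined" if "x \<in> tuples M \<Psi>" "case_sum \<Gamma> \<Delta> v = None" for x q v
  proof -
    have "(q, v) \<notin> dom \<Psi>" using that(2) by (simp add: \<Psi>_def domIff)
    then show ?thesis using that(1) by (auto simp: tuples_iff extensional_def)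
  qed
  have srt: "srt M (x (q, v)) = case_sum \<Gamma> \<Delta> v" if "x \<in> tuples M \<Psi>" "case_sum \<Gamma> \<Delta> v = Some t" for x q v t
  proof -
    have "\<Psi> (q, v) = Some t" using that(2) by (simp add: \<Psi>_def)
    then show ?thesis using tuples_sort[OF that(1), of "(q, v)"] that(2) by auto
  qed
  have sfst: "fst (s x q) \<in> tuples M \<Gamma>" if "x \<in> tuples M \<Psi>" for x q
    using ext[OF that, of "Inl _" q] srt[OF that, of "Inl _" _ q]
    by (auto simp: s_def tuples_iff extensional_def dom_def)
  have ssnd: "snd (s x q) \<in> tuples M \<Delta>" if "x \<in> tuples M \<Psi>" for x q
    using ext[OF that, of "Inr _" q] srt[OF that, of "Inr _" _ q]
    by (auto simp: s_def tuples_iff extensional_def dom_def)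
  have surj: "\<exists>y\<in>Y. \<rho> = s y" if r: "\<rho> \<in> seqs (Xb \<Delta>)" for \<rho>
  proof -
    define y where "y = (\<lambda>(q, v). case v of Inl i \<Rightarrow> fst (\<rho> q) i | Inr w \<Rightarrow> snd (\<rho> q) w)"
    have 1: "fst (\<rho> q) \<in> tuples M \<Gamma>" "snd (\<rho> q) \<in> tuples M \<Delta>" for q
      using seqsD[OF r, of q] carrier_tuples by auto
    have "y \<in> tuples M \<Psi>"
      using 1 by (auto simp: y_def \<Psi>_def tuples_iff extensional_def dom_def split: sum.splits)
    moreover have sy: "s y q = \<rho> q" for q by (simp add: s_def y_def)
    ultimately show ?thesis using seqsD[OF r] by (intro bexI[of _ y]) (auto simp: Y_def mem_Times_iff)
  qed
  have "tdf L M (tuples M \<Psi>) (co \<Psi> B) (\<lambda>x. \<forall>q\<in>UNIV. fst (s x q) \<in> carrier G)" for B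
  proof (rule tdf_all, rule tdf_of_dfn, rule dfn_cm[OF dfn_carrier])
    fix q
    show "cm (tuples M \<Psi>) (co \<Psi> B) (tuples M \<Gamma>) gco (\<lambda>x. fst (s x q))"
    proof (rule cmI[OF sfst])
      fix v assume "v \<in> gco"
      then obtain i where "i \<in> dom \<Gamma>" "v = (\<lambda>x. x i)" by (auto simp: co_def)
      then show "(\<lambda>z. v (fst (s z q))) \<in> co \<Psi> B" by (auto simp: co_def s_def \<Psi>_def image_iff)
    qed
  qed
  then have tY: "tdf L M (tuples M \<Psi>) (co \<Psi> B) (\<lambda>x. x \<in> Y)" for B
    by (rule tdf_cong[THEN iffD1, rotated]) (simp add: Y_def)
  have Yne: "Y \<noteq> {}"
  proof -
    obtain d where "d \<in> tuples M \<Delta>" using tuples_nonempty[OF str] by blast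
    then have "(\<lambda>q. (\<one>, d)) \<in> seqs (Xb \<Delta>)" by (simp add: seqs_def)
    then show ?thesis using surj by blast
  qed
  have "cm Y (co \<Psi> B) (seqs (Xb \<Delta>)) (sco (Ub \<Delta>) UNIV B) s" for B
    proof (rule cmI)
      show "s x \<in> seqs (Xb \<Delta>)" if "x \<in> Y" for x
        using that ssnd by (auto simp: Y_def seqs_def mem_Times_iff)
      fix v :: "('o \<Rightarrow> ('i \<Rightarrow> 'a) \<times> ('w \<Rightarrow> 'a)) \<Rightarrow> 'a" assume "v \<in> sco (Ub \<Delta>) UNIV B"
      then consider u q where "u \<in> Ub \<Delta>" "v = (\<lambda>\<rho>. u (\<rho> q))" | b where "b \<in> B" "v = (\<lambda>\<rho>. b)"
        unfolding sco_def by auto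
      then show "(\<lambda>x. v (s x)) \<in> co \<Psi> B"
      proof cases
        case 1
        consider i where "i \<in> dom \<Gamma>" "u = (\<lambda>p. fst p i)" | w where "w \<in> dom \<Delta>" "u = (\<lambda>p. snd p w)"
          using 1(1) unfolding prodc_def co_def by auto
        then show ?thesis
        proof cases
          fix i assume i: "i \<in> dom \<Gamma>" "u = (\<lambda>p. fst p i)"
          then have "(q, Inl i) \<in> dom \<Psi>" by (auto simp: \<Psi>_def)
          from coI[OF this] show ?thesis using 1(2) i(2) by (simp add: s_def)
        next
          fix w assume w: "w \<in> dom \<Delta>" "u = (\<lambda>p. snd p w)"
          then have "(q, Inr w) \<in> dom \<Psi>" by (auto simp: \<Psi>_def)
          from coI[OF this] show ?thesis using 1(2) w(2) by (simp add: s_def)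
        qed
      next
        case 2
        then show ?thesis by (simp add: coI2)
      qed
    qed
  moreover have "Y \<subseteq> tuples M \<Psi>" by (auto simp: Y_def)
  ultimately show ?thesis using sPsi Yne tY surj
    by (intro exI[of _ \<Psi>] exI[of _ Y] exI[of _ s]) simp
qed

lemma cpt_seqs:
  fixes \<Delta> :: "'w \<Rightarrow> 's option"
  assumes small: "small M (dom \<Delta>)" "small M B"
  shows "cpt L M (seqs (Xb \<Delta>) :: ('o::countable \<Rightarrow> _) set) (sco (Ub \<Delta>) UNIV B)"
proof -
  obtain \<Psi> :: "'o \<times> ('i + 'w) \<Rightarrow> 's option" and D s where D: "small M (dom \<Psi>)" "D \<subseteq> tuples M \<Psi>" "D \<noteq> {}"
    "\<forall>B. tdf L M (tuples M \<Psi>) (co \<Psi> B) (\<lambda>x. x \<in> D)"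
    "\<forall>B. cm D (co \<Psi> B) (seqs (Xb \<Delta>) :: ('o \<Rightarrow> _) set) (sco (Ub \<Delta>) UNIV B) s" "\<forall>\<rho>\<in>seqs (Xb \<Delta>). \<exists>y\<in>D. \<rho> = s y"
    using seqs_cover[OF small(1)] by (elim exE conjE)
  show ?thesis
    by (rule cpt_image[OF cpt_D[OF D(1) small(2) D(2) spec[OF D(4)] D(3)] spec[OF D(5)] bspec[OF D(6)]])
qed

lemma tdf_ex_tuples:
  assumes "small M \<U>" "small M (dom \<Psi>)" "tdf L M (X \<times> tuples M \<Psi>) (prodc \<U> (co \<Psi> {})) (\<lambda>p. P (fst p) (snd p))"
  shows "tdf L M X \<U> (\<lambda>z. \<exists>y\<in>tuples M \<Psi>. P z y)"
  by (rule tdf_exD[OF order_refl dfn_tuples_UNIV assms])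

text \<open>Since the flattened sequences form a set that is only type-definable, the quantifier is
  taken over all tuples and membership in \<open>D\<close> becomes a further conjunct.\<close>

lemma tdf_ex_seqs:
  fixes \<Delta> :: "'w \<Rightarrow> 's option" and X :: "'z set"
  assumes small: "small M (dom \<Delta>)" "small M \<U>"
    and P: "tdf L M (X \<times> (seqs (Xb \<Delta>) :: ('o::countable \<Rightarrow> _) set)) (prodc \<U> (sco (Ub \<Delta>) UNIV {})) (\<lambda>p. P (fst p) (snd p))"
  shows "tdf L M X \<U> (\<lambda>z. \<exists>\<rho>\<in>seqs (Xb \<Delta>). P z \<rho>)"
proof (cases "X = {}")
  case True
  then show ?thesis unfolding tdf_def by (intro exI[of _ "{}"]) simp
next
  case False
  obtain \<Psi> :: "'o \<times> ('i + 'w) \<Rightarrow> 's option" and D s where D: "small M (dom \<Psi>)" "D \<subseteq> tuples M \<Psi>" "D \<noteq> {}"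
    "\<forall>B. tdf L M (tuples M \<Psi>) (co \<Psi> B) (\<lambda>x. x \<in> D)"
    "\<forall>B. cm D (co \<Psi> B) (seqs (Xb \<Delta>) :: ('o \<Rightarrow> _) set) (sco (Ub \<Delta>) UNIV B) s" "\<forall>\<rho>\<in>seqs (Xb \<Delta>). \<exists>y\<in>D. \<rho> = s y"
    using seqs_cover[OF small(1)] by (elim exE conjE)
  let ?U = "prodc \<U> (co \<Psi> {})"
  have "cm (X \<times> D) ?U (X \<times> seqs (Xb \<Delta>)) (prodc \<U> (sco (Ub \<Delta>) UNIV {})) (\<lambda>p. (fst p, s (snd p)))"
    by (rule cm_pair[OF cm_fst cm_comp[OF cm_snd spec[OF D(5)]]])
  from tdf_cm[OF P this] obtain \<P> where \<P>: "\<forall>Q\<in>\<P>. dfn L M (X \<times> D) ?U Q"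
    "\<forall>p\<in>X \<times> D. P (fst p) (s (snd p)) \<longleftrightarrow> (\<forall>Q\<in>\<P>. Q p)"
    unfolding tdf_def fst_conv snd_conv by (elim exE conjE)
  have "\<exists>Q'. dfn L M (X \<times> tuples M \<Psi>) ?U Q' \<and> (\<forall>p\<in>X \<times> D. Q p \<longleftrightarrow> Q' p)" if "Q \<in> \<P>" for Q
  proof (rule dfn_extend)
    show "X \<times> D \<subseteq> X \<times> tuples M \<Psi>" "X \<times> D \<noteq> {}" using D(2,3) False by auto
    show "dfn L M (X \<times> D) ?U Q" using \<P>(1) that by blast
    fix u s assume "u \<in> ?U" "\<And>z. z \<in> X \<times> D \<Longrightarrow> srt M (u z) = Some s"
    then show "\<forall>z\<in>X \<times> tuples M \<Psi>. srt M (u z) = Some s" by (rule prod_sorted[OF D(2,3)])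
  qed
  then have "\<forall>Q\<in>\<P>. \<exists>Q'. dfn L M (X \<times> tuples M \<Psi>) ?U Q' \<and> (\<forall>p\<in>X \<times> D. Q p \<longleftrightarrow> Q' p)" by (rule ballI)
  from bchoice[OF this] obtain e where e: "\<forall>Q\<in>\<P>. dfn L M (X \<times> tuples M \<Psi>) ?U (e Q) \<and> (\<forall>p\<in>X \<times> D. Q p \<longleftrightarrow> e Q p)"
    by (elim exE)
  have "tdf L M X \<U> (\<lambda>z. \<exists>y\<in>tuples M \<Psi>. y \<in> D \<and> (\<forall>Q\<in>\<P>. e Q (z, y)))"
  proof (rule tdf_ex_tuples[OF small(2) D(1)], rule tdf_conj)
    show "tdf L M (X \<times> tuples M \<Psi>) ?U (\<lambda>p. snd p \<in> D)" by (rule tdf_cm[OF spec[OF D(4)] cm_snd])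
    show "tdf L M (X \<times> tuples M \<Psi>) ?U (\<lambda>p. \<forall>Q\<in>\<P>. e Q (fst p, snd p))"
      by (intro tdf_all tdf_of_dfn) (use e in simp)
  qed
  then show ?thesis
  proof (rule tdf_cong[THEN iffD1, rotated])
    fix z assume z: "z \<in> X"
    have 1: "(\<forall>Q\<in>\<P>. e Q (z, y)) \<longleftrightarrow> P z (s y)" if y: "y \<in> D" for y
    proof -
      have "(\<forall>Q\<in>\<P>. e Q (z, y)) \<longleftrightarrow> (\<forall>Q\<in>\<P>. Q (z, y))"
        by (rule ball_cong[OF refl]) (use e z y in simp)
      then show ?thesis using bspec[OF \<P>(2), of "(z, y)"] z y by simp
    qed
    show "(\<exists>y\<in>tuples M \<Psi>. y \<in> D \<and> (\<forall>Q\<in>\<P>. e Q (z, y))) \<longleftrightarrow> (\<exists>\<rho>\<in>seqs (Xb \<Delta>). P z \<rho>)"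
    proof
      assume "\<exists>y\<in>tuples M \<Psi>. y \<in> D \<and> (\<forall>Q\<in>\<P>. e Q (z, y))"
      then obtain y where y: "y \<in> D" "\<forall>Q\<in>\<P>. e Q (z, y)" by (elim bexE conjE)
      then have "P z (s y)" using 1 by simp
      then show "\<exists>\<rho>\<in>seqs (Xb \<Delta>). P z \<rho>" using cmD[OF spec[OF D(5)] y(1)] by (intro bexI[of _ "s y"])
    next
      assume "\<exists>\<rho>\<in>seqs (Xb \<Delta>). P z \<rho>"
      then obtain \<rho> where r: "\<rho> \<in> seqs (Xb \<Delta>)" "P z \<rho>" by (elim bexE)
      obtain y where y: "y \<in> D" "\<rho> = s y" using bspec[OF D(6) r(1)] by (elim bexE)
      then show "\<exists>y\<in>tuples M \<Psi>. y \<in> D \<and> (\<forall>Q\<in>\<P>. e Q (z, y))"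
        using r(2) 1[OF y(1)] D(2) by (intro bexI[of _ y]) auto
    qed
  qed
qed

end

lemma dfn_co_finite:
  assumes "dfn L M X (co \<Delta> A) P"
  shows "\<exists>A'. finite A' \<and> A' \<subseteq> A \<and> dfn L M X (co \<Delta> A') P"
proof -
  obtain \<V> where V: "finite \<V>" "\<V> \<subseteq> co \<Delta> A" "dfn L M X \<V> P"
    using dfn_finite[OF assms] by metis
  have "\<exists>A'. finite A' \<and> A' \<subseteq> A \<and> v \<in> co \<Delta> A'" if "v \<in> \<V>" for v
  proof -
    have "v \<in> co \<Delta> A" using V(2) that by auto
    then consider i where "i \<in> dom \<Delta>" "v = (\<lambda>x. x i)" | a where "a \<in> A" "v = (\<lambda>x. a)"
      unfolding co_def by blast
    then show ?thesis
    proof cases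
      case 1
      then show ?thesis by (intro exI[of _ "{}"]) (auto simp: co_def)
    next
      case 2
      then show ?thesis by (intro exI[of _ "{a}"]) (auto simp: co_def)
    qed
  qed
  then obtain k where k: "\<forall>v\<in>\<V>. finite (k v) \<and> k v \<subseteq> A \<and> v \<in> co \<Delta> (k v)" by metis
  have "\<V> \<subseteq> co \<Delta> (\<Union>(k ` \<V>))"
  proof
    fix v assume v: "v \<in> \<V>"
    then have "co \<Delta> (k v) \<subseteq> co \<Delta> (\<Union>(k ` \<V>))" unfolding co_def by auto
    then show "v \<in> co \<Delta> (\<Union>(k ` \<V>))" using k v by auto
  qed
  then have "dfn L M X (co \<Delta> (\<Union>(k ` \<V>))) P" by (rule dfn_mono[OF V(3) order_refl])
  then show ?thesis using k V(1) by (intro exI[of _ "\<Union>(k ` \<V>)"]) auto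
qed

lemma co_mono: "A \<subseteq> B \<Longrightarrow> co \<Delta> A \<subseteq> co \<Delta> B"
  unfolding co_def by auto

context defgrp
begin

lemma cpt_carrier: "small M A \<Longrightarrow> cpt L M (carrier G) (co \<Gamma> A)"
  by (rule cpt_D[OF small_dom _ carrier_tuples tdf_of_dfn[OF dfn_mono[OF dfn_carrier order_refl]] carrier_ne])
    (simp_all add: co_mono)

lemma tdf_in:
  assumes "tdf L M (carrier G) (co \<Gamma> A) (\<lambda>x. x \<in> \<theta>)" "dtm X \<U> t" "params A \<subseteq> \<U>"
  shows "tdf L M X \<U> (\<lambda>z. t z \<in> \<theta>)"
proof (rule tdf_rel[OF _ cm_id assms(2)])
  show "tdf L M (X \<times> carrier G) (prodc \<U> gco) (\<lambda>p. snd p \<in> \<theta>)"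
  proof (rule tdf_cm[OF assms(1)], rule cm_co[OF cm_snd])
    fix a assume "a \<in> A"
    then have "(\<lambda>z. a) \<in> \<U>" using assms(3) by auto
    from prodcI1[OF this] show "(\<lambda>z. a) \<in> prodc \<U> gco" .
  qed
qed

text \<open>\<open>\<theta>\<close> may use parameters outside \<open>A\<close>, but only finitely
  many, so they can be added to \<open>A\<close> without losing smallness.\<close>

lemma cover:
  assumes "small M A" and Q: "\<And>Q. Q \<in> \<Q> \<Longrightarrow> dfn L M (carrier G) (co \<Gamma> A) Q"
    and \<theta>: "dfn L M (carrier G) (co \<Gamma> U) (\<lambda>x. x \<in> \<theta>)"
    and sub: "\<And>x. x \<in> carrier G \<Longrightarrow> (\<forall>Q\<in>\<Q>. Q x) \<Longrightarrow> x \<in> \<theta>"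
  shows "\<exists>F. F \<subseteq> \<Q> \<and> finite F \<and> (\<forall>x\<in>carrier G. (\<forall>Q\<in>F. Q x) \<longrightarrow> x \<in> \<theta>)"
proof -
  obtain A' where A': "finite A'" "dfn L M (carrier G) (co \<Gamma> A') (\<lambda>x. x \<in> \<theta>)"
    using dfn_co_finite[OF \<theta>] by (elim exE conjE)
  have "small M (A \<union> A')" using assms(1) small_finite[OF A'(1)] by (rule small_Un)
  from cpt_carrier[OF this] show ?thesis
  proof (rule cpt_imp)
    show "dfn L M (carrier G) (co \<Gamma> (A \<union> A')) Q" if "Q \<in> \<Q>" for Q
      by (rule dfn_mono[OF Q[OF that] order_refl]) (simp add: co_mono)
    show "dfn L M (carrier G) (co \<Gamma> (A \<union> A')) (\<lambda>x. x \<in> \<theta>)"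
      by (rule dfn_mono[OF A'(2) order_refl]) (simp add: co_mono)
    show "x \<in> \<theta>" if "x \<in> carrier G" "\<And>Q. Q \<in> \<Q> \<Longrightarrow> Q x" for x
      by (rule sub[OF that(1)]) (rule ballI, rule that(2))
  qed
qed

text \<open>The analogue of halving a neighbourhood of the identity in a topological group:
  \<open>inv x \<otimes> y \<in> \<theta>\<close> follows from \<open>x \<in> H\<close> and
  \<open>y \<in> H\<close>, hence by compactness from finitely many conditions on each. The new
  neighbourhood is over \<open>A\<close> even if \<open>\<theta>\<close> is not.\<close>

lemma half:
  assumes "small M A" "subgroup H G" and H: "tdf L M (carrier G) (co \<Gamma> A) (\<lambda>x. x \<in> H)"
    and \<theta>: "dfn L M (carrier G) (co \<Gamma> U) (\<lambda>x. x \<in> \<theta>)" "H \<subseteq> \<theta>"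
  shows "\<exists>\<theta>'. dfn L M (carrier G) (co \<Gamma> A) (\<lambda>x. x \<in> \<theta>') \<and> H \<subseteq> \<theta>' \<and> \<theta>' \<subseteq> carrier G \<and>
    (\<forall>x\<in>\<theta>'. \<forall>y\<in>\<theta>'. inv x \<otimes> y \<in> \<theta>)"
proof -
  obtain A' where A': "finite A'" "A' \<subseteq> U" "dfn L M (carrier G) (co \<Gamma> A') (\<lambda>x. x \<in> \<theta>)"
    using dfn_co_finite[OF \<theta>(1)] by (elim exE conjE)
  have sm: "small M (A \<union> A')" using assms(1) small_finite[OF A'(1)] by (rule small_Un)
  obtain \<P> where \<P>: "\<forall>Q\<in>\<P>. dfn L M (carrier G) (co \<Gamma> A) Q" "\<forall>x\<in>carrier G. x \<in> H \<longleftrightarrow> (\<forall>Q\<in>\<P>. Q x)"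
    using H unfolding tdf_def by (elim exE conjE)
  let ?X = "carrier G \<times> carrier G" and ?U = "prodc (co \<Gamma> (A \<union> A')) gco"
  have cf: "cm ?X ?U (carrier G) (co \<Gamma> (A \<union> A')) fst" by (rule cm_fst)
  have cs: "cm ?X ?U (carrier G) (co \<Gamma> (A \<union> A')) snd"
    by (rule cm_co[OF cm_snd]) (rule prodcI1[OF coI2])
  let ?Q = "(\<lambda>Q p. Q (fst p)) ` \<P> \<union> (\<lambda>Q p. Q (snd p)) ` \<P>"
  have "\<exists>F. F \<subseteq> ?Q \<and> finite F \<and> (\<forall>p\<in>?X. (\<forall>Q\<in>F. Q p) \<longrightarrow> inv (fst p) \<otimes> snd p \<in> \<theta>)"
  proof (rule cpt_imp)
    show "cpt L M ?X ?U" by (intro cpt_prodG cpt_carrier small_co small_dom sm)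
    fix Q assume "Q \<in> ?Q"
    then consider Q' where "Q' \<in> \<P>" "Q = (\<lambda>p. Q' (fst p))" | Q' where "Q' \<in> \<P>" "Q = (\<lambda>p. Q' (snd p))"
      by auto
    then show "dfn L M ?X ?U Q"
    proof cases
      case 1
      show ?thesis unfolding 1(2)
        by (rule dfn_cm[OF dfn_mono[OF \<P>(1)[rule_format, OF 1(1)] order_refl] cf]) (simp add: co_mono)
    next
      case 2
      show ?thesis unfolding 2(2)
        by (rule dfn_cm[OF dfn_mono[OF \<P>(1)[rule_format, OF 2(1)] order_refl] cs]) (simp add: co_mono)
    qed
  next
    show "dfn L M ?X ?U (\<lambda>p. inv (fst p) \<otimes> snd p \<in> \<theta>)"
    proof (rule dfn_in_definable[OF A'(3)])
      have "cm ?X ?U (carrier G) gco fst" by (rule cm_comp[OF cm_fst cm_mono[OF co_mono order_refl]]) simp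
      then show "dtm ?X ?U (\<lambda>p. inv (fst p) \<otimes> snd p)"
        by (intro dtm_mult dtm_inv dtm_var cm_snd)
      show "params A' \<subseteq> ?U" by (rule params_prodc) (auto intro: coI2)
    qed
    fix p assume p: "p \<in> ?X" and *: "\<And>Q. Q \<in> ?Q \<Longrightarrow> Q p"
    have "\<forall>Q\<in>\<P>. Q (fst p)" by (rule ballI) (rule *[OF UnI1[OF imageI]])
    moreover have "fst p \<in> carrier G" "snd p \<in> carrier G" using p by (simp_all add: mem_Times_iff)
    ultimately have 1: "fst p \<in> H" using bspec[OF \<P>(2), of "fst p"] by blast
    have "\<forall>Q\<in>\<P>. Q (snd p)" by (rule ballI) (rule *[OF UnI2[OF imageI]])
    then have "snd p \<in> H" using bspec[OF \<P>(2), of "snd p"] \<open>snd p \<in> carrier G\<close> by blast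
    then show "inv (fst p) \<otimes> snd p \<in> \<theta>"
      using 1 \<theta>(2) subgroup.m_closed[OF assms(2)] subgroup.m_inv_closed[OF assms(2)] by auto
  qed
  then obtain F where F: "F \<subseteq> ?Q" "finite F" "\<forall>p\<in>?X. (\<forall>Q\<in>F. Q p) \<longrightarrow> inv (fst p) \<otimes> snd p \<in> \<theta>"
    by (elim exE conjE)
  \<comment> \<open>Conditions on the first and on the second component are merged into one finite
    set, so that a single neighbourhood serves both.\<close>
  have "\<exists>K\<subseteq>\<P>. finite K \<and> F \<subseteq> (\<lambda>Q p. Q (fst p)) ` K \<union> (\<lambda>Q p. Q (snd p)) ` K"
  proof -
    have "\<forall>Q\<in>F. \<exists>Q'. Q' \<in> \<P> \<and> (Q = (\<lambda>p. Q' (fst p)) \<or> Q = (\<lambda>p. Q' (snd p)))"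
    proof
      fix Q assume "Q \<in> F"
      with F(1) have "Q \<in> ?Q" by (rule subsetD)
      then show "\<exists>Q'. Q' \<in> \<P> \<and> (Q = (\<lambda>p. Q' (fst p)) \<or> Q = (\<lambda>p. Q' (snd p)))"
      proof (elim UnE imageE)
        fix Q' assume "Q = (\<lambda>p. Q' (fst p))" "Q' \<in> \<P>"
        then show ?thesis by (intro exI[of _ Q'] conjI disjI1)
      next
        fix Q' assume "Q = (\<lambda>p. Q' (snd p))" "Q' \<in> \<P>"
        then show ?thesis by (intro exI[of _ Q'] conjI disjI2)
      qed
    qed
    from bchoice[OF this] obtain k where k: "\<forall>Q\<in>F. k Q \<in> \<P> \<and> (Q = (\<lambda>p. k Q (fst p)) \<or> Q = (\<lambda>p. k Q (snd p)))"
      by (elim exE)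
    have "F \<subseteq> (\<lambda>Q p. Q (fst p)) ` (k ` F) \<union> (\<lambda>Q p. Q (snd p)) ` (k ` F)"
    proof
      fix Q assume Q: "Q \<in> F"
      have "k Q \<in> k ` F" using Q by simp
      moreover have "Q = (\<lambda>p. k Q (fst p)) \<or> Q = (\<lambda>p. k Q (snd p))" using k Q by blast
      ultimately show "Q \<in> (\<lambda>Q p. Q (fst p)) ` (k ` F) \<union> (\<lambda>Q p. Q (snd p)) ` (k ` F)"
        by (elim disjE) (rule UnI1, erule image_eqI, assumption, rule UnI2, erule image_eqI, assumption)
    qed
    then show ?thesis using k F(2) by (intro exI[of _ "k ` F"]) auto
  qed
  then obtain K where K: "K \<subseteq> \<P>" "finite K" "F \<subseteq> (\<lambda>Q p. Q (fst p)) ` K \<union> (\<lambda>Q p. Q (snd p)) ` K"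
    by (elim exE conjE)
  let ?t = "{x \<in> carrier G. \<forall>Q\<in>K. Q x}"
  have "dfn L M (carrier G) (co \<Gamma> A) (\<lambda>x. \<forall>Q\<in>K. Q x)"
    by (rule dfn_ball_finite[OF K(2)]) (use K(1) \<P>(1) in blast)
  then have "dfn L M (carrier G) (co \<Gamma> A) (\<lambda>x. x \<in> ?t)" by (rule dfn_cong[THEN iffD1, rotated]) simp
  moreover have "H \<subseteq> ?t"
  proof
    fix x assume x: "x \<in> H"
    then have "x \<in> carrier G" using subgroup.subset[OF assms(2)] by auto
    then show "x \<in> ?t" using \<P>(2) x K(1) by blast
  qed
  moreover have "inv x \<otimes> y \<in> \<theta>" if xy: "x \<in> ?t" "y \<in> ?t" for x y
  proof -
    have "Q (x, y)" if "Q \<in> F" for Q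
    proof -
      have "Q \<in> (\<lambda>Q p. Q (fst p)) ` K \<union> (\<lambda>Q p. Q (snd p)) ` K" using K(3) that by blast
      then consider Q' where "Q' \<in> K" "Q = (\<lambda>p. Q' (fst p))" | Q' where "Q' \<in> K" "Q = (\<lambda>p. Q' (snd p))"
        by auto
      then show ?thesis using xy by cases auto
    qed
    then have "\<forall>Q\<in>F. Q (x, y)" by (rule ballI)
    then show ?thesis using bspec[OF F(3), of "(x, y)"] xy by simp
  qed
  ultimately show ?thesis by (intro exI[of _ ?t]) auto
qed

text \<open>
  The blocks \<open>b\<^sub>j = \<rho> \<circ> f\<^sub>j\<close> squeeze the part of \<open>\<rho>\<close> over \<open>[l, u]\<close> into \<open>[p\<^sub>j, p\<^sub>j\<^sub>+\<^sub>1]\<close>, where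
  \<open>p\<^sub>j \<rightarrow> u\<close>; a failure of the conclusion gives the order property for \<open>\<rho> p\<^sub>i\<close> against \<open>b\<^sub>j\<close>.
\<close>

lemma moving:
  fixes \<rho> :: "rat \<Rightarrow> ('i \<Rightarrow> 'a) \<times> ('w \<Rightarrow> 'a)" and \<Delta> :: "'w \<Rightarrow> 's option"
  defines "SX \<equiv> seqs (Xb \<Delta>) :: (rat \<Rightarrow> ('i \<Rightarrow> 'a) \<times> ('w \<Rightarrow> 'a)) set"
  assumes small: "small M (dom \<Delta>)" "small M B" "B \<subseteq> U" and ind: "indisc L M (Xb \<Delta>) (Ub \<Delta>) B \<rho>"
    and lu: "l < u"
    and HP: "tdf L M (SX \<times> carrier G) (prodc (sco (Ub \<Delta>) {q. q < l \<or> u < q} B) gco) (\<lambda>p. HP (fst p) (snd p))"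
    and H: "subgroup H G" "\<And>x. x \<in> carrier G \<Longrightarrow> x \<in> H \<longleftrightarrow> HP \<rho> x" "\<not> unst H"
    and P: "tdf L M (SX \<times> carrier G) (prodc (sco (Ub \<Delta>) {q. q \<noteq> l \<and> q \<noteq> u} B) gco) (\<lambda>p. P (fst p) (snd p))"
    and inv: "\<And>x h. x \<in> carrier G \<Longrightarrow> h \<in> H \<Longrightarrow> P \<rho> x \<Longrightarrow> P \<rho> (x \<otimes> h)"
    and Pu: "P \<rho> (fst (\<rho> u))"
  shows "P \<rho> (fst (\<rho> l))"
proof (rule ccontr)
  assume nP: "\<not> P \<rho> (fst (\<rho> l))"
  have \<rho>: "\<rho> \<in> SX" using ind by (simp add: indisc_def SX_def)
  have cG: "fst (\<rho> q) \<in> carrier G" for q using \<rho> by (auto simp: SX_def seqs_def mem_Times_iff)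
  have sG: "(\<sigma>, x) \<in> SX \<times> carrier G" if "\<sigma> \<in> SX" "x \<in> carrier G" for \<sigma> x using that by simp
  let ?sc = "\<lambda>I. sco (Ub \<Delta>) I B :: ((rat \<Rightarrow> ('i \<Rightarrow> 'a) \<times> ('w \<Rightarrow> 'a)) \<Rightarrow> 'a) set"
  let ?out = "{q. q < l \<or> u < q}" and ?ne = "{q. q \<noteq> l \<and> q \<noteq> u}"
  have out_ne: "?sc ?out \<subseteq> ?sc ?ne" by (rule sco_mono) (use lu in auto)
  obtain \<P> where \<P>: "\<forall>Q\<in>\<P>. dfn L M (SX \<times> carrier G) (prodc (?sc ?ne) gco) Q"
    "\<forall>p\<in>SX \<times> carrier G. P (fst p) (snd p) \<longleftrightarrow> (\<forall>Q\<in>\<P>. Q p)"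
    using P unfolding tdf_def by (elim exE conjE)
  obtain \<H> where \<H>: "\<forall>Q\<in>\<H>. dfn L M (SX \<times> carrier G) (prodc (?sc ?out) gco) Q"
    "\<forall>p\<in>SX \<times> carrier G. HP (fst p) (snd p) \<longleftrightarrow> (\<forall>Q\<in>\<H>. Q p)"
    using HP unfolding tdf_def by (elim exE conjE)
  have P\<rho>: "P \<rho> x \<longleftrightarrow> (\<forall>Q\<in>\<P>. Q (\<rho>, x))" if "x \<in> carrier G" for x
    using \<P>(2)[rule_format, OF sG[OF \<rho> that]] by simp
  have H\<rho>: "x \<in> H \<longleftrightarrow> (\<forall>Q\<in>\<H>. Q (\<rho>, x))" if "x \<in> carrier G" for x
    using \<H>(2)[rule_format, OF sG[OF \<rho> that]] H(2)[OF that] by simp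
  obtain \<phi> where \<phi>: "\<phi> \<in> \<P>" "\<not> \<phi> (\<rho>, fst (\<rho> l))" using nP P\<rho>[OF cG] by blast
  \<comment> \<open>The sequence is the only point of the first factor, so its entries act as
    parameters for the two group variables.\<close>
  let ?X1 = "({\<rho>} \<times> carrier G) \<times> carrier G" and ?U1 = "prodc (prodc (?sc UNIV) gco) gco"
  have d1: "dfn L M ?X1 ?U1 (\<lambda>p. Q (\<rho>, t p))"
    if Q: "dfn L M (SX \<times> carrier G) (prodc (?sc I) gco) Q" and t: "dtm ?X1 ?U1 t" for Q t I
  proof -
    have "dfn L M (SX \<times> carrier G) (prodc (?sc UNIV) gco) (\<lambda>p. Q (fst p, snd p))"
      using dfn_mono[OF Q order_refl, of "prodc (?sc UNIV) gco"] sco_mono[of I UNIV B B "Ub \<Delta>"]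
      by (auto simp: prodc_def)
    moreover have "cm ?X1 ?U1 SX (?sc UNIV) (\<lambda>p. fst (fst p))"
      by (rule cm_comp[OF cm_comp[OF cm_fst cm_fst] cm_mono]) (use \<rho> in auto)
    ultimately have "dfn L M ?X1 ?U1 (\<lambda>p. Q (fst (fst p), t p))"
      using dfn_rel[OF _ _ t, where R = "\<lambda>x y. Q (x, y)"] by blast
    then show ?thesis by (rule dfn_cong[THEN iffD1, rotated]) auto
  qed
  let ?tx = "\<lambda>p :: ((rat \<Rightarrow> ('i \<Rightarrow> 'a) \<times> ('w \<Rightarrow> 'a)) \<times> ('i \<Rightarrow> 'a)) \<times> ('i \<Rightarrow> 'a). snd (fst p)"
    and ?ty = "\<lambda>p :: ((rat \<Rightarrow> ('i \<Rightarrow> 'a) \<times> ('w \<Rightarrow> 'a)) \<times> ('i \<Rightarrow> 'a)) \<times> ('i \<Rightarrow> 'a). snd p"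
  have tx: "dtm ?X1 ?U1 ?tx" by (rule dtm_var[OF cm_comp[OF cm_fst cm_snd]])
  have ty: "dtm ?X1 ?U1 ?ty" by (rule dtm_var[OF cm_snd])
  let ?Q = "(\<lambda>Q p. Q (\<rho>, ?tx p)) ` \<P> \<union> (\<lambda>Q p. Q (\<rho>, ?ty p)) ` \<H>"
  have "\<exists>F. F \<subseteq> ?Q \<and> finite F \<and> (\<forall>p\<in>?X1. (\<forall>Q\<in>F. Q p) \<longrightarrow> \<phi> (\<rho>, ?tx p \<otimes> ?ty p))"
  proof (rule cpt_imp)
    have "small M (?sc UNIV)" by (rule small_sco[OF _ small(1,2)]) simp
    then show "cpt L M ?X1 ?U1"
      by (intro cpt_prodG cpt_singleton small_prodc small_gco)
    fix Q assume "Q \<in> ?Q"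
    then consider Q' where "Q' \<in> \<P>" "Q = (\<lambda>p. Q' (\<rho>, ?tx p))" | Q' where "Q' \<in> \<H>" "Q = (\<lambda>p. Q' (\<rho>, ?ty p))"
      by auto
    then show "dfn L M ?X1 ?U1 Q"
    proof cases
      case 1
      show ?thesis unfolding 1(2) by (rule d1[OF \<P>(1)[rule_format, OF 1(1)] tx])
    next
      case 2
      show ?thesis unfolding 2(2) by (rule d1[OF \<H>(1)[rule_format, OF 2(1)] ty])
    qed
  next
    show "dfn L M ?X1 ?U1 (\<lambda>p. \<phi> (\<rho>, ?tx p \<otimes> ?ty p))"
      by (rule d1[OF \<P>(1)[rule_format, OF \<phi>(1)] dtm_mult[OF tx ty]])
    fix p assume p: "p \<in> ?X1" and *: "\<And>Q. Q \<in> ?Q \<Longrightarrow> Q p"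
    then have xy: "?tx p \<in> carrier G" "?ty p \<in> carrier G" by auto
    have "P \<rho> (?tx p)" unfolding P\<rho>[OF xy(1)] by (rule ballI) (rule *[OF UnI1[OF imageI]])
    moreover have "?ty p \<in> H" unfolding H\<rho>[OF xy(2)] by (rule ballI) (rule *[OF UnI2[OF imageI]])
    ultimately have "P \<rho> (?tx p \<otimes> ?ty p)" using inv xy by blast
    then have "\<forall>Q\<in>\<P>. Q (\<rho>, ?tx p \<otimes> ?ty p)" using P\<rho> xy by simp
    then show "\<phi> (\<rho>, ?tx p \<otimes> ?ty p)" using \<phi>(1) by (rule bspec)
  qed
  then obtain F where F: "F \<subseteq> ?Q" "finite F" "\<forall>p\<in>?X1. (\<forall>Q\<in>F. Q p) \<longrightarrow> \<phi> (\<rho>, ?tx p \<otimes> ?ty p)"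
    by (elim exE conjE)
  obtain F1 where F1: "F1 \<subseteq> \<P>" "finite F1" "F \<inter> (\<lambda>Q p. Q (\<rho>, ?tx p)) ` \<P> = (\<lambda>Q p. Q (\<rho>, ?tx p)) ` F1"
    using finite_subset_image[of "F \<inter> (\<lambda>Q p. Q (\<rho>, ?tx p)) ` \<P>"] F(2)
    by (metis (no_types, lifting) finite_Int inf_le2)
  obtain F2 where F2: "F2 \<subseteq> \<H>" "finite F2" "F \<inter> (\<lambda>Q p. Q (\<rho>, ?ty p)) ` \<H> = (\<lambda>Q p. Q (\<rho>, ?ty p)) ` F2"
    using finite_subset_image[of "F \<inter> (\<lambda>Q p. Q (\<rho>, ?ty p)) ` \<H>"] F(2)
    by (metis (no_types, lifting) finite_Int inf_le2)
  define \<phi>1 where "\<phi>1 \<sigma> x \<longleftrightarrow> (\<forall>Q\<in>F1. Q (\<sigma>, x))" for \<sigma> x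
  define \<theta>1 where "\<theta>1 \<sigma> x \<longleftrightarrow> (\<forall>Q\<in>F2. Q (\<sigma>, x))" for \<sigma> x
  have imp: "\<phi> (\<rho>, x \<otimes> y)" if xy: "x \<in> carrier G" "y \<in> carrier G" and h: "\<phi>1 \<rho> x" "\<theta>1 \<rho> y" for x y
  proof -
    have "Q ((\<rho>, x), y)" if "Q \<in> F" for Q
    proof -
      have "Q \<in> (\<lambda>Q p. Q (\<rho>, ?tx p)) ` F1 \<or> Q \<in> (\<lambda>Q p. Q (\<rho>, ?ty p)) ` F2"
        using subsetD[OF F(1) that] that unfolding F1(3)[symmetric] F2(3)[symmetric] by simp
      then show ?thesis
      proof (elim disjE imageE)
        fix Q' assume "Q = (\<lambda>p. Q' (\<rho>, ?tx p))" "Q' \<in> F1"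
        then show ?thesis using bspec[OF h(1)[unfolded \<phi>1_def], of Q'] by simp
      next
        fix Q' assume "Q = (\<lambda>p. Q' (\<rho>, ?ty p))" "Q' \<in> F2"
        then show ?thesis using bspec[OF h(2)[unfolded \<theta>1_def], of Q'] by simp
      qed
    qed
    then have "\<forall>Q\<in>F. Q ((\<rho>, x), y)" by (rule ballI)
    then show ?thesis using bspec[OF F(3), of "((\<rho>, x), y)"] xy by simp
  qed
  have d\<phi>1: "dfn L M (SX \<times> carrier G) (prodc (?sc ?ne) gco) (\<lambda>p. \<phi>1 (fst p) (snd p))"
    unfolding \<phi>1_def by (rule dfn_ball_finite[OF F1(2)]) (use F1(1) \<P>(1) in auto)
  have d\<theta>1: "dfn L M (SX \<times> carrier G) (prodc (?sc ?out) gco) (\<lambda>p. \<theta>1 (fst p) (snd p))"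
    unfolding \<theta>1_def by (rule dfn_ball_finite[OF F2(2)]) (use F2(1) \<H>(1) in auto)
  have d\<phi>: "dfn L M (SX \<times> carrier G) (prodc (?sc ?ne) gco) (\<lambda>p. \<phi> (fst p, snd p))"
    using \<P>(1)[rule_format, OF \<phi>(1)] by simp
  \<comment> \<open>The implication \<open>imp\<close> becomes a definable condition on the
    sequence. It reads no position \<open>l\<close> or \<open>u\<close>, so indiscernibility carries
    it to every block \<open>\<rho> \<circ> f j\<close>.\<close>
  define T where "T \<sigma> \<longleftrightarrow> (\<forall>x\<in>carrier G. \<forall>y\<in>carrier G. \<phi>1 \<sigma> x \<and> \<theta>1 \<sigma> y \<longrightarrow> \<phi> (\<sigma>, x \<otimes> y))" for \<sigma>
  have dT: "dfn L M SX (?sc ?ne) T"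
  proof -
    let ?X2 = "(SX \<times> carrier G) \<times> carrier G" and ?U2 = "prodc (prodc (?sc ?ne) gco) gco"
    have tx: "dtm ?X2 ?U2 (\<lambda>p. snd (fst p))" by (rule dtm_var[OF cm_comp[OF cm_fst cm_snd]])
    have ty: "dtm ?X2 ?U2 (\<lambda>p. snd p)" by (rule dtm_var[OF cm_snd])
    have c: "cm ?X2 ?U2 SX (?sc ?ne) (\<lambda>p. fst (fst p))" by (rule cm_comp[OF cm_fst cm_fst])
    have 1: "dfn L M ?X2 ?U2 (\<lambda>p. \<phi>1 (fst (fst p)) (snd (fst p)))" by (rule dfn_rel[OF d\<phi>1 c tx])
    have 2: "dfn L M ?X2 ?U2 (\<lambda>p. \<theta>1 (fst (fst p)) (snd p))"
      by (rule dfn_rel[OF d\<theta>1 cm_comp[OF c cm_mono[OF out_ne order_refl]] ty])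
    have 3: "dfn L M ?X2 ?U2 (\<lambda>p. \<phi> (fst (fst p), snd (fst p) \<otimes> snd p))"
      by (rule dfn_rel[OF d\<phi> c dtm_mult[OF tx ty]])
    show ?thesis unfolding T_def by (intro dfn_allG dfn_imp dfn_conj 1 2 3)
  qed
  have T\<rho>: "T \<rho>" unfolding T_def using imp by blast
  \<comment> \<open>\<open>pt 0 = l\<close>, and the points increase strictly towards
    \<open>u\<close> without reaching it.\<close>
  define pt where "pt j = u - (u - l) / (of_nat j + 1)" for j :: nat
  have pt: "l \<le> pt i" "pt i < u" for i
    using lu by (auto simp: pt_def field_simps intro: mult_right_mono)
  have pt_less: "pt i < pt j" if "i < j" for i j
    using lu that by (simp add: pt_def divide_strict_left_mono)
  have "\<exists>f. strict_mono f \<and> (\<forall>q. q < l \<or> u < q \<longrightarrow> f q = q) \<and>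
      (\<forall>q. l < q \<and> q < u \<longrightarrow> pt j < f q \<and> f q < pt (Suc j))" for j
    by (rule squeeze[OF lu pt(1) pt_less]) (use pt(2)[of "Suc j"] in auto)
  then obtain f where f: "\<And>j. strict_mono (f j)" "\<And>j q. q < l \<or> u < q \<Longrightarrow> f j q = q"
    "\<And>j q. l < q \<Longrightarrow> q < u \<Longrightarrow> pt j < f j q \<and> f j q < pt (Suc j)"
    by metis
  let ?b = "\<lambda>j. \<rho> \<circ> f j" and ?c = "\<lambda>i. fst (\<rho> (pt i))"
  have b: "?b j \<in> SX" for j using \<rho> by (simp add: SX_def seqs_comp)
  have move: "R (\<rho> \<circ> g) = R \<rho>" if "dfn L M SX (?sc I) R" "strict_mono_on I g" for I R g
    using indisc_tdf[OF ind tdf_of_dfn[OF that(1)[unfolded SX_def]] that(2), of "\<lambda>q. q"]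
    by (simp add: strict_mono_on_def comp_def)
  have Tb: "T (?b j)" for j
    using move[OF dT, of "f j"] T\<rho> f(1) by (simp add: strict_mono_on_def strict_mono_def)
  \<comment> \<open>The blocks differ from \<open>\<rho>\<close> only at positions in
    \<open>[l, u]\<close>, which \<open>\<theta>1\<close> does not read; one neighbourhood therefore
    serves all blocks.\<close>
  have \<theta>1b: "\<theta>1 (?b j) y \<longleftrightarrow> \<theta>1 \<rho> y" if y: "y \<in> carrier G" for j y
  proof -
    have "u (?b j, y) = u (\<rho>, y)" if "u \<in> prodc (?sc ?out) gco" for u
      using that f(2) by (auto simp: prodc_def sco_def)
    from dfn_dep[OF d\<theta>1 sG[OF b y] sG[OF \<rho> y] this] show ?thesis by simp
  qed
  have at: "dtm SX (?sc I) (\<lambda>\<sigma>. fst (\<sigma> q))" if "q \<in> I" for q I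
    unfolding SX_def by (rule dtm_var[OF cm_comp[OF cm_at[OF that] cm_fst]])
  have ne_dep: "R (\<sigma>, x) = R (\<sigma>', x)"
    if R: "dfn L M (SX \<times> carrier G) (prodc (?sc ?ne) gco) R" and s: "\<sigma> \<in> SX" "\<sigma>' \<in> SX" "x \<in> carrier G"
      and eq: "\<And>q. q \<noteq> l \<Longrightarrow> q \<noteq> u \<Longrightarrow> \<sigma> q = \<sigma>' q" for R \<sigma> \<sigma>' x
  proof -
    have "u (\<sigma>, x) = u (\<sigma>', x)" if "u \<in> prodc (?sc ?ne) gco" for u
      using that eq by (auto simp: prodc_def sco_def)
    from dfn_dep[OF R sG[OF s(1,3)] sG[OF s(2,3)] this] show ?thesis .
  qed
  have gt: "\<phi>1 (?b j) (?c i)" if ji: "j < i" for i j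
  proof -
    \<comment> \<open>For \<open>j < i\<close> the point \<open>pt i\<close> lies above the inner
      part of block \<open>j\<close>, so it stands to that block as \<open>u\<close> stands to
      \<open>\<rho>\<close>. Position \<open>l\<close> is left out because neither
      \<open>\<phi>1\<close> nor the point at \<open>u\<close> reads it.\<close>
    let ?I = "{q. q \<noteq> l}" and ?g = "(f j)(u := pt i)"
    have "dfn L M SX (?sc ?I) (\<lambda>\<sigma>. \<phi>1 \<sigma> (fst (\<sigma> u)))"
      by (rule dfn_rel[OF d\<phi>1 cm_mono[OF sco_mono order_refl] at]) (use lu in auto)
    moreover have "strict_mono_on ?I ?g"
    proof (rule strict_mono_onI)
      fix q r assume qr: "q \<in> ?I" "r \<in> ?I" "q < r"
      have "pt (Suc j) \<le> pt i" using ji pt_less[of "Suc j" i] by (cases "Suc j = i") auto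
      then have 1: "f j q < pt i" if "q < u" "q \<noteq> l" for q
        using that f(3)[of q j] f(2)[of q j] pt(1)[of i] by (cases "q < l") auto
      have 2: "pt i < f j r" if "u < r" for r using f(2)[of r j] pt(2)[of i] that by auto
      show "?g q < ?g r"
        using qr 1[of q] 2[of r] f(1)[of j] by (auto simp: strict_mono_def)
    qed
    ultimately have "\<phi>1 (\<rho> \<circ> ?g) (fst ((\<rho> \<circ> ?g) u)) = \<phi>1 \<rho> (fst (\<rho> u))" by (rule move)
    moreover have "\<phi>1 \<rho> (fst (\<rho> u))" unfolding \<phi>1_def using Pu P\<rho>[OF cG] F1(1) by auto
    ultimately have "\<phi>1 (\<rho> \<circ> ?g) (?c i)" by simp
    moreover have "\<rho> \<circ> ?g \<in> SX" using \<rho> by (simp add: SX_def seqs_comp)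
    ultimately show ?thesis
      using ne_dep[OF d\<phi>1, of "\<rho> \<circ> ?g" "?b j" "?c i"] b cG by auto
  qed
  have lt: "\<not> \<phi> (?b j, ?c i)" if ij: "i < j" for i j
  proof -
    \<comment> \<open>For \<open>i < j\<close> the point \<open>pt i\<close> lies below the inner
      part of block \<open>j\<close> and plays the role of \<open>l\<close>.\<close>
    let ?I = "{q. q \<noteq> u}" and ?g = "(f j)(l := pt i)"
    have "dfn L M SX (?sc ?I) (\<lambda>\<sigma>. \<phi> (\<sigma>, fst (\<sigma> l)))"
      by (rule dfn_rel[OF d\<phi> cm_mono[OF sco_mono order_refl] at]) (use lu in auto)
    moreover have "strict_mono_on ?I ?g"
    proof (rule strict_mono_onI)
      fix q r assume qr: "q \<in> ?I" "r \<in> ?I" "q < r"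
      have 1: "pt i < f j r" if "l < r" "r \<noteq> u" for r
        using that f(3)[of r j] f(2)[of r j] pt(2)[of i] pt_less[OF ij] by (cases "r < u") auto
      have 2: "f j q < pt i" if "q < l" for q using f(2)[of q j] pt(1)[of i] that by auto
      show "?g q < ?g r"
        using qr 1[of r] 2[of q] f(1)[of j] by (auto simp: strict_mono_def)
    qed
    ultimately have "\<phi> (\<rho> \<circ> ?g, fst ((\<rho> \<circ> ?g) l)) = \<phi> (\<rho>, fst (\<rho> l))" by (rule move)
    then have "\<not> \<phi> (\<rho> \<circ> ?g, ?c i)" using \<phi>(2) by simp
    moreover have "\<rho> \<circ> ?g \<in> SX" using \<rho> by (simp add: SX_def seqs_comp)
    ultimately show ?thesis
      using ne_dep[OF d\<phi>, of "\<rho> \<circ> ?g" "?b j" "?c i"] b cG by auto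
  qed
  let ?t = "{y \<in> carrier G. \<theta>1 \<rho> y}"
  have "unst H"
  proof (rule unst_revI[where S = \<phi>1 and b = ?b and c = ?c and \<theta> = ?t, OF d\<phi>1 _ _ H(1) cG b gt])
    have "dfn L M (carrier G) (co \<Gamma> U) (\<lambda>y. \<theta>1 (fst (\<rho>, y)) (snd (\<rho>, y)))"
    proof (rule dfn_cm[OF d\<theta>1])
      show "cm (carrier G) (co \<Gamma> U) (SX \<times> carrier G) (prodc (?sc ?out) gco) (Pair \<rho>)"
      proof (rule cmI)
        fix v assume v: "v \<in> prodc (?sc ?out) gco"
        have c1: "fst (\<rho> q) i \<in> U" if "i \<in> dom \<Gamma>" for q i
          using tuples_sort[OF subsetD[OF carrier_tuples cG] that] that by (metis domIff)
        have c2: "snd (\<rho> q) w \<in> U" if "w \<in> dom \<Delta>" for q w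
          using tuples_sort[of "snd (\<rho> q)" M \<Delta> w] seqsD[OF \<rho>[unfolded SX_def], of q] that
          by (metis domIff mem_Times_iff)
        consider i where "i \<in> dom \<Gamma>" "v = (\<lambda>p. snd p i)" | w where "w \<in> ?sc ?out" "v = (\<lambda>p. w (fst p))"
          using v unfolding prodc_def co_def by auto
        then show "(\<lambda>y. v (\<rho>, y)) \<in> co \<Gamma> U"
        proof cases
          case 1
          then show ?thesis by (simp add: coI)
        next
          case 2
          have "w \<rho> \<in> U" using 2(1) c1 small(3) unfolding sco_def prodc_def co_def
            by (auto intro: domD[OF c2[OF domI]])
          then show ?thesis using 2(2) by (simp add: coI2)
        qed
      qed (use \<rho> in simp)
    qed
    then show "dfn L M (carrier G) (co \<Gamma> U) (\<lambda>x. x \<in> ?t)"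
      by (rule dfn_cong[THEN iffD1, rotated]) simp
    show "H \<subseteq> ?t"
    proof
      fix x assume x: "x \<in> H"
      then have "x \<in> carrier G" using subgroup.subset[OF H(1)] by auto
      then show "x \<in> ?t" using H\<rho> x F2(1) by (auto simp: \<theta>1_def)
    qed
    \<comment> \<open>With \<open>y = inv x \<otimes> ?c i\<close> the condition \<open>T\<close>
      would turn \<open>\<phi>1 (?b j) x\<close> into \<open>\<phi> (?b j, ?c i)\<close>, against
      \<open>lt\<close>.\<close>
    fix i j :: nat and x assume *: "i < j" "x \<in> carrier G" "\<phi>1 (?b j) x"
    show "inv x \<otimes> ?c i \<notin> ?t"
    proof
      assume t: "inv x \<otimes> ?c i \<in> ?t"
      then have "\<theta>1 (?b j) (inv x \<otimes> ?c i)" using \<theta>1b by simp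
      then have "\<phi> (?b j, x \<otimes> (inv x \<otimes> ?c i))" using Tb[of j] *(2,3) t unfolding T_def by blast
      moreover have "x \<otimes> (inv x \<otimes> ?c i) = ?c i" using *(2) cG by (simp add: m_assoc[symmetric])
      ultimately show False using lt[OF *(1)] by simp
    qed
  qed
  then show False using H(3) by simp
qed

section \<open>Finite intersections of subgroups with stable quotient\<close>

lemma em_blocks:
  assumes "small M (dom \<Delta>)" "small M B" "\<And>n. e n \<in> Xb \<Delta>"
  shows "\<exists>\<rho>. indisc L M (Xb \<Delta>) (Ub \<Delta>) B \<rho> \<and> em_of L M (Xb \<Delta>) (Ub \<Delta>) B e \<rho>"
  by (rule em_exists[OF cpt_seqs[OF assms(1,2)]]) (simp add: seqs_def assms(3))

lemma em_dfn:
  assumes "em_of L M X \<U> B e \<rho>" "dfn L M (seqs X) (sco \<U> {q, r} B) P"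
    "\<And>f. strict_mono_on {q, r} f \<Longrightarrow> P (e \<circ> f)"
  shows "P \<rho>"
  using assms(1)[unfolded em_of_def, rule_format, of "{q, r}" P] assms(2,3) by simp

lemma dtm_at: "q \<in> I \<Longrightarrow> dtm (seqs (Xb \<Delta>)) (sco (Ub \<Delta>) I B) (\<lambda>\<sigma>. fst (\<sigma> q))"
  by (rule dtm_var[OF cm_comp[OF cm_at cm_fst]])

lemma cm_at_snd: "q \<in> I \<Longrightarrow> cm (seqs (Xb \<Delta>)) (sco (Ub \<Delta>) I B) (tuples M \<Delta>) (co \<Delta> {}) (\<lambda>\<sigma>. snd (\<sigma> q))"
  by (rule cm_comp[OF cm_at cm_snd])

lemma params_sco: "A \<subseteq> B \<Longrightarrow> params A \<subseteq> sco \<U> I B"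
  unfolding sco_def by auto

lemma dfn_mono_co: "dfn L M X (co \<Delta> A) P \<Longrightarrow> A \<subseteq> B \<Longrightarrow> dfn L M X (co \<Delta> B) P"
  by (rule dfn_mono[OF _ order_refl co_mono])

text \<open>The tuples of the half-graph are kept while the group elements are replaced by elements
  \<open>z i\<close> of a single coset of \<open>H1\<close>. Inside one coset the \<open>H1\<close>
  part of the neighbourhood is satisfied automatically, so what keeps the elements away from the
  fibres must be the \<open>H2\<close> part.\<close>

lemma unst_Int:
  assumes H1: "subgroup H1 G" "small M A1" "A1 \<subseteq> U" "tdf L M (carrier G) (co \<Gamma> A1) (\<lambda>x. x \<in> H1)"
    and H2: "subgroup H2 G" "small M A2" "A2 \<subseteq> U" "tdf L M (carrier G) (co \<Gamma> A2) (\<lambda>x. x \<in> H2)"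
    and un: "unst (H1 \<inter> H2)" and nH1: "\<not> unst H1"
  shows "unst H2"
proof -
  obtain \<Delta> :: "nat \<Rightarrow> 's option" and S \<theta> c b where
    S: "dfn L M (tuples M \<Delta> \<times> carrier G) (prodc (co \<Delta> {}) gco) (\<lambda>p. S (fst p) (snd p))"
    and \<theta>: "dfn L M (carrier G) (co \<Gamma> U) (\<lambda>x. x \<in> \<theta>)" "H1 \<inter> H2 \<subseteq> \<theta>"
    and c: "\<forall>i :: nat. c i \<in> carrier G" and b: "\<forall>j. b j \<in> tuples M \<Delta>"
    and lt: "\<forall>i j. i < j \<longrightarrow> S (b j) (c i)"
    and gt: "\<forall>i j. j < i \<longrightarrow> \<not> (\<exists>x\<in>carrier G. S (b j) x \<and> inv x \<otimes> c i \<in> \<theta>)"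
    using un unfolding unst_def by (elim exE conjE)
  have sub: "H1 \<subseteq> carrier G" "H2 \<subseteq> carrier G" using H1(1) H2(1) subgroup.subset by auto
  obtain \<P>1 where P1: "\<forall>Q\<in>\<P>1. dfn L M (carrier G) (co \<Gamma> A1) Q" "\<forall>x\<in>carrier G. x \<in> H1 \<longleftrightarrow> (\<forall>Q\<in>\<P>1. Q x)"
    using H1(4) unfolding tdf_def by (elim exE conjE)
  obtain \<P>2 where P2: "\<forall>Q\<in>\<P>2. dfn L M (carrier G) (co \<Gamma> A2) Q" "\<forall>x\<in>carrier G. x \<in> H2 \<longleftrightarrow> (\<forall>Q\<in>\<P>2. Q x)"
    using H2(4) unfolding tdf_def by (elim exE conjE)
  have "\<exists>F. F \<subseteq> \<P>1 \<union> \<P>2 \<and> finite F \<and> (\<forall>x\<in>carrier G. (\<forall>Q\<in>F. Q x) \<longrightarrow> x \<in> \<theta>)"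
  proof (rule cover[OF small_Un[OF H1(2) H2(2)] _ \<theta>(1)])
    show "dfn L M (carrier G) (co \<Gamma> (A1 \<union> A2)) Q" if "Q \<in> \<P>1 \<union> \<P>2" for Q
      using that P1(1) P2(1) dfn_mono_co[of "carrier G" \<Gamma> _ Q "A1 \<union> A2"] by auto
    fix x assume x: "x \<in> carrier G" "\<forall>Q\<in>\<P>1 \<union> \<P>2. Q x"
    have "x \<in> H1"
      by (rule iffD2[OF bspec[OF P1(2) x(1)]], rule ballI, rule bspec[OF x(2)], erule UnI1)
    moreover have "x \<in> H2"
      by (rule iffD2[OF bspec[OF P2(2) x(1)]], rule ballI, rule bspec[OF x(2)], erule UnI2)
    ultimately show "x \<in> \<theta>" using \<theta>(2) by auto
  qed
  then obtain F where F: "F \<subseteq> \<P>1 \<union> \<P>2" "finite F" "\<forall>x\<in>carrier G. (\<forall>Q\<in>F. Q x) \<longrightarrow> x \<in> \<theta>"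
    by (elim exE conjE)
  define \<theta>1 where "\<theta>1 = {x \<in> carrier G. \<forall>Q\<in>F \<inter> \<P>1. Q x}"
  define \<theta>2 where "\<theta>2 = {x \<in> carrier G. \<forall>Q\<in>F \<inter> \<P>2. Q x}"
  have d1: "dfn L M (carrier G) (co \<Gamma> A1) (\<lambda>x. x \<in> \<theta>1)"
  proof -
    have "dfn L M (carrier G) (co \<Gamma> A1) (\<lambda>x. \<forall>Q\<in>F \<inter> \<P>1. Q x)"
      by (rule dfn_ball_finite) (use F(2) P1(1) in auto)
    then show ?thesis by (rule dfn_cong[THEN iffD1, rotated]) (simp add: \<theta>1_def)
  qed
  have d2: "dfn L M (carrier G) (co \<Gamma> A2) (\<lambda>x. x \<in> \<theta>2)"
  proof -
    have "dfn L M (carrier G) (co \<Gamma> A2) (\<lambda>x. \<forall>Q\<in>F \<inter> \<P>2. Q x)"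
      by (rule dfn_ball_finite) (use F(2) P2(1) in auto)
    then show ?thesis by (rule dfn_cong[THEN iffD1, rotated]) (simp add: \<theta>2_def)
  qed
  have Hth: "H1 \<subseteq> \<theta>1" "H2 \<subseteq> \<theta>2"
  proof -
    have "\<forall>Q\<in>\<P>1. Q x" if "x \<in> H1" for x by (rule iffD1[OF bspec[OF P1(2)]]) (use that sub in auto)
    moreover have "\<forall>Q\<in>\<P>2. Q x" if "x \<in> H2" for x by (rule iffD1[OF bspec[OF P2(2)]]) (use that sub in auto)
    ultimately show "H1 \<subseteq> \<theta>1" "H2 \<subseteq> \<theta>2" using sub unfolding \<theta>1_def \<theta>2_def by auto
  qed
  have th12: "x \<in> \<theta>" if x: "x \<in> \<theta>1" "x \<in> \<theta>2" for x
  proof -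
    have "Q x" if "Q \<in> F" for Q
    proof -
      have "Q \<in> F \<inter> \<P>1 \<or> Q \<in> F \<inter> \<P>2" using that F(1) by auto
      moreover have "\<forall>Q\<in>F \<inter> \<P>1. Q x" using x(1) unfolding \<theta>1_def mem_Collect_eq by (elim conjE)
      moreover have "\<forall>Q\<in>F \<inter> \<P>2. Q x" using x(2) unfolding \<theta>2_def mem_Collect_eq by (elim conjE)
      ultimately show ?thesis
        using bspec[of "F \<inter> \<P>1" "\<lambda>Q. Q x" Q] bspec[of "F \<inter> \<P>2" "\<lambda>Q. Q x" Q] by (elim disjE)
    qed
    then have "\<forall>Q\<in>F. Q x" by (rule ballI)
    then show ?thesis using bspec[OF F(3), of x] x(1) by (simp add: \<theta>1_def)
  qed
  obtain \<theta>' where th': "dfn L M (carrier G) (co \<Gamma> A1) (\<lambda>x. x \<in> \<theta>')" "H1 \<subseteq> \<theta>'"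
    "\<forall>x\<in>\<theta>'. \<forall>y\<in>\<theta>'. inv x \<otimes> y \<in> \<theta>1"
    using half[OF H1(2,1,4) dfn_mono_co[OF d1 H1(3)] Hth(1)] by (elim exE conjE)
  define B where "B = A1 \<union> A2"
  have B: "small M B" "B \<subseteq> U" "A1 \<subseteq> B" "A2 \<subseteq> B" using H1 H2 small_Un by (auto simp: B_def)
  have sd: "small M (dom \<Delta>)" by (rule small_countable) simp
  obtain \<rho> where ind: "indisc L M (Xb \<Delta>) (Ub \<Delta>) B \<rho>"
    and em: "em_of L M (Xb \<Delta>) (Ub \<Delta>) B (\<lambda>i. (c i, b i)) \<rho>"
    using em_blocks[OF sd B(1), of "\<lambda>i. (c i, b i)"] c b by auto
  define SX :: "(rat \<Rightarrow> ('i \<Rightarrow> 'a) \<times> (nat \<Rightarrow> 'a)) set" where "SX = seqs (Xb \<Delta>)"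
  have \<rho>: "\<rho> \<in> SX" using ind by (simp add: indisc_def SX_def)
  have cG: "fst (\<rho> q) \<in> carrier G" for q using \<rho> by (auto simp: SX_def seqs_def mem_Times_iff)
  have bT: "snd (\<rho> q) \<in> tuples M \<Delta>" for q using \<rho> by (auto simp: SX_def seqs_def mem_Times_iff)
  have lt': "S (snd (\<rho> r)) (fst (\<rho> q))" if "q < r" for q r
  proof (rule em_dfn[OF em, of q r])
    show "dfn L M (seqs (Xb \<Delta>)) (sco (Ub \<Delta>) {q, r} B) (\<lambda>\<sigma>. S (snd (\<sigma> r)) (fst (\<sigma> q)))"
      by (rule dfn_rel[OF S cm_at_snd dtm_at]) auto
    fix f :: "rat \<Rightarrow> nat" assume "strict_mono_on {q, r} f"
    then have "f q < f r" using that by (simp add: strict_mono_onD)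
    then show "S (snd (((\<lambda>i. (c i, b i)) \<circ> f) r)) (fst (((\<lambda>i. (c i, b i)) \<circ> f) q))" using lt by simp
  qed
  define bad where "bad y z \<longleftrightarrow> (\<exists>x\<in>carrier G. S y x \<and> (inv x \<otimes> z \<in> \<theta>1 \<and> inv x \<otimes> z \<in> \<theta>2))" for y z
  have dbad: "dfn L M X \<U> (\<lambda>z. bad (s z) (t z))"
    if s: "cm X \<U> (tuples M \<Delta>) (co \<Delta> {}) s" and t: "dtm X \<U> t" and par: "params B \<subseteq> \<U>" for X \<U> s t
  proof -
    let ?X = "X \<times> carrier G" and ?U = "prodc \<U> gco"
    have "dfn L M ?X ?U (\<lambda>p. S (s (fst p)) (snd p))"
      by (rule dfn_rel[OF S cm_comp[OF cm_fst s] dtm_var[OF cm_snd]])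
    moreover have tt: "dtm ?X ?U (\<lambda>p. inv (snd p) \<otimes> t (fst p))"
      by (intro dtm_mult dtm_inv dtm_var[OF cm_snd] dtm_cm[OF t cm_fst])
    moreover have "params A1 \<subseteq> ?U" "params A2 \<subseteq> ?U"
      by (rule params_prodc, use par B(3,4) in blast)+
    ultimately show ?thesis unfolding bad_def
      by (intro dfn_exG dfn_conj dfn_in_definable[OF d1 tt] dfn_in_definable[OF d2 tt])
  qed
  have gt': "\<not> bad (snd (\<rho> r)) (fst (\<rho> q))" if "r < q" for q r
  proof (rule em_dfn[OF em, of q r])
    show "dfn L M (seqs (Xb \<Delta>)) (sco (Ub \<Delta>) {q, r} B) (\<lambda>\<sigma>. \<not> bad (snd (\<sigma> r)) (fst (\<sigma> q)))"
      by (intro dfn_not dbad cm_at_snd dtm_at params_sco) auto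
    fix f :: "rat \<Rightarrow> nat" assume "strict_mono_on {q, r} f"
    then have "f r < f q" using that by (simp add: strict_mono_onD)
    then show "\<not> bad (snd (((\<lambda>i. (c i, b i)) \<circ> f) r)) (fst (((\<lambda>i. (c i, b i)) \<circ> f) q))"
      using gt th12 unfolding bad_def by auto
  qed
  \<comment> \<open>\<open>Pk k\<close> asks the coset of \<open>x\<close> modulo \<open>H1\<close>
    for an element that cuts the half-graph at \<open>k\<close>: inside the fibres at all later
    positions, away from those at the earlier ones. It reads neither position \<open>0\<close> nor
    \<open>k\<close>, is right invariant under \<open>H1\<close>, and holds at
    \<open>fst (\<rho> (of_nat k))\<close> with that element as its own witness; so
    \<open>moving\<close> applies.\<close>
  define Pk where "Pk k \<sigma> x \<longleftrightarrow> (\<exists>z\<in>carrier G. (inv x \<otimes> z \<in> H1 \<and>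
      (\<forall>j\<in>{j. k < j}. S (snd (\<sigma> (of_nat j))) z)) \<and>
      (\<forall>j\<in>{j. 1 \<le> j \<and> j < k}. \<not> bad (snd (\<sigma> (of_nat j))) z))"
    for k :: nat and \<sigma> :: "rat \<Rightarrow> ('i \<Rightarrow> 'a) \<times> (nat \<Rightarrow> 'a)" and x
  have Pk0: "Pk k \<rho> (fst (\<rho> 0))" if k: "1 \<le> k" for k
  proof (rule moving[OF sd B(1,2) ind, where u = "of_nat k" and HP = "\<lambda>\<sigma> x. x \<in> H1" and H = H1])
    let ?U = "sco (Ub \<Delta>) {q :: rat. q \<noteq> 0 \<and> q \<noteq> of_nat k} B"
    let ?X2 = "(SX \<times> carrier G) \<times> carrier G" and ?U2 = "prodc (prodc ?U gco) gco"
    show "0 < (of_nat k :: rat)" using k by simp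
    show "tdf L M (seqs (Xb \<Delta>) \<times> carrier G) (prodc (sco (Ub \<Delta>) {q. q < 0 \<or> of_nat k < q} B) gco) (\<lambda>p. snd p \<in> H1)"
      by (intro tdf_in[OF H1(4)] dtm_var[OF cm_snd] params_prodc params_sco B(3))
    have parU: "params B \<subseteq> ?U2" by (intro params_prodc params_sco order_refl)
    have parA: "params A1 \<subseteq> ?U2" by (intro params_prodc params_sco B(3))
    have cj: "cm ?X2 ?U2 (tuples M \<Delta>) (co \<Delta> {}) (\<lambda>p. snd (fst (fst p) (of_nat j)))" if "j \<noteq> 0" "j \<noteq> k" for j
      unfolding SX_def by (rule cm_comp[OF cm_comp[OF cm_fst cm_fst] cm_at_snd]) (use that in simp)
    have tz: "dtm ?X2 ?U2 (\<lambda>p. snd p)" by (rule dtm_var[OF cm_snd])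
    have tx: "dtm ?X2 ?U2 (\<lambda>p. snd (fst p))" by (rule dtm_var[OF cm_comp[OF cm_fst cm_snd]])
    have 1: "tdf L M ?X2 ?U2 (\<lambda>p. inv (snd (fst p)) \<otimes> snd p \<in> H1)"
      by (rule tdf_in[OF H1(4) _ parA]) (intro dtm_mult dtm_inv tx tz)
    have 2: "tdf L M ?X2 ?U2 (\<lambda>p. \<forall>j\<in>{j. k < j}. S (snd (fst (fst p) (of_nat j))) (snd p))"
      by (intro tdf_all tdf_of_dfn dfn_rel[OF S cj tz]) auto
    have 3: "tdf L M ?X2 ?U2 (\<lambda>p. \<forall>j\<in>{j. 1 \<le> j \<and> j < k}. \<not> bad (snd (fst (fst p) (of_nat j))) (snd p))"
      by (intro tdf_all tdf_of_dfn dfn_not dbad[OF cj tz parU]) auto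
    have "small M (prodc ?U gco)" by (intro small_prodc small_sco small_gco sd B(1)) simp_all
    then have "tdf L M (SX \<times> carrier G) (prodc ?U gco) (\<lambda>p. Pk k (fst p) (snd p))"
      unfolding Pk_def by (intro tdf_exG tdf_conj 1 2 3)
    then show "tdf L M (seqs (Xb \<Delta>) \<times> carrier G) (prodc ?U gco) (\<lambda>p. Pk k (fst p) (snd p))"
      by (simp add: SX_def)
    show "Pk k \<rho> (x \<otimes> h)" if x: "x \<in> carrier G" and h: "h \<in> H1" and P: "Pk k \<rho> x" for x h
    proof -
      obtain z where z: "z \<in> carrier G" "inv x \<otimes> z \<in> H1" "\<forall>j\<in>{j. k < j}. S (snd (\<rho> (of_nat j))) z"
        "\<forall>j\<in>{j. 1 \<le> j \<and> j < k}. \<not> bad (snd (\<rho> (of_nat j))) z"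
        using P unfolding Pk_def by (elim bexE conjE)
      have "inv (x \<otimes> h) \<otimes> z = inv h \<otimes> (inv x \<otimes> z)"
        using x h z(1) sub by (simp add: inv_mult_group m_assoc subsetD)
      then have "inv (x \<otimes> h) \<otimes> z \<in> H1"
        using z(2) h H1(1) subgroup.m_closed subgroup.m_inv_closed by metis
      then show ?thesis unfolding Pk_def using z by (intro bexI[of _ z] conjI)
    qed
    show "Pk k \<rho> (fst (\<rho> (of_nat k)))"
      unfolding Pk_def
      by (rule bexI[of _ "fst (\<rho> (of_nat k))"])
        (use cG subgroup.one_closed[OF H1(1)] lt' gt' in simp_all)
  qed (use H1(1) nH1 in simp_all)
  \<comment> \<open>The cuts start at \<open>1\<close> because position \<open>0\<close> is the
    target of the move; the same shift by one reappears in the choice of \<open>b\<close>.\<close>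
  have "\<forall>k. \<exists>z. z \<in> carrier G \<and> inv (fst (\<rho> 0)) \<otimes> z \<in> H1 \<and>
      (\<forall>j. Suc k < j \<longrightarrow> S (snd (\<rho> (of_nat j))) z) \<and>
      (\<forall>j. 1 \<le> j \<and> j < Suc k \<longrightarrow> \<not> bad (snd (\<rho> (of_nat j))) z)"
  proof
    fix k
    obtain z where "z \<in> carrier G" "inv (fst (\<rho> 0)) \<otimes> z \<in> H1" "\<forall>j\<in>{j. Suc k < j}. S (snd (\<rho> (of_nat j))) z"
      "\<forall>j\<in>{j. 1 \<le> j \<and> j < Suc k}. \<not> bad (snd (\<rho> (of_nat j))) z"
      using Pk0[of "Suc k", unfolded Pk_def, OF le_add1[of 1 k, unfolded plus_1_eq_Suc]] by (elim bexE conjE)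
    then show "\<exists>z. z \<in> carrier G \<and> inv (fst (\<rho> 0)) \<otimes> z \<in> H1 \<and>
      (\<forall>j. Suc k < j \<longrightarrow> S (snd (\<rho> (of_nat j))) z) \<and>
      (\<forall>j. 1 \<le> j \<and> j < Suc k \<longrightarrow> \<not> bad (snd (\<rho> (of_nat j))) z)"
      by (intro exI[of _ z]) simp
  qed
  then obtain z where z: "\<And>k. z k \<in> carrier G" "\<And>k. inv (fst (\<rho> 0)) \<otimes> z k \<in> H1"
    "\<And>k j. Suc k < j \<Longrightarrow> S (snd (\<rho> (of_nat j))) (z k)"
    "\<And>k j. 1 \<le> j \<Longrightarrow> j < Suc k \<Longrightarrow> \<not> bad (snd (\<rho> (of_nat j))) (z k)"
    by metis
  \<comment> \<open>The fibres are cut down to the translate of \<open>\<theta>'\<close> by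
    \<open>fst (\<rho> 0)\<close>. Any two elements there differ by an element of
    \<open>\<theta>1\<close>, so a failure of \<open>bad\<close> has to come from
    \<open>\<theta>2\<close>.\<close>
  define S' where "S' y x \<longleftrightarrow> S y x \<and> inv (fst (\<rho> 0)) \<otimes> x \<in> \<theta>'" for y x
  have cU: "fst (\<rho> 0) i \<in> U" if "i \<in> dom \<Gamma>" for i
    using tuples_sort[OF subsetD[OF carrier_tuples cG] that, of 0] that by (metis domIff)
  show "unst H2"
  proof (rule unstI[where S = S' and \<theta> = \<theta>2 and c = z and b = "\<lambda>j. snd (\<rho> (of_nat (Suc j)))" and \<V> = "co \<Delta> U"
        and Y = "tuples M \<Delta>", OF _ dfn_mono_co[OF d2 H2(3)] Hth(2) z(1)])
    let ?X = "tuples M \<Delta> \<times> carrier G" and ?U = "prodc (co \<Delta> U) gco"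
    have "cm ?X ?U (tuples M \<Delta>) (co \<Delta> {}) fst"
      by (rule cm_comp[OF cm_fst cm_mono]) (auto simp: co_def)
    then have "dfn L M ?X ?U (\<lambda>p. S (fst p) (snd p))" by (rule dfn_rel[OF S _ dtm_var[OF cm_snd]])
    moreover have "dfn L M ?X ?U (\<lambda>p. inv (fst (\<rho> 0)) \<otimes> snd p \<in> \<theta>')"
    proof (rule dfn_in_definable[OF th'(1)])
      have "(\<lambda>z. fst (\<rho> 0) i) \<in> ?U" if "i \<in> dom \<Gamma>" for i
        using prodcI1[OF coI2[OF cU[OF that]]] .
      then show "dtm ?X ?U (\<lambda>p. inv (fst (\<rho> 0)) \<otimes> snd p)"
        by (intro dtm_mult dtm_inv dtm_const dtm_var[OF cm_snd] cG)
      show "params A1 \<subseteq> ?U" by (rule params_prodc) (use H1(3) in \<open>auto intro: coI2\<close>)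
    qed
    ultimately show "dfn L M ?X ?U (\<lambda>p. S' (fst p) (snd p))"
      unfolding S'_def by (rule dfn_conj)
    show "snd (\<rho> (of_nat (Suc j))) \<in> tuples M \<Delta>" for j by (rule bT)
    show "S' (snd (\<rho> (of_nat (Suc j)))) (z i)" if "i < j" for i j
      unfolding S'_def using z(2)[of i] z(3)[of i "Suc j"] that th'(2) by auto
    fix i j x assume *: "j < i" "x \<in> carrier G" "S' (snd (\<rho> (of_nat (Suc j)))) x"
    show "inv x \<otimes> z i \<notin> \<theta>2"
    proof
      assume "inv x \<otimes> z i \<in> \<theta>2"
      moreover have "inv x \<otimes> z i \<in> \<theta>1"
      proof -
        have "fst (\<rho> 0) \<otimes> (inv (fst (\<rho> 0)) \<otimes> z i) = z i"
          using z(1) cG by (simp add: m_assoc[symmetric])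
        then have "inv (inv (fst (\<rho> 0)) \<otimes> x) \<otimes> (inv (fst (\<rho> 0)) \<otimes> z i) = inv x \<otimes> z i"
          using *(2) z(1) cG by (simp add: inv_mult_group m_assoc)
        moreover have "inv (fst (\<rho> 0)) \<otimes> x \<in> \<theta>'" using *(3) by (simp add: S'_def)
        moreover have "inv (fst (\<rho> 0)) \<otimes> z i \<in> \<theta>'" using z(2) th'(2) by (rule subsetD[rotated])
        ultimately show ?thesis using th'(3) by metis
      qed
      ultimately have "bad (snd (\<rho> (of_nat (Suc j)))) (z i)"
        unfolding bad_def using *(2,3) by (intro bexI[of _ x]) (simp_all add: S'_def)
      then show False using z(4)[of "Suc j" i] *(1) by simp
    qed
  qed
qed

end

section \<open>Uniform families of subgroups\<close>

text \<open>The finite set found consists of indices and not of predicates: indices taken from a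
  family of formulas can then be read at other parameter tuples as well.\<close>

lemma cpt_imp_family:
  assumes cpt: "cpt L M X \<U>" and Q: "\<And>i. i \<in> I \<Longrightarrow> dfn L M X \<U> (Q i)" and R: "dfn L M X \<U> R"
    and imp: "\<And>z. z \<in> X \<Longrightarrow> (\<And>i. i \<in> I \<Longrightarrow> Q i z) \<Longrightarrow> R z"
  shows "\<exists>K. K \<subseteq> I \<and> finite K \<and> (\<forall>z\<in>X. (\<forall>i\<in>K. Q i z) \<longrightarrow> R z)"
proof -
  have "\<exists>F. F \<subseteq> Q ` I \<and> finite F \<and> (\<forall>z\<in>X. (\<forall>P\<in>F. P z) \<longrightarrow> R z)"
  proof (rule cpt_imp[OF cpt _ R])
    show "dfn L M X \<U> P" if "P \<in> Q ` I" for P using that Q by (elim imageE) simp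
    show "R z" if "z \<in> X" "\<And>P. P \<in> Q ` I \<Longrightarrow> P z" for z
      by (rule imp[OF that(1)]) (rule that(2)[OF imageI])
  qed
  then obtain F where F: "F \<subseteq> Q ` I" "finite F" "\<forall>z\<in>X. (\<forall>P\<in>F. P z) \<longrightarrow> R z"
    by (elim exE conjE)
  obtain K where K: "K \<subseteq> I" "finite K" "F = Q ` K"
    using finite_subset_image[OF F(2,1)] by (elim exE conjE) (rule that)
  show ?thesis using K F(3) by (intro exI[of _ K]) simp
qed

context defgrp
begin

text \<open>\<open>\<Sigma>\<close> stays fixed while the parameter tuple varies: the images of the
  subgroup under automorphisms are the sets \<open>HH \<Sigma> a'\<close> for \<open>a'\<close> with
  the type of \<open>a\<close>, and \<open>eqt\<close> takes the place of conjugacy.\<close>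

definition HH :: "(('w \<Rightarrow> 'a) \<Rightarrow> ('i \<Rightarrow> 'a) \<Rightarrow> bool) set \<Rightarrow> ('w \<Rightarrow> 'a) \<Rightarrow> ('i \<Rightarrow> 'a) set" where
  "HH \<Sigma> a = {x \<in> carrier G. \<forall>\<sigma>\<in>\<Sigma>. \<sigma> a x}"

definition fam :: "('w \<Rightarrow> 's option) \<Rightarrow> (('w \<Rightarrow> 'a) \<Rightarrow> ('i \<Rightarrow> 'a) \<Rightarrow> bool) set \<Rightarrow> bool" where
  "fam \<Delta> \<Sigma> \<longleftrightarrow> (\<forall>\<sigma>\<in>\<Sigma>. dfn L M (tuples M \<Delta> \<times> carrier G) (prodc (co \<Delta> {}) gco) (\<lambda>p. \<sigma> (fst p) (snd p)))"

lemma famD: "fam \<Delta> \<Sigma> \<Longrightarrow> \<sigma> \<in> \<Sigma> \<Longrightarrow> dfn L M (tuples M \<Delta> \<times> carrier G) (prodc (co \<Delta> {}) gco) (\<lambda>p. \<sigma> (fst p) (snd p))"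
  by (simp add: fam_def)

lemma HH_D: "x \<in> HH \<Sigma> a \<Longrightarrow> \<sigma> \<in> \<Sigma> \<Longrightarrow> \<sigma> a x"
  unfolding HH_def by blast

lemma HH_carrier: "x \<in> HH \<Sigma> a \<Longrightarrow> x \<in> carrier G"
  unfolding HH_def by blast

lemma HH_I: "x \<in> carrier G \<Longrightarrow> (\<And>\<sigma>. \<sigma> \<in> \<Sigma> \<Longrightarrow> \<sigma> a x) \<Longrightarrow> x \<in> HH \<Sigma> a"
  unfolding HH_def by blast

lemma tdf_HH:
  assumes "fam \<Delta> \<Sigma>" "cm X \<U> (tuples M \<Delta>) (co \<Delta> {}) s" "dtm X \<U> t"
  shows "tdf L M X \<U> (\<lambda>z. t z \<in> HH \<Sigma> (s z))"
proof -
  have "tdf L M X \<U> (\<lambda>z. \<forall>\<sigma>\<in>\<Sigma>. \<sigma> (s z) (t z))"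
    by (rule tdf_all, rule tdf_of_dfn, rule dfn_rel[OF famD[OF assms(1)] assms(2,3)])
  then show ?thesis
    by (rule tdf_cong[THEN iffD1, rotated]) (simp add: HH_def dtm_closed[OF assms(3)])
qed

lemma cm_fix: "a \<in> tuples M \<Delta> \<Longrightarrow> cm (carrier G) (co \<Gamma> (a ` dom \<Delta>)) (tuples M \<Delta>) (co \<Delta> {}) (\<lambda>x. a)"
  by (rule cm_const) (auto intro: coI2)

lemma dtm_co: "dtm (carrier G) (co \<Gamma> A) (\<lambda>x. x)"
  by (rule dtm_var[OF cm_mono[OF _ order_refl]]) (simp add: co_mono)

lemma tdf_HH_fix: "fam \<Delta> \<Sigma> \<Longrightarrow> a \<in> tuples M \<Delta> \<Longrightarrow> tdf L M (carrier G) (co \<Gamma> (a ` dom \<Delta>)) (\<lambda>x. x \<in> HH \<Sigma> a)"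
  by (rule tdf_HH[OF _ cm_fix dtm_co])

lemma tuples_U: "a \<in> tuples M \<Delta> \<Longrightarrow> a ` dom \<Delta> \<subseteq> U"
proof
  fix b assume a: "a \<in> tuples M \<Delta>" and "b \<in> a ` dom \<Delta>"
  then obtain w where "w \<in> dom \<Delta>" "b = a w" by blast
  then show "b \<in> U" using tuples_sort[OF a] by (metis domIff)
qed

definition eqt :: "('w \<Rightarrow> 's option) \<Rightarrow> ('w \<Rightarrow> 'a) \<Rightarrow> ('w \<Rightarrow> 'a) \<Rightarrow> bool" where
  "eqt \<Delta> a a' \<longleftrightarrow> a \<in> tuples M \<Delta> \<and> a' \<in> tuples M \<Delta> \<and> (\<forall>P. dfn L M (tuples M \<Delta>) (co \<Delta> {}) P \<longrightarrow> P a = P a')"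

lemma eqt_tdf:
  assumes "eqt \<Delta> a a'" "tdf L M (tuples M \<Delta>) (co \<Delta> {}) P"
  shows "P a = P a'"
proof -
  obtain \<P> where \<P>: "\<forall>Q\<in>\<P>. dfn L M (tuples M \<Delta>) (co \<Delta> {}) Q" "\<forall>z\<in>tuples M \<Delta>. P z \<longleftrightarrow> (\<forall>Q\<in>\<P>. Q z)"
    using assms(2) unfolding tdf_def by (elim exE conjE)
  have "(\<forall>Q\<in>\<P>. Q a) = (\<forall>Q\<in>\<P>. Q a')"
    by (rule ball_cong[OF refl]) (use assms(1) \<P>(1) in \<open>simp add: eqt_def\<close>)
  then show ?thesis using \<P>(2) assms(1) by (simp add: eqt_def)
qed

text \<open>For each \<open>\<sigma>\<close>, the existence of two members \<open>x\<close>,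
  \<open>y\<close> for which \<open>\<sigma>\<close> fails at \<open>x \<otimes> inv y\<close> is
  type-definable in the parameter tuple, so it is refuted at \<open>a'\<close> because it is refuted
  at \<open>a\<close>.\<close>

lemma subgroup_transfer:
  assumes fam: "fam \<Delta> \<Sigma>" and sm: "small M (dom \<Delta>)" and eq: "eqt \<Delta> a a'" and H: "subgroup (HH \<Sigma> a) G"
  shows "subgroup (HH \<Sigma> a') G"
proof -
  let ?T = "tuples M \<Delta>" and ?U = "co \<Delta> {}"
  have "tdf L M ?T ?U (\<lambda>a. \<one> \<in> HH \<Sigma> a)" by (rule tdf_HH[OF fam cm_id dtm_one])
  from eqt_tdf[OF eq this] have one: "\<one> \<in> HH \<Sigma> a'" using subgroup.one_closed[OF H] by simp
  have step: "x \<otimes> inv y \<in> HH \<Sigma> a'" if xy: "x \<in> HH \<Sigma> a'" "y \<in> HH \<Sigma> a'" for x y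
  proof (rule HH_I)
    show "x \<otimes> inv y \<in> carrier G" using HH_carrier[OF xy(1)] HH_carrier[OF xy(2)] by simp
    fix \<sigma> assume \<sigma>: "\<sigma> \<in> \<Sigma>"
    define P where "P a \<longleftrightarrow> (\<exists>x\<in>carrier G. \<exists>y\<in>carrier G. x \<in> HH \<Sigma> a \<and> y \<in> HH \<Sigma> a \<and> \<not> \<sigma> a (x \<otimes> inv y))" for a
    have "tdf L M ?T ?U P"
      unfolding P_def
    proof (rule tdf_exG[OF small_co[OF sm]], simp add: small_finite, rule tdf_exG)
      let ?X2 = "(?T \<times> carrier G) \<times> carrier G" and ?U2 = "prodc (prodc ?U gco) gco"
      show "small M (prodc ?U gco)" by (intro small_prodc small_co sm small_gco small_finite) simp
      have c: "cm ?X2 ?U2 ?T ?U (\<lambda>p. fst (fst p))" by (rule cm_comp[OF cm_fst cm_fst])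
      have x: "dtm ?X2 ?U2 (\<lambda>p. snd (fst p))" by (rule dtm_var[OF cm_comp[OF cm_fst cm_snd]])
      have y: "dtm ?X2 ?U2 (\<lambda>p. snd p)" by (rule dtm_var[OF cm_snd])
      show "tdf L M ?X2 ?U2 (\<lambda>p. snd (fst p) \<in> HH \<Sigma> (fst (fst p)) \<and> snd p \<in> HH \<Sigma> (fst (fst p)) \<and>
          \<not> \<sigma> (fst (fst p)) (snd (fst p) \<otimes> inv (snd p)))"
        by (intro tdf_conj tdf_HH[OF fam c x] tdf_HH[OF fam c y] tdf_of_dfn dfn_not
            dfn_rel[OF famD[OF fam \<sigma>] c dtm_mult[OF x dtm_inv[OF y]]])
    qed
    from eqt_tdf[OF eq this] have e: "P a = P a'" .
    have "\<not> P a"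
      unfolding P_def using subgroup.m_closed[OF H _ subgroup.m_inv_closed[OF H]] HH_D[OF _ \<sigma>] by blast
    then have "\<not> P a'" using e by simp
    then show "\<sigma> a' (x \<otimes> inv y)" unfolding P_def using xy HH_carrier by blast
  qed
  have inv: "inv y \<in> HH \<Sigma> a'" if y: "y \<in> HH \<Sigma> a'" for y
    using step[OF one y] HH_carrier[OF y] by simp
  show ?thesis
  proof (rule subgroupI)
    show "x \<otimes> y \<in> HH \<Sigma> a'" if "x \<in> HH \<Sigma> a'" "y \<in> HH \<Sigma> a'" for x y
      using step[OF that(1) inv[OF that(2)]] HH_carrier[OF that(2)] by simp
  qed (use one inv in \<open>auto simp: HH_def\<close>)
qed

text \<open>\<open>\<theta>\<close> may involve foreign parameters. By compactness a finite part
  \<open>\<tau>\<close> of the family at \<open>a'\<close> lies inside it and separates just as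
  well; the existence of the whole half-graph for \<open>\<tau>\<close> is then a type-definable
  condition on the parameter tuple alone.\<close>

lemma unst_transfer:
  assumes fam: "fam \<Delta> \<Sigma>" and sm: "small M (dom \<Delta>)" and eq: "eqt \<Delta> a a'" and un: "unst (HH \<Sigma> a')"
  shows "unst (HH \<Sigma> a)"
proof -
  have a': "a' \<in> tuples M \<Delta>" and a: "a \<in> tuples M \<Delta>" using eq by (simp_all add: eqt_def)
  obtain D :: "nat \<Rightarrow> 's option" and S \<theta> c b where
    S: "dfn L M (tuples M D \<times> carrier G) (prodc (co D {}) gco) (\<lambda>p. S (fst p) (snd p))"
    and \<theta>: "dfn L M (carrier G) (co \<Gamma> U) (\<lambda>x. x \<in> \<theta>)" "HH \<Sigma> a' \<subseteq> \<theta>"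
    and c: "\<forall>i :: nat. c i \<in> carrier G" and b: "\<forall>j. b j \<in> tuples M D"
    and lt: "\<forall>i j. i < j \<longrightarrow> S (b j) (c i)"
    and gt: "\<forall>i j. j < i \<longrightarrow> \<not> (\<exists>x\<in>carrier G. S (b j) x \<and> inv x \<otimes> c i \<in> \<theta>)"
    using un unfolding unst_def by (elim exE conjE)
  have dfix: "dfn L M (carrier G) (co \<Gamma> (a ` dom \<Delta>)) (\<sigma> a)" if "\<sigma> \<in> \<Sigma>" "a \<in> tuples M \<Delta>" for \<sigma> a
    using dfn_rel[OF famD[OF fam that(1)] cm_fix[OF that(2)] dtm_co] .
  obtain A' where A': "finite A'" "A' \<subseteq> U" "dfn L M (carrier G) (co \<Gamma> A') (\<lambda>x. x \<in> \<theta>)"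
    using dfn_co_finite[OF \<theta>(1)] by (elim exE conjE)
  have "small M (a' ` dom \<Delta> \<union> A')" by (intro small_Un small_image sm small_finite A'(1))
  from cpt_carrier[OF this] have "\<exists>K. K \<subseteq> \<Sigma> \<and> finite K \<and> (\<forall>x\<in>carrier G. (\<forall>\<sigma>\<in>K. \<sigma> a' x) \<longrightarrow> x \<in> \<theta>)"
  proof (rule cpt_imp_family)
    show "dfn L M (carrier G) (co \<Gamma> (a' ` dom \<Delta> \<union> A')) (\<sigma> a')" if "\<sigma> \<in> \<Sigma>" for \<sigma>
      by (rule dfn_mono_co[OF dfix[OF that a']]) simp
    show "dfn L M (carrier G) (co \<Gamma> (a' ` dom \<Delta> \<union> A')) (\<lambda>x. x \<in> \<theta>)"
      by (rule dfn_mono_co[OF A'(3)]) simp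
    show "x \<in> \<theta>" if "x \<in> carrier G" "\<And>\<sigma>. \<sigma> \<in> \<Sigma> \<Longrightarrow> \<sigma> a' x" for x
    proof -
      have "x \<in> HH \<Sigma> a'" by (rule HH_I[OF that(1)]) (rule that(2))
      then show ?thesis using \<theta>(2) by auto
    qed
  qed
  then obtain K where K: "K \<subseteq> \<Sigma>" "finite K" "\<forall>x\<in>carrier G. (\<forall>\<sigma>\<in>K. \<sigma> a' x) \<longrightarrow> x \<in> \<theta>"
    by (elim exE conjE)
  define \<tau> where "\<tau> a x \<longleftrightarrow> (\<forall>\<sigma>\<in>K. \<sigma> a x)" for a x
  have d\<tau>: "dfn L M (tuples M \<Delta> \<times> carrier G) (prodc (co \<Delta> {}) gco) (\<lambda>p. \<tau> (fst p) (snd p))"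
    unfolding \<tau>_def by (rule dfn_ball_finite[OF K(2)], rule famD[OF fam]) (use K(1) in auto)
  have \<tau>\<theta>: "x \<in> \<theta>" if "x \<in> carrier G" "\<tau> a' x" for x
    using bspec[OF K(3) that(1)] that(2) by (simp add: \<tau>_def)
  let ?SX = "seqs (Xb D) :: (nat \<Rightarrow> ('i \<Rightarrow> 'a) \<times> (nat \<Rightarrow> 'a)) set"
  define Z where "Z a \<rho> \<longleftrightarrow> (\<forall>p\<in>{p. fst p < snd p}. S (snd (\<rho> (snd p))) (fst (\<rho> (fst p)))) \<and>
     (\<forall>p\<in>{p. fst p < snd p}. \<not> (\<exists>x\<in>carrier G. S (snd (\<rho> (fst p))) x \<and> \<tau> a (inv x \<otimes> fst (\<rho> (snd p)))))"
    for a and \<rho> :: "nat \<Rightarrow> ('i \<Rightarrow> 'a) \<times> (nat \<Rightarrow> 'a)"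
  have "tdf L M (tuples M \<Delta>) (co \<Delta> {}) (\<lambda>a. \<exists>\<rho>\<in>?SX. Z a \<rho>)"
  proof (rule tdf_ex_seqs)
    show "small M (dom D)" by (rule small_countable) simp
    show "small M (co \<Delta> {})" by (intro small_co sm small_finite) simp
    let ?X = "tuples M \<Delta> \<times> ?SX" and ?U = "prodc (co \<Delta> {}) (sco (Ub D) UNIV {})"
    let ?X2 = "?X \<times> carrier G" and ?U2 = "prodc ?U gco"
    have ca: "cm ?X2 ?U2 (tuples M \<Delta>) (co \<Delta> {}) (\<lambda>p. fst (fst p))" by (rule cm_comp[OF cm_fst cm_fst])
    have cb: "cm ?X ?U (tuples M D) (co D {}) (\<lambda>p. snd (snd p j))" for j
      by (rule cm_comp[OF cm_snd cm_at_snd]) simp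
    have cc: "dtm ?X ?U (\<lambda>p. fst (snd p i))" for i
      by (rule dtm_cm[OF dtm_at cm_snd]) simp
    have 1: "tdf L M ?X ?U (\<lambda>q. \<forall>p\<in>{p. fst p < snd p}. S (snd (snd q (snd p))) (fst (snd q (fst p))))"
      by (intro tdf_all tdf_of_dfn dfn_rel[OF S cb cc])
    have 2: "dfn L M ?X2 ?U2 (\<lambda>q. S (snd (snd (fst q) j)) (snd q))" for j
      by (rule dfn_rel[OF S cm_comp[OF cm_fst cb] dtm_var[OF cm_snd]])
    have 3: "dfn L M ?X2 ?U2 (\<lambda>q. \<tau> (fst (fst q)) (inv (snd q) \<otimes> fst (snd (fst q) i)))" for i
      by (rule dfn_rel[OF d\<tau> ca]) (intro dtm_mult dtm_inv dtm_var[OF cm_snd] dtm_cm[OF cc cm_fst])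
    have 4: "tdf L M ?X ?U (\<lambda>q. \<forall>p\<in>{p. fst p < snd p}. \<not> (\<exists>x\<in>carrier G. S (snd (snd q (fst p))) x \<and>
        \<tau> (fst q) (inv x \<otimes> fst (snd q (snd p)))))"
      by (intro tdf_all tdf_of_dfn dfn_not dfn_exG dfn_conj 2 3)
    show "tdf L M ?X ?U (\<lambda>p. Z (fst p) (snd p))"
      unfolding Z_def by (rule tdf_conj[OF 1 4])
  qed
  from eqt_tdf[OF eq this] have "(\<exists>\<rho>\<in>?SX. Z a \<rho>) = (\<exists>\<rho>\<in>?SX. Z a' \<rho>)" .
  moreover have "\<exists>\<rho>\<in>?SX. Z a' \<rho>"
  proof (rule bexI)
    show "(\<lambda>i. (c i, b i)) \<in> ?SX" using c b by (simp add: seqs_def)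
    show "Z a' (\<lambda>i. (c i, b i))"
      unfolding Z_def
    proof (intro conjI ballI notI)
      fix p :: "nat \<times> nat" assume p: "p \<in> {p. fst p < snd p}"
      then show "S (snd (c (snd p), b (snd p))) (fst (c (fst p), b (fst p)))" using lt by simp
      assume "\<exists>x\<in>carrier G. S (snd (c (fst p), b (fst p))) x \<and> \<tau> a' (inv x \<otimes> fst (c (snd p), b (snd p)))"
      then obtain x where x: "x \<in> carrier G" "S (b (fst p)) x" "\<tau> a' (inv x \<otimes> c (snd p))"
        unfolding fst_conv snd_conv by (elim bexE conjE)
      have "inv x \<otimes> c (snd p) \<in> \<theta>" by (rule \<tau>\<theta>[OF _ x(3)]) (use x(1) c in simp)
      then show False using gt p x(1,2) by blast
    qed
  qed
  ultimately obtain \<rho> where \<rho>: "\<rho> \<in> ?SX" "Z a \<rho>" by auto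
  have fG: "fst (\<rho> i) \<in> carrier G" "snd (\<rho> i) \<in> tuples M D" for i
    using seqsD[OF \<rho>(1), of i] by (auto simp: mem_Times_iff)
  have Z1: "S (snd (\<rho> j)) (fst (\<rho> i))" if "i < j" for i j
    using \<rho>(2) that unfolding Z_def by (elim conjE) (drule bspec[of _ _ "(i, j)"], simp, simp)
  have Z2: "\<not> (\<exists>x\<in>carrier G. S (snd (\<rho> j)) x \<and> \<tau> a (inv x \<otimes> fst (\<rho> i)))" if "j < i" for i j
    using \<rho>(2) that unfolding Z_def by (elim conjE) (drule bspec[of _ _ "(j, i)"] , simp, drule bspec[of _ _ "(j, i)"], simp, simp)
  let ?t = "{x \<in> carrier G. \<tau> a x}"
  show ?thesis
  proof (rule unstI[where \<theta> = ?t and c = "\<lambda>i. fst (\<rho> i)" and b = "\<lambda>i. snd (\<rho> i)", OF S _ _ fG])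
    have "dfn L M (carrier G) (co \<Gamma> (a ` dom \<Delta>)) (\<tau> a)"
      using dfn_rel[OF d\<tau> cm_fix[OF a] dtm_co] .
    then have "dfn L M (carrier G) (co \<Gamma> U) (\<tau> a)" by (rule dfn_mono_co[OF _ tuples_U[OF a]])
    then show "dfn L M (carrier G) (co \<Gamma> U) (\<lambda>x. x \<in> ?t)" by (rule dfn_cong[THEN iffD1, rotated]) simp
    show "HH \<Sigma> a \<subseteq> ?t" using HH_carrier HH_D K(1) unfolding \<tau>_def by blast
    show "S (snd (\<rho> j)) (fst (\<rho> i))" if "i < j" for i j by (rule Z1[OF that])
    show "inv x \<otimes> fst (\<rho> i) \<notin> ?t" if "j < i" "x \<in> carrier G" "S (snd (\<rho> j)) x" for i j x
      using Z2[OF that(1)] that(2,3) by blast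
  qed
qed

lemma unst_finite_Inter:
  assumes "finite J" "J \<noteq> {}"
    and "\<And>j. j \<in> J \<Longrightarrow> subgroup (H j) G \<and> small M (A j) \<and> A j \<subseteq> U \<and> tdf L M (carrier G) (co \<Gamma> (A j)) (\<lambda>x. x \<in> H j) \<and> \<not> unst (H j)"
  shows "\<not> unst (\<Inter>j\<in>J. H j)"
proof -
  have "subgroup (\<Inter>j\<in>J. H j) G \<and> small M (\<Union>j\<in>J. A j) \<and> (\<Union>j\<in>J. A j) \<subseteq> U \<and>
    tdf L M (carrier G) (co \<Gamma> (\<Union>j\<in>J. A j)) (\<lambda>x. x \<in> (\<Inter>j\<in>J. H j)) \<and> \<not> unst (\<Inter>j\<in>J. H j)"
    using assms
  proof (induction rule: finite_ne_induct)
    case (singleton j)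
    then show ?case by simp
  next
    case (insert j J)
    let ?H = "\<Inter>j\<in>J. H j" and ?A = "\<Union>j\<in>J. A j"
    have IH: "subgroup ?H G" "small M ?A" "?A \<subseteq> U" "tdf L M (carrier G) (co \<Gamma> ?A) (\<lambda>x. x \<in> ?H)" "\<not> unst ?H"
      using insert.IH insert.prems by simp_all
    have j: "subgroup (H j) G" "small M (A j)" "A j \<subseteq> U" "tdf L M (carrier G) (co \<Gamma> (A j)) (\<lambda>x. x \<in> H j)" "\<not> unst (H j)"
      using insert.prems[of j] by simp_all
    have "tdf L M (carrier G) (co \<Gamma> (A j \<union> ?A)) (\<lambda>x. x \<in> H j \<and> x \<in> ?H)"
      by (intro tdf_conj tdf_mono[OF j(4) order_refl] tdf_mono[OF IH(4) order_refl] co_mono) auto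
    moreover have "\<not> unst (H j \<inter> ?H)" using unst_Int[OF j(1-4) IH(1-4)] j(5) IH(5) by blast
    moreover have "subgroup (H j \<inter> ?H) G" by (rule subgroups_Inter_pair[OF j(1) IH(1)])
    ultimately show ?case using small_Un[OF j(2) IH(2)] j(3) IH(3) by simp
  qed
  then show ?thesis by simp
qed

section \<open>Consequences of NIP\<close>

text \<open>\<open>nip\<close> speaks of finite contexts indexed by numbers. The variables that read
  the tuple are renumbered by \<open>h\<close> and the entries of group elements by
  \<open>hG\<close>; the shattered set is the range of the tuples cut down to the variables that
  occur.\<close>

lemma nip_family:
  assumes nip: "nip L M"
    and R: "dfn L M (tuples M \<Delta> \<times> carrier G) (prodc (co \<Delta> {}) gco) (\<lambda>p. R (fst p) (snd p))"
    and a: "\<And>j :: nat. a j \<in> tuples M \<Delta>"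
    and sh: "\<And>J. \<exists>y\<in>carrier G. \<forall>j. R (a j) y \<longleftrightarrow> j \<in> J"
  shows False
proof -
  let ?X = "tuples M \<Delta> \<times> carrier G" and ?U = "prodc (co \<Delta> {}) gco"
  obtain \<phi> where "wf_fm L (cx M ?X ?U) [] \<phi>" "\<forall>z\<in>?X. R (fst z) (snd z) \<longleftrightarrow> sat M (\<lambda>u. u z) [] \<phi>"
    "\<forall>u\<in>fv \<phi>. u \<in> ?U" "\<forall>u\<in>fv \<phi>. \<forall>z\<in>?X. srt M (u z) = cx M ?X ?U u"
    by (rule exE[OF dfnE[OF R]], elim conjE, rule that)
  note \<phi> = this[rule_format]
  define W where "W = fv \<phi> \<inter> (\<lambda>v p. v (fst p)) ` co \<Delta> {}"
  have finW: "finite W" unfolding W_def using finite_fv by blast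
  obtain h :: "_ \<Rightarrow> nat" where h: "inj_on h W"
    using finite_imp_inj_to_nat_seg[OF finW] by (elim exE conjE)
  obtain hG :: "'i \<Rightarrow> nat" where hG: "inj_on hG (dom \<Gamma>)"
    using finite_imp_inj_to_nat_seg[OF finite_dom] by (elim exE conjE)
  have "\<forall>u\<in>fv \<phi> - W. \<exists>i. i \<in> dom \<Gamma> \<and> u = (\<lambda>p. snd p i)"
  proof
    fix u assume u: "u \<in> fv \<phi> - W"
    then have "u \<in> ?U" using \<phi>(3) by blast
    then show "\<exists>i. i \<in> dom \<Gamma> \<and> u = (\<lambda>p. snd p i)"
      using u unfolding W_def prodc_def co_def by auto
  qed
  from bchoice[OF this] obtain ix where ix: "\<forall>u\<in>fv \<phi> - W. ix u \<in> dom \<Gamma> \<and> u = (\<lambda>p. snd p (ix u))"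
    by (elim exE)
  define D where "D n = (if n \<in> h ` W then cx M ?X ?U (the_inv_into W h n) else None)" for n
  define E where "E n = (if n \<in> hG ` dom \<Gamma> then \<Gamma> (the_inv_into (dom \<Gamma>) hG n) else None)" for n
  have Dh: "D (h u) = cx M ?X ?U u" if "u \<in> W" for u
    using that the_inv_into_f_f[OF h that] by (simp add: D_def)
  have Eh: "E (hG i) = \<Gamma> i" if "i \<in> dom \<Gamma>" for i
    using that the_inv_into_f_f[OF hG that] by (simp add: E_def)
  define x where "x j n = (if n \<in> dom D then the_inv_into W h n (a j, \<one>) else undefined)" for j n
  define y' where "y' y n = (if n \<in> dom E then y (the_inv_into (dom \<Gamma>) hG n) else undefined)"
    for y :: "'i \<Rightarrow> 'a" and n
  define k :: "_ \<Rightarrow> (nat + nat) + 'a" where "k u = Inl (if u \<in> W then Inl (h u) else Inr (hG (ix u)))" for u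
  have sortW: "\<exists>s. cx M ?X ?U u = Some s" if "u \<in> fv \<phi>" for u
    using wf_fm_fv[OF \<phi>(1)] that by auto
  have xT: "x j \<in> tuples M D" for j
  proof -
    have "srt M (x j n) = D n" if n: "n \<in> dom D" for n
    proof -
      obtain u where u: "u \<in> W" "n = h u" using n by (auto simp: D_def split: if_splits)
      then have "x j n = u (a j, \<one>)" using n the_inv_into_f_f[OF h u(1)] by (simp add: x_def)
      then show ?thesis using \<phi>(4)[of u "(a j, \<one>)"] u a Dh by (auto simp: W_def)
    qed
    then show ?thesis by (auto simp: tuples_iff extensional_def x_def)
  qed
  have yT: "y' y \<in> tuples M E" if y: "y \<in> carrier G" for y
  proof -
    have "srt M (y' y n) = E n" if n: "n \<in> dom E" for n
    proof -
      have "n \<in> hG ` dom \<Gamma>" using n by (auto simp: E_def split: if_splits)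
      then obtain i where i: "i \<in> dom \<Gamma>" "n = hG i" by blast
      then have "y' y n = y i" using n the_inv_into_f_f[OF hG i(1)] by (simp add: y'_def)
      then show ?thesis using tuples_sort[OF subsetD[OF carrier_tuples y] i(1)] Eh[OF i(1)] i(2) by simp
    qed
    then show ?thesis by (auto simp: tuples_iff extensional_def y'_def)
  qed
  have "wf_fm L (\<lambda>u. case_sum (case_sum D E) (srt M |` {}) (k u)) [] \<phi>"
  proof (rule wf_fm_cong[THEN iffD1, OF _ \<phi>(1)])
    fix u assume u: "u \<in> fv \<phi>"
    show "cx M ?X ?U u = case_sum (case_sum D E) (srt M |` {}) (k u)"
    proof (cases "u \<in> W")
      case True
      then show ?thesis using Dh by (simp add: k_def)
    next
      case False
      then have i: "ix u \<in> dom \<Gamma>" "u = (\<lambda>p. snd p (ix u))" using ix u by auto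
      have "cx M ?X ?U u = srt M (u (a 0, \<one>))" using \<phi>(4)[OF u, of "(a 0, \<one>)"] a by simp
      also have "u (a 0, \<one>) = \<one> (ix u)" using i(2) by (metis snd_conv)
      also have "srt M (\<one> (ix u)) = \<Gamma> (ix u)" using tuples_sort[OF subsetD[OF carrier_tuples one_closed] i(1)] .
      finally show ?thesis using False Eh[OF i(1)] by (simp add: k_def)
    qed
  qed
  then have re: "ren k \<phi> \<in> fm_over L M {} (case_sum D E)" unfolding fm_over_def mem_Collect_eq wf_fm_ren .
  have fD: "finite (dom D)" by (rule finite_subset[OF _ finite_imageI[OF finW, of h]]) (auto simp: D_def split: if_splits)
  have fE: "finite (dom E)" by (rule finite_subset[OF _ finite_imageI[OF finite_dom, of hG]]) (auto simp: E_def split: if_splits)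
  have no: "\<not> (\<exists>S\<subseteq>tuples M D. infinite S \<and> (\<forall>S'\<subseteq>S. \<exists>y\<in>tuples M E. \<forall>x\<in>S.
      holds M (ren k \<phi>) (case_sum x y) \<longleftrightarrow> x \<in> S'))"
    using bspec[OF mp[OF spec[OF spec[OF nip[unfolded nip_def], of D], of E] conjI[OF fD fE]] re] .
  have hold: "holds M (ren k \<phi>) (case_sum (x j) (y' y)) \<longleftrightarrow> R (a j) y" if y: "y \<in> carrier G" for j y
  proof -
    have "case_sum (case_sum (x j) (y' y)) (\<lambda>a. a) (k u) = u (a j, y)" if u: "u \<in> fv \<phi>" for u
    proof (cases "u \<in> W")
      case True
      then have "h u \<in> dom D" using Dh[OF True] sortW[OF u] by auto
      then have "case_sum (case_sum (x j) (y' y)) (\<lambda>a. a) (k u) = u (a j, \<one>)"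
        using True the_inv_into_f_f[OF h True] by (simp add: k_def x_def)
      also have "\<dots> = u (a j, y)" using True by (auto simp: W_def)
      finally show ?thesis .
    next
      case False
      then have i: "ix u \<in> dom \<Gamma>" "u = (\<lambda>p. snd p (ix u))" using ix u by auto
      then have "hG (ix u) \<in> dom E" using Eh[OF i(1)] by (simp add: domIff)
      then have "case_sum (case_sum (x j) (y' y)) (\<lambda>a. a) (k u) = y (ix u)"
        using False the_inv_into_f_f[OF hG i(1)] by (simp add: k_def y'_def)
      also have "\<dots> = u (a j, y)" using i(2) by (metis snd_conv)
      finally show ?thesis .
    qed
    then have "holds M (ren k \<phi>) (case_sum (x j) (y' y)) \<longleftrightarrow> sat M (\<lambda>u. u (a j, y)) [] \<phi>"
      unfolding holds_def sat_ren by (rule sat_cong)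
    then show ?thesis using \<phi>(2)[of "(a j, y)"] a y by simp
  qed
  \<comment> \<open>Cutting down might identify tuples; the pattern \<open>J = {i}\<close> separates
    \<open>x i\<close> from all others, so the range stays infinite.\<close>
  have "inj x"
  proof (rule injI)
    fix i j assume ij: "x i = x j"
    obtain y where y: "y \<in> carrier G" "\<forall>l. R (a l) y \<longleftrightarrow> l \<in> {i}" by (rule bexE[OF sh[of "{i}"]], rule that)
    have "R (a i) y \<longleftrightarrow> R (a j) y"
      using hold[OF y(1), of i] hold[OF y(1), of j] unfolding ij by (rule subst)
    then show "i = j" using spec[OF y(2), of i] spec[OF y(2), of j] by auto
  qed
  then have "infinite (range x)" by (rule range_inj_infinite)
  moreover have "\<exists>y\<in>tuples M E. \<forall>s\<in>range x. holds M (ren k \<phi>) (case_sum s y) \<longleftrightarrow> s \<in> S'" for S'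
  proof -
    obtain y where y: "y \<in> carrier G" "\<forall>l. R (a l) y \<longleftrightarrow> l \<in> {l. x l \<in> S'}"
      by (rule bexE[OF sh[of "{l. x l \<in> S'}"]], rule that)
    have "holds M (ren k \<phi>) (case_sum s (y' y)) \<longleftrightarrow> s \<in> S'" if s: "s \<in> range x" for s
    proof -
      obtain l where l: "s = x l" using s by (elim rangeE)
      have "R (a l) y \<longleftrightarrow> x l \<in> S'" using spec[OF y(2), of l] unfolding mem_Collect_eq .
      then show ?thesis unfolding l hold[OF y(1)] .
    qed
    then show ?thesis by (intro bexI[OF _ yT[OF y(1)]] ballI)
  qed
  moreover have "range x \<subseteq> tuples M D" by (rule image_subsetI, rule xT)
  ultimately have "\<exists>S\<subseteq>tuples M D. infinite S \<and> (\<forall>S'\<subseteq>S. \<exists>y\<in>tuples M E. \<forall>x\<in>S.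
      holds M (ren k \<phi>) (case_sum x y) \<longleftrightarrow> x \<in> S')"
    by (intro exI[of _ "range x"] conjI allI impI)
  then show False by (rule notE[OF no])
qed

text \<open>
  If \<open>c\<^sub>k\<close> lies in all \<open>H\<^sub>j\<close> with \<open>j \<noteq> k\<close> but is far from \<open>H\<^sub>k\<close>, the ordered products of the \<open>c\<^sub>k\<close>
  over finite sets of indices shatter the sequence of the parameters of the \<open>H\<^sub>j\<close>.
\<close>

lemma nip_inter:
  fixes f :: "rat \<Rightarrow> rat"
  assumes nip: "nip L M" and fam: "fam \<Delta> \<Sigma>" and sm: "small M (dom \<Delta>)"
    and ind: "indisc L M (Xb \<Delta>) (Ub \<Delta>) {} \<rho>"
    and sub: "\<And>q. subgroup (HH \<Sigma> (snd (\<rho> q))) G"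
    and f: "strict_mono f" "f 0 = 0"
    and c: "c \<in> carrier G" "\<And>j. j \<noteq> 0 \<Longrightarrow> c \<in> HH \<Sigma> (snd (\<rho> (f j)))"
  shows "c \<in> HH \<Sigma> (snd (\<rho> 0))"
proof (rule HH_I[OF c(1)], rule ccontr)
  fix \<sigma> assume \<sigma>: "\<sigma> \<in> \<Sigma>" and n\<sigma>: "\<not> \<sigma> (snd (\<rho> 0)) c"
  let ?SX = "seqs (Xb \<Delta>) :: (rat \<Rightarrow> _) set" and ?SU = "sco (Ub \<Delta>) UNIV {}"
  have \<rho>: "\<rho> \<in> ?SX" using ind by (simp add: indisc_def)
  define a where "a k = snd (\<rho> (of_nat k))" for k :: nat
  have aT: "snd (\<rho> q) \<in> tuples M \<Delta>" for q using seqsD[OF \<rho>, of q] by (auto simp: mem_Times_iff)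
  have a0: "a 0 = snd (\<rho> 0)" by (simp add: a_def)
  have suba: "subgroup (HH \<Sigma> (a j)) G" for j unfolding a_def by (rule sub)
  \<comment> \<open>An element in every subgroup with natural index other than \<open>k\<close>,
    with \<open>\<sigma>\<close> failing at \<open>k\<close>. Its existence is type-definable in the
    sequence, so the single element \<open>c\<close> yields one for every \<open>k\<close>.\<close>
  define A where "A k \<pi> \<longleftrightarrow> (\<exists>x\<in>carrier G. (\<forall>j\<in>{j. j \<noteq> k}. x \<in> HH \<Sigma> (snd (\<pi> (of_nat j)))) \<and>
      \<not> \<sigma> (snd (\<pi> (of_nat k))) x)" for k :: nat and \<pi> :: "rat \<Rightarrow> ('i \<Rightarrow> 'a) \<times> ('b \<Rightarrow> 'a)"
  have dA: "tdf L M ?SX ?SU (A k)" for k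
    unfolding A_def
  proof (rule tdf_exG)
    show "small M (sco (Ub \<Delta>) (UNIV :: rat set) {})" by (intro small_sco sm small_finite) simp_all
    let ?X = "?SX \<times> carrier G" and ?U = "prodc ?SU gco"
    have c: "cm ?X ?U (tuples M \<Delta>) (co \<Delta> {}) (\<lambda>p. snd (fst p q))" for q
      by (rule cm_comp[OF cm_fst cm_at_snd]) simp
    have x: "dtm ?X ?U (\<lambda>p. snd p)" by (rule dtm_var[OF cm_snd])
    show "tdf L M ?X ?U (\<lambda>p. (\<forall>j\<in>{j. j \<noteq> k}. snd p \<in> HH \<Sigma> (snd (fst p (of_nat j)))) \<and>
        \<not> \<sigma> (snd (fst p (of_nat k))) (snd p))"
      by (intro tdf_conj tdf_all tdf_HH[OF fam c x] tdf_of_dfn dfn_not dfn_rel[OF famD[OF fam \<sigma>] c x])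
  qed
  have "\<exists>x\<in>carrier G. (\<forall>j\<in>{j. j \<noteq> k}. x \<in> HH \<Sigma> (a j)) \<and> \<not> \<sigma> (a k) x" for k
  proof -
    \<comment> \<open>The shift puts the exceptional position \<open>k\<close> at \<open>0\<close>,
      and \<open>f\<close> spreads the others to positions where \<open>c\<close> is known to be a
      member.\<close>
    let ?g = "\<lambda>q. f (q - of_nat k)"
    have "strict_mono_on UNIV ?g" using f(1) by (simp add: strict_mono_on_def strict_mono_def)
    moreover have "strict_mono_on (UNIV :: rat set) (\<lambda>q. q)" by (simp add: strict_mono_on_def)
    ultimately have "A k (\<rho> \<circ> ?g) = A k (\<rho> \<circ> (\<lambda>q. q))" by (rule indisc_tdf[OF ind dA])
    moreover have "A k (\<rho> \<circ> ?g)"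
      unfolding A_def by (rule bexI[OF _ c(1)]) (use c(2) n\<sigma> f(2) in simp)
    ultimately have "A k \<rho>" by (simp add: comp_def)
    then show ?thesis by (simp add: A_def a_def)
  qed
  then have "\<forall>k. \<exists>x. x \<in> carrier G \<and> ((\<forall>j\<in>{j. j \<noteq> k}. x \<in> HH \<Sigma> (a j)) \<and> \<not> \<sigma> (a k) x)"
    unfolding Bex_def by (rule allI)
  from choice[OF this] obtain d where
    d': "\<forall>k. d k \<in> carrier G \<and> ((\<forall>j\<in>{j. j \<noteq> k}. d k \<in> HH \<Sigma> (a j)) \<and> \<not> \<sigma> (a k) (d k))"
    by (elim exE)
  have d: "d k \<in> carrier G" "j \<noteq> k \<Longrightarrow> d k \<in> HH \<Sigma> (a j)" "\<not> \<sigma> (a k) (d k)" for k j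
    using spec[OF d', of k] by simp_all
  let ?X3 = "(carrier G \<times> carrier G) \<times> carrier G" and ?U3 = "prodc (prodc (co \<Gamma> (a 0 ` dom \<Delta>)) gco) gco"
  have c3: "cm ?X3 ?U3 (tuples M \<Delta>) (co \<Delta> {}) (\<lambda>p. a 0)"
    using cm_comp[OF cm_comp[OF cm_fst cm_fst] cm_fix[OF aT[of 0]]] unfolding a0 .
  have t1: "dtm ?X3 ?U3 (\<lambda>p. fst (fst p))" by (rule dtm_cm[OF dtm_co cm_comp[OF cm_fst cm_fst]])
  have t2: "dtm ?X3 ?U3 (\<lambda>p. snd (fst p))" by (rule dtm_var[OF cm_comp[OF cm_fst cm_snd]])
  have t3: "dtm ?X3 ?U3 (\<lambda>p. snd p)" by (rule dtm_var[OF cm_snd])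
  have "\<exists>K. K \<subseteq> \<Sigma> \<and> finite K \<and> (\<forall>p\<in>?X3. (\<forall>\<tau>\<in>K. \<tau> (a 0) (fst (fst p)) \<and> \<tau> (a 0) (snd (fst p)) \<and> \<tau> (a 0) (snd p)) \<longrightarrow>
      \<sigma> (a 0) (snd (fst p) \<otimes> fst (fst p) \<otimes> snd p))"
  proof (rule cpt_imp_family)
    show "cpt L M ?X3 ?U3"
      by (intro cpt_prodG cpt_carrier small_prodc small_co small_gco small_dom small_image sm)
    show "dfn L M ?X3 ?U3 (\<lambda>p. \<tau> (a 0) (fst (fst p)) \<and> \<tau> (a 0) (snd (fst p)) \<and> \<tau> (a 0) (snd p))" if "\<tau> \<in> \<Sigma>" for \<tau>
      by (intro dfn_conj dfn_rel[OF famD[OF fam that] c3] t1 t2 t3)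
    show "dfn L M ?X3 ?U3 (\<lambda>p. \<sigma> (a 0) (snd (fst p) \<otimes> fst (fst p) \<otimes> snd p))"
      by (intro dfn_rel[OF famD[OF fam \<sigma>] c3] dtm_mult t1 t2 t3)
    fix p assume p: "p \<in> ?X3" and *: "\<And>\<tau>. \<tau> \<in> \<Sigma> \<Longrightarrow> \<tau> (a 0) (fst (fst p)) \<and> \<tau> (a 0) (snd (fst p)) \<and> \<tau> (a 0) (snd p)"
    have pG: "fst (fst p) \<in> carrier G" "snd (fst p) \<in> carrier G" "snd p \<in> carrier G"
      using p by (elim SigmaE, simp)+
    have "fst (fst p) \<in> HH \<Sigma> (a 0)"
    proof (rule HH_I[OF pG(1)])
      fix \<tau> assume t: "\<tau> \<in> \<Sigma>"
      show "\<tau> (a 0) (fst (fst p))" by (rule conjunct1[OF *[OF t]])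
    qed
    moreover have "snd (fst p) \<in> HH \<Sigma> (a 0)"
    proof (rule HH_I[OF pG(2)])
      fix \<tau> assume t: "\<tau> \<in> \<Sigma>"
      show "\<tau> (a 0) (snd (fst p))" by (rule conjunct1[OF conjunct2[OF *[OF t]]])
    qed
    moreover have "snd p \<in> HH \<Sigma> (a 0)"
    proof (rule HH_I[OF pG(3)])
      fix \<tau> assume t: "\<tau> \<in> \<Sigma>"
      show "\<tau> (a 0) (snd p)" by (rule conjunct2[OF conjunct2[OF *[OF t]]])
    qed
    ultimately have "snd (fst p) \<otimes> fst (fst p) \<otimes> snd p \<in> HH \<Sigma> (a 0)"
      using subgroup.m_closed[OF suba] by simp
    then show "\<sigma> (a 0) (snd (fst p) \<otimes> fst (fst p) \<otimes> snd p)" by (rule HH_D[OF _ \<sigma>])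
  qed
  then obtain K where K: "K \<subseteq> \<Sigma>" "finite K" "\<forall>p\<in>?X3. (\<forall>\<tau>\<in>K. \<tau> (a 0) (fst (fst p)) \<and> \<tau> (a 0) (snd (fst p)) \<and> \<tau> (a 0) (snd p)) \<longrightarrow>
      \<sigma> (a 0) (snd (fst p) \<otimes> fst (fst p) \<otimes> snd p)"
    by (elim exE conjE)
  \<comment> \<open>A neighbourhood of the subgroup at \<open>a 0\<close> that remains inside
    \<open>\<sigma>\<close> after multiplication by subgroup elements on both sides.\<close>
  define \<chi> where "\<chi> b x \<longleftrightarrow> (\<forall>\<tau>\<in>K. \<tau> b x)" for b x
  have d\<chi>: "dfn L M (tuples M \<Delta> \<times> carrier G) (prodc (co \<Delta> {}) gco) (\<lambda>p. \<chi> (fst p) (snd p))"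
    unfolding \<chi>_def by (rule dfn_ball_finite[OF K(2)], rule famD[OF fam]) (use K(1) in auto)
  have HH\<chi>: "\<chi> b x" if "x \<in> HH \<Sigma> b" for b x
    unfolding \<chi>_def by (rule ballI, rule HH_D[OF that]) (use K(1) in auto)
  \<comment> \<open>\<open>T\<close> says that \<open>\<chi>\<close> lacks this property at
    \<open>b\<close>. It is type-definable over the empty set, so indiscernibility passes its
    negation from \<open>a 0\<close> to every \<open>a k\<close>.\<close>
  define T where "T b \<longleftrightarrow> (\<exists>x\<in>carrier G. \<exists>h\<in>carrier G. \<exists>h'\<in>carrier G. \<chi> b x \<and> h \<in> HH \<Sigma> b \<and> h' \<in> HH \<Sigma> b \<and>
      \<not> \<sigma> b (h \<otimes> x \<otimes> h'))" for b
  have dT: "tdf L M (tuples M \<Delta>) (co \<Delta> {}) T"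
    unfolding T_def
  proof (rule tdf_exG[OF small_co[OF sm small_finite[OF finite.emptyI]]], rule tdf_exG, goal_cases)
    case 1
    show ?case by (intro small_prodc small_co small_gco sm small_finite) simp
  next
    case 2
    let ?X = "((tuples M \<Delta> \<times> carrier G) \<times> carrier G) \<times> carrier G"
    let ?U = "prodc (prodc (prodc (co \<Delta> {}) gco) gco) gco"
    have b: "cm ?X ?U (tuples M \<Delta>) (co \<Delta> {}) (\<lambda>p. fst (fst (fst p)))"
      by (rule cm_comp[OF cm_comp[OF cm_fst cm_fst] cm_fst])
    have x: "dtm ?X ?U (\<lambda>p. snd (fst (fst p)))" by (rule dtm_var[OF cm_comp[OF cm_comp[OF cm_fst cm_fst] cm_snd]])
    have h: "dtm ?X ?U (\<lambda>p. snd (fst p))" by (rule dtm_var[OF cm_comp[OF cm_fst cm_snd]])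
    have h': "dtm ?X ?U (\<lambda>p. snd p)" by (rule dtm_var[OF cm_snd])
    have "tdf L M ?X ?U (\<lambda>p. \<chi> (fst (fst (fst p))) (snd (fst (fst p))) \<and> snd (fst p) \<in> HH \<Sigma> (fst (fst (fst p))) \<and>
        snd p \<in> HH \<Sigma> (fst (fst (fst p))) \<and> \<not> \<sigma> (fst (fst (fst p))) (snd (fst p) \<otimes> snd (fst (fst p)) \<otimes> snd p))"
      by (intro tdf_conj tdf_HH[OF fam b h] tdf_HH[OF fam b h'] tdf_of_dfn dfn_not dfn_rel[OF d\<chi> b x]
          dfn_rel[OF famD[OF fam \<sigma>] b dtm_mult[OF dtm_mult[OF h x] h']])
    moreover have "small M (prodc (prodc (co \<Delta> {}) gco) gco)"
      by (intro small_prodc small_co small_gco sm small_finite) simp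
    ultimately show ?case by (intro tdf_exG)
  qed
  have nT0: "\<not> T (a 0)"
  proof
    assume "T (a 0)"
    then obtain x h h' where x: "x \<in> carrier G" "h \<in> carrier G" "h' \<in> carrier G" "\<chi> (a 0) x" "h \<in> HH \<Sigma> (a 0)"
      "h' \<in> HH \<Sigma> (a 0)" "\<not> \<sigma> (a 0) (h \<otimes> x \<otimes> h')" unfolding T_def by (elim bexE conjE)
    have "\<forall>\<tau>\<in>K. \<tau> (a 0) x \<and> \<tau> (a 0) h \<and> \<tau> (a 0) h'"
      using x(4) HH\<chi>[OF x(5)] HH\<chi>[OF x(6)] unfolding \<chi>_def by (simp add: ball_conj_distrib)
    moreover have "((x, h), h') \<in> ?X3" using x(1-3) by (intro SigmaI)
    ultimately show False using mp[OF bspec[OF K(3), of "((x, h), h')"], unfolded fst_conv snd_conv] x(7) by (elim notE) iprover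
  qed
  have nT: "\<not> T (a k)" for k
  proof -
    have "tdf L M ?SX (sco (Ub \<Delta>) {0} {}) (\<lambda>\<pi>. T (snd (\<pi> 0)))"
      by (rule tdf_cm[OF dT cm_at_snd]) simp
    from indisc_tdf[OF ind this, of "\<lambda>q. of_nat k" "\<lambda>q. q"] have "T (a k) = T (a 0)"
      by (simp add: strict_mono_on_def a_def)
    then show ?thesis using nT0 by simp
  qed
  \<comment> \<open>The product of the \<open>d i\<close> with \<open>i \<in> J\<close> and
    \<open>i < n\<close> in increasing order. All its factors other than \<open>d j\<close> lie in
    the subgroup at \<open>j\<close>.\<close>
  define p where "p J n = rec_nat \<one> (\<lambda>n r. if n \<in> J then r \<otimes> d n else r) n" for J :: "nat set" and n
  have p0: "p J 0 = \<one>" and pS: "p J (Suc n) = (if n \<in> J then p J n \<otimes> d n else p J n)" for J n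
    by (simp_all add: p_def)
  have pG: "p J n \<in> carrier G" for J n
    by (induction n) (simp_all add: p0 pS d(1))
  have pin: "p J n \<in> HH \<Sigma> (a j)" if "j \<notin> J \<or> n \<le> j" for J n j
    using that
  proof (induction n)
    case 0
    show ?case unfolding p0 by (rule subgroup.one_closed[OF suba])
  next
    case (Suc n)
    then have IH: "p J n \<in> HH \<Sigma> (a j)" by auto
    show ?case
    proof (cases "n \<in> J")
      case True
      then have "j \<noteq> n" using Suc.prems by auto
      then show ?thesis using True subgroup.m_closed[OF suba IH d(2)] by (simp add: pS)
    qed (simp add: pS IH)
  qed
  have pj: "\<exists>h\<in>HH \<Sigma> (a j). \<exists>h'\<in>HH \<Sigma> (a j). p J n = h \<otimes> d j \<otimes> h'" if "j \<in> J" "j < n" for J n j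
    using that(2)
  proof (induction n)
    case (Suc n)
    show ?case
    proof (cases "j = n")
      case True
      have "p J n \<in> HH \<Sigma> (a j)" by (rule pin) (simp add: True)
      moreover have "p J (Suc n) = p J n \<otimes> d j \<otimes> \<one>" using True that(1) pG d(1) by (simp add: pS)
      ultimately show ?thesis using subgroup.one_closed[OF suba] by blast
    next
      case False
      then obtain h h' where h: "h \<in> HH \<Sigma> (a j)" "h' \<in> HH \<Sigma> (a j)" "p J n = h \<otimes> d j \<otimes> h'"
        using Suc by auto
      show ?thesis
      proof (cases "n \<in> J")
        case True
        have "d n \<in> HH \<Sigma> (a j)" using d(2) False by simp
        then have "h' \<otimes> d n \<in> HH \<Sigma> (a j)" by (rule subgroup.m_closed[OF suba h(2)])
        moreover have "p J (Suc n) = h \<otimes> d j \<otimes> (h' \<otimes> d n)"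
          using True h HH_carrier[OF h(1)] HH_carrier[OF h(2)] d(1) by (simp add: pS m_assoc)
        ultimately show ?thesis using h(1) by blast
      next
        case False
        then have "p J (Suc n) = h \<otimes> d j \<otimes> h'" using h(3) by (simp add: pS)
        then show ?thesis using h(1,2) by blast
      qed
    qed
  qed simp
  have \<chi>p: "\<not> \<chi> (a j) (p J n) \<longleftrightarrow> j \<in> J" if jn: "j < n" for J n j
  proof
    show "j \<in> J" if "\<not> \<chi> (a j) (p J n)" using that HH\<chi>[OF pin, of j J n] by auto
    assume j: "j \<in> J"
    show "\<not> \<chi> (a j) (p J n)"
    proof
      assume ch: "\<chi> (a j) (p J n)"
      obtain h h' where h: "h \<in> HH \<Sigma> (a j)" "h' \<in> HH \<Sigma> (a j)" "p J n = h \<otimes> d j \<otimes> h'"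
        using pj[OF j jn] by (elim bexE)
      have hG: "h \<in> carrier G" "h' \<in> carrier G" using h HH_carrier by auto
      \<comment> \<open>Stripping the outer factors recovers \<open>d j\<close>, at which
        \<open>\<sigma>\<close> fails; since \<open>T\<close> is false at \<open>a j\<close>,
        \<open>\<chi>\<close> cannot hold at the product.\<close>
      have "inv h \<otimes> p J n = d j \<otimes> h'" using h(3) hG d(1)[of j] by (simp add: m_assoc[symmetric])
      then have "inv h \<otimes> p J n \<otimes> inv h' = d j" using hG d(1)[of j] by (simp add: m_assoc)
      then have "\<not> \<sigma> (a j) (inv h \<otimes> p J n \<otimes> inv h')" using d(3) by simp
      then have "T (a j)"
        unfolding T_def using ch pG hG subgroup.m_inv_closed[OF suba h(1)] subgroup.m_inv_closed[OF suba h(2)]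
        by (intro bexI[of _ "p J n"] bexI[of _ "inv h"] bexI[of _ "inv h'"] conjI) simp_all
      then show False using nT by simp
    qed
  qed
  show False
  proof (rule nip_family[OF nip dfn_not[OF d\<chi>]])
    show "a j \<in> tuples M \<Delta>" for j unfolding a_def by (rule aT)
    fix J :: "nat set"
    \<comment> \<open>The finite products realise every pattern on an initial segment of indices;
      compactness over the entries of all \<open>a j\<close> realises the whole set
      \<open>J\<close>.\<close>
    define B where "B = (\<lambda>(j, w). a j w) ` (UNIV \<times> dom \<Delta>)"
    have "small M B" unfolding B_def by (intro small_image small_times sm) simp
    from cpt_carrier[OF this] have "\<exists>y\<in>carrier G. \<forall>Q\<in>range (\<lambda>j x. \<not> \<chi> (a j) x \<longleftrightarrow> j \<in> J). Q y"
    proof (rule cptD)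
      fix Q assume "Q \<in> range (\<lambda>j x. \<not> \<chi> (a j) x \<longleftrightarrow> j \<in> J)"
      then obtain j where Q: "Q = (\<lambda>x. \<not> \<chi> (a j) x \<longleftrightarrow> j \<in> J)" by (elim rangeE)
      have "dfn L M (carrier G) (co \<Gamma> (a j ` dom \<Delta>)) (\<chi> (a j))"
        using dfn_rel[OF d\<chi> cm_fix dtm_co] aT by (simp add: a_def)
      then have "dfn L M (carrier G) (co \<Gamma> B) (\<chi> (a j))" by (rule dfn_mono_co) (auto simp: B_def)
      then show "dfn L M (carrier G) (co \<Gamma> B) Q" unfolding Q by (intro dfn_iff dfn_not dfn_const)
    next
      fix \<Q> assume fin: "\<Q> \<subseteq> range (\<lambda>j x. \<not> \<chi> (a j) x \<longleftrightarrow> j \<in> J)" "finite \<Q>"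
      obtain N where N: "finite N" "\<Q> = (\<lambda>j x. \<not> \<chi> (a j) x \<longleftrightarrow> j \<in> J) ` N"
        using finite_subset_image[OF fin(2,1)] by (elim exE conjE) (rule that)
      obtain n where n: "\<forall>j\<in>N. j < n" using finite_nat_set_iff_bounded[of N] N(1) by auto
      show "\<exists>y\<in>carrier G. \<forall>Q\<in>\<Q>. Q y"
        unfolding N(2) using \<chi>p n pG by (intro bexI[of _ "p J n"]) simp_all
    qed
    then obtain y where y: "y \<in> carrier G" "\<forall>Q\<in>range (\<lambda>j x. \<not> \<chi> (a j) x \<longleftrightarrow> j \<in> J). Q y" by (elim bexE)
    then show "\<exists>y\<in>carrier G. \<forall>j. \<not> \<chi> (a j) y \<longleftrightarrow> j \<in> J" by (intro bexI[of _ y]) simp_all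
  qed
qed

text \<open>
  The element \<open>z\<close> produced by the moving lemma lies in the same coset of \<open>\<Inter>j. H\<^sub>j\<close>, \<open>j \<notin> [0,1]\<close>, as
  \<open>c\<^sub>0\<close>, so it avoids \<open>H\<^sub>0\<close>, but it lies in \<open>H\<^sub>j\<close> for all other \<open>j < 1\<close>.
\<close>

lemma no_descent:
  assumes nip: "nip L M" and fam: "fam \<Delta> \<Sigma>" and sm: "small M (dom \<Delta>)"
    and ind: "indisc L M (Xb \<Delta>) (Ub \<Delta>) {} \<rho>"
    and sub: "\<And>q. subgroup (HH \<Sigma> (snd (\<rho> q))) G" and st: "\<And>q. \<not> unst (HH \<Sigma> (snd (\<rho> q)))"
    and below: "\<And>q r. r < q \<Longrightarrow> fst (\<rho> q) \<in> HH \<Sigma> (snd (\<rho> r))"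
  shows "fst (\<rho> 0) \<in> HH \<Sigma> (snd (\<rho> 0))"
proof -
  let ?SX = "seqs (Xb \<Delta>) :: (rat \<Rightarrow> _) set"
  have \<rho>: "\<rho> \<in> ?SX" using ind by (simp add: indisc_def)
  define H where "H q = HH \<Sigma> (snd (\<rho> q))" for q
  have subH: "subgroup (H q) G" for q unfolding H_def by (rule sub)
  have aT: "snd (\<rho> q) \<in> tuples M \<Delta>" and cG: "fst (\<rho> q) \<in> carrier G" for q
    using seqsD[OF \<rho>, of q] by (auto simp: mem_Times_iff)
  \<comment> \<open>The closed interval is left out because \<open>moving\<close> from
    \<open>1\<close> to \<open>0\<close> requires a subgroup whose conditions read only positions
    outside it.\<close>
  define Out where "Out = {q :: rat. q < 0 \<or> 1 < q}"
  define N where "N = (\<Inter>j\<in>Out. H j)"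
  have m1: "-1 \<in> Out" by (simp add: Out_def)
  have subN: "subgroup N G" unfolding N_def
    by (rule subgroups_Inter[of "H ` Out"]) (use subH m1 in auto)
  have NG: "x \<in> carrier G" if "x \<in> N" for x using that subgroup.subset[OF subN] by auto
  have N0: "N \<subseteq> H 0"
  proof
    fix x assume x: "x \<in> N"
    show "x \<in> H 0" unfolding H_def
    \<comment> \<open>This map fixes \<open>0\<close> and sends every other position into
      \<open>Out\<close>.\<close>
    proof (rule nip_inter[OF nip fam sm ind sub, where f = "\<lambda>q. if q \<le> 0 then q else q + 1"])
      show "strict_mono (\<lambda>q :: rat. if q \<le> 0 then q else q + 1)" by (auto simp: strict_mono_def)
      show "x \<in> HH \<Sigma> (snd (\<rho> (if j \<le> 0 then j else j + 1)))" if "j \<noteq> 0" for j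
        using x that unfolding N_def H_def Out_def by auto
    qed (use NG[OF x] in simp_all)
  qed
  \<comment> \<open>\<open>N\<close> is an infinite intersection, out of reach of
    \<open>unst_finite_Inter\<close>. Compactness finds finitely many members whose intersection
    already lies in \<open>\<theta>\<close>, and the same half-graph would make that finite
    intersection unstable.\<close>
  have nN: "\<not> unst N"
  proof
    assume "unst N"
    then obtain D :: "nat \<Rightarrow> 's option" and S \<theta> c b where
      S: "dfn L M (tuples M D \<times> carrier G) (prodc (co D {}) gco) (\<lambda>p. S (fst p) (snd p))"
      and \<theta>: "dfn L M (carrier G) (co \<Gamma> U) (\<lambda>x. x \<in> \<theta>)" "N \<subseteq> \<theta>"
      and c: "\<forall>i :: nat. c i \<in> carrier G" and b: "\<forall>j. b j \<in> tuples M D"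
      and lt: "\<forall>i j. i < j \<longrightarrow> S (b j) (c i)"
      and gt: "\<forall>i j. j < i \<longrightarrow> \<not> (\<exists>x\<in>carrier G. S (b j) x \<and> inv x \<otimes> c i \<in> \<theta>)"
      unfolding unst_def by (elim exE conjE)
    obtain A' where A': "finite A'" "A' \<subseteq> U" "dfn L M (carrier G) (co \<Gamma> A') (\<lambda>x. x \<in> \<theta>)"
      using dfn_co_finite[OF \<theta>(1)] by (elim exE conjE)
    define B where "B = (\<lambda>(j, w). snd (\<rho> j) w) ` (UNIV \<times> dom \<Delta>) \<union> A'"
    have "small M B" unfolding B_def by (intro small_Un small_image small_times sm small_finite A'(1)) simp
    from cpt_carrier[OF this] have "\<exists>K. K \<subseteq> Out \<times> \<Sigma> \<and> finite K \<and>
        (\<forall>x\<in>carrier G. (\<forall>p\<in>K. snd p (snd (\<rho> (fst p))) x) \<longrightarrow> x \<in> \<theta>)"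
    proof (rule cpt_imp_family)
      fix p assume p: "p \<in> Out \<times> \<Sigma>"
      then have "snd p \<in> \<Sigma>" by auto
      from dfn_rel[OF famD[OF fam this] cm_fix[OF aT] dtm_co]
      show "dfn L M (carrier G) (co \<Gamma> B) (snd p (snd (\<rho> (fst p))))"
        by (rule dfn_mono_co) (auto simp: B_def)
    next
      show "dfn L M (carrier G) (co \<Gamma> B) (\<lambda>x. x \<in> \<theta>)"
        by (rule dfn_mono_co[OF A'(3)]) (simp add: B_def)
      fix x assume x: "x \<in> carrier G" and *: "\<And>p. p \<in> Out \<times> \<Sigma> \<Longrightarrow> snd p (snd (\<rho> (fst p))) x"
      have "x \<in> H j" if "j \<in> Out" for j
        unfolding H_def by (rule HH_I[OF x]) (use *[of "(j, _)"] that in simp)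
      then show "x \<in> \<theta>" using \<theta>(2) by (auto simp: N_def)
    qed
    then obtain K where K: "K \<subseteq> Out \<times> \<Sigma>" "finite K"
      "\<forall>x\<in>carrier G. (\<forall>p\<in>K. snd p (snd (\<rho> (fst p))) x) \<longrightarrow> x \<in> \<theta>" by (elim exE conjE)
    \<comment> \<open>\<open>-1\<close> belongs to \<open>Out\<close> and keeps the index set
      non-empty.\<close>
    let ?J = "insert (-1) (fst ` K)"
    have "(\<Inter>j\<in>?J. H j) \<subseteq> \<theta>"
    proof
      fix x assume x: "x \<in> (\<Inter>j\<in>?J. H j)"
      have "x \<in> H (-1)" using x by simp
      then have xG: "x \<in> carrier G" unfolding H_def by (rule HH_carrier)
      have "snd p (snd (\<rho> (fst p))) x" if p: "p \<in> K" for p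
      proof -
        have "x \<in> H (fst p)" using x p by auto
        then show ?thesis unfolding H_def by (rule HH_D) (use K(1) p in auto)
      qed
      then have "\<forall>p\<in>K. snd p (snd (\<rho> (fst p))) x" by (rule ballI)
      then show "x \<in> \<theta>" using bspec[OF K(3) xG] by simp
    qed
    then have "unst (\<Inter>j\<in>?J. H j)"
      unfolding unst_def using S \<theta>(1) c b lt gt
      by (intro exI[of _ D] exI[of _ S] exI[of _ \<theta>] exI[of _ c] exI[of _ b] conjI)
    moreover have "\<not> unst (\<Inter>j\<in>?J. H j)"
    proof (rule unst_finite_Inter[where A = "\<lambda>j. snd (\<rho> j) ` dom \<Delta>"])
      show "finite ?J" using K(2) by simp
      fix j
      show "subgroup (H j) G \<and> small M (snd (\<rho> j) ` dom \<Delta>) \<and> snd (\<rho> j) ` dom \<Delta> \<subseteq> U \<and>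
          tdf L M (carrier G) (co \<Gamma> (snd (\<rho> j) ` dom \<Delta>)) (\<lambda>x. x \<in> H j) \<and> \<not> unst (H j)"
        using subH st tuples_U[OF aT] tdf_HH_fix[OF fam aT] small_image[OF sm] unfolding H_def by blast
    qed simp
    ultimately show False by simp
  qed
  \<comment> \<open>The element \<open>fst (\<rho> 1)\<close> is its own witness, because
    \<open>below\<close> puts it in the subgroups at all positions under \<open>1\<close>.\<close>
  define P where "P \<pi> x \<longleftrightarrow> (\<exists>z\<in>carrier G. (\<forall>j\<in>Out. inv x \<otimes> z \<in> HH \<Sigma> (snd (\<pi> j))) \<and>
      (\<forall>k\<in>{k. 0 < k \<and> k < 1}. z \<in> HH \<Sigma> (snd (\<pi> k))))" for \<pi> :: "rat \<Rightarrow> ('i \<Rightarrow> 'a) \<times> ('b \<Rightarrow> 'a)" and x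
  have "P \<rho> (fst (\<rho> 0))"
  proof (rule moving[OF sm small_finite _ ind, where u = 1 and H = N and HP = "\<lambda>\<pi> x. \<forall>j\<in>Out. x \<in> HH \<Sigma> (snd (\<pi> j))"])
    show "tdf L M (?SX \<times> carrier G) (prodc (sco (Ub \<Delta>) {q. q < 0 \<or> 1 < q} {}) gco) (\<lambda>p. \<forall>j\<in>Out. snd p \<in> HH \<Sigma> (snd (fst p j)))"
      by (intro tdf_all tdf_HH[OF fam] cm_comp[OF cm_fst cm_at_snd] dtm_var[OF cm_snd]) (simp add: Out_def)
    show "x \<in> N \<longleftrightarrow> (\<forall>j\<in>Out. x \<in> HH \<Sigma> (snd (\<rho> j)))" for x by (simp add: N_def H_def)
    let ?U = "sco (Ub \<Delta>) {q :: rat. q \<noteq> 0 \<and> q \<noteq> 1} {}"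
    let ?X2 = "(?SX \<times> carrier G) \<times> carrier G" and ?U2 = "prodc (prodc ?U gco) gco"
    have cq: "cm ?X2 ?U2 (tuples M \<Delta>) (co \<Delta> {}) (\<lambda>p. snd (fst (fst p) q))" if "q \<noteq> 0" "q \<noteq> 1" for q
      by (rule cm_comp[OF cm_comp[OF cm_fst cm_fst] cm_at_snd]) (use that in simp)
    have z: "dtm ?X2 ?U2 (\<lambda>p. snd p)" by (rule dtm_var[OF cm_snd])
    have x: "dtm ?X2 ?U2 (\<lambda>p. snd (fst p))" by (rule dtm_var[OF cm_comp[OF cm_fst cm_snd]])
    have 1: "tdf L M ?X2 ?U2 (\<lambda>p. \<forall>j\<in>Out. inv (snd (fst p)) \<otimes> snd p \<in> HH \<Sigma> (snd (fst (fst p) j)))"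
      by (intro tdf_all tdf_HH[OF fam cq dtm_mult[OF dtm_inv[OF x] z]]) (auto simp: Out_def)
    have 2: "tdf L M ?X2 ?U2 (\<lambda>p. \<forall>k\<in>{k. 0 < k \<and> k < 1}. snd p \<in> HH \<Sigma> (snd (fst (fst p) k)))"
      by (intro tdf_all tdf_HH[OF fam cq z]) auto
    have "small M (prodc ?U gco)" by (intro small_prodc small_sco small_gco sm small_finite) simp_all
    then show "tdf L M (?SX \<times> carrier G) (prodc ?U gco) (\<lambda>p. P (fst p) (snd p))"
      unfolding P_def by (intro tdf_exG tdf_conj 1 2)
    show "P \<rho> (x \<otimes> h)" if x: "x \<in> carrier G" and h: "h \<in> N" and P: "P \<rho> x" for x h
    proof -
      obtain z where z: "z \<in> carrier G" "\<forall>j\<in>Out. inv x \<otimes> z \<in> HH \<Sigma> (snd (\<rho> j))"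
        "\<forall>k\<in>{k. 0 < k \<and> k < 1}. z \<in> HH \<Sigma> (snd (\<rho> k))" using P unfolding P_def by (elim bexE conjE)
      have "inv (x \<otimes> h) \<otimes> z \<in> HH \<Sigma> (snd (\<rho> j))" if j: "j \<in> Out" for j
      proof -
        have "h \<in> HH \<Sigma> (snd (\<rho> j))" using h j by (simp add: N_def H_def)
        then have "inv h \<otimes> (inv x \<otimes> z) \<in> HH \<Sigma> (snd (\<rho> j))"
          using z(2) j subgroup.m_closed[OF sub subgroup.m_inv_closed[OF sub]] by simp
        moreover have "inv (x \<otimes> h) \<otimes> z = inv h \<otimes> (inv x \<otimes> z)"
          using x NG[OF h] z(1) by (simp add: inv_mult_group m_assoc)
        ultimately show ?thesis by simp
      qed
      then show ?thesis unfolding P_def using z(1,3) by (intro bexI[of _ z] conjI ballI) simp_all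
    qed
    show "P \<rho> (fst (\<rho> 1))"
      unfolding P_def
    proof (intro bexI[of _ "fst (\<rho> 1)"] conjI ballI)
      show "inv fst (\<rho> 1) \<otimes> fst (\<rho> 1) \<in> HH \<Sigma> (snd (\<rho> j))" for j
        using cG subgroup.one_closed[OF sub] by simp
      show "fst (\<rho> 1) \<in> HH \<Sigma> (snd (\<rho> k))" if "k \<in> {k. 0 < k \<and> k < 1}" for k using below that by simp
    qed (rule cG)
  qed (use subN nN in simp_all)
  then obtain z where z: "z \<in> carrier G" "\<forall>j\<in>Out. inv (fst (\<rho> 0)) \<otimes> z \<in> HH \<Sigma> (snd (\<rho> j))"
    "\<forall>k\<in>{k. 0 < k \<and> k < 1}. z \<in> HH \<Sigma> (snd (\<rho> k))" unfolding P_def by (elim bexE conjE)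
  have cz: "fst (\<rho> 0) \<otimes> (inv (fst (\<rho> 0)) \<otimes> z) = z" using cG z(1) by (simp add: m_assoc[symmetric])
  \<comment> \<open>Below \<open>0\<close> the hypothesis puts \<open>fst (\<rho> 0)\<close> in the
    subgroup, and \<open>z\<close> differs from it by an element of that subgroup.\<close>
  have neg: "z \<in> HH \<Sigma> (snd (\<rho> j))" if "j < 0" for j
  proof -
    have "inv (fst (\<rho> 0)) \<otimes> z \<in> HH \<Sigma> (snd (\<rho> j))" using z(2) that by (simp add: Out_def)
    from subgroup.m_closed[OF sub below[OF that] this] show ?thesis by (simp add: cz)
  qed
  have "z \<in> HH \<Sigma> (snd (\<rho> 0))"
  \<comment> \<open>Positive positions go into the open unit interval, where membership of
    \<open>z\<close> is part of \<open>P\<close>; negative ones are covered by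
    \<open>neg\<close>.\<close>
  proof (rule nip_inter[OF nip fam sm ind sub, where f = "\<lambda>q. if q \<le> 0 then q else q / (1 + q)"])
    show "strict_mono (\<lambda>q :: rat. if q \<le> 0 then q else q / (1 + q))"
    proof (rule strict_monoI)
      fix q r :: rat assume "q < r"
      moreover have "q / (1 + q) < r / (1 + r)" if "0 < q" "q < r"
      proof -
        have "q * (1 + r) < r * (1 + q)" using that by (simp add: algebra_simps)
        then show ?thesis using that by (simp add: pos_divide_less_eq pos_less_divide_eq)
      qed
      moreover have "q < r / (1 + r)" if "q \<le> 0" "0 < r"
        using that by (intro order.strict_trans1[OF that(1)]) simp
      ultimately show "(if q \<le> 0 then q else q / (1 + q)) < (if r \<le> 0 then r else r / (1 + r))"
        by auto
    qed
    fix j :: rat assume j: "j \<noteq> 0"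
    show "z \<in> HH \<Sigma> (snd (\<rho> (if j \<le> 0 then j else j / (1 + j))))"
    proof (cases "j < 0")
      case True
      then show ?thesis using neg by simp
    next
      case False
      then have "j / (1 + j) \<in> {k. 0 < k \<and> k < 1}" using j by simp
      then show ?thesis using z(3) False j by simp
    qed
  qed (use z(1) in simp_all)
  moreover have "inv (fst (\<rho> 0)) \<otimes> z \<in> HH \<Sigma> (snd (\<rho> 0))"
    using z(2) N0 unfolding N_def H_def by blast
  ultimately have m: "z \<otimes> inv (inv (fst (\<rho> 0)) \<otimes> z) \<in> HH \<Sigma> (snd (\<rho> 0))"
    by (rule subgroup.m_closed[OF sub _ subgroup.m_inv_closed[OF sub]])
  have e: "z \<otimes> inv (inv (fst (\<rho> 0)) \<otimes> z) = fst (\<rho> 0)"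
    using z(1) cG by (simp add: inv_mult_group m_assoc[symmetric])
  show ?thesis using m unfolding e .
qed

section \<open>The smallest subgroup with stable quotient\<close>

text \<open>Only \<open>Q\<close> has to be type-defined over the smaller coordinate set, since the
  separating predicate negates finitely many of its conditions. This is how parameters are
  eliminated from a neighbourhood.\<close>

lemma tdf_separate:
  assumes cpt: "cpt L M X \<V>" and sub: "\<U> \<subseteq> \<V>" and P: "tdf L M X \<V> P" and Q: "tdf L M X \<U> Q"
    and disj: "\<And>x. x \<in> X \<Longrightarrow> P x \<Longrightarrow> Q x \<Longrightarrow> False"
  shows "\<exists>R. dfn L M X \<U> R \<and> (\<forall>x\<in>X. P x \<longrightarrow> R x) \<and> (\<forall>x\<in>X. Q x \<longrightarrow> \<not> R x)"
proof -
  obtain \<P> where \<P>: "\<forall>S\<in>\<P>. dfn L M X \<V> S" "\<forall>x\<in>X. P x \<longleftrightarrow> (\<forall>S\<in>\<P>. S x)"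
    using P unfolding tdf_def by (elim exE conjE)
  obtain \<Q> where \<Q>: "\<forall>S\<in>\<Q>. dfn L M X \<U> S" "\<forall>x\<in>X. Q x \<longleftrightarrow> (\<forall>S\<in>\<Q>. S x)"
    using Q unfolding tdf_def by (elim exE conjE)
  have "\<exists>K. K \<subseteq> \<P> \<union> \<Q> \<and> finite K \<and> (\<forall>x\<in>X. (\<forall>S\<in>K. S x) \<longrightarrow> False)"
  proof (rule cpt_imp[OF cpt _ dfn_const])
    show "dfn L M X \<V> S" if "S \<in> \<P> \<union> \<Q>" for S
      using that
    proof
      assume "S \<in> \<P>"
      then show ?thesis by (rule bspec[OF \<P>(1)])
    next
      assume "S \<in> \<Q>"
      then show ?thesis by (intro dfn_mono[OF bspec[OF \<Q>(1)] order_refl sub])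
    qed
    fix x assume x: "x \<in> X" and *: "\<And>S. S \<in> \<P> \<union> \<Q> \<Longrightarrow> S x"
    have "P x" by (rule iffD2[OF bspec[OF \<P>(2) x]], rule ballI, rule *, erule UnI1)
    moreover have "Q x" by (rule iffD2[OF bspec[OF \<Q>(2) x]], rule ballI, rule *, erule UnI2)
    ultimately show False by (rule disj[OF x])
  qed
  then obtain K where K: "K \<subseteq> \<P> \<union> \<Q>" "finite K" "\<forall>x\<in>X. (\<forall>S\<in>K. S x) \<longrightarrow> False"
    by (elim exE conjE)
  define R where "R x \<longleftrightarrow> \<not> (\<forall>S\<in>K \<inter> \<Q>. S x)" for x
  have "dfn L M X \<U> R"
    unfolding R_def by (rule dfn_not, rule dfn_ball_finite) (use K(2) \<Q>(1) in auto)
  moreover have "\<forall>x\<in>X. P x \<longrightarrow> R x"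
  proof (intro ballI impI)
    fix x assume x: "x \<in> X" "P x"
    have p: "\<forall>S\<in>\<P>. S x" using iffD1[OF bspec[OF \<P>(2) x(1)] x(2)] .
    show "R x"
      unfolding R_def
    proof
      assume q: "\<forall>S\<in>K \<inter> \<Q>. S x"
      have "\<forall>S\<in>K. S x"
      proof
        fix S assume S: "S \<in> K"
        show "S x"
        proof (cases "S \<in> \<Q>")
          case True
          show ?thesis by (rule bspec[OF q IntI[OF S True]])
        next
          case False
          then have "S \<in> \<P>" using K(1) S by auto
          then show ?thesis by (rule bspec[OF p])
        qed
      qed
      then show False by (rule mp[OF bspec[OF K(3) x(1)]])
    qed
  qed
  moreover have "\<forall>x\<in>X. Q x \<longrightarrow> \<not> R x"
  proof (intro ballI impI)
    fix x assume x: "x \<in> X" "Q x"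
    have q: "\<forall>S\<in>\<Q>. S x" using iffD1[OF bspec[OF \<Q>(2) x(1)] x(2)] .
    show "\<not> R x"
      unfolding R_def not_not
    proof
      fix S assume "S \<in> K \<inter> \<Q>"
      then show "S x" by (rule bspec[OF q IntD2])
    qed
  qed
  ultimately show ?thesis by (intro exI[of _ R] conjI)
qed

text \<open>The witnesses mention \<open>H\<close> only through
  \<open>H \<subseteq> \<theta>\<close>, so they serve every subset of \<open>\<theta>\<close>.
  Instability of an infinite intersection thereby passes to finite ones.\<close>

lemma unst_nbhd:
  assumes "unst H"
  shows "\<exists>\<theta>. dfn L M (carrier G) (co \<Gamma> U) (\<lambda>x. x \<in> \<theta>) \<and> H \<subseteq> \<theta> \<and> (\<forall>K\<subseteq>\<theta>. unst K)"
proof -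
  obtain D :: "nat \<Rightarrow> 's option" and S \<theta> c b where
    S: "dfn L M (tuples M D \<times> carrier G) (prodc (co D {}) gco) (\<lambda>p. S (fst p) (snd p))"
    and \<theta>: "dfn L M (carrier G) (co \<Gamma> U) (\<lambda>x. x \<in> \<theta>)" "H \<subseteq> \<theta>"
    and c: "\<forall>i :: nat. c i \<in> carrier G" "\<forall>j. b j \<in> tuples M D" "\<forall>i j. i < j \<longrightarrow> S (b j) (c i)"
    "\<forall>i j. j < i \<longrightarrow> \<not> (\<exists>x\<in>carrier G. S (b j) x \<and> inv x \<otimes> c i \<in> \<theta>)"
    using assms unfolding unst_def by (elim exE conjE)
  have "unst K" if "K \<subseteq> \<theta>" for K
    unfolding unst_def
    by (rule exI[of _ D], rule exI[of _ S], rule exI[of _ \<theta>], rule exI[of _ c], rule exI[of _ b])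
      (intro conjI S \<theta>(1) that c)
  then show ?thesis using \<theta> by (intro exI[of _ \<theta>] conjI allI impI)
qed

text \<open>Each parameter becomes a variable indexed by itself, and the identity on
  \<open>A\<close> is the tuple that gives back the original formula.\<close>

lemma unparam:
  assumes Q: "dfn L M (carrier G) (co \<Gamma> A) Q" and A: "A \<subseteq> U"
  shows "\<exists>Q'. dfn L M (tuples M (srt M |` A) \<times> carrier G) (prodc (co (srt M |` A) {}) gco) (\<lambda>p. Q' (fst p) (snd p)) \<and>
    (\<forall>x\<in>carrier G. Q x \<longleftrightarrow> Q' (restrict (\<lambda>a. a) A) x)"
proof -
  let ?D = "srt M |` A" and ?a = "restrict (\<lambda>a. a) A"
  let ?X = "tuples M ?D \<times> carrier G"
  have domD: "dom ?D = A" using A by auto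
  obtain \<phi> where "wf_fm L (cx M (carrier G) (co \<Gamma> A)) [] \<phi>" "\<forall>z\<in>carrier G. Q z \<longleftrightarrow> sat M (\<lambda>u. u z) [] \<phi>"
    "\<forall>u\<in>fv \<phi>. u \<in> co \<Gamma> A" "\<forall>u\<in>fv \<phi>. \<forall>z\<in>carrier G. srt M (u z) = cx M (carrier G) (co \<Gamma> A) u"
    by (rule exE[OF dfnE[OF Q]], elim conjE, rule that)
  note \<phi> = this
  have "\<forall>u\<in>fv \<phi>. \<exists>v. v \<in> prodc (co ?D {}) gco \<and>
      (\<forall>p\<in>?X. srt M (v p) = cx M (carrier G) (co \<Gamma> A) u) \<and> (\<forall>x\<in>carrier G. v (?a, x) = u x)"
  proof
    fix u assume u: "u \<in> fv \<phi>"
    have one: "srt M (u \<one>) = cx M (carrier G) (co \<Gamma> A) u" using bspec[OF bspec[OF \<phi>(4) u] one_closed] .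
    have "(\<exists>i\<in>dom \<Gamma>. u = (\<lambda>x. x i)) \<or> (\<exists>a\<in>A. u = (\<lambda>x. a))"
      using bspec[OF \<phi>(3) u] unfolding co_def by blast
    then show "\<exists>v. v \<in> prodc (co ?D {}) gco \<and>
      (\<forall>p\<in>?X. srt M (v p) = cx M (carrier G) (co \<Gamma> A) u) \<and> (\<forall>x\<in>carrier G. v (?a, x) = u x)"
    proof (elim disjE bexE)
      fix i assume i: "i \<in> dom \<Gamma>" "u = (\<lambda>x. x i)"
      have s: "srt M (x i) = \<Gamma> i" if "x \<in> carrier G" for x
        by (rule tuples_sort[OF subsetD[OF carrier_tuples that] i(1)])
      have "(\<lambda>p :: ('a \<Rightarrow> 'a) \<times> ('i \<Rightarrow> 'a). snd p i) \<in> prodc (co ?D {}) gco" by (rule prodcI2[OF coI[OF i(1)]])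
      moreover have "\<forall>p\<in>?X. srt M (snd p i) = cx M (carrier G) (co \<Gamma> A) u"
        using s s[OF one_closed] one i(2) by (auto simp: mem_Times_iff)
      ultimately show ?thesis using i(2) by (intro exI[of _ "\<lambda>p. snd p i"]) simp
    next
      fix a assume a: "a \<in> A" "u = (\<lambda>x. a)"
      have "(\<lambda>p :: ('a \<Rightarrow> 'a) \<times> ('i \<Rightarrow> 'a). fst p a) \<in> prodc (co ?D {}) gco"
        by (rule prodcI1, rule coI) (use a domD in simp)
      moreover have "\<forall>p\<in>?X. srt M (fst p a) = cx M (carrier G) (co \<Gamma> A) u"
      proof
        fix p assume "p \<in> ?X"
        then have "fst p \<in> tuples M ?D" by (simp add: mem_Times_iff)
        from tuples_sort[OF this, unfolded domD, OF a(1)] show "srt M (fst p a) = cx M (carrier G) (co \<Gamma> A) u"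
          using a one by simp
      qed
      ultimately show ?thesis using a by (intro exI[of _ "\<lambda>p. fst p a"]) simp
    qed
  qed
  from bchoice[OF this] obtain \<alpha> where \<alpha>: "\<forall>u\<in>fv \<phi>. \<alpha> u \<in> prodc (co ?D {}) gco \<and>
      (\<forall>p\<in>?X. srt M (\<alpha> u p) = cx M (carrier G) (co \<Gamma> A) u) \<and> (\<forall>x\<in>carrier G. \<alpha> u (?a, x) = u x)"
    by (elim exE)
  define Q' where "Q' a x \<longleftrightarrow> sat M (\<lambda>u. \<alpha> u (a, x)) [] \<phi>" for a x
  have "dfn L M ?X (prodc (co ?D {}) gco) (\<lambda>p. Q' (fst p) (snd p))"
  proof (rule dfnI[OF \<phi>(1), of \<alpha>])
    show "\<alpha> v \<in> prodc (co ?D {}) gco" if "v \<in> fv \<phi>" for v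
      by (rule conjunct1[OF bspec[OF \<alpha> that]])
    show "srt M (\<alpha> v p) = cx M (carrier G) (co \<Gamma> A) v" if "v \<in> fv \<phi>" "p \<in> ?X" for v p
      by (rule bspec[OF conjunct1[OF conjunct2[OF bspec[OF \<alpha> that(1)]]] that(2)])
  qed (simp add: Q'_def)
  moreover have "\<forall>x\<in>carrier G. Q x \<longleftrightarrow> Q' ?a x"
  proof
    fix x assume x: "x \<in> carrier G"
    have "sat M (\<lambda>u. \<alpha> u (?a, x)) [] \<phi> \<longleftrightarrow> sat M (\<lambda>u. u x) [] \<phi>"
      by (rule sat_cong) (use \<alpha> x in simp)
    then show "Q x \<longleftrightarrow> Q' ?a x" unfolding Q'_def using bspec[OF \<phi>(2) x] by simp
  qed
  ultimately show ?thesis by (intro exI[of _ Q'] conjI)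
qed

lemma ex_fam:
  assumes H: "H \<subseteq> carrier G" "tdf L M (carrier G) (co \<Gamma> A) (\<lambda>x. x \<in> H)" and A: "A \<subseteq> U"
  shows "\<exists>\<Sigma>. fam (srt M |` A) \<Sigma> \<and> H = HH \<Sigma> (restrict (\<lambda>a. a) A)"
proof -
  obtain \<P> where \<P>: "\<forall>S\<in>\<P>. dfn L M (carrier G) (co \<Gamma> A) S" "\<forall>x\<in>carrier G. x \<in> H \<longleftrightarrow> (\<forall>S\<in>\<P>. S x)"
    using H(2) unfolding tdf_def by (elim exE conjE)
  have "\<forall>S\<in>\<P>. \<exists>Q'. dfn L M (tuples M (srt M |` A) \<times> carrier G) (prodc (co (srt M |` A) {}) gco) (\<lambda>p. Q' (fst p) (snd p)) \<and>
    (\<forall>x\<in>carrier G. S x \<longleftrightarrow> Q' (restrict (\<lambda>a. a) A) x)"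
    by (rule ballI, rule unparam[OF bspec[OF \<P>(1)] A])
  from bchoice[OF this] obtain Q where Q: "\<forall>S\<in>\<P>. dfn L M (tuples M (srt M |` A) \<times> carrier G)
    (prodc (co (srt M |` A) {}) gco) (\<lambda>p. Q S (fst p) (snd p)) \<and> (\<forall>x\<in>carrier G. S x \<longleftrightarrow> Q S (restrict (\<lambda>a. a) A) x)"
    by (elim exE)
  have "fam (srt M |` A) (Q ` \<P>)"
    unfolding fam_def by (rule ballI, elim imageE, hypsubst) (rule conjunct1[OF bspec[OF Q]])
  moreover have "H = HH (Q ` \<P>) (restrict (\<lambda>a. a) A)"
  proof (rule Set.set_eqI)
    fix x
    show "x \<in> H \<longleftrightarrow> x \<in> HH (Q ` \<P>) (restrict (\<lambda>a. a) A)"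
    proof (cases "x \<in> carrier G")
      case True
      have "S x \<longleftrightarrow> Q S (restrict (\<lambda>a. a) A) x" if "S \<in> \<P>" for S
        using bspec[OF conjunct2[OF bspec[OF Q that]] True] .
      then have "(\<forall>S\<in>\<P>. S x) \<longleftrightarrow> (\<forall>S\<in>\<P>. Q S (restrict (\<lambda>a. a) A) x)" by (rule ball_cong[OF refl])
      then show ?thesis unfolding bspec[OF \<P>(2) True] HH_def mem_Collect_eq ball_simps using True by simp
    next
      case False
      then show ?thesis using H(1) by (auto simp: HH_def)
    qed
  qed
  ultimately show ?thesis by (intro exI[of _ "Q ` \<P>"] conjI)
qed

text \<open>The set \<open>F\<close> may depend on \<open>\<sigma>\<close>; the uniformity lies in
  the conjugate \<open>a\<close> at which \<open>\<sigma>\<close> is read. A counterexample for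
  every finite \<open>F\<close> would produce the descending configuration that
  \<open>no_descent\<close> forbids.\<close>

lemma fam_finite_bound:
  assumes nip: "nip L M" and fam: "fam \<Delta> \<Sigma>" and sm: "small M (dom \<Delta>)" and a0: "a0 \<in> tuples M \<Delta>"
    and sub: "subgroup (HH \<Sigma> a0) G" and st: "\<not> unst (HH \<Sigma> a0)" and \<sigma>: "\<sigma> \<in> \<Sigma>"
  shows "\<exists>F. finite F \<and> a0 \<in> F \<and> (\<forall>a\<in>F. eqt \<Delta> a0 a) \<and>
    (\<forall>x\<in>carrier G. (\<forall>a\<in>F. x \<in> HH \<Sigma> a) \<longrightarrow> (\<forall>a. eqt \<Delta> a0 a \<longrightarrow> \<sigma> a x))"
proof (rule ccontr)
  assume no: "\<not> ?thesis"
  have "\<forall>F. \<exists>p. finite F \<longrightarrow> a0 \<in> F \<longrightarrow> (\<forall>a\<in>F. eqt \<Delta> a0 a) \<longrightarrow>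
      fst p \<in> carrier G \<and> (\<forall>a\<in>F. fst p \<in> HH \<Sigma> a) \<and> eqt \<Delta> a0 (snd p) \<and> \<not> \<sigma> (snd p) (fst p)"
  proof
    fix F
    show "\<exists>p. finite F \<longrightarrow> a0 \<in> F \<longrightarrow> (\<forall>a\<in>F. eqt \<Delta> a0 a) \<longrightarrow>
      fst p \<in> carrier G \<and> (\<forall>a\<in>F. fst p \<in> HH \<Sigma> a) \<and> eqt \<Delta> a0 (snd p) \<and> \<not> \<sigma> (snd p) (fst p)"
    proof (cases "finite F \<and> a0 \<in> F \<and> (\<forall>a\<in>F. eqt \<Delta> a0 a)")
      case True
      have "\<not> (\<forall>x\<in>carrier G. (\<forall>a\<in>F. x \<in> HH \<Sigma> a) \<longrightarrow> (\<forall>a. eqt \<Delta> a0 a \<longrightarrow> \<sigma> a x))"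
      proof
        assume "\<forall>x\<in>carrier G. (\<forall>a\<in>F. x \<in> HH \<Sigma> a) \<longrightarrow> (\<forall>a. eqt \<Delta> a0 a \<longrightarrow> \<sigma> a x)"
        show False
        proof (rule notE[OF no], rule exI[of _ F], intro conjI)
          show "finite F" "a0 \<in> F" "\<forall>a\<in>F. eqt \<Delta> a0 a" using True by simp_all
        qed fact
      qed
      then obtain x a where "x \<in> carrier G" "\<forall>a\<in>F. x \<in> HH \<Sigma> a" "eqt \<Delta> a0 a" "\<not> \<sigma> a x"
        unfolding Ball_def not_all not_imp by (elim exE conjE)
      then show ?thesis by (intro exI[of _ "(x, a)"] impI) (simp only: fst_conv snd_conv simp_thms)
    next
      case False
      then show ?thesis by (intro exI impI) (elim notE, intro conjI)
    qed
  qed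
  from choice[OF this] obtain g where g: "\<forall>F. finite F \<longrightarrow> a0 \<in> F \<longrightarrow> (\<forall>a\<in>F. eqt \<Delta> a0 a) \<longrightarrow>
      fst (g F) \<in> carrier G \<and> (\<forall>a\<in>F. fst (g F) \<in> HH \<Sigma> a) \<and> eqt \<Delta> a0 (snd (g F)) \<and> \<not> \<sigma> (snd (g F)) (fst (g F))"
    by (elim exE)
  \<comment> \<open>Each step adds the tuple at which \<open>\<sigma>\<close> has just failed, so
    every later group element lies in the subgroups of all earlier tuples.\<close>
  define F where "F n = rec_nat {a0} (\<lambda>_ F. insert (snd (g F)) F) n" for n :: nat
  have F0: "F 0 = {a0}" and FS: "F (Suc n) = insert (snd (g (F n))) (F n)" for n by (simp_all add: F_def)
  have e0: "eqt \<Delta> a0 a0" unfolding eqt_def by (intro conjI a0 allI impI refl)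
  have inv: "finite (F n) \<and> a0 \<in> F n \<and> (\<forall>a\<in>F n. eqt \<Delta> a0 a)" for n
  proof (induction n)
    case 0
    then show ?case using e0 by (simp add: F0)
  next
    case (Suc n)
    then have "eqt \<Delta> a0 (snd (g (F n)))" using g by simp
    then show ?case using Suc by (simp add: FS)
  qed
  define e where "e n = g (F n)" for n
  have e: "fst (e n) \<in> carrier G" "\<And>a. a \<in> F n \<Longrightarrow> fst (e n) \<in> HH \<Sigma> a" "eqt \<Delta> a0 (snd (e n))"
    "\<not> \<sigma> (snd (e n)) (fst (e n))" for n
    using g[rule_format, of "F n"] inv[of n] by (simp_all add: e_def)
  have memF: "snd (e m) \<in> F n" if "m < n" for m n
    using that by (induction n) (auto simp: FS e_def less_Suc_eq)
  have eX: "e n \<in> Xb \<Delta>" for n using e(1,3)[of n] by (simp add: mem_Times_iff eqt_def)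
  obtain \<rho> where ind: "indisc L M (Xb \<Delta>) (Ub \<Delta>) {} \<rho>" and em: "em_of L M (Xb \<Delta>) (Ub \<Delta>) {} e \<rho>"
    using em_blocks[where e = e, OF sm small_finite[OF finite.emptyI] eX] by (elim exE conjE)
  have \<rho>: "\<rho> \<in> seqs (Xb \<Delta>)" using ind by (simp add: indisc_def)
  \<comment> \<open>The type over the empty set is constant along \<open>e\<close> and so belongs to
    its Ehrenfeucht-Mostowski type: the tuples of \<open>\<rho>\<close> are still conjugates of
    \<open>a0\<close>.\<close>
  have eq: "eqt \<Delta> a0 (snd (\<rho> q))" for q
    unfolding eqt_def
  proof (intro conjI a0 allI impI)
    show "snd (\<rho> q) \<in> tuples M \<Delta>" using seqsD[OF \<rho>, of q] by (simp add: mem_Times_iff)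
    fix P assume P: "dfn L M (tuples M \<Delta>) (co \<Delta> {}) P"
    show "P a0 = P (snd (\<rho> q))"
    proof (rule em_dfn[OF em, of q q])
      show "dfn L M (seqs (Xb \<Delta>)) (sco (Ub \<Delta>) {q, q} {}) (\<lambda>\<pi>. P a0 = P (snd (\<pi> q)))"
        by (intro dfn_iff dfn_const dfn_cm[OF P cm_at_snd]) simp
      fix f :: "rat \<Rightarrow> nat"
      show "P a0 = P (snd ((e \<circ> f) q))" using e(3)[of "f q"] P unfolding eqt_def comp_def by (elim conjE allE impE)
    qed
  qed
  have "fst (\<rho> 0) \<in> HH \<Sigma> (snd (\<rho> 0))"
  proof (rule no_descent[OF nip fam sm ind])
    show "subgroup (HH \<Sigma> (snd (\<rho> q))) G" for q by (rule subgroup_transfer[OF fam sm eq sub])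
    show "\<not> unst (HH \<Sigma> (snd (\<rho> q)))" for q using unst_transfer[OF fam sm eq] st by (rule contrapos_nn[rotated])
    show "fst (\<rho> q) \<in> HH \<Sigma> (snd (\<rho> r))" if "r < q" for q r
    proof (rule em_of_tdf[OF em \<rho>, where I = "{q, r}"])
      show "e \<in> seqs (Xb \<Delta>)" using eX by (simp add: seqs_def)
      show "tdf L M (seqs (Xb \<Delta>)) (sco (Ub \<Delta>) {q, r} {}) (\<lambda>\<pi>. fst (\<pi> q) \<in> HH \<Sigma> (snd (\<pi> r)))"
        by (rule tdf_HH[OF fam cm_at_snd dtm_at]) simp_all
      fix f :: "rat \<Rightarrow> nat" assume "strict_mono_on {q, r} f"
      then have "f r < f q" using that by (simp add: strict_mono_onD)
      then show "fst ((e \<circ> f) q) \<in> HH \<Sigma> (snd ((e \<circ> f) r))" unfolding comp_def by (intro e(2) memF)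
    qed simp
  qed
  then have "\<sigma> (snd (\<rho> 0)) (fst (\<rho> 0))" by (rule HH_D[OF _ \<sigma>])
  moreover have "\<not> \<sigma> (snd (\<rho> 0)) (fst (\<rho> 0))"
  proof (rule em_dfn[OF em, of 0 0])
    show "dfn L M (seqs (Xb \<Delta>)) (sco (Ub \<Delta>) {0, 0} {}) (\<lambda>\<pi>. \<not> \<sigma> (snd (\<pi> 0)) (fst (\<pi> 0)))"
      by (intro dfn_not dfn_rel[OF famD[OF fam \<sigma>] cm_at_snd dtm_at]) simp_all
    show "\<not> \<sigma> (snd ((e \<circ> f) 0)) (fst ((e \<circ> f) 0))" for f :: "rat \<Rightarrow> nat" unfolding comp_def by (rule e(4))
  qed
  ultimately show False by (rule notE[rotated])
qed

text \<open>All conjugates together need not have a small set of parameters. For each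
  \<open>\<sigma>\<close> a parameter-free definable \<open>R \<sigma>\<close> is squeezed between a
  finite intersection of conjugates and the set where \<open>\<sigma>\<close> holds at every
  conjugate; jointly the \<open>R \<sigma>\<close> cut out the intersection of all
  conjugates.\<close>

lemma ex_invariant_subgroup:
  assumes nip: "nip L M" and H: "subgroup H G" and A: "small M A" "A \<subseteq> U"
    and dH: "tdf L M (carrier G) (co \<Gamma> A) (\<lambda>x. x \<in> H)" and st: "\<not> unst H"
  shows "\<exists>N\<subseteq>H. subgroup N G \<and> tdf L M (carrier G) gco (\<lambda>x. x \<in> N) \<and> \<not> unst N"
proof -
  define D where "D = srt M |` A"
  define a0 where "a0 = restrict (\<lambda>a. a) A"
  have domD: "dom D = A" using A(2) by (auto simp: D_def)
  have sm: "small M (dom D)" using A(1) domD by simp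
  have a0: "a0 \<in> tuples M D" using restrict_tuples[of D M "\<lambda>a. a"] domD by (simp add: a0_def D_def)
  obtain \<Sigma> where fam: "fam D \<Sigma>" and H\<Sigma>: "H = HH \<Sigma> a0"
    using ex_fam[OF subgroup.subset[OF H] dH A(2)] unfolding D_def a0_def by (elim exE conjE)
  have sub: "subgroup (HH \<Sigma> a0) G" and st0: "\<not> unst (HH \<Sigma> a0)" using H st unfolding H\<Sigma> by auto
  have e0: "eqt D a0 a0" unfolding eqt_def by (intro conjI a0 allI impI refl)
  have "\<forall>\<sigma>\<in>\<Sigma>. \<exists>F. finite F \<and> a0 \<in> F \<and> (\<forall>a\<in>F. eqt D a0 a) \<and>
    (\<forall>x\<in>carrier G. (\<forall>a\<in>F. x \<in> HH \<Sigma> a) \<longrightarrow> (\<forall>a. eqt D a0 a \<longrightarrow> \<sigma> a x))"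
    by (rule ballI, rule fam_finite_bound[OF nip fam sm a0 sub st0])
  from bchoice[OF this] obtain F where F: "\<forall>\<sigma>\<in>\<Sigma>. finite (F \<sigma>) \<and> a0 \<in> F \<sigma> \<and> (\<forall>a\<in>F \<sigma>. eqt D a0 a) \<and>
    (\<forall>x\<in>carrier G. (\<forall>a\<in>F \<sigma>. x \<in> HH \<Sigma> a) \<longrightarrow> (\<forall>a. eqt D a0 a \<longrightarrow> \<sigma> a x))"
    by (elim exE)
  have Fe: "a \<in> tuples M D" if "\<sigma> \<in> \<Sigma>" "a \<in> F \<sigma>" for \<sigma> a
    using bspec[OF conjunct1[OF conjunct2[OF conjunct2[OF bspec[OF F that(1)]]]] that(2)] unfolding eqt_def by (elim conjE)
  have "\<forall>\<sigma>\<in>\<Sigma>. \<exists>R. dfn L M (carrier G) gco R \<and> (\<forall>x\<in>carrier G. (\<forall>a\<in>F \<sigma>. x \<in> HH \<Sigma> a) \<longrightarrow> R x) \<and>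
    (\<forall>x\<in>carrier G. (\<exists>a\<in>tuples M D. (\<forall>P\<in>{P. dfn L M (tuples M D) (co D {}) P}. P a0 \<longleftrightarrow> P a) \<and> \<not> \<sigma> a x) \<longrightarrow> \<not> R x)"
  proof
    fix \<sigma> assume \<sigma>: "\<sigma> \<in> \<Sigma>"
    let ?B = "\<Union>a\<in>F \<sigma>. a ` A"
    have "small M ?B"
    proof -
      have "small M (F \<sigma> \<times> A)" by (intro small_times A(1) countable_finite) (use F \<sigma> in simp)
      then have "small M ((\<lambda>(a, i). a i) ` (F \<sigma> \<times> A))" by (rule small_image)
      moreover have "(\<lambda>(a, i). a i) ` (F \<sigma> \<times> A) = ?B" by auto
      ultimately show ?thesis by simp
    qed
    then have cpt: "cpt L M (carrier G) (co \<Gamma> ?B)" by (rule cpt_carrier)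
    show "\<exists>R. dfn L M (carrier G) gco R \<and> (\<forall>x\<in>carrier G. (\<forall>a\<in>F \<sigma>. x \<in> HH \<Sigma> a) \<longrightarrow> R x) \<and>
      (\<forall>x\<in>carrier G. (\<exists>a\<in>tuples M D. (\<forall>P\<in>{P. dfn L M (tuples M D) (co D {}) P}. P a0 \<longleftrightarrow> P a) \<and> \<not> \<sigma> a x) \<longrightarrow> \<not> R x)"
    proof (rule tdf_separate[OF cpt])
      show "gco \<subseteq> co \<Gamma> ?B" by (rule co_mono) simp
      show "tdf L M (carrier G) (co \<Gamma> ?B) (\<lambda>x. \<forall>a\<in>F \<sigma>. x \<in> HH \<Sigma> a)"
      proof (rule tdf_all)
        fix a assume a: "a \<in> F \<sigma>"
        show "tdf L M (carrier G) (co \<Gamma> ?B) (\<lambda>x. x \<in> HH \<Sigma> a)"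
          by (rule tdf_mono[OF tdf_HH_fix[OF fam Fe[OF \<sigma> a]] order_refl co_mono]) (use a domD in auto)
      qed
      \<comment> \<open>Having the type of \<open>a0\<close> needs no parameters: for each
        \<open>P\<close> the value \<open>P a0\<close> is a fixed truth value.\<close>
      show "tdf L M (carrier G) gco
        (\<lambda>x. \<exists>a\<in>tuples M D. (\<forall>P\<in>{P. dfn L M (tuples M D) (co D {}) P}. P a0 \<longleftrightarrow> P a) \<and> \<not> \<sigma> a x)"
      proof (rule tdf_ex_tuples[OF small_gco sm], rule tdf_conj, rule tdf_all)
        fix P assume "P \<in> {P. dfn L M (tuples M D) (co D {}) P}"
        then have P: "dfn L M (tuples M D) (co D {}) P" unfolding mem_Collect_eq .
        show "tdf L M (carrier G \<times> tuples M D) (prodc gco (co D {})) (\<lambda>p. P a0 \<longleftrightarrow> P (snd p))"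
          by (intro tdf_of_dfn dfn_iff dfn_const dfn_cm[OF P cm_snd])
      next
        show "tdf L M (carrier G \<times> tuples M D) (prodc gco (co D {})) (\<lambda>p. \<not> \<sigma> (snd p) (fst p))"
          by (intro tdf_of_dfn dfn_not dfn_rel[OF famD[OF fam \<sigma>] cm_snd dtm_var[OF cm_fst]])
      qed
      fix x assume x: "x \<in> carrier G" "\<forall>a\<in>F \<sigma>. x \<in> HH \<Sigma> a"
        "\<exists>a\<in>tuples M D. (\<forall>P\<in>{P. dfn L M (tuples M D) (co D {}) P}. P a0 \<longleftrightarrow> P a) \<and> \<not> \<sigma> a x"
      from x(3) obtain a where a: "a \<in> tuples M D" "\<forall>P\<in>{P. dfn L M (tuples M D) (co D {}) P}. P a0 \<longleftrightarrow> P a"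
        "\<not> \<sigma> a x" by (elim bexE conjE)
      have "eqt D a0 a" unfolding eqt_def
        by (intro conjI a0 a(1) allI impI, rule bspec[OF a(2)], rule CollectI)
      then have "\<sigma> a x"
        by (rule mp[OF spec[OF mp[OF bspec[OF conjunct2[OF conjunct2[OF conjunct2[OF bspec[OF F \<sigma>]]]] x(1)] x(2)]]])
      then show False by (rule notE[OF a(3)])
    qed
  qed
  from bchoice[OF this] obtain R where "\<forall>\<sigma>\<in>\<Sigma>. dfn L M (carrier G) gco (R \<sigma>) \<and> (\<forall>x\<in>carrier G. (\<forall>a\<in>F \<sigma>. x \<in> HH \<Sigma> a) \<longrightarrow> R \<sigma> x) \<and>
    (\<forall>x\<in>carrier G. (\<exists>a\<in>tuples M D. (\<forall>P\<in>{P. dfn L M (tuples M D) (co D {}) P}. P a0 \<longleftrightarrow> P a) \<and> \<not> \<sigma> a x) \<longrightarrow> \<not> R \<sigma> x)"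
    by (elim exE)
  note R = bspec[OF this]
  have R1: "R \<sigma> x" if "\<sigma> \<in> \<Sigma>" "x \<in> carrier G" "\<And>a. a \<in> F \<sigma> \<Longrightarrow> x \<in> HH \<Sigma> a" for \<sigma> x
    by (rule mp[OF bspec[OF conjunct1[OF conjunct2[OF R[OF that(1)]]] that(2)]], rule ballI, rule that(3))
  have R2: "\<sigma> a x" if \<sigma>: "\<sigma> \<in> \<Sigma>" and x: "x \<in> carrier G" and Rx: "R \<sigma> x" and a: "eqt D a0 a" for \<sigma> a x
  proof (rule ccontr)
    assume n: "\<not> \<sigma> a x"
    have "a \<in> tuples M D" by (rule conjunct1[OF conjunct2[OF a[unfolded eqt_def]]])
    moreover have "\<forall>P\<in>{P. dfn L M (tuples M D) (co D {}) P}. P a0 \<longleftrightarrow> P a"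
      by (rule ballI, elim CollectE, rule mp[OF spec[OF conjunct2[OF conjunct2[OF a[unfolded eqt_def]]]]])
    ultimately have "\<exists>a\<in>tuples M D. (\<forall>P\<in>{P. dfn L M (tuples M D) (co D {}) P}. P a0 \<longleftrightarrow> P a) \<and> \<not> \<sigma> a x"
      by (intro bexI[of _ a] conjI n)
    then show False by (rule notE[OF mp[OF bspec[OF conjunct2[OF conjunct2[OF R[OF \<sigma>]]] x]] Rx])
  qed
  define N where "N = \<Inter>(HH \<Sigma> ` {a. eqt D a0 a})"
  have NH: "N \<subseteq> H" unfolding N_def H\<Sigma> using e0 by blast
  have Nc: "N \<subseteq> carrier G" using NH subgroup.subset[OF H] by auto
  have NI: "x \<in> N" if x: "x \<in> carrier G" "\<And>\<sigma>. \<sigma> \<in> \<Sigma> \<Longrightarrow> R \<sigma> x" for x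
    unfolding N_def
  proof (rule InterI, elim imageE, hypsubst)
    fix a assume "a \<in> {a. eqt D a0 a}"
    then have a: "eqt D a0 a" by simp
    show "x \<in> HH \<Sigma> a"
    proof (rule HH_I[OF x(1)])
      fix \<sigma> assume s: "\<sigma> \<in> \<Sigma>"
      show "\<sigma> a x" by (rule R2[OF s x(1) x(2)[OF s] a])
    qed
  qed
  have ND: "R \<sigma> x" if \<sigma>: "\<sigma> \<in> \<Sigma>" and x: "x \<in> N" for \<sigma> x
  proof (rule R1[OF \<sigma> subsetD[OF Nc x]])
    fix a assume "a \<in> F \<sigma>"
    then have "eqt D a0 a" by (rule bspec[OF conjunct1[OF conjunct2[OF conjunct2[OF bspec[OF F \<sigma>]]]]])
    then show "x \<in> HH \<Sigma> a" using x unfolding N_def by blast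
  qed
  have "subgroup N G"
    unfolding N_def
  proof (rule subgroups_Inter)
    show "subgroup K G" if K: "K \<in> HH \<Sigma> ` {a. eqt D a0 a}" for K
    proof -
      obtain a where "K = HH \<Sigma> a" "eqt D a0 a" using K by (elim imageE CollectE)
      then show ?thesis using subgroup_transfer[OF fam sm _ sub] by simp
    qed
    show "HH \<Sigma> ` {a. eqt D a0 a} \<noteq> {}" using e0 by blast
  qed
  moreover have "tdf L M (carrier G) gco (\<lambda>x. x \<in> N)"
  proof -
    have "tdf L M (carrier G) gco (\<lambda>x. \<forall>\<sigma>\<in>\<Sigma>. R \<sigma> x)"
      by (rule tdf_all, rule tdf_of_dfn, rule conjunct1[OF R])
    then show ?thesis
    proof (rule tdf_cong[THEN iffD1, rotated])
      fix x assume x: "x \<in> carrier G"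
      show "(\<forall>\<sigma>\<in>\<Sigma>. R \<sigma> x) = (x \<in> N)"
      proof
        assume r: "\<forall>\<sigma>\<in>\<Sigma>. R \<sigma> x"
        show "x \<in> N" by (rule NI[OF x bspec[OF r]])
      next
        assume n: "x \<in> N"
        show "\<forall>\<sigma>\<in>\<Sigma>. R \<sigma> x" by (rule ballI, rule ND[OF _ n])
      qed
    qed
  qed
  \<comment> \<open>A definable neighbourhood of \<open>N\<close> contains the intersection of
    finitely many \<open>R \<sigma>\<close>, hence a finite intersection of conjugates, each of
    which inherits from \<open>H\<close> that it is not \<open>unst\<close>.\<close>
  moreover have "\<not> unst N"
  proof
    assume "unst N"
    from unst_nbhd[OF this] obtain \<theta> where \<theta>: "dfn L M (carrier G) (co \<Gamma> U) (\<lambda>x. x \<in> \<theta>)" "N \<subseteq> \<theta>" "\<forall>K\<subseteq>\<theta>. unst K"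
      by (elim exE conjE)
    have "\<exists>F. F \<subseteq> R ` \<Sigma> \<and> finite F \<and> (\<forall>x\<in>carrier G. (\<forall>Q\<in>F. Q x) \<longrightarrow> x \<in> \<theta>)"
    proof (rule cover[OF small_finite[OF finite.emptyI] _ \<theta>(1)])
      show "dfn L M (carrier G) gco Q" if "Q \<in> R ` \<Sigma>" for Q
        using that by (elim imageE, hypsubst) (rule conjunct1[OF R])
      fix x assume x: "x \<in> carrier G" "\<forall>Q\<in>R ` \<Sigma>. Q x"
      have "x \<in> N" by (rule NI[OF x(1)], rule bspec[OF x(2)], rule imageI)
      then show "x \<in> \<theta>" by (rule subsetD[OF \<theta>(2)])
    qed
    then obtain F' where F': "F' \<subseteq> R ` \<Sigma>" "finite F'" "\<forall>x\<in>carrier G. (\<forall>Q\<in>F'. Q x) \<longrightarrow> x \<in> \<theta>"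
      by (elim exE conjE)
    obtain K where K: "K \<subseteq> \<Sigma>" "finite K" "F' = R ` K" using finite_subset_image[OF F'(2,1)] by (elim exE conjE)
    define J where "J = insert a0 (\<Union>\<sigma>\<in>K. F \<sigma>)"
    have "(\<Inter>a\<in>J. HH \<Sigma> a) \<subseteq> \<theta>"
    proof
      fix x assume x: "x \<in> (\<Inter>a\<in>J. HH \<Sigma> a)"
      then have xc: "x \<in> carrier G" using HH_carrier[of x \<Sigma> a0] by (simp add: J_def)
      have "\<forall>Q\<in>F'. Q x"
        unfolding K(3)
      proof (rule ballI, elim imageE, hypsubst)
        fix \<sigma> assume \<sigma>: "\<sigma> \<in> K"
        show "R \<sigma> x" by (rule R1[OF subsetD[OF K(1) \<sigma>] xc]) (use x \<sigma> in \<open>auto simp: J_def\<close>)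
      qed
      then show "x \<in> \<theta>" by (rule mp[OF bspec[OF F'(3) xc]])
    qed
    then have "unst (\<Inter>a\<in>J. HH \<Sigma> a)" by (rule mp[OF spec[OF \<theta>(3)]])
    moreover have "\<not> unst (\<Inter>a\<in>J. HH \<Sigma> a)"
    proof (rule unst_finite_Inter[where A = "\<lambda>a. a ` dom D"])
      show "finite J" unfolding J_def using K F by auto
      fix a assume "a \<in> J"
      then have a: "eqt D a0 a" unfolding J_def using e0 K(1) F by auto
      then have aT: "a \<in> tuples M D" unfolding eqt_def by (elim conjE)
      show "subgroup (HH \<Sigma> a) G \<and> small M (a ` dom D) \<and> a ` dom D \<subseteq> U \<and>
        tdf L M (carrier G) (co \<Gamma> (a ` dom D)) (\<lambda>x. x \<in> HH \<Sigma> a) \<and> \<not> unst (HH \<Sigma> a)"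
        using unst_transfer[OF fam sm a] st0
        by (intro conjI subgroup_transfer[OF fam sm a sub] small_image[OF sm] tuples_U[OF aT] tdf_HH_fix[OF fam aT]) (rule notI, erule notE, assumption)
    qed (simp add: J_def)
    ultimately show False by (rule notE[rotated])
  qed
  ultimately show ?thesis using NH by (intro exI[of _ N] conjI)
qed

section \<open>Conjugation in the group and the least subgroup\<close>

lemma not_unst_carrier: "\<not> unst (carrier G)"
proof
  assume "unst (carrier G)"
  then obtain D :: "nat \<Rightarrow> 's option" and S \<theta> c b where
    "dfn L M (tuples M D \<times> carrier G) (prodc (co D {}) gco) (\<lambda>p. S (fst p) (snd p))"
    and "dfn L M (carrier G) (co \<Gamma> U) (\<lambda>x. x \<in> \<theta>)" and \<theta>: "carrier G \<subseteq> \<theta>"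
    and c: "\<forall>i :: nat. c i \<in> carrier G" "\<forall>j. b j \<in> tuples M D" "\<forall>i j. i < j \<longrightarrow> S (b j) (c i)"
    "\<forall>i j. j < i \<longrightarrow> \<not> (\<exists>x\<in>carrier G. S (b j) x \<and> inv x \<otimes> c i \<in> \<theta>)"
    unfolding unst_def by (elim exE conjE)
  \<comment> \<open>Three indices suffice: \<open>c 0\<close> lies in the fibre of
    \<open>b 1\<close>, and \<open>\<theta>\<close> contains the whole group, so \<open>c 2\<close>
    is not separated from that fibre.\<close>
  have "S (b 1) (c 0)" using c(3) by simp
  moreover have "inv (c 0) \<otimes> c 2 \<in> \<theta>" using c(1) \<theta> by (intro subsetD[OF \<theta>]) simp
  ultimately show False using spec[OF spec[OF c(4), of 2], of 1] c(1) by auto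
qed

text \<open>Right translation by \<open>inv g\<close> sends left cosets of the conjugate to left
  cosets of \<open>N\<close>. The element \<open>g\<close> is carried along in every
  \<open>b j\<close>, so the new \<open>S\<close> acquires no parameter.\<close>

lemma unst_conjugate:
  assumes g: "g \<in> carrier G" and N: "N \<subseteq> carrier G" and un: "unst {y \<in> carrier G. g \<otimes> y \<otimes> inv g \<in> N}"
  shows "unst N"
proof -
  obtain D :: "nat \<Rightarrow> 's option" and S \<theta> c b where
    S: "dfn L M (tuples M D \<times> carrier G) (prodc (co D {}) gco) (\<lambda>p. S (fst p) (snd p))"
    and \<theta>: "dfn L M (carrier G) (co \<Gamma> U) (\<lambda>x. x \<in> \<theta>)" "{y \<in> carrier G. g \<otimes> y \<otimes> inv g \<in> N} \<subseteq> \<theta>"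
    and c: "\<forall>i :: nat. c i \<in> carrier G" and b: "\<forall>j. b j \<in> tuples M D" and lt: "\<forall>i j. i < j \<longrightarrow> S (b j) (c i)"
    and gt: "\<forall>i j. j < i \<longrightarrow> \<not> (\<exists>x\<in>carrier G. S (b j) x \<and> inv x \<otimes> c i \<in> \<theta>)"
    using un unfolding unst_def by (elim exE conjE)
  have l1: "inv g \<otimes> (g \<otimes> w) = w" "g \<otimes> (inv g \<otimes> w) = w" if "w \<in> carrier G" for w
    using that g by (simp_all add: m_assoc[symmetric])
  define \<theta>' where "\<theta>' = {z. inv g \<otimes> z \<otimes> g \<in> \<theta>}"
  show ?thesis
  proof (rule unstI[where \<theta> = \<theta>' and Y = "tuples M D \<times> carrier G" and \<V> = "prodc (co D {}) gco" and
        S = "\<lambda>q x. S (fst q) (x \<otimes> snd q)" and c = "\<lambda>i. c i \<otimes> inv g" and b = "\<lambda>j. (b j, g)"])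
    show "dfn L M ((tuples M D \<times> carrier G) \<times> carrier G) (prodc (prodc (co D {}) gco) gco)
        (\<lambda>p. S (fst (fst p)) (snd p \<otimes> snd (fst p)))"
      by (rule dfn_rel[OF S cm_comp[OF cm_fst cm_fst]])
        (intro dtm_mult dtm_var[OF cm_snd] dtm_var[OF cm_comp[OF cm_fst cm_snd]])
    have gc: "dtm (carrier G) (co \<Gamma> U) (\<lambda>y. g)"
    proof (rule dtm_const[OF g])
      fix i assume i: "i \<in> dom \<Gamma>"
      have "g i \<in> U" using tuples_U[OF subsetD[OF carrier_tuples g]] i by auto
      then show "(\<lambda>z. g i) \<in> co \<Gamma> U" by (rule coI2)
    qed
    have "params U \<subseteq> co \<Gamma> U" by (rule image_subsetI, rule coI2)
    then show "dfn L M (carrier G) (co \<Gamma> U) (\<lambda>z. z \<in> \<theta>')"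
      unfolding \<theta>'_def mem_Collect_eq
      by (intro dfn_in_definable[OF \<theta>(1)] dtm_mult dtm_inv gc dtm_co)
    show "N \<subseteq> \<theta>'"
    proof
      fix z assume z: "z \<in> N"
      then have zc: "z \<in> carrier G" using N by auto
      have "g \<otimes> (inv g \<otimes> z \<otimes> g) \<otimes> inv g = z" using g zc by (simp add: m_assoc l1)
      then show "z \<in> \<theta>'" unfolding \<theta>'_def using \<theta>(2) z g zc by auto
    qed
    show "c i \<otimes> inv g \<in> carrier G" for i using c g by simp
    show "(b j, g) \<in> tuples M D \<times> carrier G" for j using b g by simp
    show "S (fst (b j, g)) (c i \<otimes> inv g \<otimes> snd (b j, g))" if "i < j" for i j
      using lt that c g by (simp add: m_assoc)
    show "inv x \<otimes> (c i \<otimes> inv g) \<notin> \<theta>'" if "j < i" "x \<in> carrier G" "S (fst (b j, g)) (x \<otimes> snd (b j, g))" for i j x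
    proof
      assume "inv x \<otimes> (c i \<otimes> inv g) \<in> \<theta>'"
      then have "inv g \<otimes> (inv x \<otimes> (c i \<otimes> inv g)) \<otimes> g \<in> \<theta>" by (simp add: \<theta>'_def)
      moreover have "inv g \<otimes> (inv x \<otimes> (c i \<otimes> inv g)) \<otimes> g = inv (x \<otimes> g) \<otimes> c i"
        using that(2) c g by (simp add: m_assoc inv_mult_group)
      ultimately have "inv (x \<otimes> g) \<otimes> c i \<in> \<theta>" by (simp only:)
      then show False using gt that g by auto
    qed
  qed
qed

lemma subgroup_conjugate:
  assumes g: "g \<in> carrier G" and N: "subgroup N G"
  shows "subgroup {y \<in> carrier G. g \<otimes> y \<otimes> inv g \<in> N} G"
proof -
  have l1: "inv g \<otimes> (g \<otimes> w) = w" "g \<otimes> (inv g \<otimes> w) = w" if "w \<in> carrier G" for w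
    using that g by (simp_all add: m_assoc[symmetric])
  show ?thesis
  proof (rule subgroupI)
    have "\<one> \<in> {y \<in> carrier G. g \<otimes> y \<otimes> inv g \<in> N}" using g subgroup.one_closed[OF N] by simp
    then show "{y \<in> carrier G. g \<otimes> y \<otimes> inv g \<in> N} \<noteq> {}" by blast
    fix a assume a: "a \<in> {y \<in> carrier G. g \<otimes> y \<otimes> inv g \<in> N}"
    have "inv (g \<otimes> a \<otimes> inv g) = g \<otimes> inv a \<otimes> inv g" using a g by (simp add: inv_mult_group m_assoc)
    then show "inv a \<in> {y \<in> carrier G. g \<otimes> y \<otimes> inv g \<in> N}"
      using a subgroup.m_inv_closed[OF N, of "g \<otimes> a \<otimes> inv g"] by simp
    fix b assume b: "b \<in> {y \<in> carrier G. g \<otimes> y \<otimes> inv g \<in> N}"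
    have "(g \<otimes> a \<otimes> inv g) \<otimes> (g \<otimes> b \<otimes> inv g) = g \<otimes> (a \<otimes> b) \<otimes> inv g"
      using a b g by (simp add: m_assoc l1)
    then show "a \<otimes> b \<in> {y \<in> carrier G. g \<otimes> y \<otimes> inv g \<in> N}"
      using a b subgroup.m_closed[OF N, of "g \<otimes> a \<otimes> inv g" "g \<otimes> b \<otimes> inv g"] by simp
  qed simp
qed

lemma ex_smallest_stable:
  assumes nip: "nip L M"
  shows "\<exists>N. N \<lhd> G \<and> tdf L M (carrier G) gco (\<lambda>x. x \<in> N) \<and> \<not> unst N \<and>
    (\<forall>A H. A \<subseteq> U \<longrightarrow> small M A \<longrightarrow> subgroup H G \<longrightarrow> tdf L M (carrier G) (co \<Gamma> A) (\<lambda>x. x \<in> H) \<longrightarrow> \<not> unst H \<longrightarrow> N \<subseteq> H)"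
proof -
  \<comment> \<open>Only parameter-free subgroups are intersected, so an arbitrary intersection
    remains type-definable over the empty set; \<open>ex_invariant_subgroup\<close> finds a member
    of this family inside every other candidate.\<close>
  define \<N> where "\<N> = {N. subgroup N G \<and> tdf L M (carrier G) gco (\<lambda>x. x \<in> N) \<and> \<not> unst N}"
  have carr: "carrier G \<in> \<N>"
  proof -
    have "tdf L M (carrier G) gco (\<lambda>x. x \<in> carrier G)"
      by (rule tdf_cong[THEN iffD1, OF _ tdf_of_dfn[OF dfn_True]]) simp
    then show ?thesis unfolding \<N>_def using not_unst_carrier subgroup_self by simp
  qed
  define N where "N = \<Inter>\<N>"
  have Nc: "N \<subseteq> carrier G" using carr by (auto simp: N_def)
  have sub: "subgroup N G" unfolding N_def by (rule subgroups_Inter) (use carr in \<open>auto simp: \<N>_def\<close>)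
  have td: "tdf L M (carrier G) gco (\<lambda>x. x \<in> N)"
    unfolding N_def Inter_iff by (rule tdf_all) (simp add: \<N>_def)
  have st: "\<not> unst N"
  proof
    assume "unst N"
    from unst_nbhd[OF this] obtain \<theta> where \<theta>: "dfn L M (carrier G) (co \<Gamma> U) (\<lambda>x. x \<in> \<theta>)" "N \<subseteq> \<theta>" "\<forall>K\<subseteq>\<theta>. unst K"
      by (elim exE conjE)
    \<comment> \<open>Definable sets that contain some member of the family. They include every
      condition from a presentation of a member, so together they cut out \<open>N\<close>, and any
      finite number of them contains a finite intersection of members.\<close>
    define \<Q> where "\<Q> = {P. dfn L M (carrier G) gco P \<and> (\<exists>K\<in>\<N>. \<forall>x\<in>K. P x)}"
    have "\<exists>F. F \<subseteq> \<Q> \<and> finite F \<and> (\<forall>x\<in>carrier G. (\<forall>Q\<in>F. Q x) \<longrightarrow> x \<in> \<theta>)"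
    proof (rule cover[OF small_finite[OF finite.emptyI] _ \<theta>(1)])
      show "dfn L M (carrier G) gco Q" if "Q \<in> \<Q>" for Q
        using that unfolding \<Q>_def mem_Collect_eq by (elim conjE)
      fix x assume x: "x \<in> carrier G" "\<forall>Q\<in>\<Q>. Q x"
      have xK: "x \<in> K" if K: "K \<in> \<N>" for K
      proof -
        have "tdf L M (carrier G) gco (\<lambda>x. x \<in> K)" and Kc: "K \<subseteq> carrier G"
          using K subgroup.subset unfolding \<N>_def by auto
        from this(1) obtain \<P> where \<P>: "\<forall>S\<in>\<P>. dfn L M (carrier G) gco S" "\<forall>x\<in>carrier G. x \<in> K \<longleftrightarrow> (\<forall>S\<in>\<P>. S x)"
          unfolding tdf_def by (elim exE conjE)
        have SQ: "S \<in> \<Q>" if S: "S \<in> \<P>" for S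
        proof -
          have "\<forall>x\<in>K. S x"
          proof
            fix x assume x: "x \<in> K"
            show "S x" by (rule bspec[OF iffD1[OF bspec[OF \<P>(2) subsetD[OF Kc x]] x] S])
          qed
          then show ?thesis unfolding \<Q>_def mem_Collect_eq by (intro conjI bspec[OF \<P>(1) S] bexI[OF _ K])
        qed
        have "\<forall>S\<in>\<P>. S x"
        proof
          fix S assume S: "S \<in> \<P>"
          show "S x" by (rule bspec[OF x(2) SQ[OF S]])
        qed
        then show ?thesis by (rule iffD2[OF bspec[OF \<P>(2) x(1)]])
      qed
      have "x \<in> N" unfolding N_def by (rule InterI, rule xK)
      then show "x \<in> \<theta>" by (rule subsetD[OF \<theta>(2)])
    qed
    then obtain F where F: "F \<subseteq> \<Q>" "finite F" "\<forall>x\<in>carrier G. (\<forall>Q\<in>F. Q x) \<longrightarrow> x \<in> \<theta>"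
      by (elim exE conjE)
    have "\<forall>Q\<in>F. \<exists>K. K \<in> \<N> \<and> (\<forall>x\<in>K. Q x)"
    proof
      fix Q assume "Q \<in> F"
      then have "Q \<in> \<Q>" by (rule subsetD[OF F(1)])
      then show "\<exists>K. K \<in> \<N> \<and> (\<forall>x\<in>K. Q x)" unfolding \<Q>_def mem_Collect_eq Bex_def by (elim conjE)
    qed
    from bchoice[OF this] obtain K where K: "\<forall>Q\<in>F. K Q \<in> \<N> \<and> (\<forall>x\<in>K Q. Q x)" by (elim exE)
    define J where "J = insert (carrier G) (K ` F)"
    have "\<Inter>J \<subseteq> \<theta>"
    proof
      fix x assume x: "x \<in> \<Inter>J"
      then have xc: "x \<in> carrier G" by (simp add: J_def)
      have "\<forall>Q\<in>F. Q x"
      proof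
        fix Q assume Q: "Q \<in> F"
        have "x \<in> K Q" by (rule InterD[OF x]) (unfold J_def, rule insertI2, rule imageI[OF Q])
        then show "Q x" by (rule bspec[OF conjunct2[OF bspec[OF K Q]]])
      qed
      then show "x \<in> \<theta>" by (rule mp[OF bspec[OF F(3) xc]])
    qed
    then have "unst (\<Inter>J)" by (rule mp[OF spec[OF \<theta>(3)]])
    moreover have "\<not> unst (\<Inter>j\<in>J. j)"
    proof (rule unst_finite_Inter[where A = "\<lambda>_. {}"])
      show "finite J" using F(2) by (simp add: J_def)
      show "J \<noteq> {}" by (simp add: J_def)
      fix j assume "j \<in> J"
      then have "j \<in> \<N>" unfolding J_def using carr K by auto
      then show "subgroup j G \<and> small M {} \<and> {} \<subseteq> U \<and> tdf L M (carrier G) gco (\<lambda>x. x \<in> j) \<and> \<not> unst j"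
        unfolding \<N>_def using small_finite[OF finite.emptyI] by simp
    qed
    ultimately show False by simp
  qed
  have min: "N \<subseteq> H" if h: "A \<subseteq> U" "small M A" "subgroup H G" "tdf L M (carrier G) (co \<Gamma> A) (\<lambda>x. x \<in> H)" "\<not> unst H" for A H
  proof -
    obtain K where K: "K \<subseteq> H" "subgroup K G" "tdf L M (carrier G) gco (\<lambda>x. x \<in> K)" "\<not> unst K"
      using ex_invariant_subgroup[OF nip h(3,2,1,4,5)] by (elim exE conjE)
    then have "K \<in> \<N>" by (simp add: \<N>_def)
    then show ?thesis using K(1) unfolding N_def by blast
  qed
  have "N \<lhd> G"
    unfolding normal_inv_iff
  proof (intro conjI sub ballI)
    fix g h assume g: "g \<in> carrier G" and h: "h \<in> N"
    let ?H = "{y \<in> carrier G. g \<otimes> y \<otimes> inv g \<in> N}"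
    \<comment> \<open>The conjugate uses the entries of \<open>g\<close> as parameters, so the
      minimality of \<open>N\<close> among subgroups with parameters is what applies here.\<close>
    have "N \<subseteq> ?H"
    proof (rule min)
      have gT: "g \<in> tuples M \<Gamma>" by (rule subsetD[OF carrier_tuples g])
      show "g ` dom \<Gamma> \<subseteq> U" by (rule tuples_U[OF gT])
      show "small M (g ` dom \<Gamma>)" by (intro small_image small_dom)
      show "subgroup ?H G" by (rule subgroup_conjugate[OF g sub])
      show "\<not> unst ?H" using unst_conjugate[OF g Nc] st by blast
      have "dtm (carrier G) (co \<Gamma> (g ` dom \<Gamma>)) (\<lambda>y. g)" by (rule dtm_const[OF g], rule coI2, rule imageI)
      then have "tdf L M (carrier G) (co \<Gamma> (g ` dom \<Gamma>)) (\<lambda>y. g \<otimes> y \<otimes> inv g \<in> N)"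
        by (intro tdf_in[OF td] dtm_mult dtm_inv dtm_co) simp_all
      then show "tdf L M (carrier G) (co \<Gamma> (g ` dom \<Gamma>)) (\<lambda>x. x \<in> ?H)"
        by (rule tdf_cong[THEN iffD1, rotated]) simp
    qed
    then show "g \<otimes> h \<otimes> inv g \<in> N" using h by auto
  qed
  then show ?thesis using td st min by (intro exI[of _ N] conjI allI impI)
qed

section \<open>Stability of hyperdefinable quotients\<close>

lemma tdf_agree:
  assumes P: "tdf L M X \<U> P" and z: "z \<in> X" "z' \<in> X" and eq: "\<And>Q. dfn L M X \<U> Q \<Longrightarrow> Q z = Q z'" and Pz: "P z"
  shows "P z'"
proof -
  obtain \<P> where \<P>: "\<forall>S\<in>\<P>. dfn L M X \<U> S" "\<forall>x\<in>X. P x \<longleftrightarrow> (\<forall>S\<in>\<P>. S x)"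
    using P unfolding tdf_def by (elim exE conjE)
  have p: "\<forall>S\<in>\<P>. S z" using iffD1[OF bspec[OF \<P>(2) z(1)] Pz] .
  have "\<forall>S\<in>\<P>. S z'"
  proof
    fix S assume S: "S \<in> \<P>"
    show "S z'" using bspec[OF p S] eq[OF bspec[OF \<P>(1) S]] by simp
  qed
  then show ?thesis by (rule iffD2[OF bspec[OF \<P>(2) z(2)]])
qed

lemma co_sorted:
  assumes u: "u \<in> co \<Gamma> A" "\<And>z. z \<in> carrier G \<Longrightarrow> srt M (u z) = Some s" and z: "z \<in> tuples M \<Gamma>"
  shows "srt M (u z) = Some s"
proof -
  have one: "srt M (u \<one>) = Some s" by (rule u(2)[OF one_closed])
  have "(\<exists>i\<in>dom \<Gamma>. u = (\<lambda>x. x i)) \<or> (\<exists>a\<in>A. u = (\<lambda>x. a))" using u(1) unfolding co_def by blast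
  then show ?thesis
  proof (elim disjE bexE)
    fix i assume i: "i \<in> dom \<Gamma>" "u = (\<lambda>x. x i)"
    show ?thesis using one tuples_sort[OF z i(1)] tuples_sort[OF subsetD[OF carrier_tuples one_closed] i(1)] i(2) by simp
  next
    fix a assume "u = (\<lambda>x. a)"
    then show ?thesis using one by simp
  qed
qed

lemma tdf_tuples_carrier:
  assumes H: "H \<subseteq> carrier G"
  shows "tdf L M (tuples M \<Gamma>) (co \<Gamma> A) (\<lambda>x. x \<in> H) \<longleftrightarrow> tdf L M (carrier G) (co \<Gamma> A) (\<lambda>x. x \<in> H)"
proof
  show "tdf L M (carrier G) (co \<Gamma> A) (\<lambda>x. x \<in> H)" if "tdf L M (tuples M \<Gamma>) (co \<Gamma> A) (\<lambda>x. x \<in> H)"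
    by (rule tdf_mono[OF that carrier_tuples order_refl])
  assume "tdf L M (carrier G) (co \<Gamma> A) (\<lambda>x. x \<in> H)"
  then obtain \<P> where \<P>: "\<forall>S\<in>\<P>. dfn L M (carrier G) (co \<Gamma> A) S" "\<forall>x\<in>carrier G. x \<in> H \<longleftrightarrow> (\<forall>S\<in>\<P>. S x)"
    unfolding tdf_def by (elim exE conjE)
  have "\<forall>S\<in>\<P>. \<exists>Q'. dfn L M (tuples M \<Gamma>) (co \<Gamma> A) Q' \<and> (\<forall>z\<in>carrier G. S z \<longleftrightarrow> Q' z)"
    by (rule ballI, rule dfn_extend[OF carrier_tuples carrier_ne _ bspec[OF \<P>(1)]]) (rule ballI, rule co_sorted)
  from bchoice[OF this] obtain Q where Q: "\<forall>S\<in>\<P>. dfn L M (tuples M \<Gamma>) (co \<Gamma> A) (Q S) \<and> (\<forall>z\<in>carrier G. S z \<longleftrightarrow> Q S z)"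
    by (elim exE)
  have "tdf L M (tuples M \<Gamma>) (co \<Gamma> A) (\<lambda>x. x \<in> carrier G \<and> (\<forall>S\<in>\<P>. Q S x))"
  proof (rule tdf_conj)
    show "tdf L M (tuples M \<Gamma>) (co \<Gamma> A) (\<lambda>x. x \<in> carrier G)"
      by (rule tdf_of_dfn, rule dfn_mono[OF dfn_carrier order_refl co_mono]) simp
    show "tdf L M (tuples M \<Gamma>) (co \<Gamma> A) (\<lambda>x. \<forall>S\<in>\<P>. Q S x)"
      by (rule tdf_all, rule tdf_of_dfn, rule conjunct1[OF bspec[OF Q]])
  qed
  then show "tdf L M (tuples M \<Gamma>) (co \<Gamma> A) (\<lambda>x. x \<in> H)"
  proof (rule tdf_cong[THEN iffD1, rotated])
    fix x assume "x \<in> tuples M \<Gamma>"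
    show "(x \<in> carrier G \<and> (\<forall>S\<in>\<P>. Q S x)) = (x \<in> H)"
    proof (cases "x \<in> carrier G")
      case True
      have "S x \<longleftrightarrow> Q S x" if "S \<in> \<P>" for S by (rule bspec[OF conjunct2[OF bspec[OF Q that]] True])
      then have "(\<forall>S\<in>\<P>. S x) \<longleftrightarrow> (\<forall>S\<in>\<P>. Q S x)" by (rule ball_cong[OF refl])
      then show ?thesis unfolding bspec[OF \<P>(2) True] using True by simp
    next
      case False
      then show ?thesis using H by auto
    qed
  qed
qed

lemma type_definable_carrier:
  assumes "H \<subseteq> carrier G"
  shows "type_definable L M A \<Gamma> H \<longleftrightarrow> tdf L M (carrier G) (co \<Gamma> A) (\<lambda>x. x \<in> H)"
  unfolding tdf_type_definable[OF str] tdf_tuples_carrier[OF assms] using assms carrier_tuples by blast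

lemma same_type_dfn:
  fixes \<Delta> :: "'w \<Rightarrow> 's option"
  assumes xy: "x \<in> tuples M \<Delta>" "y \<in> tuples M \<Delta>"
  shows "same_type L M A \<Delta> x y \<longleftrightarrow> (\<forall>P. dfn L M (tuples M \<Delta>) (co \<Delta> A) P \<longrightarrow> P x = P y)"
proof
  assume st: "same_type L M A \<Delta> x y"
  show "\<forall>P. dfn L M (tuples M \<Delta>) (co \<Delta> A) P \<longrightarrow> P x = P y"
  proof (intro allI impI)
    fix P assume "dfn L M (tuples M \<Delta>) (co \<Delta> A) P"
    from fm_over_of_dfn[OF str this] obtain \<phi> where
      \<phi>: "\<phi> \<in> fm_over L M A \<Delta>" "\<forall>x\<in>tuples M \<Delta>. P x \<longleftrightarrow> holds M \<phi> x" by (elim bexE)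
    show "P x = P y"
      unfolding bspec[OF \<phi>(2) xy(1)] bspec[OF \<phi>(2) xy(2)] by (rule bspec[OF st[unfolded same_type_def] \<phi>(1)])
  qed
next
  assume *: "\<forall>P. dfn L M (tuples M \<Delta>) (co \<Delta> A) P \<longrightarrow> P x = P y"
  show "same_type L M A \<Delta> x y"
    unfolding same_type_def by (rule ballI, rule mp[OF spec[OF *] dfn_of_fm_over])
qed

lemma case_sum_tuples:
  "x \<in> tuples M \<Delta> \<Longrightarrow> y \<in> tuples M \<Delta>' \<Longrightarrow> case_sum x y \<in> tuples M (case_sum \<Delta> \<Delta>')"
proof -
  assume xy: "x \<in> tuples M \<Delta>" "y \<in> tuples M \<Delta>'"
  have "case_sum x y v = undefined" if "v \<notin> dom (case_sum \<Delta> \<Delta>')" for v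
    using that xy by (cases v) (auto simp: tuples_iff extensional_def domIff)
  moreover have "srt M (case_sum x y v) = case_sum \<Delta> \<Delta>' v" if "v \<in> dom (case_sum \<Delta> \<Delta>')" for v
    using that tuples_sort[OF xy(1)] tuples_sort[OF xy(2)] by (cases v) (simp_all add: domIff)
  ultimately show ?thesis unfolding tuples_iff extensional_def by simp
qed

text \<open>The parameters are attached to the group component alone; being constant functions they
  are available on the whole product from there.\<close>

lemma same_type_pair:
  fixes \<Delta> :: "'w \<Rightarrow> 's option"
  assumes x: "x \<in> carrier G" "x' \<in> carrier G" and y: "y \<in> tuples M \<Delta>" "y' \<in> tuples M \<Delta>"
  shows "same_type L M A (case_sum \<Gamma> \<Delta>) (case_sum x y) (case_sum x' y') \<longleftrightarrow>
    (\<forall>Q. dfn L M (carrier G \<times> tuples M \<Delta>) (prodc (co \<Gamma> A) (co \<Delta> {})) Q \<longrightarrow> Q (x, y) = Q (x', y'))"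
    (is "?L \<longleftrightarrow> ?R")
proof -
  let ?X = "carrier G \<times> tuples M \<Delta>" and ?U = "prodc (co \<Gamma> A) (co \<Delta> {})"
  let ?C = "case_sum \<Gamma> \<Delta>"
  have T: "case_sum x y \<in> tuples M ?C" "case_sum x' y' \<in> tuples M ?C"
    using x y carrier_tuples by (auto intro!: case_sum_tuples)
  have 1: ?R if L: ?L
  proof (intro allI impI)
    fix Q assume Q: "dfn L M ?X ?U Q"
    have "\<exists>Q'. dfn L M (tuples M \<Gamma> \<times> tuples M \<Delta>) ?U Q' \<and> (\<forall>z\<in>?X. Q z \<longleftrightarrow> Q' z)"
    proof (rule dfn_extend[OF _ _ _ Q])
      show "?X \<subseteq> tuples M \<Gamma> \<times> tuples M \<Delta>" using carrier_tuples by auto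
      show "?X \<noteq> {}" using x y by auto
      fix u s assume u: "u \<in> ?U" "\<And>z. z \<in> ?X \<Longrightarrow> srt M (u z) = Some s"
      show "\<forall>z\<in>tuples M \<Gamma> \<times> tuples M \<Delta>. srt M (u z) = Some s"
      proof
        fix z assume z: "z \<in> tuples M \<Gamma> \<times> tuples M \<Delta>"
        from u(1) show "srt M (u z) = Some s"
          unfolding prodc_def
        proof (elim UnE imageE)
          fix v assume v: "u = (\<lambda>p. v (fst p))" "v \<in> co \<Gamma> A"
          have "srt M (v (fst z)) = Some s"
          proof (rule co_sorted[OF v(2)])
            show "srt M (v w) = Some s" if "w \<in> carrier G" for w using u(2)[of "(w, y)"] that y v(1) by simp
          qed (use z in auto)
          then show ?thesis by (simp add: v(1))
        next
          fix v assume v: "u = (\<lambda>p. v (snd p))" "v \<in> co \<Delta> {}"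
          have "srt M (v (snd z)) = Some s" using u(2)[of "(x, snd z)"] x z v(1) by auto
          then show ?thesis by (simp add: v(1))
        qed
      qed
    qed
    then obtain Q' where Q': "dfn L M (tuples M \<Gamma> \<times> tuples M \<Delta>) ?U Q'" "\<forall>z\<in>?X. Q z \<longleftrightarrow> Q' z" by (elim exE conjE)
    have "cm (tuples M ?C) (co ?C A) (tuples M \<Gamma> \<times> tuples M \<Delta>) ?U (\<lambda>w. (\<lambda>i. w (Inl i), \<lambda>j. w (Inr j)))"
    proof (rule cm_pair; rule cmI)
      show "(\<lambda>i. w (Inl i)) \<in> tuples M \<Gamma>" "(\<lambda>j. w (Inr j)) \<in> tuples M \<Delta>" if "w \<in> tuples M ?C" for w
        using that unfolding tuples_iff extensional_def by (auto simp: domIff)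
      show "(\<lambda>w. v (\<lambda>i. w (Inl i))) \<in> co ?C A" if v: "v \<in> co \<Gamma> A" for v
        using v unfolding co_def[of \<Gamma>]
      proof (elim UnE imageE)
        fix i assume i: "v = (\<lambda>x. x i)" "i \<in> dom \<Gamma>"
        then have "Inl i \<in> dom ?C" by (simp add: domIff)
        then show ?thesis unfolding i(1) by (rule coI)
      next
        fix a assume a: "v = (\<lambda>x. a)" "a \<in> A"
        show ?thesis unfolding a(1) by (rule coI2[OF a(2)])
      qed
      show "(\<lambda>w. v (\<lambda>j. w (Inr j))) \<in> co ?C A" if v: "v \<in> co \<Delta> {}" for v
        using v unfolding co_def[of \<Delta>]
      proof (elim UnE imageE)
        fix i assume i: "v = (\<lambda>x. x i)" "i \<in> dom \<Delta>"
        then have "Inr i \<in> dom ?C" by (simp add: domIff)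
        then show ?thesis unfolding i(1) by (rule coI)
      qed simp
    qed
    from dfn_cm[OF Q'(1) this] L have "Q' (x, y) = Q' (x', y')"
      unfolding same_type_dfn[OF T] by (elim allE[of _ "\<lambda>w. Q' (\<lambda>i. w (Inl i), \<lambda>j. w (Inr j))"] impE) simp_all
    moreover have "Q (x, y) = Q' (x, y)" "Q (x', y') = Q' (x', y')" by (rule bspec[OF Q'(2)], use x y in simp)+
    ultimately show "Q (x, y) = Q (x', y')" by simp
  qed
  have 2: ?L if R: ?R
    unfolding same_type_dfn[OF T]
  proof (intro allI impI)
    fix P assume P: "dfn L M (tuples M ?C) (co ?C A) P"
    have "cm ?X ?U (tuples M ?C) (co ?C {}) (\<lambda>p. case_sum (fst p) (snd p))"
      by (rule cm_case_sum[OF cm_carrier_tuples[OF cm_comp[OF cm_fst cm_mono]] cm_snd]) (simp_all add: co_mono)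
    then have "cm ?X ?U (tuples M ?C) (co ?C A) (\<lambda>p. case_sum (fst p) (snd p))"
      by (rule cm_co) (rule prodcI1, rule coI2)
    from mp[OF spec[OF R] dfn_cm[OF P this]] show "P (case_sum x y) = P (case_sum x' y')" by simp
  qed
  show ?thesis using 1 2 by (rule iffI)
qed

lemma rcong_iff: "(x, y) \<in> rcong H \<longleftrightarrow> x \<in> carrier G \<and> y \<in> carrier G \<and> inv x \<otimes> y \<in> H"
  unfolding r_congruent_def by simp

text \<open>Real tuples are hyperimaginaries modulo equality. For tuples of infinite length equality
  is presented by one condition per entry.\<close>

lemma hyperdefinable_Id:
  fixes \<Delta> :: "'w \<Rightarrow> 's option"
  shows "hyperdefinable L M A \<Delta> (tuples M \<Delta>) (Id_on (tuples M \<Delta>))"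
  unfolding hyperdefinable_def tdf_type_definable[OF str]
proof (intro conjI)
  show "tuples M \<Delta> \<subseteq> tuples M \<Delta>" by (rule order_refl)
  show "tdf L M (tuples M \<Delta>) (co \<Delta> A) (\<lambda>x. x \<in> tuples M \<Delta>)"
    by (rule tdf_cong[THEN iffD1, OF _ tdf_of_dfn[OF dfn_True]]) simp
  show "equiv (tuples M \<Delta>) (Id_on (tuples M \<Delta>))"
    by (auto simp: equiv_def refl_on_def sym_def trans_def)
  let ?D = "{case_sum x y |x y. (x, y) \<in> Id_on (tuples M \<Delta>)}" and ?C = "case_sum \<Delta> \<Delta>"
  show "?D \<subseteq> tuples M ?C" by (auto intro: case_sum_tuples)
  have "tdf L M (tuples M ?C) (co ?C A) (\<lambda>w. \<forall>i\<in>dom \<Delta>. w (Inl i) = w (Inr i))"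
  proof (rule tdf_all, rule tdf_of_dfn)
    fix i assume "i \<in> dom \<Delta>"
    then obtain s where s: "\<Delta> i = Some s" by blast
    then have d: "Inl i \<in> dom ?C" "Inr i \<in> dom ?C" by (auto simp: domIff)
    show "dfn L M (tuples M ?C) (co ?C A) (\<lambda>w. w (Inl i) = w (Inr i))"
      by (rule dfn_eq[OF coI[OF d(1)] coI[OF d(2)], where s = s]) (use tuples_sort[OF _ d(1)] tuples_sort[OF _ d(2)] s in simp_all)
  qed
  then show "tdf L M (tuples M ?C) (co ?C A) (\<lambda>w. w \<in> ?D)"
  proof (rule tdf_cong[THEN iffD1, rotated])
    fix w assume w: "w \<in> tuples M ?C"
    have l: "(\<lambda>i. w (Inl i)) \<in> tuples M \<Delta>" "(\<lambda>i. w (Inr i)) \<in> tuples M \<Delta>"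
      using w unfolding tuples_iff extensional_def by (auto simp: domIff)
    have w': "w = case_sum (\<lambda>i. w (Inl i)) (\<lambda>i. w (Inr i))" by (rule ext) (simp split: sum.split)
    show "(\<forall>i\<in>dom \<Delta>. w (Inl i) = w (Inr i)) = (w \<in> ?D)"
    proof
      assume "\<forall>i\<in>dom \<Delta>. w (Inl i) = w (Inr i)"
      then have "(\<lambda>i. w (Inl i)) = (\<lambda>i. w (Inr i))" by (intro tuples_eqI[OF l]) simp
      then have m: "((\<lambda>i. w (Inl i)), (\<lambda>i. w (Inr i))) \<in> Id_on (tuples M \<Delta>)" using l by (simp add: Id_on_iff)
      show "w \<in> ?D" by (rule CollectI, rule exI, rule exI, rule conjI[OF w' m])
    qed auto
  qed
qed

text \<open>The naturals are positions among the rationals, and having equal types asks two classes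
  only for some representatives of equal type; the entries of \<open>\<rho>\<close> supply
  them.\<close>

lemma indiscernible_of_indisc:
  fixes \<Delta> :: "'w \<Rightarrow> 's option"
  assumes ind: "indisc L M (Xb \<Delta>) (Ub \<Delta>) B \<rho>" and AB: "A \<subseteq> B"
    and mem: "\<And>k. case_sum (fst (\<rho> (of_nat k))) (snd (\<rho> (of_nat k))) \<in> c k"
  shows "indiscernible L M A (case_sum \<Gamma> \<Delta>) c"
  unfolding indiscernible_def
proof (intro allI impI, elim conjE)
  fix n and f g :: "nat \<Rightarrow> nat" assume fg: "strict_mono_on {..<n} f" "strict_mono_on {..<n} g"
  let ?C = "case_sum \<Gamma> \<Delta>"
  let ?S = "seq_ctxt n ?C"
  define s where "s \<sigma> = (\<lambda>(k, i). if k < n then case_sum (fst (\<sigma> (of_nat k))) (snd (\<sigma> (of_nat k))) i else undefined)"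
    for \<sigma> :: "rat \<Rightarrow> ('i \<Rightarrow> 'a) \<times> ('w \<Rightarrow> 'a)"
  define I where "I = (of_nat ` {..<n} :: rat set)"
  have \<rho>: "\<rho> \<in> seqs (Xb \<Delta>)" using ind by (simp add: indisc_def)
  have sT: "s \<sigma> \<in> tuples M ?S" if "\<sigma> \<in> seqs (Xb \<Delta>)" for \<sigma>
  proof -
    have "case_sum (fst (\<sigma> q)) (snd (\<sigma> q)) \<in> tuples M ?C" for q
      using seqsD[OF that, of q] carrier_tuples by (intro case_sum_tuples) auto
    then show ?thesis unfolding tuples_iff extensional_def s_def seq_ctxt_def by (auto simp: domIff)
  qed
  have cm: "cm (seqs (Xb \<Delta>)) (sco (Ub \<Delta>) I B) (tuples M ?S) (co ?S A) s"
  proof (rule cmI)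
    show "s \<sigma> \<in> tuples M ?S" if "\<sigma> \<in> seqs (Xb \<Delta>)" for \<sigma> by (rule sT[OF that])
    fix v assume "v \<in> co ?S A"
    then have "v \<in> (\<lambda>i x. x i) ` dom ?S \<union> (\<lambda>a x. a) ` A" unfolding co_def .
    then show "(\<lambda>\<sigma>. v (s \<sigma>)) \<in> sco (Ub \<Delta>) I B"
    proof (elim UnE imageE)
      fix p assume v: "v = (\<lambda>x. x p)" and p: "p \<in> dom ?S"
      obtain k i where ki: "p = (k, i)" by (cases p)
      then have k: "k < n" "i \<in> dom ?C" using p by (auto simp: seq_ctxt_def split: if_splits)
      have kI: "of_nat k \<in> I" using k by (simp add: I_def)
      show ?thesis
      proof (cases i)
        case (Inl j)
        then have "(\<lambda>p. fst p j) \<in> Ub \<Delta>" using k by (intro prodcI1 coI) (auto simp: domIff)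
        moreover have "(\<lambda>\<sigma>. v (s \<sigma>)) = (\<lambda>\<sigma>. (\<lambda>p. fst p j) (\<sigma> (of_nat k)))" using k v ki Inl by (simp add: s_def)
        ultimately show ?thesis using kI unfolding sco_def by (intro UnI1 image_eqI[of _ _ "(\<lambda>p. fst p j, of_nat k)"]) simp_all
      next
        case (Inr j)
        then have "(\<lambda>p. snd p j) \<in> Ub \<Delta>" using k by (intro prodcI2 coI) (auto simp: domIff)
        moreover have "(\<lambda>\<sigma>. v (s \<sigma>)) = (\<lambda>\<sigma>. (\<lambda>p. snd p j) (\<sigma> (of_nat k)))" using k v ki Inr by (simp add: s_def)
        ultimately show ?thesis using kI unfolding sco_def by (intro UnI1 image_eqI[of _ _ "(\<lambda>p. snd p j, of_nat k)"]) simp_all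
      qed
    next
      fix a assume "v = (\<lambda>x. a)" "a \<in> A"
      then show ?thesis using AB sco_const[of a B] by auto
    qed
  qed
  \<comment> \<open>Turns a map of natural indices into a map of rational positions; on the
    positions in \<open>I\<close> the floor just recovers the natural number.\<close>
  define r where "r f q = (of_nat (f (nat \<lfloor>q\<rfloor>)) :: rat)" for f :: "nat \<Rightarrow> nat" and q :: rat
  have rI: "strict_mono_on I (r f)" if "strict_mono_on {..<n} f" for f
    using that unfolding strict_mono_on_def I_def r_def by auto
  have s: "s (\<rho> \<circ> r f) = (\<lambda>(k, i). if k < n then case_sum (fst (\<rho> (of_nat (f k)))) (snd (\<rho> (of_nat (f k)))) i else undefined)" for f
  proof -
    have nk: "nat \<lfloor>of_nat k :: rat\<rfloor> = k" for k by simp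
    show ?thesis unfolding s_def r_def comp_def nk ..
  qed
  have "s (\<rho> \<circ> r f) \<in> hseq n (\<lambda>k. c (f k))" for f
    unfolding hseq_def s using mem
    by (intro CollectI exI[of _ "\<lambda>k. case_sum (fst (\<rho> (of_nat (f k)))) (snd (\<rho> (of_nat (f k))))"]) auto
  moreover have "same_type L M A ?S (s (\<rho> \<circ> r f)) (s (\<rho> \<circ> r g))"
    unfolding same_type_dfn[OF sT[OF seqs_comp[OF \<rho>]] sT[OF seqs_comp[OF \<rho>]]]
  proof (intro allI impI)
    fix P assume "dfn L M (tuples M ?S) (co ?S A) P"
    from indisc_tdf[OF ind tdf_of_dfn[OF dfn_cm[OF this cm]] rI[OF fg(1)] rI[OF fg(2)]]
    show "P (s (\<rho> \<circ> r f)) = P (s (\<rho> \<circ> r g))" .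
  qed
  ultimately show "same_htype L M A ?S (hseq n (\<lambda>k. c (f k))) (hseq n (\<lambda>k. c (g k)))"
    unfolding same_htype_def by (intro bexI[of _ "s (\<rho> \<circ> r f)"] bexI[of _ "s (\<rho> \<circ> r g)"])
qed

text \<open>Stability would identify the types of \<open>(c 0, b 1)\<close> and
  \<open>(c 1, b 0)\<close> modulo \<open>H\<close>. That the coset of the first component meets the
  fibre over the second is true for one pair and false for the other;
  \<open>H \<subseteq> \<theta>\<close> makes the failure hold for the whole coset.\<close>

lemma not_unst_of_stable:
  assumes A: "A \<subseteq> U" "small M A" and H: "subgroup H G" "type_definable L M A \<Gamma> H"
    and stable: "stable_quotient L M A \<Gamma> (carrier G) (rcong H)"
  shows "\<not> unst H"
proof
  assume "unst H"
  then obtain D :: "nat \<Rightarrow> 's option" and S \<theta> c b where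
    S: "dfn L M (tuples M D \<times> carrier G) (prodc (co D {}) gco) (\<lambda>p. S (fst p) (snd p))"
    and \<theta>: "dfn L M (carrier G) (co \<Gamma> U) (\<lambda>x. x \<in> \<theta>)" "H \<subseteq> \<theta>"
    and c: "\<forall>i :: nat. c i \<in> carrier G" and b: "\<forall>j. b j \<in> tuples M D" and lt: "\<forall>i j. i < j \<longrightarrow> S (b j) (c i)"
    and gt: "\<forall>i j. j < i \<longrightarrow> \<not> (\<exists>x\<in>carrier G. S (b j) x \<and> inv x \<otimes> c i \<in> \<theta>)"
    unfolding unst_def by (elim exE conjE)
  have Hc: "H \<subseteq> carrier G" by (rule subgroup.subset[OF H(1)])
  have dH: "tdf L M (carrier G) (co \<Gamma> A) (\<lambda>x. x \<in> H)" using H(2) unfolding type_definable_carrier[OF Hc] .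
  \<comment> \<open>Tuples in the definition of stability are indexed by the element type of the
    structure, so the context \<open>D\<close> is transported along an injection of the
    naturals.\<close>
  obtain h :: "nat \<Rightarrow> 'a" where h: "inj h" using infinite_U infinite_countable_subset by blast
  define \<Delta> where "\<Delta> a = (if a \<in> range h then D (inv_into UNIV h a) else None)" for a
  have \<Delta>h: "\<Delta> (h n) = D n" for n using h by (simp add: \<Delta>_def)
  have sd: "small M (dom \<Delta>)"
    by (rule small_countable, rule countable_subset[of _ "range h"]) (auto simp: \<Delta>_def split: if_splits)
  define t where "t y = restrict (\<lambda>n. y (h n)) (dom D)" for y :: "'a \<Rightarrow> 'a"
  have ct: "cm (tuples M \<Delta>) (co \<Delta> {}) (tuples M D) (co D {}) t"
  proof (rule cmI)
    fix y assume y: "y \<in> tuples M \<Delta>"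
    show "t y \<in> tuples M D"
      unfolding t_def
    proof (rule restrict_tuples)
      fix i assume "i \<in> dom D"
      then have "h i \<in> dom \<Delta>" by (simp add: domIff \<Delta>h)
      then show "srt M (y (h i)) = D i" using tuples_sort[OF y] by (simp add: \<Delta>h)
    qed
  next
    fix v :: "(nat \<Rightarrow> 'a) \<Rightarrow> 'a" assume "v \<in> co D {}"
    then obtain i where i: "i \<in> dom D" "v = (\<lambda>x. x i)" unfolding co_def by blast
    then have "h i \<in> dom \<Delta>" by (simp add: domIff \<Delta>h)
    then have "(\<lambda>y. y (h i)) \<in> co \<Delta> {}" by (rule coI)
    then show "(\<lambda>z. v (t z)) \<in> co \<Delta> {}" using i by (simp add: t_def)
  qed
  define b' where "b' j = restrict (\<lambda>a. b j (inv_into UNIV h a)) (dom \<Delta>)" for j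
  have b'T: "b' j \<in> tuples M \<Delta>" for j
    unfolding b'_def
  proof (rule restrict_tuples)
    fix a assume "a \<in> dom \<Delta>"
    then obtain n where n: "a = h n" "D n \<noteq> None" by (auto simp: \<Delta>_def h split: if_splits)
    then have n': "n \<in> dom D" by (simp add: domIff)
    show "srt M (b j (inv_into UNIV h a)) = \<Delta> a" using tuples_sort[OF spec[OF b] n'] h n(1) by (simp add: \<Delta>h)
  qed
  have tb: "t (b' j) = b j" for j
  proof (rule tuples_eqI[OF cmD[OF ct b'T] spec[OF b]])
    fix n assume "n \<in> dom D"
    then show "t (b' j) n = b j n" using h by (simp add: t_def b'_def \<Delta>h domIff)
  qed
  obtain A' where A': "finite A'" "A' \<subseteq> U" "dfn L M (carrier G) (co \<Gamma> A') (\<lambda>x. x \<in> \<theta>)"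
    using dfn_co_finite[OF \<theta>(1)] by (elim exE conjE)
  \<comment> \<open>The parameters of \<open>\<theta>\<close> join \<open>A\<close> so that the
    separation passes to \<open>\<rho>\<close>; indiscernibility over the larger set is more than
    stability asks for.\<close>
  define B where "B = A \<union> A'"
  have B: "small M B" "A \<subseteq> B" "A' \<subseteq> B" using A(2) A'(1) by (auto simp: B_def intro: small_Un small_finite)
  have eX: "(c n, b' n) \<in> Xb \<Delta>" for n using c b'T by simp
  obtain \<rho> where ind: "indisc L M (Xb \<Delta>) (Ub \<Delta>) B \<rho>" and em: "em_of L M (Xb \<Delta>) (Ub \<Delta>) B (\<lambda>n. (c n, b' n)) \<rho>"
    using em_blocks[where e = "\<lambda>n. (c n, b' n)", OF sd B(1) eX] by (elim exE conjE)
  have \<rho>: "\<rho> \<in> seqs (Xb \<Delta>)" using ind by (simp add: indisc_def)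
  define cc where "cc k = fst (\<rho> (of_nat k))" for k :: nat
  define bb where "bb k = snd (\<rho> (of_nat k))" for k :: nat
  have cc: "cc k \<in> carrier G" and bb: "bb k \<in> tuples M \<Delta>" for k
    using seqsD[OF \<rho>, of "of_nat k"] by (auto simp: cc_def bb_def)
  have lt': "S (t (bb 1)) (cc 0)"
    unfolding cc_def bb_def
  proof (rule em_dfn[OF em, of "of_nat 0" "of_nat 1"])
    show "dfn L M (seqs (Xb \<Delta>)) (sco (Ub \<Delta>) {of_nat 0, of_nat 1} B) (\<lambda>\<pi>. S (t (snd (\<pi> (of_nat 1)))) (fst (\<pi> (of_nat 0))))"
      by (rule dfn_rel[OF S cm_comp[OF cm_at_snd ct] dtm_at]) simp_all
    fix f :: "rat \<Rightarrow> nat" assume "strict_mono_on {of_nat 0, of_nat 1} f"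
    then have "f (of_nat 0) < f (of_nat 1)" by (simp add: strict_mono_onD)
    then show "S (t (snd (((\<lambda>n. (c n, b' n)) \<circ> f) (of_nat 1)))) (fst (((\<lambda>n. (c n, b' n)) \<circ> f) (of_nat 0)))"
      using lt by (simp add: tb)
  qed
  have gt': "\<not> (\<exists>x\<in>carrier G. S (t (bb 0)) x \<and> inv x \<otimes> cc 1 \<in> \<theta>)"
    unfolding cc_def bb_def
  proof (rule em_dfn[OF em, of "of_nat 0" "of_nat 1"])
    let ?V = "sco (Ub \<Delta>) {of_nat 0, of_nat 1 :: rat} B"
    show "dfn L M (seqs (Xb \<Delta>)) ?V
        (\<lambda>\<pi>. \<not> (\<exists>x\<in>carrier G. S (t (snd (\<pi> (of_nat 0)))) x \<and> inv x \<otimes> fst (\<pi> (of_nat 1)) \<in> \<theta>))"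
    proof (rule dfn_not, rule dfn_exG, rule dfn_conj)
      show "dfn L M (seqs (Xb \<Delta>) \<times> carrier G) (prodc ?V gco) (\<lambda>p. S (t (snd (fst p (of_nat 0)))) (snd p))"
        by (rule dfn_rel[OF S cm_comp[OF cm_comp[OF cm_fst cm_at_snd] ct] dtm_var[OF cm_snd]]) simp
      show "dfn L M (seqs (Xb \<Delta>) \<times> carrier G) (prodc ?V gco) (\<lambda>p. inv (snd p) \<otimes> fst (fst p (of_nat 1)) \<in> \<theta>)"
        by (intro dfn_in_definable[OF A'(3)] dtm_mult dtm_inv dtm_var[OF cm_snd] dtm_cm[OF dtm_at cm_fst]
            params_prodc params_sco B(3)) simp
    qed
    fix f :: "rat \<Rightarrow> nat" assume "strict_mono_on {of_nat 0, of_nat 1} f"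
    then have "f (of_nat 0) < f (of_nat 1)" by (simp add: strict_mono_onD)
    then show "\<not> (\<exists>x\<in>carrier G. S (t (snd (((\<lambda>n. (c n, b' n)) \<circ> f) (of_nat 0)))) x \<and>
        inv x \<otimes> fst (((\<lambda>n. (c n, b' n)) \<circ> f) (of_nat 1)) \<in> \<theta>)"
      using spec[OF spec[OF gt, of "f (of_nat 1)"], of "f (of_nat 0)"] by (simp add: tb)
  qed
  define ca where "ca k = rcong H `` {cc k}" for k
  have eqv: "equiv (carrier G) (rcong H)" by (rule subgroup.equiv_rcong[OF H(1) is_group])
  have caq: "ca k \<in> carrier G // rcong H" for k unfolding ca_def by (rule quotientI[OF cc])
  have cb: "{bb k} \<in> tuples M \<Delta> // Id_on (tuples M \<Delta>)" for k
  proof -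
    have "Id_on (tuples M \<Delta>) `` {bb k} = {bb k}" using bb by auto
    then show ?thesis using quotientI[OF bb, of "Id_on (tuples M \<Delta>)" k] by simp
  qed
  have "indiscernible L M A (case_sum \<Gamma> \<Delta>) (\<lambda>i. hpair (ca i) {bb i})"
  proof (rule indiscernible_of_indisc[OF ind B(2)])
    fix k
    have "cc k \<in> ca k" unfolding ca_def by (rule equiv_class_self[OF eqv cc])
    then show "case_sum (fst (\<rho> (of_nat k))) (snd (\<rho> (of_nat k))) \<in> hpair (ca k) {bb k}"
      unfolding hpair_def cc_def bb_def by blast
  qed
  then have "same_htype L M A (case_sum \<Gamma> \<Delta>) (hpair (ca 0) {bb 1}) (hpair (ca 1) {bb 0})"
    using conjunct2[OF stable[unfolded stable_quotient_def], rule_format, of \<Delta> "tuples M \<Delta>" "Id_on (tuples M \<Delta>)" ca "\<lambda>i. {bb i}" 0 1]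
      sd hyperdefinable_Id[of A \<Delta>] caq cb by simp
  then obtain x x' where x: "x \<in> ca 0" "x' \<in> ca 1"
    and st: "same_type L M A (case_sum \<Gamma> \<Delta>) (case_sum x (bb 1)) (case_sum x' (bb 0))"
    unfolding same_htype_def hpair_def by blast
  have xc: "x \<in> carrier G" "x' \<in> carrier G" "inv (cc 0) \<otimes> x \<in> H" "inv (cc 1) \<otimes> x' \<in> H"
    using x by (auto simp: ca_def rcong_iff)
  let ?X = "carrier G \<times> tuples M \<Delta>" and ?V = "prodc (co \<Gamma> A) (co \<Delta> {})"
  \<comment> \<open>Meeting the fibre is a condition on the pair that is type-definable over
    \<open>A\<close>, so it passes between the representatives \<open>x\<close> and
    \<open>x'\<close> supplied by stability.\<close>
  have "tdf L M ?X ?V (\<lambda>p. \<exists>z\<in>carrier G. inv (fst p) \<otimes> z \<in> H \<and> S (t (snd p)) z)"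
  proof (rule tdf_exG, intro small_prodc small_co small_dom A(2) sd small_finite finite.emptyI, rule tdf_conj)
    have parA: "params A \<subseteq> prodc ?V gco" by (intro params_prodc) (auto intro: coI2)
    show "tdf L M (?X \<times> carrier G) (prodc ?V gco) (\<lambda>p. inv (fst (fst p)) \<otimes> snd p \<in> H)"
      by (rule tdf_in[OF dH _ parA]) (intro dtm_mult dtm_inv dtm_var[OF cm_snd] dtm_cm[OF dtm_co cm_comp[OF cm_fst cm_fst]])
    show "tdf L M (?X \<times> carrier G) (prodc ?V gco) (\<lambda>p. S (t (snd (fst p))) (snd p))"
      by (rule tdf_of_dfn, rule dfn_rel[OF S cm_comp[OF cm_comp[OF cm_fst cm_snd] ct] dtm_var[OF cm_snd]])
  qed
  from tdf_agree[OF this, of "(x, bb 1)" "(x', bb 0)"]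
  have tr: "\<exists>z\<in>carrier G. inv x \<otimes> z \<in> H \<and> S (t (bb 1)) z \<Longrightarrow> \<exists>z\<in>carrier G. inv x' \<otimes> z \<in> H \<and> S (t (bb 0)) z"
    using st unfolding same_type_pair[OF xc(1,2) bb bb] using xc bb by simp
  have "inv (inv (cc 0) \<otimes> x) \<in> H" by (rule subgroup.m_inv_closed[OF H(1) xc(3)])
  then have "inv x \<otimes> cc 0 \<in> H" using xc cc by (simp add: inv_mult_group)
  then obtain z where z: "z \<in> carrier G" "inv x' \<otimes> z \<in> H" "S (t (bb 0)) z" using tr cc lt' by blast
  have "inv ((inv (cc 1) \<otimes> x') \<otimes> (inv x' \<otimes> z)) \<in> H"
    by (intro subgroup.m_inv_closed[OF H(1)] subgroup.m_closed[OF H(1) xc(4) z(2)])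
  moreover have "(inv (cc 1) \<otimes> x') \<otimes> (inv x' \<otimes> z) = inv (cc 1) \<otimes> z"
  proof -
    have "x' \<otimes> (inv x' \<otimes> z) = z" using xc z by (simp add: m_assoc[symmetric])
    then show ?thesis using xc z cc by (simp add: m_assoc)
  qed
  ultimately have "inv z \<otimes> cc 1 \<in> H" using z cc by (simp add: inv_mult_group)
  then show False using gt' z \<theta>(2) by blast
qed

text \<open>The trivial condition is added because \<open>unst_of_separation\<close> indexes
  compactness by triples of conditions, and a product with an empty factor would forget the other
  two.\<close>

lemma tdf_nonempty:
  assumes "tdf L M X \<U> P"
  shows "\<exists>\<P>. \<P> \<noteq> {} \<and> (\<forall>Q\<in>\<P>. dfn L M X \<U> Q) \<and> (\<forall>z\<in>X. P z \<longleftrightarrow> (\<forall>Q\<in>\<P>. Q z))"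
proof -
  obtain \<P> where \<P>: "\<forall>S\<in>\<P>. dfn L M X \<U> S" "\<forall>x\<in>X. P x \<longleftrightarrow> (\<forall>S\<in>\<P>. S x)"
    using assms unfolding tdf_def by (elim exE conjE)
  have "\<forall>Q\<in>insert (\<lambda>_. True) \<P>. dfn L M X \<U> Q" unfolding ball_simps by (intro conjI dfn_True \<P>(1))
  moreover have "\<forall>z\<in>X. P z \<longleftrightarrow> (\<forall>Q\<in>insert (\<lambda>_. True) \<P>. Q z)" unfolding ball_simps simp_thms by (rule \<P>(2))
  ultimately show ?thesis by (intro exI[of _ "insert (\<lambda>_. True) \<P>"] conjI) simp_all
qed

text \<open>
  If \<open>P\<close> and \<open>Q\<close> were to separate the pairs above the diagonal from those below it, compactness would
  turn this into a definable witness of instability.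
\<close>

lemma unst_of_separation:
  fixes \<Delta> :: "'w \<Rightarrow> 's option"
  assumes sd: "small M (dom \<Delta>)" and N: "N \<subseteq> carrier G" "tdf L M (carrier G) gco (\<lambda>x. x \<in> N)"
    and P: "tdf L M (carrier G \<times> tuples M \<Delta>) (prodc gco (co \<Delta> {})) P"
    and Q: "tdf L M (carrier G \<times> tuples M \<Delta>) (prodc gco (co \<Delta> {})) Q"
    and cd: "\<And>i. c i \<in> carrier G" "\<And>j. d j \<in> tuples M \<Delta>"
    and above: "\<And>i j :: nat. i < j \<Longrightarrow> P (c i, d j)" and below: "\<And>i j. j < i \<Longrightarrow> Q (c i, d j)"
    and sep: "\<And>x z y. x \<in> carrier G \<Longrightarrow> z \<in> carrier G \<Longrightarrow> y \<in> tuples M \<Delta> \<Longrightarrow> P (x, y) \<Longrightarrow> Q (z, y) \<Longrightarrow>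
      inv x \<otimes> z \<in> N \<Longrightarrow> False"
  shows "unst N"
proof -
  let ?X = "carrier G \<times> tuples M \<Delta>" and ?U = "prodc gco (co \<Delta> {})"
  let ?X2 = "(tuples M \<Delta> \<times> carrier G) \<times> carrier G" and ?U2 = "prodc (prodc (co \<Delta> {}) gco) gco"
  obtain \<P> where \<P>: "\<P> \<noteq> {}" "\<forall>S\<in>\<P>. dfn L M ?X ?U S" "\<forall>x\<in>?X. P x \<longleftrightarrow> (\<forall>S\<in>\<P>. S x)"
    using tdf_nonempty[OF P] by (elim exE conjE)
  obtain \<Q> where \<Q>: "\<Q> \<noteq> {}" "\<forall>S\<in>\<Q>. dfn L M ?X ?U S" "\<forall>x\<in>?X. Q x \<longleftrightarrow> (\<forall>S\<in>\<Q>. S x)"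
    using tdf_nonempty[OF Q] by (elim exE conjE)
  obtain \<N> where \<N>: "\<N> \<noteq> {}" "\<forall>S\<in>\<N>. dfn L M (carrier G) gco S" "\<forall>x\<in>carrier G. x \<in> N \<longleftrightarrow> (\<forall>S\<in>\<N>. S x)"
    using tdf_nonempty[OF N(2)] by (elim exE conjE)
  let ?B = "\<lambda>k p. fst k (snd (fst p), fst (fst p)) \<and> fst (snd k) (snd p, fst (fst p)) \<and>
    snd (snd k) (inv (snd (fst p)) \<otimes> snd p)"
  have x: "dtm ?X2 ?U2 (\<lambda>p. snd (fst p))" by (rule dtm_var[OF cm_comp[OF cm_fst cm_snd]])
  have z: "dtm ?X2 ?U2 (\<lambda>p. snd p)" by (rule dtm_var[OF cm_snd])
  have xy: "cm ?X2 ?U2 ?X ?U (\<lambda>p. (snd (fst p), fst (fst p)))"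
    by (intro cm_pair cm_comp[OF cm_fst cm_snd] cm_comp[OF cm_fst cm_fst])
  have zy: "cm ?X2 ?U2 ?X ?U (\<lambda>p. (snd p, fst (fst p)))" by (intro cm_pair cm_snd cm_comp[OF cm_fst cm_fst])
  have in_def: "dfn L M Y \<V> (\<lambda>p. R (t p))"
    if "dfn L M (carrier G) gco R" "dtm Y \<V> t" for Y :: "'z set" and \<V> R t
    by (rule dfn_subst[OF dfn_cm[OF that(1) cm_snd] that(2)])
  have "\<exists>K. K \<subseteq> \<P> \<times> \<Q> \<times> \<N> \<and> finite K \<and> (\<forall>p\<in>?X2. (\<forall>k\<in>K. ?B k p) \<longrightarrow> False)"
  proof (rule cpt_imp_family[OF _ _ dfn_const])
    show "cpt L M ?X2 ?U2"
    proof (intro cpt_prodG small_prodc small_co small_gco sd small_finite finite.emptyI finite_dom)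
      show "cpt L M (tuples M \<Delta>) (co \<Delta> {})" by (rule cpt_tuples[OF sd small_finite[OF finite.emptyI]])
    qed
    fix k assume k: "k \<in> \<P> \<times> \<Q> \<times> \<N>"
    then have k1: "fst k \<in> \<P>" "fst (snd k) \<in> \<Q>" "snd (snd k) \<in> \<N>" by (simp_all only: mem_Times_iff)
    have "dfn L M ?X2 ?U2 (\<lambda>p. snd (snd k) (inv (snd (fst p)) \<otimes> snd p))"
      by (rule dfn_subst[of ?X2 ?U2 "\<lambda>_. snd (snd k)" "\<lambda>p. inv (snd (fst p)) \<otimes> snd p",
            OF dfn_cm[OF bspec[OF \<N>(2) k1(3)] cm_snd]]) (intro dtm_mult dtm_inv x z)
    then show "dfn L M ?X2 ?U2 (?B k)"
      by (intro dfn_conj dfn_cm[OF bspec[OF \<P>(2) k1(1)] xy] dfn_cm[OF bspec[OF \<Q>(2) k1(2)] zy])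
  next
    fix p assume p: "p \<in> ?X2" and *: "\<And>k. k \<in> \<P> \<times> \<Q> \<times> \<N> \<Longrightarrow> ?B k p"
    obtain y x z where e: "p = ((y, x), z)" by (metis prod.collapse)
    have m: "y \<in> tuples M \<Delta>" "x \<in> carrier G" "z \<in> carrier G" using p unfolding e by simp_all
    obtain p0 q0 n0 where 0: "p0 \<in> \<P>" "q0 \<in> \<Q>" "n0 \<in> \<N>" using \<P>(1) \<Q>(1) \<N>(1) unfolding ex_in_conv[symmetric] by (elim exE)
    have "P (x, y)"
    proof (rule iffD2[OF bspec[OF \<P>(3)]], use m in simp, rule ballI)
      fix S assume "S \<in> \<P>"
      then have "(S, q0, n0) \<in> \<P> \<times> \<Q> \<times> \<N>" using 0 by (intro SigmaI)
      from *[OF this] show "S (x, y)" unfolding e fst_conv snd_conv by (elim conjE)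
    qed
    moreover have "Q (z, y)"
    proof (rule iffD2[OF bspec[OF \<Q>(3)]], use m in simp, rule ballI)
      fix S assume "S \<in> \<Q>"
      then have "(p0, S, n0) \<in> \<P> \<times> \<Q> \<times> \<N>" using 0 by (intro SigmaI)
      from *[OF this] show "S (z, y)" unfolding e fst_conv snd_conv by (elim conjE)
    qed
    moreover have "inv x \<otimes> z \<in> N"
    proof (rule iffD2[OF bspec[OF \<N>(3)]], use m in simp, rule ballI)
      fix S assume "S \<in> \<N>"
      then have "(p0, q0, S) \<in> \<P> \<times> \<Q> \<times> \<N>" using 0 by (intro SigmaI)
      from *[OF this] show "S (inv x \<otimes> z)" unfolding e fst_conv snd_conv by (elim conjE)
    qed
    ultimately show False by (rule sep[OF m(2,3,1)])
  qed
  then obtain K where K: "K \<subseteq> \<P> \<times> \<Q> \<times> \<N>" "finite K" "\<forall>p\<in>?X2. (\<forall>k\<in>K. ?B k p) \<longrightarrow> False"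
    by (elim exE conjE)
  have Km: "fst k \<in> \<P>" "fst (snd k) \<in> \<Q>" "snd (snd k) \<in> \<N>" if "k \<in> K" for k
    using subsetD[OF K(1) that] by (simp_all only: mem_Times_iff)
  \<comment> \<open>The third components of \<open>K\<close> give the neighbourhood of
    \<open>N\<close> and the first ones the half-graph. The second components hold at
    \<open>c i\<close> whenever \<open>j < i\<close>, and together the three parts are
    contradictory.\<close>
  define \<theta> where "\<theta> = {w. \<forall>k\<in>K. snd (snd k) w}"
  show ?thesis
  proof (rule unstI[where Y = "tuples M \<Delta>" and \<V> = "co \<Delta> {}" and S = "\<lambda>y x. \<forall>k\<in>K. fst k (x, y)" and \<theta> = \<theta> and c = c and b = d])
    show "dfn L M (tuples M \<Delta> \<times> carrier G) (prodc (co \<Delta> {}) gco) (\<lambda>p. \<forall>k\<in>K. fst k (snd p, fst p))"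
      by (rule dfn_ball_finite[OF K(2)], rule dfn_cm[OF bspec[OF \<P>(2) Km(1)]], assumption) (intro cm_pair cm_snd cm_fst)
    show "dfn L M (carrier G) (co \<Gamma> U) (\<lambda>x. x \<in> \<theta>)"
      unfolding \<theta>_def mem_Collect_eq
      by (rule dfn_ball_finite[OF K(2)], rule dfn_mono[OF bspec[OF \<N>(2) Km(3)] order_refl co_mono], assumption) simp
    show "N \<subseteq> \<theta>"
    proof
      fix w assume w: "w \<in> N"
      have n: "\<forall>S\<in>\<N>. S w" using iffD1[OF bspec[OF \<N>(3) subsetD[OF N(1) w]] w] .
      show "w \<in> \<theta>" unfolding \<theta>_def by (rule CollectI, rule ballI, rule bspec[OF n Km(3)])
    qed
    show "c i \<in> carrier G" "d i \<in> tuples M \<Delta>" for i by (rule cd)+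
    show "\<forall>k\<in>K. fst k (c i, d j)" if ij: "i < j" for i j
    proof
      fix k assume k: "k \<in> K"
      have "\<forall>S\<in>\<P>. S (c i, d j)" by (rule iffD1[OF bspec[OF \<P>(3)] above[OF ij]], rule SigmaI[OF cd])
      then show "fst k (c i, d j)" by (rule bspec[OF _ Km(1)[OF k]])
    qed
    show "inv x \<otimes> c i \<notin> \<theta>" if ij: "j < i" and x: "x \<in> carrier G" and S: "\<forall>k\<in>K. fst k (x, d j)" for i j x
    proof
      assume th: "inv x \<otimes> c i \<in> \<theta>"
      have q: "\<forall>S\<in>\<Q>. S (c i, d j)" by (rule iffD1[OF bspec[OF \<Q>(3)] below[OF ij]], rule SigmaI[OF cd])
      have "\<forall>k\<in>K. ?B k ((d j, x), c i)"
        unfolding fst_conv snd_conv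
      proof (rule ballI, intro conjI)
        fix k assume k: "k \<in> K"
        show "fst k (x, d j)" by (rule bspec[OF S k])
        show "fst (snd k) (c i, d j)" by (rule bspec[OF q Km(2)[OF k]])
        show "snd (snd k) (inv x \<otimes> c i)" by (rule bspec[OF CollectD[OF th[unfolded \<theta>_def]] k])
      qed
      then show False by (rule mp[OF bspec[OF K(3)], rotated]) (intro SigmaI cd x)
    qed
  qed
qed

lemma hyperdefinable_rcong:
  assumes N: "subgroup N G" "tdf L M (carrier G) gco (\<lambda>x. x \<in> N)"
  shows "hyperdefinable L M {} \<Gamma> (carrier G) (rcong N)"
  unfolding hyperdefinable_def
proof (intro conjI)
  show "type_definable L M {} \<Gamma> (carrier G)"
    unfolding type_definable_carrier[OF order_refl]
    by (rule tdf_cong[THEN iffD1, OF _ tdf_of_dfn[OF dfn_True]]) simp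
  show "equiv (carrier G) (rcong N)" by (rule subgroup.equiv_rcong[OF N(1) is_group])
  let ?D = "{case_sum x y |x y. (x, y) \<in> rcong N}" and ?C = "case_sum \<Gamma> \<Gamma>"
  have D: "?D \<subseteq> tuples M ?C" using carrier_tuples by (auto simp: rcong_iff intro!: case_sum_tuples)
  have sm: "small M (dom ?C)"
    by (rule small_finite, rule finite_subset[of _ "Inl ` dom \<Gamma> \<union> Inr ` dom \<Gamma>"])
      (use finite_dom in \<open>auto simp: domIff split: sum.splits\<close>)
  let ?X = "(tuples M ?C \<times> carrier G) \<times> carrier G" and ?U = "prodc (prodc (co ?C {}) gco) gco"
  \<comment> \<open>The relation becomes a condition on the concatenated tuple \<open>w\<close> by
    naming its two halves as group elements; \<open>tdf_exG\<close> absorbs the two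
    quantifiers.\<close>
  have "tdf L M (tuples M ?C) (co ?C {}) (\<lambda>w. \<exists>x\<in>carrier G. \<exists>y\<in>carrier G.
      (\<forall>i\<in>dom \<Gamma>. w (Inl i) = x i) \<and> (\<forall>i\<in>dom \<Gamma>. w (Inr i) = y i) \<and> inv x \<otimes> y \<in> N)"
  proof (rule tdf_exG[OF small_co[OF sm small_finite[OF finite.emptyI]]],
      rule tdf_exG[OF small_prodc[OF small_co[OF sm small_finite[OF finite.emptyI]] small_gco]], rule tdf_conj, rule tdf_all)
    fix i assume i: "i \<in> dom \<Gamma>"
    then obtain s where s: "\<Gamma> i = Some s" by blast
    have d: "Inl i \<in> dom ?C" using s by (simp add: domIff)
    show "tdf L M ?X ?U (\<lambda>p. fst (fst p) (Inl i) = snd (fst p) i)"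
    proof (rule tdf_of_dfn, rule dfn_eq[where s = s])
      show "(\<lambda>p. fst (fst p) (Inl i)) \<in> ?U" by (rule prodcI1[OF prodcI1[OF coI[OF d]]])
      show "(\<lambda>p. snd (fst p) i) \<in> ?U" by (rule prodcI1[OF prodcI2[OF coI[OF i]]])
      fix p assume p: "p \<in> ?X"
      then have "fst (fst p) \<in> tuples M ?C" "snd (fst p) \<in> tuples M \<Gamma>" using carrier_tuples by auto
      from tuples_sort[OF this(1) d] tuples_sort[OF this(2) i]
      show "srt M (fst (fst p) (Inl i)) = Some s" "srt M (snd (fst p) i) = Some s" using s by simp_all
    qed
  next
    show "tdf L M ?X ?U (\<lambda>p. (\<forall>i\<in>dom \<Gamma>. fst (fst p) (Inr i) = snd p i) \<and> inv (snd (fst p)) \<otimes> snd p \<in> N)"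
    proof (rule tdf_conj, rule tdf_all)
      show "tdf L M ?X ?U (\<lambda>p. inv (snd (fst p)) \<otimes> snd p \<in> N)"
        by (intro tdf_in[OF N(2)] dtm_mult dtm_inv dtm_var[OF cm_snd] dtm_var[OF cm_comp[OF cm_fst cm_snd]]) simp
      fix i assume i: "i \<in> dom \<Gamma>"
      then obtain s where s: "\<Gamma> i = Some s" by blast
      have d: "Inr i \<in> dom ?C" using s by (simp add: domIff)
      show "tdf L M ?X ?U (\<lambda>p. fst (fst p) (Inr i) = snd p i)"
      proof (rule tdf_of_dfn, rule dfn_eq[where s = s])
        show "(\<lambda>p. fst (fst p) (Inr i)) \<in> ?U" by (rule prodcI1[OF prodcI1[OF coI[OF d]]])
        show "(\<lambda>p. snd p i) \<in> ?U" by (rule prodcI2[OF coI[OF i]])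
        fix p assume p: "p \<in> ?X"
        then have "fst (fst p) \<in> tuples M ?C" "snd p \<in> tuples M \<Gamma>" using carrier_tuples by auto
        from tuples_sort[OF this(1) d] tuples_sort[OF this(2) i]
        show "srt M (fst (fst p) (Inr i)) = Some s" "srt M (snd p i) = Some s" using s by simp_all
      qed
    qed
  qed
  then have "tdf L M (tuples M ?C) (co ?C {}) (\<lambda>w. w \<in> ?D)"
  proof (rule tdf_cong[THEN iffD1, rotated])
    fix w assume w: "w \<in> tuples M ?C"
    show "(\<exists>x\<in>carrier G. \<exists>y\<in>carrier G. (\<forall>i\<in>dom \<Gamma>. w (Inl i) = x i) \<and> (\<forall>i\<in>dom \<Gamma>. w (Inr i) = y i) \<and> inv x \<otimes> y \<in> N) =
      (w \<in> ?D)" (is "?l = ?r")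
    proof
      assume ?l
      then obtain x y where xy: "x \<in> carrier G" "y \<in> carrier G" "\<forall>i\<in>dom \<Gamma>. w (Inl i) = x i"
        "\<forall>i\<in>dom \<Gamma>. w (Inr i) = y i" "inv x \<otimes> y \<in> N" by (elim bexE conjE)
      have "w = case_sum x y"
      proof (rule tuples_eqI[OF w case_sum_tuples])
        show "x \<in> tuples M \<Gamma>" "y \<in> tuples M \<Gamma>" using xy carrier_tuples by auto
        show "w v = case_sum x y v" if "v \<in> dom ?C" for v
          using that xy(3,4) by (cases v) (auto simp: domIff)
      qed
      moreover have "(x, y) \<in> rcong N" unfolding rcong_iff using xy by simp
      ultimately show ?r by (rule_tac CollectI, rule_tac exI, rule_tac exI, rule_tac conjI)
    next
      assume ?r
      then obtain x y where xy: "w = case_sum x y" "(x, y) \<in> rcong N" by blast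
      then have "x \<in> carrier G" "y \<in> carrier G" "inv x \<otimes> y \<in> N" by (simp_all add: rcong_iff)
      then show ?l unfolding xy(1) by (intro bexI[of _ x] bexI[of _ y]) simp_all
    qed
  qed
  then show "type_definable L M {} ?C ?D" unfolding tdf_type_definable[OF str] using D by (intro conjI)
qed

text \<open>This is the partial type, in \<open>p\<close>, of the pair of classes of
  \<open>r\<close>: some representative of the classes of \<open>p\<close> modulo \<open>N\<close>
  and \<open>F\<close> realises the type of \<open>r\<close>. All conditions true at
  \<open>r\<close> include the negations of the false ones, so that type is complete.\<close>

lemma tdf_near_type:
  fixes \<Delta> :: "'w \<Rightarrow> 's option"
  assumes sd: "small M (dom \<Delta>)" and N: "tdf L M (carrier G) gco (\<lambda>x. x \<in> N)"
    and F: "type_definable L M {} (case_sum \<Delta> \<Delta>) {case_sum x y |x y. (x, y) \<in> F}"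
  shows "tdf L M (carrier G \<times> tuples M \<Delta>) (prodc gco (co \<Delta> {})) (\<lambda>p. \<exists>x\<in>carrier G. \<exists>y\<in>tuples M \<Delta>.
    inv (fst p) \<otimes> x \<in> N \<and> (snd p, y) \<in> F \<and>
    (\<forall>R\<in>{R. dfn L M (carrier G \<times> tuples M \<Delta>) (prodc gco (co \<Delta> {})) R \<and> R r}. R (x, y)))"
proof -
  let ?X = "carrier G \<times> tuples M \<Delta>" and ?U = "prodc gco (co \<Delta> {})"
  let ?X2 = "(?X \<times> carrier G) \<times> tuples M \<Delta>" and ?U2 = "prodc (prodc ?U gco) (co \<Delta> {})"
  let ?C = "case_sum \<Delta> \<Delta>"
  have sU: "small M ?U" by (intro small_prodc small_gco small_co sd small_finite finite.emptyI finite_dom)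
  have dF: "tdf L M (tuples M ?C) (co ?C {}) (\<lambda>w. w \<in> {case_sum x y |x y. (x, y) \<in> F})"
    using F unfolding tdf_type_definable[OF str] by (elim conjE)
  have "cm ?X2 ?U2 (tuples M ?C) (co ?C {}) (\<lambda>p. case_sum (snd (fst (fst p))) (snd p))"
    by (rule cm_case_sum[OF cm_comp[OF cm_comp[OF cm_fst cm_fst] cm_snd] cm_snd])
  from tdf_cm[OF dF this]
  have F': "tdf L M ?X2 ?U2 (\<lambda>p. (snd (fst (fst p)), snd p) \<in> F)"
    by (rule tdf_cong[THEN iffD1, rotated]) (auto simp: case_sum_eq)
  have N': "tdf L M ?X2 ?U2 (\<lambda>p. inv (fst (fst (fst p))) \<otimes> snd (fst p) \<in> N)"
    by (rule tdf_in[OF N]) (intro dtm_mult dtm_inv dtm_var[OF cm_comp[OF cm_fst cm_snd]]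
        dtm_var[OF cm_comp[OF cm_comp[OF cm_fst cm_fst] cm_fst]], simp)
  have R': "tdf L M ?X2 ?U2 (\<lambda>p. \<forall>R\<in>{R. dfn L M ?X ?U R \<and> R r}. R (snd (fst p), snd p))"
  proof (rule tdf_all, rule tdf_of_dfn)
    fix R assume "R \<in> {R. dfn L M ?X ?U R \<and> R r}"
    then have "dfn L M ?X ?U R" unfolding mem_Collect_eq by (elim conjE)
    then show "dfn L M ?X2 ?U2 (\<lambda>p. R (snd (fst p), snd p))"
      by (rule dfn_cm) (intro cm_pair cm_comp[OF cm_fst cm_snd] cm_snd)
  qed
  show ?thesis
    by (rule tdf_exG[OF sU], rule tdf_ex_tuples[OF small_prodc[OF sU small_gco] sd]) (intro tdf_conj N' F' R')
qed

lemma same_htype_sym: "same_htype L M A \<Delta> c d \<Longrightarrow> same_htype L M A \<Delta> d c"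
  unfolding same_htype_def same_type_def by (elim bexE) (intro bexI ballI, rule sym, erule bspec)

text \<open>Indiscernibility compares blocks of two pairs; dropping the unwanted halves leaves the
  first component at one position and the second at the other. Thus \<open>p = 0\<close>,
  \<open>q = 1\<close> gives pairs above the diagonal and \<open>p = 1\<close>, \<open>q = 0\<close>
  pairs below it.\<close>

lemma same_htype_project:
  fixes \<Delta> :: "'w \<Rightarrow> 's option" and p q :: nat
  assumes ind: "indiscernible L M A (case_sum \<Gamma> \<Delta>) (\<lambda>i. hpair (a i) (b i))"
    and a: "\<And>i. a i \<subseteq> tuples M \<Gamma>" and b: "\<And>i. b i \<subseteq> tuples M \<Delta>"
    and f: "strict_mono_on {..<2} f" and g: "strict_mono_on {..<2} g" and pq: "p < 2" "q < 2"
  shows "same_htype L M A (case_sum \<Gamma> \<Delta>) (hpair (a (f p)) (b (f q))) (hpair (a (g p)) (b (g q)))"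
proof -
  let ?C = "case_sum \<Gamma> \<Delta>"
  let ?S = "seq_ctxt 2 ?C"
  define \<pi> where "\<pi> w = case_sum (\<lambda>i. w (p, Inl i)) (\<lambda>j. w (q, Inr j))" for w :: "nat \<times> ('i + 'w) \<Rightarrow> 'a"
  have dS: "(n, v) \<in> dom ?S \<longleftrightarrow> v \<in> dom ?C" if "n < 2" for n v using that by (simp add: seq_ctxt_def domIff)
  have cm: "cm (tuples M ?S) (co ?S A) (tuples M ?C) (co ?C A) \<pi>"
  proof (rule cmI)
    fix w assume w: "w \<in> tuples M ?S"
    show "\<pi> w \<in> tuples M ?C"
      unfolding \<pi>_def
    proof (rule case_sum_tuples)
      show "(\<lambda>i. w (p, Inl i)) \<in> tuples M \<Gamma>"
        unfolding tuples_iff extensional_def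
      proof (intro conjI CollectI allI impI ballI)
        show "w (p, Inl i) = undefined" if "i \<notin> dom \<Gamma>" for i
        proof -
          have "(p, Inl i) \<notin> dom ?S" unfolding dS[OF pq(1)] using that by (simp add: domIff)
          then show ?thesis using w unfolding tuples_iff extensional_def by simp
        qed
        show "srt M (w (p, Inl i)) = \<Gamma> i" if "i \<in> dom \<Gamma>" for i
        proof -
          have "(p, Inl i) \<in> dom ?S" unfolding dS[OF pq(1)] using that by (simp add: domIff)
          from tuples_sort[OF w this] show ?thesis using pq by (simp add: seq_ctxt_def)
        qed
      qed
      show "(\<lambda>j. w (q, Inr j)) \<in> tuples M \<Delta>"
        unfolding tuples_iff extensional_def
      proof (intro conjI CollectI allI impI ballI)
        show "w (q, Inr i) = undefined" if "i \<notin> dom \<Delta>" for i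
        proof -
          have "(q, Inr i) \<notin> dom ?S" unfolding dS[OF pq(2)] using that by (simp add: domIff)
          then show ?thesis using w unfolding tuples_iff extensional_def by simp
        qed
        show "srt M (w (q, Inr i)) = \<Delta> i" if "i \<in> dom \<Delta>" for i
        proof -
          have "(q, Inr i) \<in> dom ?S" unfolding dS[OF pq(2)] using that by (simp add: domIff)
          from tuples_sort[OF w this] show ?thesis using pq by (simp add: seq_ctxt_def)
        qed
      qed
    qed
  next
    fix v assume "v \<in> co ?C A"
    then have "v \<in> (\<lambda>i x. x i) ` dom ?C \<union> (\<lambda>a x. a) ` A" unfolding co_def .
    then show "(\<lambda>w. v (\<pi> w)) \<in> co ?S A"
    proof (elim UnE imageE)
      fix i assume i: "v = (\<lambda>x. x i)" "i \<in> dom ?C"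
      show ?thesis
      proof (cases i)
        case (Inl k)
        have "(p, i) \<in> dom ?S" unfolding dS[OF pq(1)] by (rule i(2))
        from coI[OF this] show ?thesis using i(1) Inl by (simp add: \<pi>_def)
      next
        case (Inr k)
        have "(q, i) \<in> dom ?S" unfolding dS[OF pq(2)] by (rule i(2))
        from coI[OF this] show ?thesis using i(1) Inr by (simp add: \<pi>_def)
      qed
    next
      fix a assume v: "v = (\<lambda>x. a)" "a \<in> A"
      show ?thesis unfolding v(1) by (rule coI2[OF v(2)])
    qed
  qed
  have hs: "u \<in> tuples M ?S \<and> \<pi> u \<in> hpair (a (f p)) (b (f q))" if "u \<in> hseq 2 (\<lambda>k. hpair (a (f k)) (b (f k)))" for u f
  proof -
    obtain x where u: "u = (\<lambda>(k, i). if k < 2 then x k i else undefined)" and x: "\<forall>k<2. x k \<in> hpair (a (f k)) (b (f k))"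
      using \<open>u \<in> _\<close> unfolding hseq_def by blast
    have xT: "x k \<in> tuples M ?C" if k: "k < 2" for k
    proof -
      obtain y z where "x k = case_sum y z" "y \<in> a (f k)" "z \<in> b (f k)" using x k unfolding hpair_def by blast
      then show ?thesis using subsetD[OF a] subsetD[OF b] by (simp add: case_sum_tuples)
    qed
    have "u v = undefined" if v: "v \<notin> dom ?S" for v
    proof -
      obtain k i where ki: "v = (k, i)" by (cases v)
      show ?thesis
      proof (cases "k < 2")
        case True
        then have "i \<notin> dom ?C" using v dS ki by simp
        then have "x k i = undefined" using xT[OF True] unfolding tuples_iff extensional_def by simp
        then show ?thesis using True ki by (simp add: u)
      qed (simp add: u ki)
    qed
    moreover have "srt M (u v) = ?S v" if v: "v \<in> dom ?S" for v
    proof -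
      obtain k i where ki: "v = (k, i)" by (cases v)
      then have k: "k < 2" using v by (auto simp: seq_ctxt_def split: if_splits)
      then have "i \<in> dom ?C" using v dS ki by simp
      from tuples_sort[OF xT[OF k] this] show ?thesis using k ki by (simp add: u seq_ctxt_def)
    qed
    moreover have "\<pi> u \<in> hpair (a (f p)) (b (f q))"
    proof -
      obtain y z where y: "x p = case_sum y z" "y \<in> a (f p)" using x pq(1) unfolding hpair_def by blast
      obtain y' z' where z: "x q = case_sum y' z'" "z' \<in> b (f q)" using x pq(2) unfolding hpair_def by blast
      have "\<pi> u = case_sum y z'" unfolding \<pi>_def u using pq y(1) z(1) by simp
      then show ?thesis unfolding hpair_def using y(2) z(2) by blast
    qed
    ultimately show ?thesis unfolding tuples_iff extensional_def by simp
  qed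
  have "same_htype L M A ?S (hseq 2 (\<lambda>k. hpair (a (f k)) (b (f k)))) (hseq 2 (\<lambda>k. hpair (a (g k)) (b (g k))))"
    using ind f g unfolding indiscernible_def by simp
  then obtain u v where u: "u \<in> hseq 2 (\<lambda>k. hpair (a (f k)) (b (f k)))" and v: "v \<in> hseq 2 (\<lambda>k. hpair (a (g k)) (b (g k)))"
    and st: "same_type L M A ?S u v" unfolding same_htype_def by (elim bexE)
  have uT: "u \<in> tuples M ?S" and vT: "v \<in> tuples M ?S" using hs[OF u] hs[OF v] by simp_all
  have "same_type L M A ?C (\<pi> u) (\<pi> v)"
    unfolding same_type_dfn[OF cmD[OF cm uT] cmD[OF cm vT]]
  proof (intro allI impI)
    fix P assume "dfn L M (tuples M ?C) (co ?C A) P"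
    from mp[OF spec[OF st[unfolded same_type_dfn[OF uT vT]]] dfn_cm[OF this cm]] show "P (\<pi> u) = P (\<pi> v)" .
  qed
  then show ?thesis unfolding same_htype_def using hs[OF u] hs[OF v] by (intro bexI[of _ "\<pi> u"] bexI[of _ "\<pi> v"]) simp_all
qed

lemma stable_of_not_unst:
  assumes N: "subgroup N G" "tdf L M (carrier G) gco (\<lambda>x. x \<in> N)" and st: "\<not> unst N"
  shows "stable_quotient L M {} \<Gamma> (carrier G) (rcong N)"
  unfolding stable_quotient_def
proof (intro conjI hyperdefinable_rcong[OF N] allI impI, elim conjE)
  fix \<Delta> :: "'a \<Rightarrow> 's option" and Y F a b and i0 j0 :: nat
  assume sd: "small M (dom \<Delta>)" and hF: "hyperdefinable L M {} \<Delta> Y F"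
    and aq: "\<forall>i. a i \<in> carrier G // rcong N" and bq: "\<forall>i. b i \<in> Y // F"
    and ind: "indiscernible L M {} (case_sum \<Gamma> \<Delta>) (\<lambda>i. hpair (a i) (b i))" and ij0: "i0 \<noteq> j0"
  have eqF: "equiv Y F" and tF: "type_definable L M {} (case_sum \<Delta> \<Delta>) {case_sum x y |x y. (x, y) \<in> F}"
    and YT: "Y \<subseteq> tuples M \<Delta>"
    using hF unfolding hyperdefinable_def type_definable_def[of L M "{}" \<Delta>] by auto
  have eqE: "equiv (carrier G) (rcong N)" by (rule subgroup.equiv_rcong[OF N(1) is_group])
  have "\<forall>i. \<exists>x. x \<in> carrier G \<and> a i = rcong N `` {x}" using aq by (meson quotientE)
  from choice[OF this] obtain c where c: "\<forall>i. c i \<in> carrier G \<and> a i = rcong N `` {c i}" by (elim exE)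
  have "\<forall>i. \<exists>x. x \<in> Y \<and> b i = F `` {x}" using bq by (meson quotientE)
  from choice[OF this] obtain d where d: "\<forall>i. d i \<in> Y \<and> b i = F `` {d i}" by (elim exE)
  have cG: "c k \<in> carrier G" and dY: "d k \<in> Y" and dT: "d k \<in> tuples M \<Delta>" for k using c d YT by auto
  have mem_a: "x \<in> a k \<longleftrightarrow> x \<in> carrier G \<and> inv (c k) \<otimes> x \<in> N" for x k using c by (auto simp: rcong_iff)
  have mem_b: "y \<in> b k \<longleftrightarrow> (d k, y) \<in> F" for y k using d by auto
  have bT: "y \<in> tuples M \<Delta>" if "y \<in> b k" for y k using that equiv_type[OF eqF] YT unfolding mem_b by auto
  have aT: "x \<in> tuples M \<Gamma>" if "x \<in> a k" for x k using that carrier_tuples unfolding mem_a by auto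
  have symF: "(y, y') \<in> F \<Longrightarrow> (y', y) \<in> F" for y y' using eqF by (meson equivE symD)
  have transF: "(y, y') \<in> F \<Longrightarrow> (y', y'') \<in> F \<Longrightarrow> (y, y'') \<in> F" for y y' y'' using eqF by (meson equivE transD)
  have symN: "inv x \<otimes> y \<in> N \<Longrightarrow> inv y \<otimes> x \<in> N" if "x \<in> carrier G" "y \<in> carrier G" for x y
    using subgroup.m_inv_closed[OF N(1), of "inv x \<otimes> y"] that by (simp add: inv_mult_group)
  have transN: "inv x \<otimes> z \<in> N" if "x \<in> carrier G" "y \<in> carrier G" "z \<in> carrier G" "inv x \<otimes> y \<in> N" "inv y \<otimes> z \<in> N" for x y z
  proof -
    have "y \<otimes> (inv y \<otimes> z) = z" using that by (simp add: m_assoc[symmetric])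
    then have "(inv x \<otimes> y) \<otimes> (inv y \<otimes> z) = inv x \<otimes> z" using that by (simp add: m_assoc)
    then show ?thesis using subgroup.m_closed[OF N(1) that(4,5)] by simp
  qed
  let ?X = "carrier G \<times> tuples M \<Delta>" and ?U = "prodc gco (co \<Delta> {})" and ?C = "case_sum \<Gamma> \<Delta>"
  \<comment> \<open>\<open>near r p\<close> expresses by a partial type in \<open>p\<close> that the
    classes of \<open>p\<close> and of \<open>r\<close> have the same type; \<open>near_inv\<close>
    and \<open>near_st\<close> show that it depends only on the classes and on the type of
    \<open>p\<close>.\<close>
  define near where "near r p \<longleftrightarrow> (\<exists>x\<in>carrier G. \<exists>y\<in>tuples M \<Delta>. inv (fst p) \<otimes> x \<in> N \<and> (snd p, y) \<in> F \<and>
    (\<forall>R\<in>{R. dfn L M ?X ?U R \<and> R r}. R (x, y)))" for r p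
  have tnear: "tdf L M ?X ?U (near r)" for r unfolding near_def by (rule tdf_near_type[OF sd N(2) tF])
  have near_inv: "near r (x', y')" if n: "near r (x, y)" and m: "x \<in> carrier G" "x' \<in> carrier G" "inv x' \<otimes> x \<in> N" "(y', y) \<in> F" for r x y x' y'
  proof -
    obtain z w where z: "z \<in> carrier G" "w \<in> tuples M \<Delta>" "inv x \<otimes> z \<in> N" "(y, w) \<in> F"
      "\<forall>R\<in>{R. dfn L M ?X ?U R \<and> R r}. R (z, w)" using n unfolding near_def fst_conv snd_conv by (elim bexE conjE)
    show ?thesis
      unfolding near_def fst_conv snd_conv
      by (rule bexI[OF _ z(1)], rule bexI[OF _ z(2)], intro conjI transN[OF m(2,1) z(1) m(3) z(3)] transF[OF m(4) z(4)] z(5))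
  qed
  have near_self: "near (x', y') (x, y)" if "x' \<in> carrier G" "y' \<in> tuples M \<Delta>" "inv x \<otimes> x' \<in> N" "(y, y') \<in> F" for x y x' y'
    unfolding near_def fst_conv snd_conv
    by (rule bexI[OF _ that(1)], rule bexI[OF _ that(2)], intro conjI that(3,4) ballI) (elim CollectE conjE)
  have near_st: "near r (x, y) \<Longrightarrow> near r (x', y')"
    if st: "same_type L M {} ?C (case_sum x y) (case_sum x' y')"
      and m: "x \<in> carrier G" "x' \<in> carrier G" "y \<in> tuples M \<Delta>" "y' \<in> tuples M \<Delta>" for r x y x' y'
    using st unfolding same_type_pair[OF m] by (intro tdf_agree[OF tnear, of "(x, y)" "(x', y')"]) (use m in simp_all)
  have st_sym: "same_type L M {} ?C u v \<Longrightarrow> same_type L M {} ?C v u" for u v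
    unfolding same_type_def by (rule ballI, rule sym, erule bspec)
  have R_st: "same_type L M {} ?C (case_sum x' y') (case_sum x y)"
    if R: "\<forall>R\<in>{R. dfn L M ?X ?U R \<and> R (x', y')}. R (x, y)"
      and m: "x' \<in> carrier G" "x \<in> carrier G" "y' \<in> tuples M \<Delta>" "y \<in> tuples M \<Delta>" for x y x' y'
    unfolding same_type_pair[OF m]
  proof (intro allI impI)
    fix Q assume Q: "dfn L M ?X ?U Q"
    show "Q (x', y') = Q (x, y)"
    proof
      assume q: "Q (x', y')"
      show "Q (x, y)" by (rule bspec[OF R], rule CollectI, rule conjI[OF Q q])
    next
      assume q: "Q (x, y)"
      show "Q (x', y')"
      proof (rule ccontr)
        assume nq: "\<not> Q (x', y')"
        \<comment> \<open>Conditions are closed under negation, so one-sided inclusion of types is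
          equality.\<close>
        have "(\<lambda>p. \<not> Q p) (x, y)" by (rule bspec[OF R], rule CollectI, rule conjI[OF dfn_not[OF Q] nq])
        then show False using q by simp
      qed
    qed
  qed
  let ?T = "\<lambda>k l. hpair (a k) (b l)"
  \<comment> \<open>By indiscernibility all pairs above the diagonal have the type of
    \<open>?T i j\<close> and all pairs below it that of \<open>?T j i\<close>. If these differ, no
    coset realises both against the same second component, and this is the separation that makes
    \<open>N\<close> unstable.\<close>
  have main: "same_htype L M {} ?C (?T i j) (?T j i)" if ij: "i < j" for i j
  proof (rule ccontr)
    assume no: "\<not> same_htype L M {} ?C (?T i j) (?T j i)"
    have near: "near (c k', d l') (c k, d l)" if "same_htype L M {} ?C (?T k l) (?T k' l')" for k l k' l'
    proof -
      obtain x y x' y' where m: "x \<in> a k" "y \<in> b l" "x' \<in> a k'" "y' \<in> b l'"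
        and s: "same_type L M {} ?C (case_sum x y) (case_sum x' y')"
        using \<open>same_htype L M {} ?C (?T k l) (?T k' l')\<close> unfolding same_htype_def hpair_def by blast
      have G: "x \<in> carrier G" "x' \<in> carrier G" "inv (c k) \<otimes> x \<in> N" "inv (c k') \<otimes> x' \<in> N"
        using m(1,3) unfolding mem_a by auto
      have F: "(d l, y) \<in> F" "(d l', y') \<in> F" using m(2,4) unfolding mem_b by auto
      have "near (c k', d l') (x', y')" by (rule near_self[OF cG dT symN[OF cG G(2,4)] symF[OF F(2)]])
      then have "near (c k', d l') (x, y)" by (rule near_st[OF st_sym[OF s] G(2,1) bT[OF m(4)] bT[OF m(2)]])
      then show ?thesis by (rule near_inv[OF _ G(1) cG G(3) F(1)])
    qed
    have mono: "strict_mono_on {..<2} (\<lambda>n :: nat. if n = 0 then k else l)" if "k < l" for k l :: nat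
      using that unfolding strict_mono_on_def by auto
    have "unst N"
    proof (rule unst_of_separation[OF sd subgroup.subset[OF N(1)] N(2) tnear tnear cG dT])
      show "near (c i, d j) (c k, d l)" if "k < l" for k l
        using same_htype_project[where p = 0 and q = 1, OF ind subsetI[OF aT] subsetI[OF bT] mono[OF that] mono[OF ij]]
        by (intro near) simp
      show "near (c j, d i) (c k, d l)" if "l < k" for k l
        using same_htype_project[where p = 1 and q = 0, OF ind subsetI[OF aT] subsetI[OF bT] mono[OF that] mono[OF ij]]
        by (intro near) simp
      fix x z y assume m: "x \<in> carrier G" "z \<in> carrier G" "y \<in> tuples M \<Delta>"
        and P: "near (c i, d j) (x, y)" and Q: "near (c j, d i) (z, y)" and xz: "inv x \<otimes> z \<in> N"
      obtain x1 y1 where 1: "x1 \<in> carrier G" "y1 \<in> tuples M \<Delta>" "inv x \<otimes> x1 \<in> N" "(y, y1) \<in> F"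
        "\<forall>R\<in>{R. dfn L M ?X ?U R \<and> R (c i, d j)}. R (x1, y1)" using P unfolding near_def fst_conv snd_conv by (elim bexE conjE)
      \<comment> \<open>Dependence on the classes alone moves the second condition from
        \<open>(z, y)\<close> to \<open>(x1, y1)\<close>; equality of types then moves it to
        \<open>(c i, d j)\<close>, so the two types would coincide, against
        \<open>no\<close>.\<close>
      have "near (c j, d i) (x1, y1)"
        by (rule near_inv[OF Q m(2) 1(1) transN[OF 1(1) m(1,2) symN[OF m(1) 1(1,3)] xz] symF[OF 1(4)]])
      then have "near (c j, d i) (c i, d j)"
        by (rule near_st[OF st_sym[OF R_st[OF 1(5) cG 1(1) dT 1(2)]] 1(1) cG 1(2) dT])
      then obtain x2 y2 where 2: "x2 \<in> carrier G" "y2 \<in> tuples M \<Delta>" "inv (c i) \<otimes> x2 \<in> N" "(d j, y2) \<in> F"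
        "\<forall>R\<in>{R. dfn L M ?X ?U R \<and> R (c j, d i)}. R (x2, y2)" unfolding near_def fst_conv snd_conv by (elim bexE conjE)
      have "case_sum x2 y2 \<in> ?T i j" unfolding hpair_def using 2(1,3,4) mem_a mem_b by blast
      moreover have "case_sum (c j) (d i) \<in> ?T j i"
      proof -
        have "inv (c j) \<otimes> c j \<in> N" using cG subgroup.one_closed[OF N(1)] by simp
        moreover have "(d i, d i) \<in> F" using equiv_class_self[OF eqF dY] by auto
        ultimately show ?thesis unfolding hpair_def using cG mem_a mem_b by blast
      qed
      moreover have "same_type L M {} ?C (case_sum x2 y2) (case_sum (c j) (d i))"
        by (rule st_sym, rule R_st[OF 2(5) cG 2(1) dT 2(2)])
      ultimately have "same_htype L M {} ?C (?T i j) (?T j i)" unfolding same_htype_def by (intro bexI)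
      then show False by (rule notE[OF no])
    qed
    then show False by (rule notE[OF st])
  qed
  show "same_htype L M {} ?C (?T i0 j0) (?T j0 i0)"
  proof (cases "i0 < j0")
    case True
    then show ?thesis by (rule main)
  next
    case False
    then have "j0 < i0" using ij0 by simp
    then show ?thesis by (rule same_htype_sym[OF main])
  qed
qed

end

text \<open>Of any two consecutive iterated negations of one sentence, one lies in \<open>T\<close>,
  and all these sentences differ in size. The purpose is to make a model larger than
  \<open>T\<close> uncountable.\<close>

lemma infinite_complete_theory:
  fixes L :: "('f, 'r, 's) lang" and T :: "('f, 'r, 's, 'v) fm set"
  assumes "complete_theory L T"
  shows "infinite T"
proof
  assume fin: "finite T"
  define \<phi> :: "nat \<Rightarrow> ('f, 'r, 's, 'v) fm" where "\<phi> n = (Neg ^^ n) (Exi undefined (Eq (Bnd 0) (Bnd 0)))" for n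
  have sent: "sentence L (\<phi> n)" for n by (induction n) (simp_all add: \<phi>_def)
  have sz: "size (\<phi> n) = size (\<phi> 0) + n" for n by (induction n) (simp_all add: \<phi>_def)
  have "inj \<phi>" by (rule injI) (metis sz add_left_cancel)
  then have "finite {n. \<phi> n \<in> T}" using finite_vimageI[OF fin, of \<phi>] by (simp add: vimage_def)
  then obtain m where m: "\<forall>n. \<phi> n \<in> T \<longrightarrow> n < m" by (metis finite_nat_set_iff_bounded mem_Collect_eq)
  have "\<phi> m \<in> T \<or> \<phi> (Suc m) \<in> T" using assms sent[of m] unfolding complete_theory_def \<phi>_def by auto
  then show False using m by (metis less_irrefl not_less_eq less_SucI)
qed

theorem theorem1p1:
  fixes L :: "('f, 'r, 's) lang"
    and T :: "('f, 'r, 's, nat) fm set"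
    and M :: "('f, 'r, 's, 'a) fo_struct"
    and \<Gamma> :: "'i \<Rightarrow> 's option"
    and G :: "('i \<Rightarrow> 'a) monoid"
  assumes "complete_theory L T"
    and "monster_model L T M"
    and "nip L M"
    and "eq_closed L M"
    and "definable_group L M {} \<Gamma> G"
  shows "\<exists>Gst. subgroup Gst G \<and>
           type_definable L M {} \<Gamma> Gst \<and>
           stable_quotient L M {} \<Gamma> (carrier G) (rcong\<^bsub>G\<^esub> Gst) \<and>
           (\<forall>A H. A \<subseteq> dom (srt M) \<and> small M A \<and> subgroup H G \<and> type_definable L M A \<Gamma> H \<and>
              stable_quotient L M A \<Gamma> (carrier G) (rcong\<^bsub>G\<^esub> H) \<longrightarrow> Gst \<subseteq> H) \<and>
           Gst \<lhd> G"
proof -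
  have mm: "is_struct L M" "saturated L M" "T \<prec> dom (srt M)"
    using assms(2) unfolding monster_model_def by simp_all
  \<comment> \<open>The cardinality of \<open>M\<close> exceeds that of the infinite set
    \<open>T\<close>; countable index sets such as the naturals and the rationals are therefore
    small.\<close>
  have "(UNIV :: nat set) \<lesssim> T" using infinite_complete_theory[OF assms(1)] by (simp add: infinite_le_lepoll)
  then have unc: "(UNIV :: nat set) \<prec> dom (srt M)" using mm(3) by (rule lesspoll_trans1)
  interpret defgrp L M \<Gamma> G by unfold_locales (use mm unc assms(5) in simp_all)
  obtain N where N: "N \<lhd> G" "tdf L M (carrier G) (co \<Gamma> {}) (\<lambda>x. x \<in> N)" "\<not> unst N"
    and min: "\<forall>A H. A \<subseteq> dom (srt M) \<longrightarrow> small M A \<longrightarrow> subgroup H G \<longrightarrow> tdf L M (carrier G) (co \<Gamma> A) (\<lambda>x. x \<in> H) \<longrightarrow>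
      \<not> unst H \<longrightarrow> N \<subseteq> H"
    using ex_smallest_stable[OF assms(3)] by (elim exE conjE)
  have sub: "subgroup N G" by (rule normal_imp_subgroup[OF N(1)])
  show ?thesis
  proof (intro exI[of _ N] conjI sub N(1) stable_of_not_unst[OF sub N(2,3)] allI impI)
    show "type_definable L M {} \<Gamma> N" unfolding type_definable_carrier[OF subgroup.subset[OF sub]] by (rule N(2))
    fix A H assume *: "A \<subseteq> dom (srt M) \<and> small M A \<and> subgroup H G \<and> type_definable L M A \<Gamma> H \<and>
      stable_quotient L M A \<Gamma> (carrier G) (rcong\<^bsub>G\<^esub> H)"
    then have H: "A \<subseteq> dom (srt M)" "small M A" "subgroup H G" "type_definable L M A \<Gamma> H"
      "stable_quotient L M A \<Gamma> (carrier G) (rcong\<^bsub>G\<^esub> H)" by simp_all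
    have "tdf L M (carrier G) (co \<Gamma> A) (\<lambda>x. x \<in> H)"
      using H(4) unfolding type_definable_carrier[OF subgroup.subset[OF H(3)]] .
    then show "N \<subseteq> H" using min H(1-3) not_unst_of_stable[OF H] by simp
  qed
qed

end
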